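(* Let $\omega\in\mathbb{C}\tilde{W}_-$ be admissible. Then there is an algebra homomorphism $\zeta_\omega\colon Z^{\mathrm{gr}}(O_{t,c})\to Z^{\mathrm{ug}}(\mathbb{C}\tilde{W}_-)$ such that for every $z\in Z^{\mathrm{gr}}(O_{t,c})$ there exists $a\in O_{t,c}$ satisfying $$z=\zeta_\omega(z)+D_\omega a+aD_\omega ,$$ where $\zeta_\omega(z)$ is viewed in $O_{t,c}$ via $\mathbb{C}\tilde W_-\cong\rho(\mathbb{C}\tilde W)\subset O_{t,c}$.
   Context: Let $d\geq 3$, let $V_0\cong\mathbb{R}^d$ be a Euclidean space and $(V,B)$ its complexification. Let $W\subset\mathsf{O}(V_0)\subset\mathsf{O}(V,B)$ be a finite real reflection group (not necessarily irreducible or essential), with root system $R\subset V^*$, positive roots $R^+$, reflections $s_\alpha$, coroots $\alpha^\vee\in V$ ($\langle\alpha^\vee,\alpha\rangle=2$). Let $c$ be a $W$-invariant complex-valued function on roots, $t\in\mathbb{C}^\times$, $\{y_j\}$ a real orthonormal basis of $V$, $\{x_j\}\subset V^*$ the dual basis. $\mathsf{H}_{t,c}$ is the quotient of $T(V\oplus V^* )\rtimes W$ by $[x,u]=0=[y,v]$, $[y,x]=t\langle y,x\rangle-\sum_{\alpha>0}\langle y,\alpha\rangle\langle\alpha^\vee,x\rangle c(\alpha)s_\alpha$ ($y,v\in V$, $x,u\in V^*$). $\mathcal{C}$ is the Clifford algebra of $(V,B)$ with canonical map $\gamma\colon V\to\mathcal{C}$, $e_j=\gamma(y_j)$, $e_je_k+e_ke_j=2\delta_{jk}$.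 $\mathsf{H}_{t,c}\otimes\mathcal{C}$ is $\mathbb{Z}_2$-graded with $\mathsf{H}_{t,c}$ even and $e_j$ odd; $\llbracket a,b\rrbracket=ab-(-1)^{|a||b|}ba$. Put $\Omega_c=\sum_{\alpha>0}c(\alpha)s_\alpha$, $F^+=\frac{1}{\sqrt{2t}}\sum_p x_pe_p$, $F^-=\frac{1}{\sqrt{2t}}\sum_p y_pe_p$, $E^+=\frac{1}{2t}\sum_p x_p^2$, $E^-=-\frac{1}{2t}\sum_p y_p^2$, $H=\frac1t(\sum_p x_py_p+\frac{td}{2}-\Omega_c)$; these span a copy of $\mathfrak{osp}(1|2)$. $O_{t,c}=\{a\in\mathsf{H}_{t,c}\otimes\mathcal{C}\mid\llbracket a,b\rrbracket=0\ \forall b\in\mathfrak{osp}(1|2)\}$. Put $\mathcal{S}=F^-F^+-F^+F^--\frac12$, $\Gamma=i^{d(d-1)/2}e_1\cdots e_d$ and $D=\Gamma\mathcal{S}\in O_{t,c}$. The double cover $\tilde W=p^{-1}(W)$ for $p\colon\mathrm{Pin}\to\mathsf{O}(d)$ is, concretely, the subgroup of $\mathcal{C}^\times$ generated by $-1$ and the elements $\gamma(\alpha^\vee)/|\alpha^\vee|$, $\alpha\in R$, with $p(\gamma(\alpha^\vee)/|\alpha^\vee|)=s_\alpha$; $\theta\in\tilde W$ is the element corresponding to $-1$. $\tilde W$ and $\mathbb{C}\tilde W$ inherit a $\mathbb{Z}_2$-grading $|\tilde w|$ from $\mathcal{C}$. $\mathbb{C}\tilde W_-=\frac12(1-\theta)\mathbb{C}\tilde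 W$. The homomorphism $\rho\colon\mathbb{C}\tilde W\to\mathsf{H}_{t,c}\otimes\mathcal{C}$, $\rho(\tilde w)=p(\tilde w)\otimes\tilde w$, has image contained in $O_{t,c}$ and isomorphic to $\mathbb{C}\tilde W_-$; these are identified. For homogeneous $b\in\mathbb{C}\tilde W_-$, $\epsilon(b)\in\{\pm1\}$ is the sign with $D\rho(b)=\epsilon(b)\rho(b)D$; explicitly $\epsilon=1$ if $d$ is odd and $\epsilon(b)=(-1)^{|b|}$ if $d$ is even. $a\in\mathbb{C}\tilde W_-$ is $\epsilon$-central if $ab=\epsilon(b)ba$ for all homogeneous $b\in\mathbb{C}\tilde W_-$. The conjugate-linear anti-involution $\bullet$ on $\mathbb{C}\tilde W_-\cong\rho(\mathbb{C}\tilde W)$ is $\rho(\tilde w)^\bullet=(-1)^{|\tilde w|}\rho(\tilde w^{-1})$ (it is the restriction of the anti-involution with $w^\bullet=w^{-1}$, $x_i^\bullet=y_i$, $y_i^\bullet=x_i$, $e_i^\bullet=-e_i$). A homogeneous $\omega\in\mathbb{C}\tilde W_-$ is admissible if it is $\epsilon$-central and $\omega^\bullet=\omega$; then $D_\omega=D+\rho(\omega)\in O_{t,c}$. $Z^{\mathrm{gr}}(A)=\{z\in A\mid\llbracket z,x\rrbracket=0\ \forall x\in A\}$ and $Z^{\mathrm{ug}}(A)=\{z\in A\mid zx=xz\ \forall x\in A\}$. *)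

theory Defs
  imports
    "HOL-Analysis.Analysis"
    "HOL-Library.Poly_Mapping"
    "HOL-Algebra.QuotRing"
    "HOL-Algebra.Module"
    "HOL-Algebra.Generated_Groups"
begin

section \<open>Complex associative algebras\<close>

text \<open>
  A complex associative unital algebra is given by a record of type \<open>(complex, 'a) module\<close> of
  HOL-Algebra: a ring together with a scalar multiplication.
\<close>

abbreviation scale :: "complex \<Rightarrow> ('a \<Rightarrow>\<^sub>0 complex) \<Rightarrow> ('a \<Rightarrow>\<^sub>0 complex)"
  where "scale c \<equiv> Poly_Mapping.map ((*) c)"

definition monoid_alg :: "('m, 'r) monoid_scheme \<Rightarrow> (complex, 'm \<Rightarrow>\<^sub>0 complex) module" where
  "monoid_alg M =
    \<lparr>carrier = {f. Poly_Mapping.keys f \<subseteq> carrier M},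
     mult = (\<lambda>f g. \<Sum>a\<in>Poly_Mapping.keys f. \<Sum>b\<in>Poly_Mapping.keys g.
               Poly_Mapping.single (a \<otimes>\<^bsub>M\<^esub> b) (Poly_Mapping.lookup f a * Poly_Mapping.lookup g b)),
     one = Poly_Mapping.single \<one>\<^bsub>M\<^esub> 1,
     zero = 0,
     add = (+),
     smult = scale\<rparr>"

definition free_monoid :: "'g set \<Rightarrow> 'g list monoid" where
  "free_monoid G = \<lparr>carrier = lists G, mult = (@), one = []\<rparr>"

abbreviation free_alg :: "'g set \<Rightarrow> (complex, 'g list \<Rightarrow>\<^sub>0 complex) module" where
  "free_alg G \<equiv> monoid_alg (free_monoid G)"

abbreviation word :: "'g list \<Rightarrow> ('g list \<Rightarrow>\<^sub>0 complex)" where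
  "word l \<equiv> Poly_Mapping.single l 1"

text \<open>Quotient of an algebra by the two-sided ideal generated by a set of relators.\<close>

definition quot_alg :: "(complex, 'a) module \<Rightarrow> 'a set \<Rightarrow> (complex, 'a set) module" where
  "quot_alg A S =
    ring.extend (A Quot (Idl\<^bsub>A\<^esub> S))
      (module.fields (\<lambda>c X. \<Union>a\<in>X. Idl\<^bsub>A\<^esub> S +>\<^bsub>A\<^esub> (c \<odot>\<^bsub>A\<^esub> a)))"

definition quot_class :: "(complex, 'a) module \<Rightarrow> 'a set \<Rightarrow> 'a \<Rightarrow> 'a set" where
  "quot_class A S a = Idl\<^bsub>A\<^esub> S +>\<^bsub>A\<^esub> a"

text \<open>
  The tensor product of two algebras: the free vector space on pairs \<open>(a, b)\<close>, with product
  \<open>(a, b) (a', b') = (a a', b b')\<close> extended bilinearly, modulo the bilinearity relations.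
  (The span of these relations is already a two-sided ideal.)
\<close>

definition tensor_rels ::
    "(complex, 'a) module \<Rightarrow> (complex, 'b) module \<Rightarrow> ('a \<times> 'b \<Rightarrow>\<^sub>0 complex) set" where
  "tensor_rels A B =
     {Poly_Mapping.single (a \<oplus>\<^bsub>A\<^esub> a', b) 1 - Poly_Mapping.single (a, b) 1 - Poly_Mapping.single (a', b) 1
        | a a' b. a \<in> carrier A \<and> a' \<in> carrier A \<and> b \<in> carrier B}
   \<union> {Poly_Mapping.single (a, b \<oplus>\<^bsub>B\<^esub> b') 1 - Poly_Mapping.single (a, b) 1 - Poly_Mapping.single (a, b') 1
        | a b b'. a \<in> carrier A \<and> b \<in> carrier B \<and> b' \<in> carrier B}
   \<union> {Poly_Mapping.single (k \<odot>\<^bsub>A\<^esub> a, b) 1 - Poly_Mapping.single (a, b) k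
        | k a b. a \<in> carrier A \<and> b \<in> carrier B}
   \<union> {Poly_Mapping.single (a, k \<odot>\<^bsub>B\<^esub> b) 1 - Poly_Mapping.single (a, b) k
        | k a b. a \<in> carrier A \<and> b \<in> carrier B}"

definition tensor_alg ::
    "(complex, 'a) module \<Rightarrow> (complex, 'b) module \<Rightarrow> (complex, ('a \<times> 'b \<Rightarrow>\<^sub>0 complex) set) module" where
  "tensor_alg A B = quot_alg (monoid_alg (A \<times>\<times> B)) (tensor_rels A B)"

definition tensor ::
    "(complex, 'a) module \<Rightarrow> (complex, 'b) module \<Rightarrow> 'a \<Rightarrow> 'b \<Rightarrow> ('a \<times> 'b \<Rightarrow>\<^sub>0 complex) set" where
  "tensor A B a b =
     quot_class (monoid_alg (A \<times>\<times> B)) (tensor_rels A B) (Poly_Mapping.single (a, b) 1)"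

inductive_set lin_span :: "(complex, 'a) module \<Rightarrow> 'a set \<Rightarrow> 'a set"
  for A and S where
  zero: "\<zero>\<^bsub>A\<^esub> \<in> lin_span A S"
| step: "u \<in> lin_span A S \<Longrightarrow> s \<in> S \<Longrightarrow> k \<odot>\<^bsub>A\<^esub> s \<oplus>\<^bsub>A\<^esub> u \<in> lin_span A S"

text \<open>
  A \<open>\<int>/2\<close>-grading of \<open>A\<close> is given by its even part \<open>Q 0\<close> and its odd part \<open>Q 1\<close>.  The
  supercommutator \<open>ab - (-1)\<^bsup>|a||b|\<^esup> ba\<close> of homogeneous elements is extended
  bilinearly to all elements by means of the homogeneous components.
\<close>

definition hcomp :: "(complex, 'a) module \<Rightarrow> (nat \<Rightarrow> 'a set) \<Rightarrow> nat \<Rightarrow> 'a \<Rightarrow> 'a" where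
  "hcomp A Q i a = (THE u. u \<in> Q i \<and> (\<exists>v\<in>Q (1 - i). a = u \<oplus>\<^bsub>A\<^esub> v))"

definition superbracket :: "(complex, 'a) module \<Rightarrow> (nat \<Rightarrow> 'a set) \<Rightarrow> 'a \<Rightarrow> 'a \<Rightarrow> 'a" where
  "superbracket A Q a b =
     (\<Oplus>\<^bsub>A\<^esub>i\<in>{0, 1}. \<Oplus>\<^bsub>A\<^esub>j\<in>{0, 1}.
        hcomp A Q i a \<otimes>\<^bsub>A\<^esub> hcomp A Q j b
        \<ominus>\<^bsub>A\<^esub> ((-1) ^ (i * j)) \<odot>\<^bsub>A\<^esub> (hcomp A Q j b \<otimes>\<^bsub>A\<^esub> hcomp A Q i a))"

definition graded_center :: "(complex, 'a) module \<Rightarrow> (nat \<Rightarrow> 'a set) \<Rightarrow> 'a set \<Rightarrow> 'a set" where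
  "graded_center A Q S = {z \<in> S. \<forall>x\<in>S. superbracket A Q z x = \<zero>\<^bsub>A\<^esub>}"

definition ungraded_center :: "(complex, 'a) module \<Rightarrow> 'a set" where
  "ungraded_center A = {z \<in> carrier A. \<forall>x\<in>carrier A. z \<otimes>\<^bsub>A\<^esub> x = x \<otimes>\<^bsub>A\<^esub> z}"

definition alg_hom :: "(complex, 'a) module \<Rightarrow> (complex, 'b) module \<Rightarrow> ('a \<Rightarrow> 'b) set" where
  "alg_hom A B =
     {f \<in> ring_hom A B. \<forall>k. \<forall>a\<in>carrier A. f (k \<odot>\<^bsub>A\<^esub> a) = k \<odot>\<^bsub>B\<^esub> f a}"


section \<open>Real reflection groups\<close>

text \<open>
  \<open>V\<^sub>0\<close> is \<^typ>\<open>real^'n\<close>, \<open>V\<close> is \<^typ>\<open>complex^'n\<close>, and the dual spaces are written in the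
  coordinates dual to the standard basis; thus the pairing is the standard bilinear form, and
  orthogonal matrices act on \<open>V\<close> and contragrediently on \<open>V\<^sup>*\<close> by the same formula.
\<close>

definition pairing :: "complex^'n \<Rightarrow> complex^'n \<Rightarrow> complex" where
  "pairing y x = (\<Sum>i\<in>UNIV. y $ i * x $ i)"

definition cvec :: "real^'n \<Rightarrow> complex^'n" where
  "cvec v = (\<chi> i. complex_of_real (v $ i))"

definition cmat :: "real^'n^'n \<Rightarrow> complex^'n^'n" where
  "cmat g = (\<chi> i j. complex_of_real (g $ i $ j))"

definition coroot :: "real^'n \<Rightarrow> real^'n" where
  "coroot \<alpha> = (2 / (\<alpha> \<bullet> \<alpha>)) *\<^sub>R \<alpha>"

definition root_refl :: "real^'n \<Rightarrow> real^'n^'n" where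
  "root_refl \<alpha> = matrix (\<lambda>v. v - (v \<bullet> \<alpha>) *\<^sub>R coroot \<alpha>)"

definition root_system :: "(real^'n) set \<Rightarrow> bool" where
  "root_system R \<longleftrightarrow>
     finite R \<and> 0 \<notin> R \<and>
     (\<forall>\<alpha>\<in>R. \<forall>\<beta>\<in>R. root_refl \<alpha> *v \<beta> \<in> R) \<and>
     (\<forall>\<alpha>\<in>R. \<forall>k. k *\<^sub>R \<alpha> \<in> R \<longrightarrow> k = 1 \<or> k = -1)"

definition positive_roots :: "(real^'n) set \<Rightarrow> (real^'n) set \<Rightarrow> bool" where
  "positive_roots R P \<longleftrightarrow>
     (\<exists>v. (\<forall>\<alpha>\<in>R. v \<bullet> \<alpha> \<noteq> 0) \<and> P = {\<alpha>\<in>R. v \<bullet> \<alpha> > 0})"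

text \<open>The reflection group \<open>W\<close>; reflections are involutions, so no inverses are needed.\<close>

inductive_set refl_group :: "(real^'n) set \<Rightarrow> (real^'n^'n) set"
  for R where
  one: "mat 1 \<in> refl_group R"
| step: "\<alpha> \<in> R \<Longrightarrow> g \<in> refl_group R \<Longrightarrow> root_refl \<alpha> ** g \<in> refl_group R"

definition W_invariant :: "(real^'n) set \<Rightarrow> (real^'n \<Rightarrow> complex) \<Rightarrow> bool" where
  "W_invariant R c \<longleftrightarrow> (\<forall>g\<in>refl_group R. \<forall>\<alpha>\<in>R. c (g *v \<alpha>) = c \<alpha>)"

definition orthonormal_basis :: "(nat \<Rightarrow> real^'n) \<Rightarrow> bool" where
  "orthonormal_basis y \<longleftrightarrow>
     (\<forall>i\<in>{1..CARD('n)}. \<forall>j\<in>{1..CARD('n)}. y i \<bullet> y j = (if i = j then 1 else 0))"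


section \<open>The rational Cherednik algebra\<close>

datatype ('n::finite) rca_gen = Vec "complex^'n" | Cov "complex^'n" | Grp "real^'n^'n"

definition rca_gens :: "(real^'n) set \<Rightarrow> 'n rca_gen set" where
  "rca_gens R = range Vec \<union> range Cov \<union> Grp ` refl_group R"

text \<open>The relations of \<open>T(V \<oplus> V\<^sup>*) \<rtimes> W\<close>.\<close>

definition smash_rels :: "(real^'n) set \<Rightarrow> ('n rca_gen list \<Rightarrow>\<^sub>0 complex) set" where
  "smash_rels R =
     {word [Vec (k *s u + v)] - scale k (word [Vec u]) - word [Vec v] | k u v. True}
   \<union> {word [Cov (k *s u + v)] - scale k (word [Cov u]) - word [Cov v] | k u v. True}
   \<union> {word [Grp (mat 1)] - word []}
   \<union> {word [Grp g, Grp h] - word [Grp (g ** h)] | g h. g \<in> refl_group R \<and> h \<in> refl_group R}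
   \<union> {word [Grp g, Vec v] - word [Vec (cmat g *v v), Grp g] | g v. g \<in> refl_group R}
   \<union> {word [Grp g, Cov x] - word [Cov (cmat g *v x), Grp g] | g x. g \<in> refl_group R}"

definition cherednik_rels ::
    "(real^'n) set \<Rightarrow> (real^'n \<Rightarrow> complex) \<Rightarrow> complex \<Rightarrow> ('n rca_gen list \<Rightarrow>\<^sub>0 complex) set" where
  "cherednik_rels P c t =
     {word [Cov x, Cov u] - word [Cov u, Cov x] | x u. True}
   \<union> {word [Vec y, Vec v] - word [Vec v, Vec y] | y v. True}
   \<union> {word [Vec y, Cov x] - word [Cov x, Vec y]
        - (scale (t * pairing y x) (word [])
           - (\<Sum>\<alpha>\<in>P. scale (pairing y (cvec \<alpha>) * pairing (cvec (coroot \<alpha>)) x * c \<alpha>)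
                        (word [Grp (root_refl \<alpha>)]))) | y x. True}"

definition rca ::
    "(real^'n) set \<Rightarrow> (real^'n) set \<Rightarrow> (real^'n \<Rightarrow> complex) \<Rightarrow> complex
      \<Rightarrow> (complex, ('n rca_gen list \<Rightarrow>\<^sub>0 complex) set) module" where
  "rca R P c t = quot_alg (free_alg (rca_gens R)) (smash_rels R \<union> cherednik_rels P c t)"

definition rca_gen ::
    "(real^'n) set \<Rightarrow> (real^'n) set \<Rightarrow> (real^'n \<Rightarrow> complex) \<Rightarrow> complex
      \<Rightarrow> 'n rca_gen \<Rightarrow> ('n rca_gen list \<Rightarrow>\<^sub>0 complex) set" where
  "rca_gen R P c t a =
     quot_class (free_alg (rca_gens R)) (smash_rels R \<union> cherednik_rels P c t) (word [a])"


section \<open>The Clifford algebra and the double cover\<close>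

type_synonym 'n cliff = "((complex^'n) list \<Rightarrow>\<^sub>0 complex) set"

definition cliff_rels :: "((complex^'n) list \<Rightarrow>\<^sub>0 complex) set" where
  "cliff_rels =
     {word [k *s u + v] - scale k (word [u]) - word [v] | k u v. True}
   \<union> {word [v, v] - scale (pairing v v) (word []) | v. True}"

definition cliff :: "(complex, ('n::finite) cliff) module" where
  "cliff = quot_alg (free_alg UNIV) cliff_rels"

definition \<gamma> :: "complex^'n \<Rightarrow> 'n cliff" where
  "\<gamma> v = quot_class (free_alg UNIV) cliff_rels (word [v])"

definition cliff_part :: "nat \<Rightarrow> ('n::finite) cliff set" where
  "cliff_part i =
     quot_class (free_alg UNIV) cliff_rels ` {f. \<forall>l\<in>Poly_Mapping.keys f. length l mod 2 = i}"

text \<open>Parity of a homogeneous unit.\<close>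

definition cliff_parity :: "('n::finite) cliff \<Rightarrow> nat" where
  "cliff_parity w = (if w \<in> cliff_part 1 then 1 else 0)"

definition pin_group :: "(real^'n) set \<Rightarrow> 'n cliff monoid" where
  "pin_group R =
     (units_of cliff)\<lparr>carrier :=
        generate (units_of cliff)
          ({\<ominus>\<^bsub>cliff\<^esub> \<one>\<^bsub>cliff\<^esub>} \<union>
           {complex_of_real (1 / norm (coroot \<alpha>)) \<odot>\<^bsub>cliff\<^esub> \<gamma> (cvec (coroot \<alpha>)) | \<alpha>. \<alpha> \<in> R})\<rparr>"

text \<open>
  The covering map is the twisted adjoint action \<open>v \<mapsto> (-1)\<^bsup>|w|\<^esup> w v w\<^sup>-\<^sup>1\<close>, so
  that \<open>\<gamma>(\<alpha>\<^sup>\<or>)/|\<alpha>\<^sup>\<or>|\<close> is sent to the reflection in \<open>\<alpha>\<close>.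
\<close>

definition pin_proj :: "('n::finite) cliff \<Rightarrow> real^'n^'n" where
  "pin_proj w =
     (THE g. \<forall>v. \<gamma> (cmat g *v v) =
        ((-1) ^ cliff_parity w) \<odot>\<^bsub>cliff\<^esub> (w \<otimes>\<^bsub>cliff\<^esub> \<gamma> v \<otimes>\<^bsub>cliff\<^esub> inv\<^bsub>cliff\<^esub> w))"

text \<open>The group algebra of the double cover, and its ideal \<open>\<half>(1 - \<theta>) \<complex>W\<^sup>~\<close>, which is an algebra
  with unit \<open>\<half>(1 - \<theta>)\<close>.\<close>

definition pin_alg :: "(real^'n) set \<Rightarrow> (complex, 'n cliff \<Rightarrow>\<^sub>0 complex) module" where
  "pin_alg R = monoid_alg (pin_group R)"

definition minus_idem :: "('n::finite) cliff \<Rightarrow>\<^sub>0 complex" where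
  "minus_idem = Poly_Mapping.single \<one>\<^bsub>cliff\<^esub> (1/2) - Poly_Mapping.single (\<ominus>\<^bsub>cliff\<^esub> \<one>\<^bsub>cliff\<^esub>) (1/2)"

definition pin_alg_minus :: "(real^'n) set \<Rightarrow> (complex, 'n cliff \<Rightarrow>\<^sub>0 complex) module" where
  "pin_alg_minus R =
     (pin_alg R)\<lparr>carrier := (\<lambda>a. minus_idem \<otimes>\<^bsub>pin_alg R\<^esub> a) ` carrier (pin_alg R),
                 one := minus_idem\<rparr>"

definition pin_minus_part :: "(real^'n) set \<Rightarrow> nat \<Rightarrow> ('n cliff \<Rightarrow>\<^sub>0 complex) set" where
  "pin_minus_part R i =
     {a \<in> carrier (pin_alg_minus R). \<forall>w\<in>Poly_Mapping.keys a. cliff_parity w = i}"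

definition bullet :: "(('n::finite) cliff \<Rightarrow>\<^sub>0 complex) \<Rightarrow> ('n cliff \<Rightarrow>\<^sub>0 complex)" where
  "bullet a = (\<Sum>w\<in>Poly_Mapping.keys a.
     Poly_Mapping.single (inv\<^bsub>cliff\<^esub> w) ((-1) ^ cliff_parity w * cnj (Poly_Mapping.lookup a w)))"

text \<open>The sign \<open>\<epsilon>(b)\<close> for \<open>b\<close> of parity \<open>i\<close>, in dimension \<open>d\<close>.\<close>

definition eps :: "nat \<Rightarrow> nat \<Rightarrow> complex" where
  "eps d i = (if odd d then 1 else (-1) ^ i)"

definition eps_central :: "(real^'n) set \<Rightarrow> ('n cliff \<Rightarrow>\<^sub>0 complex) \<Rightarrow> bool" where
  "eps_central R a \<longleftrightarrow>
     a \<in> carrier (pin_alg_minus R) \<and>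
     (\<forall>i\<in>{0, 1}. \<forall>b\<in>pin_minus_part R i.
        a \<otimes>\<^bsub>pin_alg_minus R\<^esub> b = eps CARD('n) i \<odot>\<^bsub>pin_alg_minus R\<^esub> (b \<otimes>\<^bsub>pin_alg_minus R\<^esub> a))"

definition admissible :: "(real^'n) set \<Rightarrow> ('n cliff \<Rightarrow>\<^sub>0 complex) \<Rightarrow> bool" where
  "admissible R \<omega> \<longleftrightarrow>
     (\<exists>i\<in>{0, 1}. \<omega> \<in> pin_minus_part R i) \<and> eps_central R \<omega> \<and> bullet \<omega> = \<omega>"


section \<open>The total angular momentum algebra\<close>

type_synonym 'n rcc = "(('n rca_gen list \<Rightarrow>\<^sub>0 complex) set \<times> 'n cliff \<Rightarrow>\<^sub>0 complex) set"

text \<open>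
  The parameters \<open>R P c t\<close> (roots, positive roots, multiplicity function, deformation parameter)
  and the orthonormal basis \<open>y\<close>, indexed by \<open>1, \<dots>, d\<close>, are fixed throughout the locale.
  Since \<open>y\<close> is orthonormal, the dual basis vector \<open>x\<^sub>p\<close> has the same coordinates as \<open>y\<^sub>p\<close>.
\<close>

locale dunkl_data =
  fixes R P :: "(real^'n) set"
    and c :: "real^'n \<Rightarrow> complex"
    and t :: complex
    and y :: "nat \<Rightarrow> real^'n"
begin

definition HC :: "(complex, 'n rcc) module" where
  "HC = tensor_alg (rca R P c t) cliff"

definition HC_part :: "nat \<Rightarrow> 'n rcc set" where
  "HC_part i =
     lin_span HC {tensor (rca R P c t) cliff h b | h b. h \<in> carrier (rca R P c t) \<and> b \<in> cliff_part i}"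

definition of_H :: "'n rca_gen \<Rightarrow> 'n rcc" where
  "of_H a = tensor (rca R P c t) cliff (rca_gen R P c t a) \<one>\<^bsub>cliff\<^esub>"

definition of_C :: "'n cliff \<Rightarrow> 'n rcc" where
  "of_C b = tensor (rca R P c t) cliff \<one>\<^bsub>rca R P c t\<^esub> b"

definition ey :: "nat \<Rightarrow> 'n rcc" where "ey p = of_H (Vec (cvec (y p)))"
definition ex :: "nat \<Rightarrow> 'n rcc" where "ex p = of_H (Cov (cvec (y p)))"
definition ee :: "nat \<Rightarrow> 'n rcc" where "ee p = of_C (\<gamma> (cvec (y p)))"

definition Omega :: "'n rcc" where
  "Omega = (\<Oplus>\<^bsub>HC\<^esub>\<alpha>\<in>P. c \<alpha> \<odot>\<^bsub>HC\<^esub> of_H (Grp (root_refl \<alpha>)))"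

definition Fp :: "'n rcc" where
  "Fp = (1 / csqrt (2 * t)) \<odot>\<^bsub>HC\<^esub> (\<Oplus>\<^bsub>HC\<^esub>p\<in>{1..CARD('n)}. ex p \<otimes>\<^bsub>HC\<^esub> ee p)"

definition Fm :: "'n rcc" where
  "Fm = (1 / csqrt (2 * t)) \<odot>\<^bsub>HC\<^esub> (\<Oplus>\<^bsub>HC\<^esub>p\<in>{1..CARD('n)}. ey p \<otimes>\<^bsub>HC\<^esub> ee p)"

definition Ep :: "'n rcc" where
  "Ep = (1 / (2 * t)) \<odot>\<^bsub>HC\<^esub> (\<Oplus>\<^bsub>HC\<^esub>p\<in>{1..CARD('n)}. ex p \<otimes>\<^bsub>HC\<^esub> ex p)"

definition Em :: "'n rcc" where
  "Em = (- 1 / (2 * t)) \<odot>\<^bsub>HC\<^esub> (\<Oplus>\<^bsub>HC\<^esub>p\<in>{1..CARD('n)}. ey p \<otimes>\<^bsub>HC\<^esub> ey p)"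

definition Hh :: "'n rcc" where
  "Hh = (1 / t) \<odot>\<^bsub>HC\<^esub>
     ((\<Oplus>\<^bsub>HC\<^esub>p\<in>{1..CARD('n)}. ex p \<otimes>\<^bsub>HC\<^esub> ey p)
      \<oplus>\<^bsub>HC\<^esub> (t * of_nat CARD('n) / 2) \<odot>\<^bsub>HC\<^esub> \<one>\<^bsub>HC\<^esub> \<ominus>\<^bsub>HC\<^esub> Omega)"

definition osp :: "'n rcc set" where
  "osp = lin_span HC {Fp, Fm, Ep, Em, Hh}"

text \<open>The algebra \<open>O\<^sub>t\<^sub>,\<^sub>c\<close>, as a subset of the carrier of \<open>H\<^sub>t\<^sub>,\<^sub>c \<otimes> C\<close>.\<close>

definition tama :: "'n rcc set" where
  "tama = {a \<in> carrier HC. \<forall>b\<in>osp. superbracket HC HC_part a b = \<zero>\<^bsub>HC\<^esub>}"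

definition Scasimir :: "'n rcc" where
  "Scasimir = Fm \<otimes>\<^bsub>HC\<^esub> Fp \<ominus>\<^bsub>HC\<^esub> Fp \<otimes>\<^bsub>HC\<^esub> Fm \<ominus>\<^bsub>HC\<^esub> (1/2) \<odot>\<^bsub>HC\<^esub> \<one>\<^bsub>HC\<^esub>"

definition Gamma :: "'n rcc" where
  "Gamma = (\<i> ^ (CARD('n) * (CARD('n) - 1) div 2)) \<odot>\<^bsub>HC\<^esub>
     foldr (\<lambda>p u. ee p \<otimes>\<^bsub>HC\<^esub> u) [1..<CARD('n) + 1] \<one>\<^bsub>HC\<^esub>"

definition Dirac :: "'n rcc" where
  "Dirac = Gamma \<otimes>\<^bsub>HC\<^esub> Scasimir"

definition \<rho> :: "('n cliff \<Rightarrow>\<^sub>0 complex) \<Rightarrow> 'n rcc" where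
  "\<rho> a = (\<Oplus>\<^bsub>HC\<^esub>w\<in>Poly_Mapping.keys a.
     Poly_Mapping.lookup a w \<odot>\<^bsub>HC\<^esub>
       tensor (rca R P c t) cliff (rca_gen R P c t (Grp (pin_proj w))) w)"

definition Dirac_deformed :: "('n cliff \<Rightarrow>\<^sub>0 complex) \<Rightarrow> 'n rcc" where
  "Dirac_deformed \<omega> = Dirac \<oplus>\<^bsub>HC\<^esub> \<rho> \<omega>"

definition tama_center :: "'n rcc set" where
  "tama_center = graded_center HC HC_part tama"

end

end

(* The polynomial (Dunkl-type) representation of H (x) C is faithful.  The leading symbols of a
central element of O are killed by sl2 and so(d), hence determined by their value at one point.
Peeling off powers of D degree by degree gives Z^gr(O) <= C[D] + C[D] n with n a lift of -1
(when -1 lies in W).  Then zeta evaluates at D = -omega: since D + omega = D_omega divides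
p(D) - p(-omega), the element a is half the quotient. *)
theory Submission
 imports Defs "HOL-Computational_Algebra.Polynomial"
begin

text \<open>The module has the PBW basis of H (x) C itself, so z is recovered from
  \<open>app z vac\<close>, and right multiplication by a generator is a second explicit operator,
  commuting with all left multiplications. A commutation relation of z thus becomes an equation
  between two operators on one vector, and its top degrees become differential equations. The
  decomposition uses only two relations of a central element: supercommutation with F+ and F-, and
  commutation with the even angular momentum elements \<open>AA u v\<close>. The symbol has one
  component per Clifford monomial e_S; rotations mix them by constants, so the object determined by
  its value at (y_1, y_2) is the whole family. Degree 2m leaves room for one scalar, realised by
  D^m. d >= 3 ensures that only 1 and -1 act trivially on bivectors. Substituting -\<omega> is
  multiplicative because the pair (p, q) is unique and -\<omega> commutes with n. For the quotient,
  D must commute with \<omega>: for even d, odd admissible elements vanish by positivity of the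
  anti-involution. The values of zeta are central in the ungraded sense because, for even d and an
  odd group element, supercommutation forces p even and q odd.\<close>

abbreviation "keys == Poly_Mapping.keys"
abbreviation "single == Poly_Mapping.single"
abbreviation "lookup == Poly_Mapping.lookup"

lemmas m_ass = mult.assoc
lemmas diff_dists = left_diff_distrib right_diff_distrib
lemmas add_dists = distrib_left distrib_right
lemmas sum_dists = sum_distrib_left sum_distrib_right

section \<open>Complex algebras as records: monoid algebras, quotients, and maps from them into
  operator rings\<close>

section \<open>Complex algebras and their homomorphisms\<close>

text \<open>The scalars are the type \<open>complex\<close> and not the carrier of a second record,
  as in the definitions. Free, Clifford, Cherednik, tensor and pin group algebras are all shown to
  be instances.\<close>

locale calg = ring A for A :: "(complex, 'a) module" (structure) +
 assumes smult_closed [simp, intro]: "a : carrier A ==> k \<odot> a : carrier A"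
  and smult_r_distr: "a : carrier A ==> b : carrier A ==> k \<odot> (a \<oplus> b) = k \<odot> a \<oplus> k \<odot> b"
  and smult_l_distr: "a : carrier A ==> (k + l) \<odot> a = k \<odot> a \<oplus> l \<odot> a"
  and smult_smult: "a : carrier A ==> k \<odot> (l \<odot> a) = (k * l) \<odot> a"
  and smult_one [simp]: "a : carrier A ==> 1 \<odot> a = a"
  and smult_mult_l: "a : carrier A ==> b : carrier A ==> (k \<odot> a) \<otimes> b = k \<odot> (a \<otimes> b)"
  and smult_mult_r: "a : carrier A ==> b : carrier A ==> a \<otimes> (k \<odot> b) = k \<odot> (a \<otimes> b)"
begin

lemma smult_zero_l [simp]: "a : carrier A ==> 0 \<odot> a = \<zero>"
 using smult_l_distr[of a 0 0] by simp

lemma smult_zero_r [simp]: "k \<odot> \<zero> = \<zero>"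
 using smult_r_distr[of \<zero> \<zero> k] by (metis add.l_cancel_one' smult_closed zero_closed l_zero)

lemma smult_minus_one: "a : carrier A ==> (-1) \<odot> a = \<ominus> a"
 using smult_l_distr[of a "-1" 1] by (simp add: minus_equality)

lemma lin_span_subset:
 assumes "S <= carrier A" shows "lin_span A S <= carrier A"
proof
 fix u assume "u : lin_span A S" thus "u : carrier A"
  by induction (use assms in auto)
qed

lemma lin_span_base: "S <= carrier A ==> s : S ==> s : lin_span A S"
 using lin_span.step[OF lin_span.zero, of s S A 1] by (auto simp: subset_iff)

lemma lin_span_add:
 assumes "S <= carrier A" "u : lin_span A S" "v : lin_span A S"
 shows "u \<oplus> v : lin_span A S"
 using assms(2)
proof induction
 case zero
 have "v : carrier A" using assms lin_span_subset by blast
 thus ?case using assms by simp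
next
 case (step u s k)
 hence "u : carrier A" "v : carrier A" "s : carrier A"
  using assms lin_span_subset by auto
 hence "k \<odot> s \<oplus> u \<oplus> v = k \<odot> s \<oplus> (u \<oplus> v)" by (simp add: a_assoc)
 thus ?case using step lin_span.step by metis
qed

lemma lin_span_smult:
 assumes "S <= carrier A" "u : lin_span A S"
 shows "k \<odot> u : lin_span A S"
 using assms(2)
proof induction
 case zero
 thus ?case by (simp add: lin_span.zero)
next
 case (step u s l)
 hence "u : carrier A" "s : carrier A"
  using assms lin_span_subset by auto
 hence "k \<odot> (l \<odot> s \<oplus> u) = (k * l) \<odot> s \<oplus> k \<odot> u"
  by (simp add: smult_r_distr smult_smult)
 thus ?case using step lin_span.step by metis
qed

end

definition lext :: "(complex, 'a) module => ('k => 'a) => ('k \<Rightarrow>\<^sub>0 complex) => 'a" where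
 "lext A f F = (\<Oplus>\<^bsub>A\<^esub>k\<in>keys F. lookup F k \<odot>\<^bsub>A\<^esub> f k)"

text \<open>Setting one key to 0 lowers the number of keys, so a finitely supported function is
  built monomial by monomial. The bound \<open>K\<close> on the keys carries carrier conditions
  through the induction.\<close>

lemma pm_induct_on [consumes 1, case_names zero add]:
 assumes "keys F <= K" "P 0"
  and "!!k v f. k : K ==> keys f <= K ==> P f ==> P (single k v + f)"
 shows "P (F :: 'k \<Rightarrow>\<^sub>0 'v::comm_monoid_add)"
 using assms(1)
proof (induction "card (keys F)" arbitrary: F rule: less_induct)
 case less
 show ?case
 proof (cases "keys F = {}")
  case True
  thus ?thesis using assms(2)
   by (metis lookup_not_eq_zero_eq_in_keys empty_iff poly_mapping_eqI lookup_zero)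
 next
  case False
  then obtain k where k: "k : keys F" by blast
  define G where "G = Poly_Mapping.update k 0 F"
  have keysG: "keys G = keys F - {k}"
   unfolding G_def by (simp add: keys_update)
  have "F = single k (lookup F k) + G"
   by (rule poly_mapping_eqI) (auto simp: G_def lookup_add lookup_update lookup_single when_def)
  moreover have "card (keys G) < card (keys F)"
   unfolding keysG using k by (intro card_Diff1_less) auto
  hence "P G" using less(1)[of G] keysG less(2) by auto
  ultimately show ?thesis using assms(3)[of k G] keysG k less(2)
   by (metis Diff_subset dual_order.trans subsetD)
 qed
qed

lemma pm_induct [case_names zero add]:
 assumes "P 0" "!!k v f. P f ==> P (single k v + f)"
 shows "P (F :: 'k \<Rightarrow>\<^sub>0 'v::comm_monoid_add)"
 by (rule pm_induct_on[of F UNIV]) (use assms in auto)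

context calg
begin

lemma lext_superset:
 assumes "finite B" "keys F <= B" "f ` B <= carrier A"
 shows "lext A f F = (\<Oplus>k\<in>B. lookup F k \<odot> f k)"
 unfolding lext_def
 by (rule add.finprod_mono_neutral_cong_left)
  (use assms in \<open>auto simp: in_keys_iff image_subset_iff\<close>)

lemma lext_zero [simp]: "lext A f 0 = \<zero>"
 by (simp add: lext_def)

lemma lext_single: "f k : carrier A ==> lext A f (single k v) = v \<odot> f k"
 using lext_superset[of "{k}" "single k v" f] by simp

lemma lext_add:
 assumes "f ` keys F <= carrier A" "f ` keys G <= carrier A"
 shows "lext A f (F + G) = lext A f F \<oplus> lext A f G"
proof -
 let ?B = "keys F \<union> keys G"
 have f: "f : ?B \<rightarrow> carrier A" using assms by auto
 have "lext A f (F + G) = (\<Oplus>k\<in>?B. lookup F k \<odot> f k \<oplus> lookup G k \<odot> f k)"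
  unfolding lext_superset[of ?B "F + G" f, OF _ keys_add image_subsetI, OF _ funcset_mem[OF f], simplified]
  by (rule finsum_cong') (use f in \<open>auto simp: lookup_add intro!: smult_l_distr\<close>)
 also have "... = (\<Oplus>k\<in>?B. lookup F k \<odot> f k) \<oplus> (\<Oplus>k\<in>?B. lookup G k \<odot> f k)"
  by (rule finsum_addf) (use assms in auto)
 finally show ?thesis using lext_superset[of ?B F f] lext_superset[of ?B G f] assms
  by (simp add: image_Un)
qed

end

subsection \<open>Monoid algebras\<close>

text \<open>The convolution product of \<open>monoid_alg\<close> detached from its record:
  bilinearity then holds for all finitely supported functions, without carrier conditions.\<close>

definition mmul :: "('m, 'r) monoid_scheme => ('m \<Rightarrow>\<^sub>0 complex) => ('m \<Rightarrow>\<^sub>0 complex) => ('m \<Rightarrow>\<^sub>0 complex)" where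
 "mmul M f g = (SUM a:keys f. SUM b:keys g.
       single (a \<otimes>\<^bsub>M\<^esub> b) (lookup f a * lookup g b))"

lemma monoid_alg_simps:
 "carrier (monoid_alg M) = {f. keys f <= carrier M}"
 "mult (monoid_alg M) = mmul M"
 "one (monoid_alg M) = single \<one>\<^bsub>M\<^esub> 1"
 "zero (monoid_alg M) = 0"
 "add (monoid_alg M) = (+)"
 "smult (monoid_alg M) = scale"
 by (auto simp: monoid_alg_def mmul_def fun_eq_iff)

text \<open>Terms outside the keys have coefficient 0, so both sums may run over larger finite sets.
  With common index sets, additivity of the product is distributivity of coefficients.\<close>

lemma mmul_superset:
 assumes "finite S" "finite T" "keys f <= S" "keys g <= T"
 shows "mmul M f g = (SUM a:S. SUM b:T.
       single (a \<otimes>\<^bsub>M\<^esub> b) (lookup f a * lookup g b))"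
proof -
 have "(SUM b:keys g. single (a \<otimes>\<^bsub>M\<^esub> b) (lookup f a * lookup g b))
  = (SUM b:T. single (a \<otimes>\<^bsub>M\<^esub> b) (lookup f a * lookup g b))" for a
  by (rule sum.mono_neutral_left) (use assms in \<open>auto simp: in_keys_iff\<close>)
 thus ?thesis unfolding mmul_def
  by (simp, intro sum.mono_neutral_left) (use assms in \<open>auto simp: in_keys_iff\<close>)
qed

lemma mmul_add_l: "mmul M (f + f') g = mmul M f g + mmul M f' g"
proof -
 let ?S = "keys f \<union> keys f'" and ?T = "keys g"
 have *: "finite ?S" "finite ?T" by auto
 show ?thesis
  using mmul_superset[OF *, of "f + f'" g M] mmul_superset[OF *, of "f" g M]
   mmul_superset[OF *, of "f'" g M] keys_add[of f f']
  by (simp add: lookup_add distrib_right single_add sum.distrib)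
qed

lemma mmul_add_r: "mmul M f (g + g') = mmul M f g + mmul M f g'"
proof -
 let ?T = "keys g \<union> keys g'" and ?S = "keys f"
 have *: "finite ?S" "finite ?T" by auto
 show ?thesis
  using mmul_superset[OF *, of f "g + g'" M] mmul_superset[OF *, of "f" g M]
   mmul_superset[OF *, of "f" g' M] keys_add[of g g']
  by (simp add: lookup_add distrib_left single_add sum.distrib)
qed

lemma mmul_zero [simp]: "mmul M 0 g = 0" "mmul M f 0 = 0"
 by (simp_all add: mmul_def)

lemma mmul_single: "mmul M (single a k) (single b l)
  = single (a \<otimes>\<^bsub>M\<^esub> b) (k * l)"
 using mmul_superset[of "{a}" "{b}" "single a k" "single b l" M] by simp

lemma lookup_scale [simp]: "lookup (scale k f) a = k * lookup f a"
 by (simp add: Poly_Mapping.map.rep_eq when_def)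

lemma scale_add: "scale k (f + g) = scale k f + scale k g"
 by (rule poly_mapping_eqI) (simp add: lookup_add distrib_left)

lemma scale_zero [simp]: "scale k 0 = 0"
 by (rule poly_mapping_eqI) simp

lemma scale_single [simp]: "scale k (single a l) = single a (k * l)"
 by (rule poly_mapping_eqI) (simp add: lookup_single when_def)

lemma keys_scale: "keys (scale k f) <= keys f"
 by (auto simp: in_keys_iff)

lemma mmul_scale: "mmul M (scale k f) g = scale k (mmul M f g)" "mmul M f (scale k g) = scale k (mmul M f g)"
proof -
 have 1: "mmul M (scale k f) (single b l) = scale k (mmul M f (single b l))" for b l
  by (induction f rule: pm_induct) (auto simp: mmul_add_l scale_add mmul_single m_ass)
 show "mmul M (scale k f) g = scale k (mmul M f g)"
  by (induction g rule: pm_induct) (auto simp: mmul_add_r scale_add 1)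
 have 2: "mmul M (single b l) (scale k g) = scale k (mmul M (single b l) g)" for b l
  by (induction g rule: pm_induct) (simp_all add: mmul_add_r scale_add mmul_single mult.left_commute)
 show "mmul M f (scale k g) = scale k (mmul M f g)"
  by (induction f rule: pm_induct) (auto simp: mmul_add_l scale_add 2)
qed

context Group.monoid
begin

lemma mmul_closed:
 assumes "keys f <= carrier G" "keys g <= carrier G"
 shows "keys (mmul G f g) <= carrier G"
proof -
 have 1: "keys (mmul G (single b l) g) <= carrier G" if "b : carrier G" for b l
  using assms(2)
 proof (induction rule: pm_induct_on)
  case (add k v f)
  thus ?case using that m_closed[OF that add(1)]
   by (auto simp: mmul_add_r mmul_single dest!: keys_add[THEN subsetD] split: if_splits)
 qed simp
 show ?thesis using assms(1)
 proof (induction rule: pm_induct_on)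
  case (add k v f)
  thus ?case using 1[OF add(1), of v] by (auto simp: mmul_add_l dest!: keys_add[THEN subsetD])
 qed simp
qed

lemma mmul_assoc:
 assumes "keys f <= carrier G" "keys g <= carrier G" "keys h <= carrier G"
 shows "mmul G (mmul G f g) h = mmul G f (mmul G g h)"
proof -
 have 1: "mmul G (mmul G (single a k) (single b l)) h
  = mmul G (single a k) (mmul G (single b l) h)"
  if "a : carrier G" "b : carrier G" for a b k l
  using assms(3)
  by (induction rule: pm_induct_on) (use that in \<open>auto simp: mmul_add_r mmul_single m_assoc m_ass\<close>)
 have 2: "mmul G (mmul G (single a k) g) h = mmul G (single a k) (mmul G g h)"
  if "a : carrier G" for a k
  using assms(2)
  by (induction rule: pm_induct_on) (use that 1 in \<open>auto simp: mmul_add_r mmul_add_l\<close>)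
 show ?thesis using assms(1)
  by (induction rule: pm_induct_on) (use 2 in \<open>auto simp: mmul_add_r mmul_add_l\<close>)
qed

lemma mmul_one:
 assumes "keys f <= carrier G"
 shows "mmul G (single \<one> 1) f = f" "mmul G f (single \<one> 1) = f"
 using assms by (induction rule: pm_induct_on) (auto simp: mmul_add_r mmul_add_l mmul_single)

lemma calg_monoid_alg: "calg (monoid_alg G)"
proof -
 have "abelian_group (monoid_alg G)"
 proof (rule abelian_groupI)
  fix x assume "x : carrier (monoid_alg G)"
  thus "EX y:carrier (monoid_alg G). y \<oplus>\<^bsub>monoid_alg G\<^esub> x = \<zero>\<^bsub>monoid_alg G\<^esub>"
   by (intro bexI[of _ "- x"]) (auto simp: monoid_alg_simps in_keys_iff subset_iff)
 qed (auto simp: monoid_alg_simps add.assoc add.commute dest!: keys_add[THEN subsetD])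
 moreover have "Group.monoid (monoid_alg G)"
  by (rule monoidI) (auto simp: monoid_alg_simps mmul_assoc mmul_one mmul_closed[THEN subsetD])
 ultimately have "ring (monoid_alg G)"
  by (rule ringI) (auto simp: monoid_alg_simps mmul_add_l mmul_add_r)
 moreover have "scale (k + l) f = scale k f + scale l f" "scale k (scale l f) = scale (k * l) f"
   "scale 1 f = f" for k l and f :: "'a \<Rightarrow>\<^sub>0 complex"
  by (auto intro!: poly_mapping_eqI simp: lookup_add distrib_right)
 ultimately show ?thesis
  by (intro calg.intro calg_axioms.intro)
   (use keys_scale in \<open>auto simp: monoid_alg_simps scale_add mmul_scale dest!: keys_scale[THEN subsetD]\<close>)
qed

end

subsection \<open>Homomorphisms to operator rings\<close>

text \<open>A type-class ring with a central copy \<open>sc\<close> of the complex numbers. The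
  record algebras are mapped into such a ring so that identities are plain equations, free of
  membership conditions.\<close>

locale scalars =
 fixes sc :: "complex => 'r::ring_1"
 assumes sc_add: "sc (k + l) = sc k + sc l" and sc_mult: "sc (k * l) = sc k * sc l"
  and sc_one [simp]: "sc 1 = 1" and sc_comm: "a * sc k = sc k * a"
begin

lemma sc_zero [simp]: "sc 0 = 0"
 using sc_add[of 0 0] by simp

lemma sc_minus: "sc (- k) = - sc k"
 using sc_add[of k "-k"] by (simp add: eq_neg_iff_add_eq_0 add.commute)

lemma sc_diff: "sc (k - l) = sc k - sc l"
 using sc_add[of k "-l"] by (simp add: sc_minus)

lemma slc: "a * (sc k * b) = sc k * (a * b)"
 by (metis m_ass sc_comm)

lemma sc_mult_mult: "(sc k * a) * (sc l * b) = sc (k * l) * (a * b)"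
 by (metis m_ass sc_comm sc_mult)

lemma sc_sum: "sc (sum f I) = (SUM i:I. sc (f i))"
 by (induction I rule: infinite_finite_induct) (auto simp: sc_add)

definition ahom :: "(complex, 'a) module => ('a => 'r) => bool" where
 "ahom A f \<longleftrightarrow> (ALL a:carrier A. ALL b:carrier A. f (a \<otimes>\<^bsub>A\<^esub> b) = f a * f b & f (a \<oplus>\<^bsub>A\<^esub> b) = f a + f b)
  & f \<one>\<^bsub>A\<^esub> = 1 & (\<forall>k. ALL a:carrier A. f (k \<odot>\<^bsub>A\<^esub> a) = sc k * f a)"

lemma ahomD:
 assumes "ahom A f" "a : carrier A" "b : carrier A"
 shows "f (a \<otimes>\<^bsub>A\<^esub> b) = f a * f b" "f (a \<oplus>\<^bsub>A\<^esub> b) = f a + f b" "f \<one>\<^bsub>A\<^esub> = 1" "f (k \<odot>\<^bsub>A\<^esub> a) = sc k * f a"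
 using assms by (auto simp: ahom_def)

lemma ahom_group:
 assumes "ahom A f" "calg A"
 shows "f \<zero>\<^bsub>A\<^esub> = 0" "a : carrier A ==> f (\<ominus>\<^bsub>A\<^esub> a) = - f a"
  "a : carrier A ==> b : carrier A ==> f (a \<ominus>\<^bsub>A\<^esub> b) = f a - f b"
proof -
 interpret calg A by fact
 have 0: "f \<zero>\<^bsub>A\<^esub> = 0" using ahomD(2)[OF assms(1), of "\<zero>\<^bsub>A\<^esub>" "\<zero>\<^bsub>A\<^esub>"] by simp
 have 1: "f (\<ominus>\<^bsub>A\<^esub> a) = - f a" if "a : carrier A" for a
  using ahomD(2)[OF assms(1), of "a" "\<ominus>\<^bsub>A\<^esub> a"] 0 that by (simp add: r_neg eq_neg_iff_add_eq_0 add.commute)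
 show "f \<zero>\<^bsub>A\<^esub> = 0" "a : carrier A ==> f (\<ominus>\<^bsub>A\<^esub> a) = - f a" using 0 1 by auto
 show "a : carrier A ==> b : carrier A ==> f (a \<ominus>\<^bsub>A\<^esub> b) = f a - f b"
  using ahomD(2)[OF assms(1), of "a" "\<ominus>\<^bsub>A\<^esub> b"] 1[of b] by (simp add: a_minus_def)
qed

lemma ahom_finsum:
 assumes "ahom A f" "calg A" "g : I \<rightarrow> carrier A"
 shows "f (\<Oplus>\<^bsub>A\<^esub>i\<in>I. g i) = (SUM i:I. f (g i))"
proof -
 interpret calg A by fact
 show ?thesis using assms(3)
 proof (induction I rule: infinite_finite_induct)
  case (infinite I)
  thus ?case by (simp add: finsum_infinite ahom_group[OF assms(1,2)])
 next
  case empty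
  thus ?case by (simp add: ahom_group[OF assms(1,2)])
 next
  case (insert x I)
  hence "(\<Oplus>\<^bsub>A\<^esub>i\<in>insert x I. g i) = g x \<oplus>\<^bsub>A\<^esub> (\<Oplus>\<^bsub>A\<^esub>i\<in>I. g i)"
   by (intro finsum_insert) auto
  moreover have "(\<Oplus>\<^bsub>A\<^esub>i\<in>I. g i) : carrier A" using insert by (intro finsum_closed) auto
  ultimately show ?case using insert ahomD(2)[OF assms(1), of "g x" "\<Oplus>\<^bsub>A\<^esub>i\<in>I. g i"] by auto
 qed
qed

definition mlin :: "('k => 'r) => ('k \<Rightarrow>\<^sub>0 complex) => 'r" where
 "mlin \<phi> F = (SUM k:keys F. sc (lookup F k) * \<phi> k)"

lemma mlin_superset:
 "finite B ==> keys F <= B ==> mlin \<phi> F = (SUM k:B. sc (lookup F k) * \<phi> k)"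
 unfolding mlin_def by (rule sum.mono_neutral_left) (auto simp: in_keys_iff)

lemma mlin_zero [simp]: "mlin \<phi> 0 = 0"
 by (simp add: mlin_def)

lemma mlin_single [simp]: "mlin \<phi> (single k v) = sc v * \<phi> k"
 using mlin_superset[of "{k}" "single k v" \<phi>] by simp

lemma mlin_add: "mlin \<phi> (F + G) = mlin \<phi> F + mlin \<phi> G"
 using mlin_superset[of "keys F \<union> keys G" F \<phi>]
  mlin_superset[of "keys F \<union> keys G" G \<phi>]
  mlin_superset[of "keys F \<union> keys G" "F + G" \<phi>] keys_add[of F G]
 by (simp add: lookup_add sc_add distrib_right sum.distrib)

lemma mlin_diff: "mlin \<phi> (F - G) = mlin \<phi> F - mlin \<phi> G"
 using mlin_add[of \<phi> "F - G" G] by simp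

lemma mlin_scale: "mlin \<phi> (scale c F) = sc c * mlin \<phi> F"
 using mlin_superset[of "keys F" "scale c F" \<phi>] keys_scale[of c F]
 by (simp add: mlin_def sum_distrib_left sc_mult m_ass)

lemma mlin_sum: "mlin \<phi> (sum f I) = (SUM i:I. mlin \<phi> (f i))"
 by (induction I rule: infinite_finite_induct) (auto simp: mlin_add)

lemma mlin_mmul:
 assumes "!!a b. a : carrier M ==> b : carrier M ==> \<phi> (a \<otimes>\<^bsub>M\<^esub> b) = \<phi> a * \<phi> b"
  "keys F <= carrier M" "keys G <= carrier M"
 shows "mlin \<phi> (mmul M F G) = mlin \<phi> F * mlin \<phi> G"
proof -
 have 1: "mlin \<phi> (mmul M (single k v) G) = mlin \<phi> (single k v) * mlin \<phi> G"
  if "k : carrier M" for k v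
  using assms(3)
  by (induction rule: pm_induct_on)
   (use that assms(1) in \<open>auto simp: mmul_add_r mlin_add mmul_single distrib_left sc_mult_mult\<close>)
 show ?thesis using assms(2)
  by (induction rule: pm_induct_on) (use 1 in \<open>auto simp: mmul_add_l mlin_add distrib_right\<close>)
qed

lemma ahom_mlin:
 assumes "!!a b. a : carrier M ==> b : carrier M ==> \<phi> (a \<otimes>\<^bsub>M\<^esub> b) = \<phi> a * \<phi> b" "\<phi> \<one>\<^bsub>M\<^esub> = 1"
 shows "ahom (monoid_alg M) (mlin \<phi>)"
 unfolding ahom_def by (auto simp: monoid_alg_simps mlin_mmul[where M = M] assms mlin_add mlin_scale)

text \<open>Evaluation at a chosen representative of the coset; \<open>qlift_props\<close> shows
  that the choice is immaterial when \<open>f\<close> kills the relators.\<close>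

definition qlift :: "('a => 'r) => 'a set => 'r" where
 "qlift f X = f (SOME a. a : X)"

end

subsection \<open>Quotients\<close>

lemma quot_alg_simps:
 "carrier (quot_alg A S) = carrier (A Quot (Idl\<^bsub>A\<^esub> S))"
 "mult (quot_alg A S) = mult (A Quot (Idl\<^bsub>A\<^esub> S))"
 "one (quot_alg A S) = one (A Quot (Idl\<^bsub>A\<^esub> S))"
 "zero (quot_alg A S) = zero (A Quot (Idl\<^bsub>A\<^esub> S))"
 "add (quot_alg A S) = add (A Quot (Idl\<^bsub>A\<^esub> S))"
 "smult (quot_alg A S) = (%c X. \<Union>a\<in>X. Idl\<^bsub>A\<^esub> S +>\<^bsub>A\<^esub> (c \<odot>\<^bsub>A\<^esub> a))"
 by (simp_all add: quot_alg_def ring.defs module.defs)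

locale calg_quot = calg A for A :: "(complex, 'a) module" (structure) and S +
 assumes S_sub: "S <= carrier A"
begin

abbreviation "I == Idl S"
abbreviation "Q == quot_alg A S"
abbreviation "q == quot_class A S"

sublocale idl: ideal "I" A
 by (rule genideal_ideal[OF S_sub])

lemma q_props:
 assumes "a : carrier A" "b : carrier A"
 shows "q a : carrier Q" "q a \<otimes>\<^bsub>Q\<^esub> q b = q (a \<otimes> b)" "q a \<oplus>\<^bsub>Q\<^esub> q b = q (a \<oplus> b)" "\<one>\<^bsub>Q\<^esub> = q \<one>"
 using ring_hom_closed[OF idl.rcos_ring_hom] ring_hom_mult[OF idl.rcos_ring_hom]
  ring_hom_add[OF idl.rcos_ring_hom] ring_hom_one[OF idl.rcos_ring_hom] assms
 by (auto simp: quot_alg_simps quot_class_def)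

lemma q_eq_iff: "a : carrier A ==> b : carrier A ==> q a = q b \<longleftrightarrow> a \<ominus> b : I"
 unfolding quot_class_def using quotient_eq_iff_same_a_r_cos[OF idl.ideal_axioms, of a b] by simp

lemma q_surj:
 assumes "X : carrier Q" obtains a where "a : carrier A" "X = q a"
 using assms by (auto simp: quot_alg_simps quot_class_def FactRing_def A_RCOSETS_def RCOSETS_def a_r_coset_def)

lemma idl_smult: "i : I ==> k \<odot> i : I"
proof -
 assume i: "i : I"
 hence "k \<odot> i = (k \<odot> \<one>) \<otimes> i" using smult_mult_l[of \<one> i k] idl.a_Hcarr by auto
 thus ?thesis using idl.I_l_closed[OF i, of "k \<odot> \<one>"] by auto
qed

lemma q_mem: "a : carrier A ==> a : q a"
 unfolding quot_class_def using idl.a_rcos_self by auto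

lemma q_memD:
 assumes "a : carrier A" "b : q a" shows "b : carrier A" "q b = q a" "b \<ominus> a : I"
proof -
 show b: "b : carrier A" using assms idl.a_elemrcos_carrier unfolding quot_class_def by auto
 show "q b = q a" using assms idl.a_repr_independence'[of b a] unfolding quot_class_def by simp
 thus "b \<ominus> a : I" using q_eq_iff b assms(1) by auto
qed

lemma smult_minus_r: 
 assumes "a : carrier A" "b : carrier A" shows "k \<odot> (a \<ominus> b) = k \<odot> a \<ominus> k \<odot> b"
proof -
 have "k \<odot> (\<ominus> b) = k \<odot> ((-1) \<odot> b)" using smult_minus_one[OF assms(2)] by (rule arg_cong[OF sym])
 also have "... = (-1) \<odot> (k \<odot> b)" using assms by (simp add: smult_smult)
 also have "... = \<ominus> (k \<odot> b)" using assms by (intro smult_minus_one) auto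
 finally show ?thesis unfolding a_minus_def using assms by (subst smult_r_distr) auto
qed

text \<open>The scalar action on a coset is a union over all its representatives. Scalars preserve
  the ideal, so every member of the union is the same coset.\<close>

lemma q_smult: "a : carrier A ==> k \<odot>\<^bsub>Q\<^esub> q a = q (k \<odot> a)"
proof -
 assume a: "a : carrier A"
 have *: "q (k \<odot> b) = q (k \<odot> a)" if b: "b : q a" for b
 proof -
  have "k \<odot> b \<ominus> k \<odot> a : I"
   unfolding smult_minus_r[OF q_memD(1)[OF a b] a, symmetric] by (rule idl_smult[OF q_memD(3)[OF a b]])
  thus ?thesis using iffD2[OF q_eq_iff[OF smult_closed[OF q_memD(1)[OF a b]] smult_closed[OF a]]] by blast
 qed
 have "(\<Union>b\<in>q a. q (k \<odot> b)) = q (k \<odot> a)"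
  by (rule SUP_eq_const) (use q_mem[OF a] * in blast)+
 thus ?thesis by (simp add: quot_alg_simps quot_class_def)
qed

lemma q_zero: "\<zero>\<^bsub>Q\<^esub> = q \<zero>"
 unfolding quot_class_def quot_alg_simps by (simp add: FactRing_def idl.a_rcos_const)

lemma calg_Q: "calg Q"
proof -
 have "ring Q"
 proof (rule ringI)
  show "abelian_group Q"
  proof (rule abelian_groupI)
   fix X assume "X : carrier Q"
   then obtain a where a: "a : carrier A" "X = q a" using q_surj by blast
   thus "EX Y:carrier Q. Y \<oplus>\<^bsub>Q\<^esub> X = \<zero>\<^bsub>Q\<^esub>"
    by (intro bexI[of _ "q (\<ominus> a)"]) (simp_all add: q_props q_zero l_neg)
  qed (auto simp: q_props(1)[OF zero_closed zero_closed] q_props q_zero a_ac elim!: q_surj)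
  show "Group.monoid Q" by (rule monoidI) (auto simp: q_props(1)[OF one_closed one_closed] q_props(4)[OF one_closed one_closed] q_props m_assoc elim!: q_surj)
 qed (auto simp: q_props l_distr r_distr elim!: q_surj)
 moreover have "calg_axioms Q"
 proof
  fix X Y k l assume X: "X : carrier Q"
  then obtain a where a: "a : carrier A" "X = q a" using q_surj by blast
  show "k \<odot>\<^bsub>Q\<^esub> X : carrier Q" using a by (simp add: q_smult q_props)
  show "(k + l) \<odot>\<^bsub>Q\<^esub> X = k \<odot>\<^bsub>Q\<^esub> X \<oplus>\<^bsub>Q\<^esub> l \<odot>\<^bsub>Q\<^esub> X" using a by (simp add: q_smult q_props smult_l_distr)
  show "k \<odot>\<^bsub>Q\<^esub> (l \<odot>\<^bsub>Q\<^esub> X) = (k * l) \<odot>\<^bsub>Q\<^esub> X" using a by (simp add: q_smult smult_smult)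
  show "1 \<odot>\<^bsub>Q\<^esub> X = X" using a by (simp add: q_smult)
  assume Y: "Y : carrier Q"
  then obtain b where b: "b : carrier A" "Y = q b" using q_surj by blast
  show "k \<odot>\<^bsub>Q\<^esub> (X \<oplus>\<^bsub>Q\<^esub> Y) = k \<odot>\<^bsub>Q\<^esub> X \<oplus>\<^bsub>Q\<^esub> k \<odot>\<^bsub>Q\<^esub> Y" using a b by (simp add: q_smult q_props smult_r_distr)
  show "k \<odot>\<^bsub>Q\<^esub> X \<otimes>\<^bsub>Q\<^esub> Y = k \<odot>\<^bsub>Q\<^esub> (X \<otimes>\<^bsub>Q\<^esub> Y)" using a b by (simp add: q_smult q_props smult_mult_l)
  show "X \<otimes>\<^bsub>Q\<^esub> (k \<odot>\<^bsub>Q\<^esub> Y) = k \<odot>\<^bsub>Q\<^esub> (X \<otimes>\<^bsub>Q\<^esub> Y)" using a b by (simp add: q_smult q_props smult_mult_r)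
 qed
 ultimately show ?thesis by (rule calg.intro)
qed

end

text \<open>The kernel of \<open>f\<close> is an ideal containing the relators, hence the ideal they
  generate; so \<open>f\<close> is constant on cosets.\<close>

lemma (in scalars) qlift_props:
 assumes "calg_quot A S" "ahom A f" "!!s. s : S ==> f s = 0"
 shows "ahom (quot_alg A S) (qlift f)" "a : carrier A ==> qlift f (quot_class A S a) = f a"
proof -
 interpret calg_quot A S by fact
 note fg = ahom_group[OF assms(2) calg_axioms]
 have "ideal {a : carrier A. f a = 0} A"
 proof (rule idealI)
  show "ring A" by unfold_locales
  show "subgroup {a : carrier A. f a = 0} (add_monoid A)"
   by (rule add.subgroupI) (use fg ahomD[OF assms(2)] in \<open>auto simp flip: a_inv_def\<close>)
 qed (use ahomD[OF assms(2)] in auto)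
 hence "I <= {a : carrier A. f a = 0}"
  by (rule genideal_minimal) (use assms(3) S_sub in auto)
 hence fI: "f i = 0" if "i : I" for i using that by auto
 have 1: "qlift f (q a) = f a" if a: "a : carrier A" for a
 proof -
  have "(SOME b. b : q a) : q a" using q_mem[OF a] by (rule someI)
  thus ?thesis using q_memD[OF a] fI fg(3) a unfolding qlift_def by fastforce
 qed
 thus "a : carrier A ==> qlift f (q a) = f a" .
 show "ahom Q (qlift f)"
  unfolding ahom_def
 proof (intro conjI ballI allI)
  show "qlift f \<one>\<^bsub>Q\<^esub> = 1" using 1[OF one_closed] ahomD(3)[OF assms(2) one_closed one_closed] q_props(4)[OF one_closed one_closed] by simp
  fix X k assume "X : carrier Q"
  then obtain a where a: "a : carrier A" "X = q a" using q_surj by blast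
  show "qlift f (k \<odot>\<^bsub>Q\<^esub> X) = sc k * qlift f X" using a 1 ahomD(4)[OF assms(2)] by (simp add: q_smult)
  fix Y assume "Y : carrier Q"
  then obtain b where b: "b : carrier A" "Y = q b" using q_surj by blast
  show "qlift f (X \<otimes>\<^bsub>Q\<^esub> Y) = qlift f X * qlift f Y" "qlift f (X \<oplus>\<^bsub>Q\<^esub> Y) = qlift f X + qlift f Y"
   using a b 1 ahomD[OF assms(2)] by (simp_all add: q_props)
 qed
qed

section \<open>Polynomial functions in x and y: derivatives, substitutions, homogeneous parts,
  divided differences\<close>

section \<open>Polynomial functions on \<open>V \<times> V\<^sup>*\<close>\<close>

type_synonym 'n pt = "(complex^'n) \<times> (complex^'n)"

text \<open>Coefficients of the module will be polynomial functions of a pair of points. As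
  functions they admit matrix substitutions, evaluation and restriction to lines directly, and
  equality is pointwise.\<close>

inductive polyfun :: "('n::finite pt => complex) => bool" where
 const: "polyfun (%_. c)"
| add: "polyfun f ==> polyfun g ==> polyfun (%v. f v + g v)"
| mx: "polyfun f ==> polyfun (%v. fst v $ i * f v)"
| my: "polyfun f ==> polyfun (%v. snd v $ i * f v)"

lemma polyfun_mult:
 assumes "polyfun f" "polyfun g" shows "polyfun (%v. f v * g v)"
 using assms(1)
proof induction
 case (const c)
 show ?case using assms(2)
 proof induction
  case (mx f i)
  thus ?case using polyfun.mx[of "%v. c * f v" i] by (simp add: mult.left_commute)
 next
  case (my f i)
  thus ?case using polyfun.my[of "%v. c * f v" i] by (simp add: mult.left_commute)
 qed (auto simp: distrib_left intro: polyfun.intros)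
qed (auto simp: distrib_right m_ass intro: polyfun.intros)

lemma polyfun_sum: "(!!i. i : I ==> polyfun (f i)) ==> polyfun (%v. SUM i:I. f i v)"
 by (induction I rule: infinite_finite_induct) (auto intro: polyfun.intros)

definition ln_pt :: "'n::finite pt => 'n pt => complex => 'n pt" where
 "ln_pt a h s = (fst a + s *s fst h, snd a + s *s snd h)"

lemma ln_pt_simps [simp]: "fst (ln_pt a h s) $ i = fst a $ i + s * fst h $ i"
 "snd (ln_pt a h s) $ i = snd a $ i + s * snd h $ i" "ln_pt a h 0 = a"
 by (auto simp: ln_pt_def)

lemma polyfun_line: "polyfun f ==> \<exists>q. \<forall>s. f (ln_pt a h s) = poly q s"
proof (induction rule: polyfun.induct)
 case (const c)
 thus ?case by (intro exI[of _ "[:c:]"]) simp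
next
 case (add f g)
 then obtain q r where "\<forall>s. f (ln_pt a h s) = poly q s" "\<forall>s. g (ln_pt a h s) = poly r s" by blast
 thus ?case by (intro exI[of _ "q + r"]) simp
next
 case (mx f i)
 then obtain q where "\<forall>s. f (ln_pt a h s) = poly q s" by blast
 thus ?case by (intro exI[of _ "[:fst a $ i, fst h $ i:] * q"]) (simp add: algebra_simps)
next
 case (my f i)
 then obtain q where "\<forall>s. f (ln_pt a h s) = poly q s" by blast
 thus ?case by (intro exI[of _ "[:snd a $ i, snd h $ i:] * q"]) (simp add: algebra_simps)
qed

typedef (overloaded) 'n::finite pfun = "{f :: 'n pt => complex. polyfun f}"
 morphisms pev Abs_pfun
 using polyfun.const by blast

setup_lifting type_definition_pfun

lemma polyfun_pev: "polyfun (pev p)"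
 using pev by auto

lemma pfun_eqI: "(!!x y. pev p (x, y) = pev q (x, y)) ==> p = q"
 by (metis ext pev_inject surj_pair)

instantiation pfun :: (finite) comm_ring_1
begin

lift_definition zero_pfun :: "'a pfun" is "%_. 0" by (rule polyfun.const)
lift_definition one_pfun :: "'a pfun" is "%_. 1" by (rule polyfun.const)
lift_definition plus_pfun :: "'a pfun => 'a pfun => 'a pfun" is "%f g v. f v + g v" by (rule polyfun.add)
lift_definition times_pfun :: "'a pfun => 'a pfun => 'a pfun" is "%f g v. f v * g v" by (rule polyfun_mult)
lift_definition uminus_pfun :: "'a pfun => 'a pfun" is "%f v. - f v"
 using polyfun_mult[OF polyfun.const[of "-1"]] by fastforce
lift_definition minus_pfun :: "'a pfun => 'a pfun => 'a pfun" is "%f g v. f v - g v"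
 using polyfun_mult[OF polyfun.const[of "-1"]] polyfun.add by fastforce

instance
 by standard (transfer; auto simp: fun_eq_iff algebra_simps)+

end

lemma pev_simps [simp]: "pev 0 v = 0" "pev 1 v = 1" "pev (p + q) v = pev p v + pev q v"
 "pev (p * q) v = pev p v * pev q v" "pev (- p) v = - pev p v" "pev (p - q) v = pev p v - pev q v"
 by (transfer; simp)+

lemma pev_sum [simp]: "pev (sum f I) v = (SUM i:I. pev (f i) v)"
 by (induction I rule: infinite_finite_induct) auto

text \<open>On the line joining a point where \<open>p\<close> is nonzero to one where
  \<open>q\<close> is nonzero, both restrict to nonzero univariate polynomials, whose product takes
  a nonzero value.\<close>

instance pfun :: (finite) idom
proof
 fix p q :: "'a pfun" assume "p ~= 0" "q ~= 0"
 then obtain a b where a: "pev p a ~= 0" and b: "pev q b ~= 0" by (metis pev_simps(1) pfun_eqI)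
 define h where "h = (fst b - fst a, snd b - snd a)"
 have 1: "ln_pt a h 1 = b" by (simp add: ln_pt_def h_def)
 obtain r where r: "\<forall>s. pev p (ln_pt a h s) = poly r s" using polyfun_line[OF polyfun_pev] by blast
 obtain r' where r': "\<forall>s. pev q (ln_pt a h s) = poly r' s" using polyfun_line[OF polyfun_pev] by blast
 have "r ~= 0" using r a by (metis ln_pt_simps(3) poly_0)
 moreover have "r' ~= 0" using r' b 1 by (metis poly_0)
 ultimately have "r * r' ~= 0" by simp
 then obtain s where "poly (r * r') s ~= 0" by (metis poly_all_0_iff_0)
 hence "pev (p * q) (ln_pt a h s) ~= 0" using r r' by simp
 thus "p * q ~= 0" by (metis pev_simps(1))
qed

lift_definition pconst :: "complex => 'n::finite pfun" is "%c _. c" by (rule polyfun.const)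
lift_definition fx :: "complex^'n => 'n::finite pfun" is "%u v. pairing (fst v) u"
 unfolding pairing_def by (intro polyfun_sum polyfun.mx polyfun.const)
lift_definition fy :: "complex^'n => 'n::finite pfun" is "%u v. pairing (snd v) u"
 unfolding pairing_def by (intro polyfun_sum polyfun.my polyfun.const)
text \<open>Restriction to the line through the origin and \<open>v\<close>. Its j-th coefficient,
  as a function of \<open>v\<close>, is the homogeneous part of degree j, which is how
  \<open>hcp\<close> arises.\<close>

definition slc0 :: "('n::finite pt => complex) => 'n pt => complex poly" where
 "slc0 f v = (THE q. \<forall>s. poly q s = f (ln_pt (0, 0) v s))"

lemma slc0_eqI: "(!!s. poly q s = f (ln_pt (0, 0) v s)) ==> slc0 f v = q"
 unfolding slc0_def by (rule the_equality) (auto intro: poly_ext)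

lemma poly_slc0: "polyfun f ==> poly (slc0 f v) s = f (ln_pt (0, 0) v s)"
 using polyfun_line[of f "(0, 0)" v] slc0_eqI[of _ f v] by auto

lift_definition hcp :: "nat => 'n::finite pfun => 'n pfun" is "%j f v. coeff (slc0 f v) j"
proof -
 fix j and f :: "'n pt => complex" assume "polyfun f"
 thus "polyfun (%v. coeff (slc0 f v) j)"
 proof (induction arbitrary: j rule: polyfun.induct)
  case (const c)
  have "slc0 (%_. c) v = [:c:]" for v :: "'n pt" by (rule slc0_eqI) simp
  thus ?case by (simp add: polyfun.const)
 next
  case (add f g)
  have "slc0 (%v. f v + g v) v = slc0 f v + slc0 g v" for v
   by (rule slc0_eqI) (simp add: poly_slc0 add)
  thus ?case by (simp add: polyfun.add add)
 next
  case (mx f i)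
  have "slc0 (%v. fst v $ i * f v) v = pCons 0 (Polynomial.smult (fst v $ i) (slc0 f v))" for v
   by (rule slc0_eqI) (simp add: poly_slc0 mx)
  thus ?case by (cases j) (auto intro: polyfun.const polyfun.mx mx)
 next
  case (my f i)
  have "slc0 (%v. snd v $ i * f v) v = pCons 0 (Polynomial.smult (snd v $ i) (slc0 f v))" for v
   by (rule slc0_eqI) (simp add: poly_slc0 my)
  thus ?case by (cases j) (auto intro: polyfun.const polyfun.my my)
 qed
qed

lemma polyfun_deriv_ex:
 "polyfun f ==> \<exists>g. polyfun g & (\<forall>v. ((%s. f (ln_pt v h s)) has_field_derivative g v) (at 0))"
proof (induction rule: polyfun.induct)
 case (const c)
 thus ?case by (intro exI[of _ "%_. 0"]) (auto intro: polyfun.const)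
next
 case (add f g)
 then obtain f' g' where "polyfun f'" "polyfun g'"
  "\<forall>v. ((%s. f (ln_pt v h s)) has_field_derivative f' v) (at 0)"
  "\<forall>v. ((%s. g (ln_pt v h s)) has_field_derivative g' v) (at 0)" by blast
 thus ?case by (intro exI[of _ "%v. f' v + g' v"]) (auto intro: polyfun.add DERIV_add)
next
 case (mx f i)
 then obtain f' where f': "polyfun f'" "!!v. ((%s. f (ln_pt v h s)) has_field_derivative f' v) (at 0)" by blast
 have "((%s. fst (ln_pt v h s) $ i * f (ln_pt v h s)) has_field_derivative fst h $ i * f v + fst v $ i * f' v) (at 0)" for v
  by (rule derivative_eq_intros f' | simp)+
 moreover have "polyfun (%v. fst h $ i * f v + fst v $ i * f' v)"
  by (intro polyfun.add polyfun.mx f' polyfun_mult polyfun.const mx)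
 ultimately show ?case by blast
next
 case (my f i)
 then obtain f' where f': "polyfun f'" "!!v. ((%s. f (ln_pt v h s)) has_field_derivative f' v) (at 0)" by blast
 have "((%s. snd (ln_pt v h s) $ i * f (ln_pt v h s)) has_field_derivative snd h $ i * f v + snd v $ i * f' v) (at 0)" for v
  by (rule derivative_eq_intros f' | simp)+
 moreover have "polyfun (%v. snd h $ i * f v + snd v $ i * f' v)"
  by (intro polyfun.add polyfun.my f' polyfun_mult polyfun.const my)
 ultimately show ?case by blast
qed

lift_definition Dd :: "'n::finite pt => 'n pfun => 'n pfun" is
 "%h f v. deriv (%s. f (ln_pt v h s)) 0"
proof -
 fix h and f :: "'n pt => complex" assume "polyfun f"
 then obtain g where g: "polyfun g" "!!v. ((%s. f (ln_pt v h s)) has_field_derivative g v) (at 0)"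
  using polyfun_deriv_ex by blast
 hence "(%v. deriv (%s. f (ln_pt v h s)) 0) = g" by (auto intro!: DERIV_imp_deriv)
 thus "polyfun (%v. deriv (%s. f (ln_pt v h s)) 0)" using g by simp
qed

lift_definition psub :: "complex^'n^'n => complex^'n^'n => 'n::finite pfun => 'n pfun" is
 "%g h f v. f (g *v fst v, h *v snd v)"
proof -
 fix g h :: "complex^'n^'n" and f :: "'n pt => complex" assume "polyfun f"
 thus "polyfun (%v. f (g *v fst v, h *v snd v))"
 proof induction
  case (mx f i)
  have "polyfun (%v. (g *v fst v) $ i)"
   unfolding matrix_vector_mult_def
   by (simp, intro polyfun_sum polyfun_mult polyfun.const polyfun.mx[of "%_. 1", simplified])
  thus ?case using polyfun_mult mx by auto
 next
  case (my f i)
  have "polyfun (%v. (h *v snd v) $ i)"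
   unfolding matrix_vector_mult_def
   by (simp, intro polyfun_sum polyfun_mult polyfun.const polyfun.my[of "%_. 1", simplified])
  thus ?case using polyfun_mult my by auto
 qed (auto intro: polyfun.intros)
qed

lemma pev_basic [simp]: "pev (pconst c) v = c" "pev (fx u) v = pairing (fst v) u" "pev (fy u) v = pairing (snd v) u"
 "pev (psub g h p) v = pev p (g *v fst v, h *v snd v)"
 by (transfer; simp)+

lemma pconst_simps: "pconst 0 = 0" "pconst 1 = 1" "pconst (a + b) = pconst a + pconst b"
 "pconst (a * b) = pconst a * pconst b" "pconst (- a) = - pconst a" "pconst (a - b) = pconst a - pconst b"
 by (rule pfun_eqI; simp)+

lemma pairing_add: "pairing (a + b) u = pairing a u + pairing b u" "pairing u (a + b) = pairing u a + pairing u b"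
 by (auto simp: pairing_def algebra_simps sum.distrib)

lemma pairing_scale: "pairing (k *s b) u = k * pairing b u" "pairing u (k *s b) = k * pairing u b"
 by (auto simp: pairing_def algebra_simps sum_distrib_left)

lemma pairing_zero [simp]: "pairing 0 u = 0" "pairing u 0 = 0"
 by (auto simp: pairing_def)

lemma pairing_diff: "pairing (a - b) u = pairing a u - pairing b u" "pairing u (a - b) = pairing u a - pairing u b"
 by (auto simp: pairing_def algebra_simps sum_subtractf)

lemma pairing_minus: "pairing (- b) u = - pairing b u" "pairing u (- b) = - pairing u b"
 by (auto simp: pairing_def sum_negf)

lemma pairing_commute: "pairing u v = pairing v u"
 by (auto simp: pairing_def mult.commute)

lemma pairing_axis [simp]: "pairing u (axis i 1) = u $ i" "pairing (axis i 1) u = u $ i"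
 by (auto simp: pairing_def axis_def if_distrib if_distribR cong: if_cong)

lemma fx_lin: "fx (k *s u + v) = pconst k * fx u + fx v" "fx (u + v) = fx u + fx v" "fx (k *s u) = pconst k * fx u"
 "fx 0 = 0" "fx (u - v) = fx u - fx v" "fx (- u) = - fx u"
 by (rule pfun_eqI; simp add: pairing_add pairing_scale pairing_diff pairing_minus)+

lemma fy_lin: "fy (k *s u + v) = pconst k * fy u + fy v" "fy (u + v) = fy u + fy v" "fy (k *s u) = pconst k * fy u"
 "fy 0 = 0" "fy (u - v) = fy u - fy v" "fy (- u) = - fy u"
 by (rule pfun_eqI; simp add: pairing_add pairing_scale pairing_diff pairing_minus)+

lemma pfun_induct [case_names const add mx my]:
 assumes "!!c. P (pconst c)" "!!p q. P p ==> P q ==> P (p + q)"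
  "!!u p. P p ==> P (fx u * p)" "!!u p. P p ==> P (fy u * p)"
 shows "P p"
proof -
 have "P (Abs_pfun f)" if "polyfun f" for f
  using that
 proof induction
  case (const c)
  have "Abs_pfun (%_. c) = pconst c" by (simp add: pconst_def)
  thus ?case using assms by metis
 next
  case (add f g)
  hence "Abs_pfun (%v. f v + g v) = Abs_pfun f + Abs_pfun g"
   by (simp add: plus_pfun_def Abs_pfun_inverse)
  thus ?case using assms add by metis
 next
  case (mx f i)
  hence "Abs_pfun (%v. fst v $ i * f v) = fx (axis i 1) * Abs_pfun f"
   by (intro pfun_eqI) (simp add: Abs_pfun_inverse polyfun.mx)
  thus ?case using assms mx by metis
 next
  case (my f i)
  hence "Abs_pfun (%v. snd v $ i * f v) = fy (axis i 1) * Abs_pfun f"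
   by (intro pfun_eqI) (simp add: Abs_pfun_inverse polyfun.my)
  thus ?case using assms my by metis
 qed
 thus ?thesis using polyfun_pev[of p] by (metis pev_inverse)
qed

lemma fx_eq_0: "fx u = 0 \<longleftrightarrow> u = 0"
proof
 assume "fx u = 0"
 hence "pev (fx u) (axis i 1, 0) = 0" for i by simp
 thus "u = 0" by (simp add: vec_eq_iff)
qed (simp add: fx_lin)

lemma fy_eq_0: "fy u = 0 \<longleftrightarrow> u = 0"
proof
 assume "fy u = 0"
 hence "pev (fy u) (0, axis i 1) = 0" for i by simp
 thus "u = 0" by (simp add: vec_eq_iff)
qed (simp add: fy_lin)

subsection \<open>Directional derivatives\<close>

lemma pev_Dd: "((%s. pev p (ln_pt v h s)) has_field_derivative pev (Dd h p) v) (at 0)"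
proof -
 obtain g where g: "polyfun g" "!!v. ((%s. pev p (ln_pt v h s)) has_field_derivative g v) (at 0)"
  using polyfun_deriv_ex[OF polyfun_pev] by blast
 have "pev (Dd h p) v = g v" unfolding Dd.rep_eq by (rule DERIV_imp_deriv[OF g(2)])
 thus ?thesis using g(2)[of v] by simp
qed

lemma Dd_eqI: "(!!v. ((%s. pev p (ln_pt v h s)) has_field_derivative pev q v) (at 0)) ==> Dd h p = q"
 by (rule pfun_eqI) (metis DERIV_unique pev_Dd)

lemma Dd_const [simp]: "Dd h (pconst c) = 0" "Dd h 0 = 0" "Dd h 1 = 0"
 by (rule Dd_eqI; simp)+

lemma Dd_add: "Dd h (p + q) = Dd h p + Dd h q"
 by (rule Dd_eqI) (simp add: pev_Dd DERIV_add)

lemma Dd_mult: "Dd h (p * q) = Dd h p * q + p * Dd h q"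
 by (rule Dd_eqI) (use DERIV_mult[OF pev_Dd pev_Dd] in \<open>simp add: algebra_simps\<close>)

lemma Dd_pconst_mult [simp]: "Dd h (pconst c * p) = pconst c * Dd h p"
 by (simp add: Dd_mult)

lemma Dd_minus: "Dd h (- p) = - Dd h p"
 using Dd_pconst_mult[of h "-1" p] by (simp add: pconst_simps)

lemma Dd_sum: "Dd h (sum f I) = (SUM i:I. Dd h (f i))"
 by (induction I rule: infinite_finite_induct) (auto simp: Dd_add)

lemma Dd_fx [simp]: "Dd h (fx u) = pconst (pairing (fst h) u)" "Dd h (fy u) = pconst (pairing (snd h) u)"
 by (rule Dd_eqI; simp add: ln_pt_def pairing_add pairing_scale; (rule derivative_eq_intros | simp)+)+

lemma Dd_dir: "Dd (fst h + fst h', snd h + snd h') p = Dd h p + Dd h' p"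
  "Dd (k *s fst h, k *s snd h) p = pconst k * Dd h p" "Dd (0, 0) p = 0"
 by (induction p rule: pfun_induct;
   simp add: Dd_add Dd_mult pairing_add pairing_scale pconst_simps algebra_simps)+

lemma Dd_dir': "Dd (a + b, c + d) p = Dd (a, c) p + Dd (b, d) p"
  "Dd (k *s a, k *s b) p = pconst k * Dd (a, b) p"
  "Dd (k *s a, 0) p = pconst k * Dd (a, 0) p" "Dd (0, k *s a) p = pconst k * Dd (0, a) p"
  "Dd (a + b, 0) p = Dd (a, 0) p + Dd (b, 0) p" "Dd (0, a + b) p = Dd (0, a) p + Dd (0, b) p"
 using Dd_dir(1)[of "(a, c)" "(b, d)"] Dd_dir(2)[of k "(a, b)"] Dd_dir(2)[of k "(a, 0)"] Dd_dir(2)[of k "(0, a)"]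
  Dd_dir(1)[of "(a, 0)" "(b, 0)"] Dd_dir(1)[of "(0, a)" "(0, b)"] by auto

lemma Dd_commute: "Dd h (Dd h' p) = Dd h' (Dd h p)"
 by (induction p rule: pfun_induct) (simp_all add: Dd_add Dd_mult algebra_simps)

text \<open>Chain rule along a real curve. It is used along circles, to compare values of a symbol
  at different points of one orbit.\<close>

lemma pev_curve:
 fixes \<gamma> :: "real => 'n::finite pt"
 assumes "!!u. ((%s. pairing (fst (\<gamma> s)) u) has_vector_derivative pairing (fst d) u) (at s)"
  "!!u. ((%s. pairing (snd (\<gamma> s)) u) has_vector_derivative pairing (snd d) u) (at s)"
 shows "((%s. pev p (\<gamma> s)) has_vector_derivative pev (Dd d p) (\<gamma> s)) (at s)"
proof (induction p rule: pfun_induct)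
 case (add p q)
 thus ?case by (simp add: Dd_add has_vector_derivative_add)
next
 case (mx u p)
 thus ?case using has_vector_derivative_mult[OF assms(1) mx, of u] by (simp add: Dd_mult algebra_simps)
next
 case (my u p)
 thus ?case using has_vector_derivative_mult[OF assms(2) my, of u] by (simp add: Dd_mult algebra_simps)
qed simp

subsection \<open>Substitutions and homogeneous components\<close>

lemma psub_simps [simp]: "psub g h (pconst c) = pconst c" "psub g h 0 = 0" "psub g h 1 = 1"
 "psub g h (p + q) = psub g h p + psub g h q" "psub g h (p * q) = psub g h p * psub g h q"
 "psub g h (- p) = - psub g h p" "psub g h (p - q) = psub g h p - psub g h q"
 by (rule pfun_eqI; simp)+

lemma psub_psub [simp]: "psub g h (psub g' h' p) = psub (g' ** g) (h' ** h) p"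
 by (rule pfun_eqI) (simp add: matrix_vector_mul_assoc)

lemma psub_id [simp]: "psub (mat 1) (mat 1) p = p"
 by (rule pfun_eqI) simp

lemma pairing_matrix: "pairing (g *v a) b = pairing a (transpose g *v b)"
proof -
 have "pairing (g *v a) b = (SUM i:UNIV. SUM j:UNIV. g $ i $ j * a $ j * b $ i)"
  by (simp add: pairing_def matrix_vector_mult_def sum_distrib_right)
 also have "... = (SUM j:UNIV. SUM i:UNIV. g $ i $ j * a $ j * b $ i)" by (rule sum.swap)
 also have "... = pairing a (transpose g *v b)"
  by (simp add: pairing_def matrix_vector_mult_def sum_distrib_left transpose_def algebra_simps)
 finally show ?thesis .
qed

lemma psub_fx [simp]: "psub g h (fx u) = fx (transpose g *v u)" "psub g h (fy u) = fy (transpose h *v u)"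
 by (rule pfun_eqI; simp add: pairing_matrix)+

lemma Dd_psub: "Dd d (psub g h p) = psub g h (Dd (g *v fst d, h *v snd d) p)"
 by (induction p rule: pfun_induct) (simp_all add: Dd_add Dd_mult pairing_matrix)

definition slc :: "'n::finite pfun => 'n pt => complex poly" where
 "slc p = slc0 (pev p)"

lemma slc_eqI: "(!!s. poly q s = pev p (ln_pt (0, 0) v s)) ==> slc p v = q"
 unfolding slc_def by (rule slc0_eqI)

lemma poly_slc: "poly (slc p v) s = pev p (s *s fst v, s *s snd v)"
 by (simp add: slc_def poly_slc0 polyfun_pev) (simp add: ln_pt_def)

lemma pev_hcp: "pev (hcp j p) v = coeff (slc p v) j"
 by (simp add: hcp.rep_eq slc_def)

lemma slc_simps [simp]: "slc (pconst c) v = [:c:]" "slc 0 v = 0" "slc (p + q) v = slc p v + slc q v"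
 "slc (p * q) v = slc p v * slc q v" "slc (- p) v = - slc p v" "slc (p - q) v = slc p v - slc q v"
 "slc (fx u) v = [:0, pairing (fst v) u:]" "slc (fy u) v = [:0, pairing (snd v) u:]"
 "slc (psub g h p) v = slc p (g *v fst v, h *v snd v)"
 by (rule slc_eqI; simp add: poly_slc ln_pt_def pairing_scale vector_scalar_commute[symmetric])+

lemma hcp_simps [simp]: "hcp j 0 = 0" "hcp j (p + q) = hcp j p + hcp j q" "hcp j (- p) = - hcp j p"
 "hcp j (p - q) = hcp j p - hcp j q" "hcp j (pconst c * p) = pconst c * hcp j p"
 "hcp 0 (pconst c) = pconst c" "hcp (Suc j) (pconst c) = 0"
 "hcp (Suc j) (fx u * p) = fx u * hcp j p" "hcp (Suc j) (fy u * p) = fy u * hcp j p"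
 "hcp 0 (fx u * p) = 0" "hcp 0 (fy u * p) = 0" "hcp j (psub g h p) = psub g h (hcp j p)"
 by (rule pfun_eqI; simp add: pev_hcp)+

lemma hcp_one [simp]: "hcp 0 1 = 1" "hcp (Suc j) 1 = 0"
 using hcp_simps(6)[of 1] hcp_simps(7)[of _ 1] by (simp_all add: pconst_simps)

lemma Dd_hcp_0 [simp]: "Dd h (hcp 0 p) = 0"
 by (induction p rule: pfun_induct) (simp_all add: Dd_add Dd_mult)

lemma hcp_Dd: "hcp j (Dd h p) = Dd h (hcp (Suc j) p)"
proof (induction p arbitrary: j rule: pfun_induct)
 case (mx u p)
 thus ?case by (cases j) (simp_all add: Dd_mult Dd_add)
next
 case (my u p)
 thus ?case by (cases j) (simp_all add: Dd_mult Dd_add)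
qed (simp_all add: Dd_add)

lemma hcp_bounded: "\<exists>N. \<forall>j>N. hcp j p = 0"
proof (induction p rule: pfun_induct)
 case (const c)
 show ?case by (intro exI[of _ 0]) (auto simp: gr0_conv_Suc)
next
 case (add p q)
 then obtain N N' where "\<forall>j>N. hcp j p = 0" "\<forall>j>N'. hcp j q = 0" by blast
 thus ?case by (intro exI[of _ "max N N'"]) auto
next
 case (mx u p)
 then obtain N where "\<forall>j>N. hcp j p = 0" by blast
 thus ?case by (intro exI[of _ "Suc N"]) (auto simp: Suc_less_eq2)
next
 case (my u p)
 then obtain N where "\<forall>j>N. hcp j p = 0" by blast
 thus ?case by (intro exI[of _ "Suc N"]) (auto simp: Suc_less_eq2)
qed

lemma hcp_all_0: assumes "!!j. hcp j p = 0" shows "p = 0"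
proof (rule pfun_eqI)
 fix x y
 have "slc p (x, y) = 0" by (rule poly_eqI) (use assms pev_hcp[of _ p "(x, y)"] in simp)
 thus "pev p (x, y) = pev 0 (x, y)" using poly_slc[of p "(x, y)" 1] by simp
qed

lemma hcp_scale: "pev (hcp j p) (s *s x, s *s y) = s ^ j * pev (hcp j p) (x, y)"
proof (induction p arbitrary: j rule: pfun_induct)
 case (const c)
 thus ?case by (cases j) auto
next
 case (mx u p)
 thus ?case by (cases j) (auto simp: pairing_scale)
next
 case (my u p)
 thus ?case by (cases j) (auto simp: pairing_scale)
qed (auto simp: algebra_simps)

text \<open>Restricted to the line from \<open>a\<close> to any other point, the polynomial has
  derivative 0 at every parameter.\<close>

lemma Dd_all_zero_const:
 assumes "!!h. Dd h p = 0" shows "p = pconst (pev p a)"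
proof (rule pfun_eqI)
 fix x y
 define h where "h = (x - fst a, y - snd a)"
 have "((%s. pev p (ln_pt a h s)) has_field_derivative 0) (at s)" for s
 proof -
  have "((%r. pev p (ln_pt (ln_pt a h s) h r)) has_field_derivative 0) (at 0)"
   using pev_Dd[of p "ln_pt a h s" h] assms by simp
  moreover have "ln_pt (ln_pt a h s) h r = ln_pt a h (s + r)" for r
   by (simp add: ln_pt_def algebra_simps)
  ultimately show ?thesis using DERIV_shift[of "%s. pev p (ln_pt a h s)" 0 0 s] by (simp add: add.commute)
 qed
 hence "(%s. pev p (ln_pt a h s)) 1 = (%s. pev p (ln_pt a h s)) 0"
  using has_field_derivative_zero_constant[of UNIV "%s. pev p (ln_pt a h s)"] by (metis UNIV_I convex_UNIV)
 moreover have "ln_pt a h 1 = (x, y)" by (simp add: ln_pt_def h_def)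
 ultimately show "pev p (x, y) = pev (pconst (pev p a)) (x, y)" by simp
qed

subsection \<open>Divided differences\<close>

text \<open>Divisibility of p - s(p) by \<open>l\<close> passes from linear forms to all p, since pq
  - s(pq) = (p - s p) s(q) + p (q - s q). The quotient \<open>dq\<close> is a twisted derivation;
  with \<open>s\<close> a reflection of the x or of the y variables it is the divided difference of
  a Dunkl operator.\<close>

locale twist =
 fixes l :: "'n::finite pfun" and s :: "'n pfun => 'n pfun"
 assumes l: "l ~= 0" and s_const: "s (pconst c) = pconst c" and s_add: "s (p + q) = s p + s q"
  and s_mult: "s (p * q) = s p * s q"
  and s_x: "\<exists>c. fx u - s (fx u) = pconst c * l" and s_y: "\<exists>c. fy u - s (fy u) = pconst c * l"
begin

lemma ex: "\<exists>q. l * q = p - s p"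
proof (induction p rule: pfun_induct)
 case (const c)
 thus ?case by (intro exI[of _ 0]) (simp add: s_const)
next
 case (add p q)
 then obtain p' q' where "l * p' = p - s p" "l * q' = q - s q" by blast
 thus ?case by (intro exI[of _ "p' + q'"]) (simp add: s_add algebra_simps)
next
 case (mx u p)
 then obtain p' c where p: "l * p' = p - s p" and c: "fx u - s (fx u) = pconst c * l" using s_x by blast
 have "l * (fx u * p' + pconst c * s p) = fx u * (l * p') + (pconst c * l) * s p" by (simp add: algebra_simps)
 thus ?case unfolding p c[symmetric] by (intro exI[of _ "fx u * p' + pconst c * s p"]) (simp add: s_mult algebra_simps)
next
 case (my u p)
 then obtain p' c where p: "l * p' = p - s p" and c: "fy u - s (fy u) = pconst c * l" using s_y by blast
 have "l * (fy u * p' + pconst c * s p) = fy u * (l * p') + (pconst c * l) * s p" by (simp add: algebra_simps)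
 thus ?case unfolding p c[symmetric] by (intro exI[of _ "fy u * p' + pconst c * s p"]) (simp add: s_mult algebra_simps)
qed

definition dq :: "'n pfun => 'n pfun" where "dq p = (SOME q. l * q = p - s p)"

lemma dq: "l * dq p = p - s p"
 unfolding dq_def using someI_ex[OF ex] .

lemma dqI: "l * q = p - s p ==> dq p = q"
 using dq[of p] l mult_cancel_left[of l "dq p" q] by simp

lemma dq_const [simp]: "dq (pconst c) = 0"
 by (rule dqI) (simp add: s_const)

lemma dq_add: "dq (p + q) = dq p + dq q"
 by (rule dqI) (simp add: distrib_left dq s_add)

lemma dq_mult: "dq (p * q) = dq p * s q + p * dq q"
proof (rule dqI)
 have "l * (dq p * s q + p * dq q) = (l * dq p) * s q + p * (l * dq q)" by (simp add: algebra_simps)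
 thus "l * (dq p * s q + p * dq q) = p * q - s (p * q)" by (simp add: dq s_mult algebra_simps)
qed

lemma dq_zero [simp]: "dq 0 = 0"
 using dq_const[of 0] by (simp add: pconst_simps)

lemma dq_pconst_mult: "dq (pconst c * p) = pconst c * dq p"
 by (simp add: dq_mult)

end

subsection \<open>Monomials\<close>

definition mon :: "'n::finite multiset => 'n multiset => 'n pfun" where
 "mon a b = (\<Prod>i\<in>#a. fx (axis i 1)) * (\<Prod>i\<in>#b. fy (axis i 1))"

lemma mon_simps: "mon {#} {#} = 1" "mon (add_mset i a) b = fx (axis i 1) * mon a b"
 "mon a (add_mset i b) = fy (axis i 1) * mon a b"
 by (auto simp: mon_def algebra_simps)

lemma Dd_mon:
 fixes a b :: "'n::finite multiset"
 shows "Dd (axis i 1, 0) (mon a b) = pconst (of_nat (count a i)) * mon (a - {#i#}) b"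
 "Dd (0, axis i 1) (mon a b) = pconst (of_nat (count b i)) * mon a (b - {#i#})"
proof -
 have x: "Dd (axis i 1, 0) (\<Prod>i\<in>#b. fy (axis i 1)) = 0" for b :: "'n multiset"
  by (induction b) (auto simp: Dd_mult pconst_simps)
 have y: "Dd (0, axis i 1) (\<Prod>i\<in>#b. fx (axis i 1)) = 0" for b :: "'n multiset"
  by (induction b) (auto simp: Dd_mult pconst_simps)
 have ax: "(axis i 1 :: complex^'n) $ j = (if i = j then 1 else 0)" for j by (auto simp: axis_def)
 have *: "add_mset j a - {#i#} = add_mset j (a - {#i#})" if "i \<in># a" for a :: "'n multiset" and j
 proof -
  have "count a i > 0" using that by simp
  thus ?thesis by (intro multiset_eqI) auto
 qed
 have x': "Dd (axis i 1, 0) (\<Prod>i\<in>#a. fx (axis i 1)) = pconst (of_nat (count a i)) * (\<Prod>i\<in>#(a - {#i#}). fx (axis i 1))" for a :: "'n multiset"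
 proof (induction a)
  case (add j a)
  show ?case
  proof (cases "i \<in># a")
   case True
   hence m1: "(\<Prod>i\<in>#(add_mset j a - {#i#}). fx (axis i 1)) = fx (axis j 1) * (\<Prod>i\<in>#(a - {#i#}). fx (axis i 1))"
    by (simp add: *)
   have m2: "(\<Prod>i\<in>#a. fx (axis i 1)) = fx (axis i 1) * (\<Prod>i\<in>#(a - {#i#}). fx (axis i 1))"
    using True by (metis insert_DiffM image_mset_add_mset prod_mset.add_mset)
   show ?thesis unfolding m1 image_mset_add_mset prod_mset.add_mset Dd_mult add
    by (cases "i = j") (simp_all add: ax pconst_simps m2 distrib_right distrib_left mult.left_commute)
  next
   case False
   thus ?thesis using add by (auto simp: Dd_mult ax pconst_simps not_in_iff)
  qed
 qed (simp add: pconst_simps)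
 have y': "Dd (0, axis i 1) (\<Prod>i\<in>#a. fy (axis i 1)) = pconst (of_nat (count a i)) * (\<Prod>i\<in>#(a - {#i#}). fy (axis i 1))" for a :: "'n multiset"
 proof (induction a)
  case (add j a)
  show ?case
  proof (cases "i \<in># a")
   case True
   hence m1: "(\<Prod>i\<in>#(add_mset j a - {#i#}). fy (axis i 1)) = fy (axis j 1) * (\<Prod>i\<in>#(a - {#i#}). fy (axis i 1))"
    by (simp add: *)
   have m2: "(\<Prod>i\<in>#a. fy (axis i 1)) = fy (axis i 1) * (\<Prod>i\<in>#(a - {#i#}). fy (axis i 1))"
    using True by (metis insert_DiffM image_mset_add_mset prod_mset.add_mset)
   show ?thesis unfolding m1 image_mset_add_mset prod_mset.add_mset Dd_mult add
    by (cases "i = j") (simp_all add: ax pconst_simps m2 distrib_right distrib_left mult.left_commute)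
  next
   case False
   thus ?thesis using add by (auto simp: Dd_mult ax pconst_simps not_in_iff)
  qed
 qed (simp add: pconst_simps)
 show "Dd (axis i 1, 0) (mon a b) = pconst (of_nat (count a i)) * mon (a - {#i#}) b"
  "Dd (0, axis i 1) (mon a b) = pconst (of_nat (count b i)) * mon a (b - {#i#})"
  by (simp_all add: mon_def Dd_mult x y x' y' algebra_simps)
qed

text \<open>A partial derivative turns a vanishing combination into one of smaller degree, in which
  each surviving coefficient is multiplied by a positive exponent. Induction on a degree bound
  leaves only the constant monomial.\<close>

lemma mon_independent:
 fixes C :: "'n::finite multiset \<times> 'n multiset => complex"
 assumes "finite A" "(SUM k:A. pconst (C k) * mon (fst k) (snd k)) = 0" "k : A"
 shows "C k = 0"
proof -
 have "!!C :: 'n multiset \<times> 'n multiset => complex. (ALL k:A. size (fst k) + size (snd k) < N) ==> finite A ==>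
   (SUM k:A. pconst (C k) * mon (fst k) (snd k)) = 0 ==> ALL k:A. C k = 0" for N A
 proof (induction N arbitrary: A)
  case 0
  thus ?case by auto
 next
  case (Suc N)
  have pos: "C (a, b) = 0" if k: "(a, b) : A" and i: "i \<in># a" for a b i
  proof -
   \<comment> \<open>\<open>?B\<close> holds the monomials that survive the derivative in x_i;
     \<open>?g\<close> lowers the exponent and \<open>?h\<close> undoes this on \<open>?B\<close>,
     so the derived combination is reindexed without collisions.\<close>
   let ?B = "{k\<in>A. i \<in># fst k}" and ?g = "%(a, b). (a - {#i#}, b)" and ?h = "%(a, b). (add_mset i a, b)"
   have inj: "inj_on ?g ?B" by (rule inj_on_inverseI[of _ ?h]) auto
   have "(SUM k:?B. pconst (C k * of_nat (count (fst k) i)) * mon (fst (?g k)) (snd (?g k)))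
    = (SUM k:A. pconst (C k) * Dd (axis i 1, 0) (mon (fst k) (snd k)))"
    by (rule sum.mono_neutral_cong_left)
     (use Suc.prems in \<open>auto simp: Dd_mon pconst_simps not_in_iff algebra_simps\<close>)
   also have "... = Dd (axis i 1, 0) (SUM k:A. pconst (C k) * mon (fst k) (snd k))" by (simp add: Dd_sum)
   finally have "(SUM k:?B. pconst (C k * of_nat (count (fst k) i)) * mon (fst (?g k)) (snd (?g k))) = 0"
    using Suc.prems by simp
   hence "(SUM k:?g ` ?B. pconst (C (?h k) * of_nat (count (fst (?h k)) i)) * mon (fst k) (snd k)) = 0"
    by (subst sum.reindex[OF inj]) (auto simp: case_prod_unfold intro!: trans[OF sum.cong])
   moreover have "ALL k:?g ` ?B. size (fst k) + size (snd k) < N"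
   proof
    fix k assume "k : ?g ` ?B"
    then obtain k' where k': "k' : ?B" "k = ?g k'" by blast
    hence "size (fst k') + size (snd k') < Suc N" using Suc.prems(1) by blast
    thus "size (fst k) + size (snd k) < N"
     using k' size_Suc_Diff1[of i "fst k'"] size_Suc_Diff1[of i "snd k'"] by (cases k') auto
   qed
   ultimately have "ALL k:?g ` ?B. C (?h k) * of_nat (count (fst (?h k)) i) = 0"
    using Suc.prems(2) by (intro Suc.IH) auto
   hence "C (?h (?g (a, b))) * of_nat (count (fst (?h (?g (a, b)))) i) = 0"
    by (rule bspec) (rule imageI, use k i in simp)
   thus ?thesis using i by (auto simp: count_eq_zero_iff)
  qed
  have pos2: "C (a, b) = 0" if k: "(a, b) : A" and i: "i \<in># b" for a b i
  proof -
   let ?B = "{k\<in>A. i \<in># snd k}" and ?g = "%(a, b). (a, b - {#i#})" and ?h = "%(a, b). (a, add_mset i b)"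
   have inj: "inj_on ?g ?B" by (rule inj_on_inverseI[of _ ?h]) auto
   have "(SUM k:?B. pconst (C k * of_nat (count (snd k) i)) * mon (fst (?g k)) (snd (?g k)))
    = (SUM k:A. pconst (C k) * Dd (0, axis i 1) (mon (fst k) (snd k)))"
    by (rule sum.mono_neutral_cong_left)
     (use Suc.prems in \<open>auto simp: Dd_mon pconst_simps not_in_iff algebra_simps\<close>)
   also have "... = Dd (0, axis i 1) (SUM k:A. pconst (C k) * mon (fst k) (snd k))" by (simp add: Dd_sum)
   finally have "(SUM k:?B. pconst (C k * of_nat (count (snd k) i)) * mon (fst (?g k)) (snd (?g k))) = 0"
    using Suc.prems by simp
   hence "(SUM k:?g ` ?B. pconst (C (?h k) * of_nat (count (snd (?h k)) i)) * mon (fst k) (snd k)) = 0"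
    by (subst sum.reindex[OF inj]) (auto simp: case_prod_unfold intro!: trans[OF sum.cong])
   moreover have "ALL k:?g ` ?B. size (fst k) + size (snd k) < N"
   proof
    fix k assume "k : ?g ` ?B"
    then obtain k' where k': "k' : ?B" "k = ?g k'" by blast
    hence "size (fst k') + size (snd k') < Suc N" using Suc.prems(1) by blast
    thus "size (fst k) + size (snd k) < N"
     using k' size_Suc_Diff1[of i "fst k'"] size_Suc_Diff1[of i "snd k'"] by (cases k') auto
   qed
   ultimately have "ALL k:?g ` ?B. C (?h k) * of_nat (count (snd (?h k)) i) = 0"
    using Suc.prems(2) by (intro Suc.IH) auto
   hence "C (?h (?g (a, b))) * of_nat (count (snd (?h (?g (a, b)))) i) = 0"
    by (rule bspec) (rule imageI, use k i in simp)
   thus ?thesis using i by (auto simp: count_eq_zero_iff)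
  qed
  have z: "C k = 0" if "k : A" "k ~= ({#}, {#})" for k
   using pos[of "fst k" "snd k"] pos2[of "fst k" "snd k"] that by (metis multiset_nonemptyE prod.collapse)
  have "C ({#}, {#}) = 0" if "({#}, {#}) : A"
  proof -
   have "(SUM k:A. pconst (C k) * mon (fst k) (snd k)) = (SUM k:{({#}, {#})}. pconst (C k) * mon (fst k) (snd k))"
    by (rule sum.mono_neutral_right) (use Suc.prems that z in \<open>auto simp: pconst_simps\<close>)
   hence "pconst (C ({#}, {#})) = (0 :: 'n pfun)" using Suc.prems by (simp add: mon_simps)
   thus ?thesis by (metis pev_basic(1) pev_simps(1))
  qed
  thus ?case using z by blast
 qed
 moreover obtain N where "ALL k:A. size (fst k) + size (snd k) < N"
  using finite_nat_set_iff_bounded[of "(%k. size (fst k) + size (snd k)) ` A"] assms(1) by auto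
 ultimately show ?thesis using assms by blast
qed

declare transpose_matrix_vector [simp del]

section \<open>The standard module and normally ordered left and right multiplications on it\<close>

section \<open>Operators on the standard module\<close>

text \<open>
 The standard module has the formal basis \<open>x\<^sup>a y\<^sup>b w e\<^sub>S\<close>: an index \<open>(w, S)\<close> stands for
 \<open>w e\<^sub>S\<close>, where \<open>e\<^sub>S\<close> is the product of the \<open>e\<^sub>p\<close>, \<open>p : S\<close>, in increasing order, and the
 coefficients are polynomials in \<open>x\<close> and \<open>y\<close>, all \<open>x\<close> being to the left of all \<open>y\<close>.
\<close>

type_synonym 'n idx = "(real^'n^'n) \<times> nat set"
type_synonym 'n M = "'n idx \<Rightarrow>\<^sub>0 'n pfun"

definition smul :: "complex => 'n::finite M => 'n M" where
 "smul k = Poly_Mapping.map ((*) (pconst k))"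

lemma lookup_smul [simp]: "lookup (smul k F) i = pconst k * lookup F i"
 by (simp add: smul_def Poly_Mapping.map.rep_eq when_def)

lemma smul_simps [simp]: "smul k (F + G) = smul k F + smul k G" "smul k 0 = 0" "smul 1 F = F"
 "smul k (smul l F) = smul (k * l) F" "smul k (single i p) = single i (pconst k * p)"
 "smul k (- F) = - smul k F" "smul k (F - G) = smul k F - smul k G" "smul 0 F = 0"
 by (rule poly_mapping_eqI; auto simp: lookup_add lookup_minus lookup_single when_def algebra_simps pconst_simps)+

lemma smul_add: "smul (k + l) F = smul k F + smul l F"
 by (rule poly_mapping_eqI) (auto simp: lookup_add algebra_simps pconst_simps)

text \<open>Linearity is put into the type, so that operators form a ring in the type-class sense
  and operator identities carry no linearity premises.\<close>

typedef (overloaded) 'n::finite op = "{f :: 'n M => 'n M. (\<forall>F G. f (F + G) = f F + f G) & (\<forall>k F. f (smul k F) = smul k (f F))}"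
 morphisms app Abs_op
 by (rule exI[of _ id]) auto

setup_lifting type_definition_op

lemma app_add [simp]: "app a (F + G) = app a F + app a G"
 and app_smul [simp]: "app a (smul k F) = smul k (app a F)"
 using app[of a] by auto

lemma app_0 [simp]: "app a 0 = 0"
 using app_add[of a 0 0] by simp

lemma app_minus [simp]: "app a (- F) = - app a F"
 using app_add[of a F "- F"] by (simp add: eq_neg_iff_add_eq_0 add.commute)

lemma app_diff [simp]: "app a (F - G) = app a F - app a G"
 using app_add[of a F "- G"] by simp

lemma app_sum [simp]: "app a (sum f I) = (SUM i:I. app a (f i))"
 by (induction I rule: infinite_finite_induct) auto

lemma op_ext: "(!!F. app a F = app b F) ==> a = b"
 by (metis app_inject ext)

instantiation op :: (finite) ring_1
begin

lift_definition zero_op :: "'a op" is "%_. 0" by auto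
lift_definition one_op :: "'a op" is "%F. F" by auto
lift_definition plus_op :: "'a op => 'a op => 'a op" is "%f g F. f F + g F" by auto
lift_definition minus_op :: "'a op => 'a op => 'a op" is "%f g F. f F - g F" by auto
lift_definition uminus_op :: "'a op => 'a op" is "%f F. - f F" by auto
lift_definition times_op :: "'a op => 'a op => 'a op" is "%f g F. f (g F)" by auto

instance
proof
 show "(0::'a op) ~= 1"
 proof
  assume "(0::'a op) = 1"
  hence "app (0::'a op) F = app 1 F" for F by simp
  hence "(0 :: 'a M) = F" for F by (simp add: zero_op.rep_eq one_op.rep_eq)
  from this[of "single undefined 1"] show False by (metis lookup_single_eq lookup_zero zero_neq_one)
 qed
qed (rule op_ext; simp add: plus_op.rep_eq times_op.rep_eq minus_op.rep_eq uminus_op.rep_eq one_op.rep_eq zero_op.rep_eq)+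

end

lift_definition sc :: "complex => 'n::finite op" is smul by (auto simp: mult.commute)

lemma app_simps [simp]: "app (a + b) F = app a F + app b F" "app (a - b) F = app a F - app b F"
 "app (- a) F = - app a F" "app (a * b) F = app a (app b F)" "app 1 F = F" "app 0 F = 0" "app (sc k) F = smul k F"
 by (simp_all add: plus_op.rep_eq times_op.rep_eq minus_op.rep_eq uminus_op.rep_eq one_op.rep_eq zero_op.rep_eq sc.rep_eq)

lemma app_op_sum [simp]: "app (sum f I) F = (SUM i:I. app (f i) F)"
 by (induction I rule: infinite_finite_induct) auto

interpretation S: scalars "sc :: complex => 'n::finite op"
 by unfold_locales (rule op_ext; simp add: smul_add mult.commute)+

lemma op_eqI:
 assumes "!!i p. app a (single i p) = app b (single i p)" shows "a = b"
proof (rule op_ext)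
 fix F show "app a F = app b F"
  by (induction F rule: pm_induct) (auto simp: assms)
qed

definition plin :: "('n::finite pfun => 'n pfun) => bool" where
 "plin \<psi> \<longleftrightarrow> (\<forall>p q. \<psi> (p + q) = \<psi> p + \<psi> q) & (\<forall>c p. \<psi> (pconst c * p) = pconst c * \<psi> p)"

lemma plin_0: "plin \<psi> ==> \<psi> 0 = 0"
 unfolding plin_def by (metis add_cancel_left_left)

text \<open>The common shape of all concrete operators: the index moves along
  \<open>\<sigma>\<close> and the coefficient polynomial is changed by a map that may depend on the
  old index. \<open>Abs_op\<close> yields the intended map once every such map is linear, whence the
  premises \<open>plin\<close> below.\<close>

definition mop :: "('n::finite idx => 'n idx) => ('n idx => 'n pfun => 'n pfun) => 'n op" where
 "mop \<sigma> \<psi> = Abs_op (%F. SUM k:keys F. single (\<sigma> k) (\<psi> k (lookup F k)))"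

lemma app_mop_single [simp]:
 assumes "!!k. plin (\<psi> k)"
 shows "app (mop \<sigma> \<psi>) (single k p) = single (\<sigma> k) (\<psi> k p)"
proof -
 let ?f = "%F. SUM k:keys F. single (\<sigma> k) (\<psi> k (lookup F k))"
 have sup: "?f F = (SUM k:B. single (\<sigma> k) (\<psi> k (lookup F k)))"
  if "finite B" "keys F <= B" for F B
  by (rule sum.mono_neutral_left) (use that plin_0[OF assms] in \<open>auto simp: in_keys_iff\<close>)
 have "?f (F + G) = ?f F + ?f G" for F G
  using sup[of "keys F \<union> keys G" F]
   sup[of "keys F \<union> keys G" G]
   sup[of "keys F \<union> keys G" "F + G"] keys_add[of F G] assms
  by (simp add: lookup_add plin_def single_add sum.distrib)
 moreover have "?f (smul c F) = smul c (?f F)" for c F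
 proof -
  have "keys (smul c F) <= keys F" by (auto simp: in_keys_iff)
  moreover have "smul c (SUM k:A. f k) = (SUM k:A. smul c (f k))" for f :: "'a idx => 'a M" and A
   by (induction A rule: infinite_finite_induct) auto
  ultimately show ?thesis using sup[of "keys F" "smul c F"] assms by (simp add: plin_def)
 qed
 ultimately have "app (mop \<sigma> \<psi>) = ?f" unfolding mop_def by (intro Abs_op_inverse) auto
 thus ?thesis using sup[of "{k}" "single k p"] by simp
qed

text \<open>For invertible \<open>\<sigma>\<close> the coefficients of an image can be read off.
  Symbols are studied through this form, operator identities through the action on
  \<open>single\<close>.\<close>

lemma lookup_mop:
 assumes "!!k. plin (\<psi> k)" "!!k. \<sigma>' (\<sigma> k) = k" "!!k. \<sigma> (\<sigma>' k) = k"
 shows "lookup (app (mop \<sigma> \<psi>) F) k = \<psi> (\<sigma>' k) (lookup F (\<sigma>' k))"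
proof (induction F rule: pm_induct)
 case zero
 thus ?case using plin_0[OF assms(1)] by simp
next
 case (add i v F)
 have "\<sigma> i = k \<longleftrightarrow> i = \<sigma>' k" using assms by metis
 thus ?case using add assms(1) plin_0[OF assms(1)]
  by (auto simp: lookup_add lookup_single plin_def when_def assms)
qed

lemma plin_intros [simp, intro]:
 "plin (%p. p)" "plin ((*) q)" "plin (Dd h)" "plin (psub g g')" "plin (hcp j)"
 "plin (%p. pconst (pev p a))"
 by (auto simp: plin_def Dd_add pconst_simps distrib_left mult.left_commute)

lemma plin_comps [simp]: "plin f ==> plin (%p. psub g g' (f p))" "plin f ==> plin (%p. q * f p)"
 "plin f ==> plin (%p. Dd h (f p))"
 by (auto simp: plin_def Dd_add algebra_simps)

subsection \<open>Complexified vectors and reflections\<close>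

lemma cmat_simps [simp]: "cmat (mat 1) = mat 1" "cmat (g ** h) = cmat g ** cmat h" "cmat (transpose g) = transpose (cmat g)"
 "cmat g *v cvec v = cvec (g *v v)"
 by (auto simp: cmat_def cvec_def vec_eq_iff mat_def matrix_matrix_mult_def transpose_def matrix_vector_mult_def)

lemma cvec_simps: "cvec (u + v) = cvec u + cvec v" "cvec (r *\<^sub>R v) = complex_of_real r *s cvec v" "cvec 0 = 0"
 "cvec (- v) = - cvec v" "cvec (u - v) = cvec u - cvec v"
 by (auto simp: cvec_def vec_eq_iff)

lemma cvec_inj [simp]: "cvec u = cvec v \<longleftrightarrow> u = v"
 by (auto simp: cvec_def vec_eq_iff)

lemma cvec_eq_0 [simp]: "cvec u = 0 \<longleftrightarrow> u = 0"
 using cvec_inj[of u 0] by (simp add: cvec_simps)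

lemma pairing_cvec: "pairing (cvec u) (cvec v) = complex_of_real (u \<bullet> v)"
 by (simp add: pairing_def cvec_def inner_vec_def)

lemma root_refl_vec: "root_refl al *v v = v - (v \<bullet> al) *\<^sub>R coroot al"
proof -
 have "linear (%v. v - (v \<bullet> al) *\<^sub>R coroot al)"
  by (rule linearI) (auto simp: algebra_simps inner_add_left scaleR_add_left)
 thus ?thesis unfolding root_refl_def by simp
qed

lemma root_refl_nth: "root_refl al $ i $ j = (if i = j then 1 else 0) - 2 * al $ i * al $ j / (al \<bullet> al)"
proof -
 have "root_refl al $ i $ j = (root_refl al *v axis j 1) $ i" by (simp add: matrix_vector_mul_component inner_axis)
 moreover have "axis j 1 \<bullet> al = al $ j" by (simp add: inner_axis')
 ultimately show ?thesis unfolding root_refl_vec by (simp add: coroot_def, simp add: axis_def)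
qed

lemma transpose_root_refl [simp]: "transpose (root_refl al) = root_refl al"
 by (simp add: vec_eq_iff transpose_def root_refl_nth)

lemma coroot_inner: "al ~= 0 ==> coroot al \<bullet> al = 2"
 by (simp add: coroot_def)

lemma coroot_minus [simp]: "coroot (- al) = - coroot al"
 by (simp add: coroot_def)

lemma root_refl_minus [simp]: "root_refl (- al) = root_refl al"
 by (simp add: root_refl_def)

lemma root_refl_self: "al ~= 0 ==> root_refl al *v al = - al"
 by (simp add: root_refl_vec coroot_def vec_eq_iff)

lemma root_refl_invol [simp]: "al ~= 0 ==> root_refl al ** root_refl al = mat 1"
proof -
 assume a: "al ~= 0"
 have "(root_refl al ** root_refl al) *v v = v" for v
 proof -
  have "(v - (v \<bullet> al) *\<^sub>R coroot al) \<bullet> al = - (v \<bullet> al)"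
   by (simp add: inner_diff_left coroot_inner[OF a])
  thus ?thesis unfolding matrix_vector_mul_assoc[symmetric] root_refl_vec by simp
 qed
 thus ?thesis by (simp add: matrix_eq)
qed

lemma root_refl_invol' [simp]: "al ~= 0 ==> root_refl al ** (root_refl al ** w) = w"
 by (simp add: matrix_mul_assoc)

lemma orthogonal_root_refl: "al ~= 0 ==> orthogonal_matrix (root_refl al)"
 by (simp add: orthogonal_matrix)

lemma coroot_matrix:
 assumes "orthogonal_matrix g" shows "coroot (g *v al) = g *v coroot al"
proof -
 have "orthogonal_transformation ((*v) g)" using assms
  by (simp add: orthogonal_transformation_matrix)
 hence "(g *v al) \<bullet> (g *v al) = al \<bullet> al" by (simp add: orthogonal_transformation_def)
 thus ?thesis by (simp add: coroot_def matrix_vector_mult_scaleR)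
qed

lemma inner_orthogonal: "orthogonal_matrix g ==> (g *v u) \<bullet> (g *v v) = u \<bullet> (v :: real^'n)"
 using orthogonal_transformation_matrix[of "(*v) g"] by (simp add: orthogonal_transformation_def)

lemma root_refl_conj:
 assumes "orthogonal_matrix g" shows "root_refl (g *v al) ** g = g ** root_refl al"
proof -
 have "(root_refl (g *v al) ** g) *v v = (g ** root_refl al) *v v" for v
  unfolding matrix_vector_mul_assoc[symmetric] root_refl_vec coroot_matrix[OF assms] inner_orthogonal[OF assms]
  by (simp add: matrix_vector_mult_diff_distrib matrix_vector_mult_scaleR)
 thus ?thesis by (simp add: matrix_eq)
qed

text \<open>Root and coroot are proportional, so the factor may sit on either. The first form is the
  reflection acting on V, the second its action on the dual space.\<close>

lemma cmat_refl_vec: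
 "cmat (root_refl al) *v u = u - pairing u (cvec al) *s cvec (coroot al)"
 "cmat (root_refl al) *v u = u - pairing u (cvec (coroot al)) *s cvec al"
proof -
 have "(cmat (root_refl al) *v u) $ i = (u - (2 / complex_of_real (al \<bullet> al) * pairing u (cvec al)) *s cvec al) $ i" for i
 proof -
  have "(cmat (root_refl al) *v u) $ i = (SUM j:UNIV. (if i = j then u $ j else 0) - 2 / complex_of_real (al \<bullet> al) * (u $ j * complex_of_real (al $ j)) * complex_of_real (al $ i))"
   unfolding matrix_vector_mult_def by (auto simp: cmat_def root_refl_nth algebra_simps intro!: sum.cong)
  thus ?thesis
   by (simp add: sum_subtractf pairing_def cvec_def sum_dists)
 qed
 hence *: "cmat (root_refl al) *v u = u - (2 / complex_of_real (al \<bullet> al) * pairing u (cvec al)) *s cvec al"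
  by (simp only: vec_eq_iff simp_thms)
 show "cmat (root_refl al) *v u = u - pairing u (cvec al) *s cvec (coroot al)"
  "cmat (root_refl al) *v u = u - pairing u (cvec (coroot al)) *s cvec al"
  unfolding * coroot_def cvec_simps pairing_scale by (simp_all add: algebra_simps)
qed

lemma orthogonal_matrix_transpose: "orthogonal_matrix g ==> transpose g ** g = mat 1" "orthogonal_matrix g ==> g ** transpose g = mat 1"
 by (auto simp: orthogonal_matrix_def)

lemma cmat_orth: "orthogonal_matrix g ==> transpose (cmat g) ** cmat g = mat 1"
  "orthogonal_matrix g ==> cmat g ** transpose (cmat g) = mat 1"
 by (metis cmat_simps(1,2,3) orthogonal_matrix_transpose(1)) (metis cmat_simps(1,2,3) orthogonal_matrix_transpose(2))

lemma pairing_cmat_orthogonal: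
 assumes "orthogonal_matrix g" shows "pairing (cmat g *v u) (cmat g *v v) = pairing u v"
 unfolding pairing_matrix matrix_vector_mul_assoc by (simp add: cmat_orth[OF assms])

lemma cmat_orth_cancel [simp]: "orthogonal_matrix g ==> transpose (cmat g) *v (cmat g *v u) = u"
 "orthogonal_matrix g ==> cmat g *v (transpose (cmat g) *v u) = u"
 by (simp_all add: matrix_vector_mul_assoc cmat_orth)

lemma orthogonal_matrix_transpose_iff: "orthogonal_matrix g ==> orthogonal_matrix (transpose g)"
 by (simp add: orthogonal_matrix_def)

subsection \<open>Elementary operators\<close>

text \<open>In the x variables one divides by the root, in the y variables by the coroot: a covector
  differs from its reflection by a multiple of the root, a vector by a multiple of the
  coroot.\<close>

definition dqx :: "real^'n => 'n::finite pfun => 'n pfun" where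
 "dqx al = twist.dq (fx (cvec al)) (psub (cmat (root_refl al)) (mat 1))"

definition dqy :: "real^'n => 'n::finite pfun => 'n pfun" where
 "dqy al = twist.dq (fy (cvec (coroot al))) (psub (mat 1) (cmat (root_refl al)))"

lemma coroot_eq_0 [simp]: "coroot al = 0 \<longleftrightarrow> al = 0"
 by (auto simp: coroot_def)

lemma twist_x: "al ~= 0 ==> twist (fx (cvec al)) (psub (cmat (root_refl al)) (mat 1))"
proof
 fix u assume "al ~= 0"
 show "\<exists>c. fx u - psub (cmat (root_refl al)) (mat 1) (fx u) = pconst c * fx (cvec al)"
  by (simp flip: cmat_simps add: cmat_refl_vec(2) fx_lin) blast
 show "\<exists>c. fy u - psub (cmat (root_refl al)) (mat 1) (fy u) = pconst c * fx (cvec al)"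
  by (rule exI[of _ 0]) (simp add: pconst_simps transpose_mat)
qed (auto simp: fx_eq_0)

lemma twist_y: "al ~= 0 ==> twist (fy (cvec (coroot al))) (psub (mat 1) (cmat (root_refl al)))"
proof
 fix u assume "al ~= 0"
 show "\<exists>c. fy u - psub (mat 1) (cmat (root_refl al)) (fy u) = pconst c * fy (cvec (coroot al))"
  by (simp flip: cmat_simps add: cmat_refl_vec(1) fy_lin) blast
 show "\<exists>c. fx u - psub (mat 1) (cmat (root_refl al)) (fx u) = pconst c * fy (cvec (coroot al))"
  by (rule exI[of _ 0]) (simp add: pconst_simps transpose_mat)
qed (auto simp: fy_eq_0)

lemma dqx_eq: "al ~= 0 ==> fx (cvec al) * dqx al p = p - psub (cmat (root_refl al)) (mat 1) p"
 unfolding dqx_def by (rule twist.dq[OF twist_x])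

lemma dqx_I: "al ~= 0 ==> fx (cvec al) * q = p - psub (cmat (root_refl al)) (mat 1) p ==> dqx al p = q"
 unfolding dqx_def by (rule twist.dqI[OF twist_x])

lemma dqy_eq: "al ~= 0 ==> fy (cvec (coroot al)) * dqy al p = p - psub (mat 1) (cmat (root_refl al)) p"
 unfolding dqy_def by (rule twist.dq[OF twist_y])

lemma dqy_I: "al ~= 0 ==> fy (cvec (coroot al)) * q = p - psub (mat 1) (cmat (root_refl al)) p ==> dqy al p = q"
 unfolding dqy_def by (rule twist.dqI[OF twist_y])

lemma plin_dq [simp]: "al ~= 0 ==> plin (dqx al)" "al ~= 0 ==> plin (dqy al)"
 unfolding dqx_def dqy_def plin_def
 by (auto simp: twist.dq_add[OF twist_x] twist.dq_pconst_mult[OF twist_x] twist.dq_add[OF twist_y] twist.dq_pconst_mult[OF twist_y])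

lemma dqx_fx: "al ~= 0 ==> dqx al (fx u * p)
  = pconst (pairing (cvec (coroot al)) u) * psub (cmat (root_refl al)) (mat 1) p + fx u * dqx al p"
proof (rule dqx_I)
 assume a: "al ~= 0"
 have "fx (cvec al) * (pconst (pairing (cvec (coroot al)) u) * psub (cmat (root_refl al)) (mat 1) p + fx u * dqx al p)
  = pconst (pairing (cvec (coroot al)) u) * fx (cvec al) * psub (cmat (root_refl al)) (mat 1) p + fx u * (fx (cvec al) * dqx al p)"
  by (simp add: algebra_simps)
 also have "... = fx u * p - psub (cmat (root_refl al)) (mat 1) (fx u * p)"
  unfolding dqx_eq[OF a] by (simp flip: cmat_simps add: cmat_refl_vec(2) fx_lin pairing_commute[of u]) (simp add: algebra_simps)
 finally show "fx (cvec al) * (pconst (pairing (cvec (coroot al)) u) * psub (cmat (root_refl al)) (mat 1) p + fx u * dqx al p)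
  = fx u * p - psub (cmat (root_refl al)) (mat 1) (fx u * p)" .
qed

lemma dqy_fy: "al ~= 0 ==> dqy al (fy u * p)
  = pconst (pairing (cvec al) u) * psub (mat 1) (cmat (root_refl al)) p + fy u * dqy al p"
proof (rule dqy_I)
 assume a: "al ~= 0"
 have "fy (cvec (coroot al)) * (pconst (pairing (cvec al) u) * psub (mat 1) (cmat (root_refl al)) p + fy u * dqy al p)
  = pconst (pairing (cvec al) u) * fy (cvec (coroot al)) * psub (mat 1) (cmat (root_refl al)) p + fy u * (fy (cvec (coroot al)) * dqy al p)"
  by (simp add: algebra_simps)
 also have "... = fy u * p - psub (mat 1) (cmat (root_refl al)) (fy u * p)"
  unfolding dqy_eq[OF a] by (simp flip: cmat_simps add: cmat_refl_vec(1) fy_lin pairing_commute[of u]) (simp add: algebra_simps)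
 finally show "fy (cvec (coroot al)) * (pconst (pairing (cvec al) u) * psub (mat 1) (cmat (root_refl al)) p + fy u * dqy al p)
  = fy u * p - psub (mat 1) (cmat (root_refl al)) (fy u * p)" .
qed

lemma dqy_fx: "al ~= 0 ==> dqy al (fx u * p) = fx u * dqy al p"
proof (rule dqy_I)
 assume a: "al ~= 0"
 have "fy (cvec (coroot al)) * (fx u * dqy al p) = fx u * (fy (cvec (coroot al)) * dqy al p)" by (simp add: algebra_simps)
 thus "fy (cvec (coroot al)) * (fx u * dqy al p) = fx u * p - psub (mat 1) (cmat (root_refl al)) (fx u * p)"
  unfolding dqy_eq[OF a] by (simp add: transpose_mat algebra_simps)
qed

lemma dqx_fy: "al ~= 0 ==> dqx al (fy u * p) = fy u * dqx al p"
proof (rule dqx_I)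
 assume a: "al ~= 0"
 have "fx (cvec al) * (fy u * dqx al p) = fy u * (fx (cvec al) * dqx al p)" by (simp add: algebra_simps)
 thus "fx (cvec al) * (fy u * dqx al p) = fy u * p - psub (cmat (root_refl al)) (mat 1) (fy u * p)"
  unfolding dqx_eq[OF a] by (simp add: transpose_mat algebra_simps)
qed

lemma dqx_conj:
 assumes a: "al ~= 0" and g: "orthogonal_matrix g"
 shows "psub (cmat (transpose g)) (cmat (transpose g)) (dqx al p) = dqx (g *v al) (psub (cmat (transpose g)) (cmat (transpose g)) p)"
proof (rule dqx_I[symmetric])
 show "g *v al ~= 0" using a g by (metis inner_eq_zero_iff inner_orthogonal)
 let ?h = "psub (cmat (transpose g)) (cmat (transpose g))"
 have "fx (cvec (g *v al)) * ?h (dqx al p) = ?h (fx (cvec al) * dqx al p)" by simp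
 also have "... = ?h p - psub (cmat (root_refl (g *v al))) (mat 1) (?h p)"
  unfolding dqx_eq[OF a] using arg_cong[OF root_refl_conj[OF g, of al], of "%m. cmat (transpose m)"]
  by (simp add: matrix_transpose_mul)
 finally show "fx (cvec (g *v al)) * ?h (dqx al p) = ?h p - psub (cmat (root_refl (g *v al))) (mat 1) (?h p)" .
qed

lemma dqy_conj:
 assumes a: "al ~= 0" and g: "orthogonal_matrix g"
 shows "psub (cmat (transpose g)) (cmat (transpose g)) (dqy al p) = dqy (g *v al) (psub (cmat (transpose g)) (cmat (transpose g)) p)"
proof (rule dqy_I[symmetric])
 show "g *v al ~= 0" using a g by (metis inner_eq_zero_iff inner_orthogonal)
 let ?h = "psub (cmat (transpose g)) (cmat (transpose g))"
 have "fy (cvec (coroot (g *v al))) * ?h (dqy al p) = ?h (fy (cvec (coroot al)) * dqy al p)" by (simp add: coroot_matrix[OF g])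
 also have "... = ?h p - psub (mat 1) (cmat (root_refl (g *v al))) (?h p)"
  unfolding dqy_eq[OF a] using arg_cong[OF root_refl_conj[OF g, of al], of "%m. cmat (transpose m)"]
  by (simp add: matrix_transpose_mul)
 finally show "fy (cvec (coroot (g *v al))) * ?h (dqy al p) = ?h p - psub (mat 1) (cmat (root_refl (g *v al))) (?h p)" .
qed

lemma hcp_dq: "al ~= 0 ==> hcp j (dqx al p) = dqx al (hcp (Suc j) p)" "al ~= 0 ==> hcp j (dqy al p) = dqy al (hcp (Suc j) p)"
proof -
 assume a: "al ~= 0"
 show "hcp j (dqx al p) = dqx al (hcp (Suc j) p)"
  by (rule dqx_I[OF a, symmetric]) (use arg_cong[OF dqx_eq[OF a, of p], of "hcp (Suc j)"] in simp)
 show "hcp j (dqy al p) = dqy al (hcp (Suc j) p)"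
  by (rule dqy_I[OF a, symmetric]) (use arg_cong[OF dqy_eq[OF a, of p], of "hcp (Suc j)"] in simp)
qed

text \<open>Multiplication by e_p toggles p in S, because e_p squares to 1. \<open>sg K S\<close> is
  the sign for moving past those factors of e_S whose index lies in K.\<close>

definition sd :: "nat set => nat => nat set" where
 "sd S p = (if p : S then S - {p} else insert p S)"

definition sg :: "nat set => nat set => complex" where
 "sg K S = (-1) ^ card (S \<inter> K)"

lemma sd_sd [simp]: "sd (sd S p) p = S"
 by (auto simp: sd_def)

lemma sd_commute: "sd (sd S p) q = sd (sd S q) p"
 by (auto simp: sd_def)

lemma sg_sq [simp]: "sg K S * sg K S = 1"
 by (simp add: sg_def flip: power_mult_distrib)

lemma sg_sd_notin: "p \<notin> K ==> sg K (sd S p) = sg K S"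
proof -
 assume "p \<notin> K"
 hence "sd S p \<inter> K = S \<inter> K" by (auto simp: sd_def)
 thus ?thesis by (simp add: sg_def)
qed

lemma sg_sd_in: "p : K ==> finite K ==> sg K (sd S p) = - sg K S"
proof -
 assume p: "p : K" and K: "finite K"
 show ?thesis
 proof (cases "p : S")
  case True
  hence "S \<inter> K = insert p (sd S p \<inter> K)" using p by (auto simp: sd_def)
  moreover have "p \<notin> sd S p \<inter> K" using True by (auto simp: sd_def)
  ultimately have "card (S \<inter> K) = Suc (card (sd S p \<inter> K))" using K by simp
  thus ?thesis by (simp add: sg_def)
 next
  case False
  hence "sd S p \<inter> K = insert p (S \<inter> K)" using p by (auto simp: sd_def)
  hence "card (sd S p \<inter> K) = Suc (card (S \<inter> K))" using K False by simp
  thus ?thesis by (simp add: sg_def)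
 qed
qed

lemma sg_sd: "finite K ==> sg K (sd S p) = (if p : K then - sg K S else sg K S)"
 by (simp add: sg_sd_in sg_sd_notin)

text \<open>Products rewritten in normal order x y w e_S. From the left, y_u passes the x's and
  leaves \<open>Yo\<close>, a derivative \<open>Dxo\<close> and, for each root, \<open>Tc\<close>: a
  divided difference whose reflection then passes the y's. From the right, x_u first passes w,
  becoming x_(w u), and then the y's, which gives \<open>rX\<close>, \<open>rD\<close> and
  \<open>rc\<close>; right multiplication by y_u and by a group element are \<open>rY\<close> and
  \<open>rg\<close>. The sign of \<open>el\<close> counts the factors below p, that of
  \<open>re\<close> those above.\<close>

definition Xo :: "complex^'n => 'n::finite op" where "Xo u = mop (%k. k) (%_. (*) (fx u))"
definition Yo :: "complex^'n => 'n::finite op" where "Yo u = mop (%k. k) (%_. (*) (fy u))"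
definition Dxo :: "complex^'n => 'n::finite op" where "Dxo u = mop (%k. k) (%_. Dd (u, 0))"
definition gr :: "real^'n^'n => 'n::finite op" where
 "gr g = mop (%k. (g ** fst k, snd k)) (%_. psub (cmat (transpose g)) (cmat (transpose g)))"
definition el :: "nat => 'n::finite op" where
 "el p = mop (%k. (fst k, sd (snd k) p)) (%k. (*) (pconst (sg {..<p} (snd k))))"
definition par :: "'n::finite op" where
 "par = mop (%k. k) (%k. (*) (pconst (sg {1..CARD('n)} (snd k))))"
definition Ho :: "nat => 'n::finite op" where "Ho j = mop (%k. k) (%_. hcp j)"
definition Tc :: "real^'n => 'n::finite op" where
 "Tc al = mop (%k. (root_refl al ** fst k, snd k)) (%_ p. psub (mat 1) (cmat (root_refl al)) (dqx al p))"
definition rX :: "complex^'n => 'n::finite op" where "rX u = mop (%k. k) (%k. (*) (fx (cmat (fst k) *v u)))"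
definition rY :: "complex^'n => 'n::finite op" where "rY u = mop (%k. k) (%k. (*) (fy (cmat (fst k) *v u)))"
definition rD :: "complex^'n => 'n::finite op" where "rD u = mop (%k. k) (%k. Dd (0, cmat (fst k) *v u))"
definition rc :: "complex^'n => real^'n => 'n::finite op" where
 "rc u al = mop (%k. (root_refl al ** fst k, snd k))
  (%k p. pconst (pairing (cvec (coroot al)) (cmat (fst k) *v u)) * dqy al p)"
definition rg :: "real^'n^'n => 'n::finite op" where "rg g = mop (%k. (fst k ** g, snd k)) (%_ p. p)"
definition re :: "nat => 'n::finite op" where
 "re p = mop (%k. (fst k, sd (snd k) p)) (%k. (*) (pconst (sg {p<..CARD('n)} (snd k))))"

lemma app_ops [simp]:
 "app (Xo u) (single k p) = single k (fx u * p)"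
 "app (Yo u) (single k p) = single k (fy u * p)"
 "app (Dxo u) (single k p) = single k (Dd (u, 0) p)"
 "app (gr g) (single k p) = single (g ** fst k, snd k) (psub (cmat (transpose g)) (cmat (transpose g)) p)"
 "app (el i) (single k p) = single (fst k, sd (snd k) i) (pconst (sg {..<i} (snd k)) * p)"
 "app (par :: 'n::finite op) (single k p) = single k (pconst (sg {1..CARD('n)} (snd k)) * p)"
 "app (Ho j) (single k p) = single k (hcp j p)"
 "al ~= 0 ==> app (Tc al) (single k p) = single (root_refl al ** fst k, snd k) (psub (mat 1) (cmat (root_refl al)) (dqx al p))"
 "app (rX u) (single k p) = single k (fx (cmat (fst k) *v u) * p)"
 "app (rY u) (single k p) = single k (fy (cmat (fst k) *v u) * p)"
 "app (rD u) (single k p) = single k (Dd (0, cmat (fst k) *v u) p)"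
 "al ~= 0 ==> app (rc u al) (single k p) = single (root_refl al ** fst k, snd k)
   (pconst (pairing (cvec (coroot al)) (cmat (fst k) *v u)) * dqy al p)"
 "app (rg g) (single k p) = single (fst k ** g, snd k) p"
 "app (re i :: 'n op) (single k p) = single (fst k, sd (snd k) i) (pconst (sg {i<..CARD('n)} (snd k)) * p)"
 by (simp_all add: Xo_def Yo_def Dxo_def gr_def el_def par_def Ho_def Tc_def rX_def rY_def rD_def rc_def rg_def re_def)

lemma pc_pc [simp]: "pconst a * (pconst b * p) = pconst (a * b) * p"
 by (simp add: pconst_simps m_ass)

lemma pc_one [simp]: "pconst 1 * p = p" "pconst (-1) * p = - p" "pconst (- a) * p = - (pconst a * p)"
 by (simp_all add: pconst_simps)

lemma dq_pc [simp]: "al ~= 0 ==> dqx al (pconst c * p) = pconst c * dqx al p" "al ~= 0 ==> dqy al (pconst c * p) = pconst c * dqy al p"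
 using plin_dq(1)[of al] plin_dq(2)[of al] unfolding plin_def by blast+

lemma Xo_lin: "Xo (u + v) = Xo u + Xo v" "Xo (k *s u) = sc k * Xo u" "Xo (- u) = - Xo u" "Xo 0 = 0" "Xo (u - v) = Xo u - Xo v"
 by (rule op_eqI; simp add: fx_lin distrib_right single_add single_uminus single_diff left_diff_distrib m_ass)+

lemma Yo_lin: "Yo (u + v) = Yo u + Yo v" "Yo (k *s u) = sc k * Yo u"
 by (rule op_eqI; simp add: fy_lin distrib_right single_add m_ass)+

lemma Dxo_lin: "Dxo (u + v) = Dxo u + Dxo v" "Dxo (k *s u) = sc k * Dxo u"
 by (rule op_eqI; simp add: Dd_dir' single_add)+

lemma Xo_Xo: "Xo u * Xo v = Xo v * Xo u"
 by (rule op_eqI) (simp add: mult.left_commute)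

lemma gr_gr: "gr g * gr h = gr (g ** h)"
 by (rule op_eqI) (simp add: matrix_mul_assoc matrix_transpose_mul)

lemma gr_one: "gr (mat 1) = 1"
 by (rule op_eqI) (simp add: transpose_mat)

lemma gr_Xo: "orthogonal_matrix g ==> gr g * Xo u = Xo (cmat g *v u) * gr g"
 by (rule op_eqI) (simp add: transpose_transpose)

lemma gr_Yo: "orthogonal_matrix g ==> gr g * Yo u = Yo (cmat g *v u) * gr g"
 by (rule op_eqI) (simp add: transpose_transpose)

lemma gr_Dxo: "orthogonal_matrix g ==> gr g * Dxo u = Dxo (cmat g *v u) * gr g"
 by (rule op_eqI) (simp add: Dd_psub)

lemma gr_Tc: "orthogonal_matrix g ==> al ~= 0 ==> gr g * Tc al = Tc (g *v al) * gr g"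
proof (rule op_eqI)
 fix k :: "'a idx" and p assume g: "orthogonal_matrix g" and a: "al ~= 0"
 hence "g *v al ~= 0" by (metis inner_eq_zero_iff inner_orthogonal)
 moreover have "root_refl al ** transpose g = transpose g ** root_refl (g *v al)"
  using arg_cong[OF root_refl_conj[OF g, of al], of transpose] by (simp add: matrix_transpose_mul)
 ultimately show "app (gr g * Tc al) (single k p) = app (Tc (g *v al) * gr g) (single k p)"
  using a root_refl_conj[OF g, of al] dqx_conj[OF a g, of p, symmetric]
  by (simp add: matrix_mul_assoc flip: cmat_simps)
qed

lemma Tc_Xo: "al ~= 0 ==> Tc al * Xo a = Xo a * Tc al + sc (pairing (cvec (coroot al)) a) * gr (root_refl al)"
 by (rule op_eqI) (simp add: dqx_fx transpose_mat single_add add.commute)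

lemma Dxo_Xo: "Dxo u * Xo a = Xo a * Dxo u + sc (pairing u a)"
 by (rule op_eqI) (simp add: Dd_mult single_add add.commute)

lemma Yo_Xo: "Yo u * Xo a = Xo a * Yo u"
 by (rule op_eqI) (simp add: mult.left_commute)

lemma el_el: "el p * el p = (1 :: 'n::finite op)" "p ~= q ==> el p * el q = - (el q * el p :: 'n op)"
proof -
 show "el p * el p = (1 :: 'n op)"
  by (rule op_eqI) (simp add: sg_sd)
 have *: "el p * el q = - (el q * el p :: 'n op)" if "p < q" for p q :: nat
  by (rule op_eqI) (use that in \<open>simp add: sg_sd sd_commute[of _ p q] single_uminus mult.commute[where 'a = complex]\<close>)
 show "p ~= q ==> el p * el q = - (el q * el p :: 'n op)"
  using *[of p q] *[of q p] by (cases p q rule: linorder_cases) auto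
qed

lemma el_comm: "el p * Xo u = Xo u * el p" "el p * Yo u = Yo u * el p" "el p * Dxo u = Dxo u * el p"
 "el p * gr g = gr g * el p" "al ~= 0 ==> el p * Tc al = Tc al * el p"
 by (rule op_eqI; simp add: mult.left_commute)+

lemma par_comm: "par * Xo u = Xo u * par" "par * Yo u = Yo u * par" "par * Dxo u = Dxo u * par"
 "par * gr g = gr g * par" "al ~= 0 ==> par * Tc al = Tc al * par"
 by (rule op_eqI; simp add: mult.left_commute)+

lemma par_par [simp]: "par * par = 1"
 by (rule op_eqI) simp

lemma par_el: "p : {1..CARD('n)} ==> par * el p = - (el p * (par :: 'n::finite op))"
 by (rule op_eqI) (simp add: single_uminus sg_sd mult.commute[where 'a = complex])

lemma re_comm: "re p * Xo u = Xo u * re p" "re p * Yo u = Yo u * re p" "re p * Dxo u = Dxo u * re p"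
 "re p * gr g = gr g * re p" "al ~= 0 ==> re p * Tc al = Tc al * re p"
 by (rule op_eqI; simp add: mult.left_commute)+

lemma re_el:
 assumes "p : {1..CARD('n)}" "q : {1..CARD('n)}"
 shows "re p * el q = el q * (re p :: 'n::finite op)"
 by (rule op_eqI) (use assms in \<open>auto simp: sg_sd sd_commute[of _ p q] mult.commute[where 'a = complex]\<close>)

lemma rg_comm: "rg h * Xo u = Xo u * rg h" "rg h * Yo u = Yo u * rg h" "rg h * Dxo u = Dxo u * rg h"
 "rg h * gr g = gr g * rg h" "al ~= 0 ==> rg h * Tc al = Tc al * rg h" "rg h * el p = el p * rg h"
 by (rule op_eqI; simp add: matrix_mul_assoc)+

lemma rY_comm: "rY v * Xo u = Xo u * rY v" "rY v * Yo u = Yo u * rY v" "rY v * Dxo u = Dxo u * rY v"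
 "orthogonal_matrix g ==> rY v * gr g = gr g * rY v" "al ~= 0 ==> rY v * Tc al = Tc al * rY v" "rY v * el p = el p * rY v"
 by (rule op_eqI; simp add: mult.left_commute Dd_mult pconst_simps transpose_transpose matrix_vector_mul_assoc dqx_fy
   transpose_transpose flip: cmat_simps)+

lemma rXD_comm: "rX v * Xo u = Xo u * rX v" "rD v * Xo u = Xo u * rD v" "al ~= 0 ==> rc v al * Xo u = Xo u * rc v al"
 "orthogonal_matrix g ==> rX v * gr g = gr g * rX v" "orthogonal_matrix g ==> rD v * gr g = gr g * rD v"
 "rX v * el p = el p * rX v" "rD v * el p = el p * rD v" "al ~= 0 ==> rc v al * el p = el p * rc v al"
 by (rule op_eqI; simp add: mult.left_commute Dd_mult pconst_simps transpose_transpose matrix_vector_mul_assoc dqy_fx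
   Dd_psub matrix_mul_assoc orthogonal_matrix_transpose flip: cmat_simps)+

lemma gr_rc:
 assumes g: "orthogonal_matrix g" and a: "al ~= 0"
 shows "gr g * rc v al = rc v (g *v al) * gr g"
proof (rule op_eqI)
 fix k :: "'a idx" and p
 have "g *v al ~= 0" using a g by (metis inner_eq_zero_iff inner_orthogonal)
 moreover have "pairing (cvec (coroot (g *v al))) (cmat (g ** fst k) *v v) = pairing (cvec (coroot al)) (cmat (fst k) *v v)"
  using pairing_cmat_orthogonal[OF g, of "cvec (coroot al)" "cmat (fst k) *v v"]
  by (simp add: coroot_matrix[OF g] matrix_vector_mul_assoc)
 ultimately show "app (gr g * rc v al) (single k p) = app (rc v (g *v al) * gr g) (single k p)"
  using a root_refl_conj[OF g, of al] dqy_conj[OF a g, of p]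
  by (simp add: matrix_mul_assoc del: cmat_simps)
qed

text \<open>Grading shifts: multiplications raise the polynomial degree by one, the other parts of the
 Dunkl operators lower it by one.\<close>

lemma Ho_shift:
 "Ho (Suc j) * Xo u = Xo u * Ho j" "Ho 0 * Xo u = 0" "Ho (Suc j) * Yo u = Yo u * Ho j" "Ho 0 * Yo u = 0"
 "Ho (Suc j) * rX u = rX u * Ho j" "Ho 0 * rX u = 0" "Ho (Suc j) * rY u = rY u * Ho j" "Ho 0 * rY u = 0"
 "Ho j * Dxo u = Dxo u * Ho (Suc j)" "Ho j * rD u = rD u * Ho (Suc j)"
 "al ~= 0 ==> Ho j * Tc al = Tc al * Ho (Suc j)" "al ~= 0 ==> Ho j * rc u al = rc u al * Ho (Suc j)"
 "Ho j * gr g = gr g * Ho j" "Ho j * el p = el p * Ho j" "Ho j * re p = re p * Ho j" "Ho j * rg g = rg g * Ho j"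
 "Ho j * par = par * Ho j" "Ho j * sc k = sc k * Ho j"
 by (rule op_eqI; simp add: hcp_Dd hcp_dq)+

section \<open>Dunkl operators, their commutativity, and the right multiplications commuting with
  them\<close>

section \<open>Dunkl operators\<close>

definition yonly :: "'n::finite pfun => bool" where
 "yonly p \<longleftrightarrow> psub 0 (mat 1) p = p"

lemma matrix_zero [simp]: "(0 :: 'a::semiring_1^'n^'m) ** g = 0" "g ** (0 :: 'a::semiring_1^'n^'m) = 0"
 by (auto simp: matrix_matrix_mult_def vec_eq_iff)

lemma yonly_rules:
 assumes "yonly p"
 shows "psub g h p = psub (mat 1) h p" "Dd (u, 0) p = 0" "yonly (fy v * p)" "yonly (pconst k * p)"
  "yonly (Dd (0, u) p)" "al ~= 0 ==> dqx al p = 0" "al ~= 0 ==> yonly (dqy al p)"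
proof -
 have p: "psub 0 (mat 1) p = p" using assms by (simp add: yonly_def)
 have 1: "psub g h p = psub 0 h p" for g h
  by (subst p[symmetric]) simp
 have gh: "psub g h p = psub (mat 1) h p" for g h by (simp add: 1[of g] 1[of "mat 1"])
 show "psub g h p = psub (mat 1) h p" by (rule gh)
 have "psub 0 (mat 1) (Dd (0, 0) p) = Dd (u, 0) p"
  using Dd_psub[of "(u, 0)" 0 "mat 1" p] p by simp
 thus "Dd (u, 0) p = 0" unfolding Dd_dir(3) by simp
 show "yonly (fy v * p)" "yonly (pconst k * p)" by (simp_all add: yonly_def p transpose_mat)
 show "yonly (Dd (0, u) p)"
  using Dd_psub[of "(0, u)" 0 "mat 1" p] p by (simp add: yonly_def)
 show "dqx al p = 0" if "al ~= 0"
  by (rule dqx_I[OF that]) (simp add: gh[of "cmat (root_refl al)"])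
 show "yonly (dqy al p)" if "al ~= 0"
  unfolding yonly_def
 proof (rule dqy_I[OF that, symmetric])
  have "fy (cvec (coroot al)) * psub 0 (mat 1) (dqy al p) = psub 0 (mat 1) (fy (cvec (coroot al)) * dqy al p)"
   by (simp add: transpose_mat)
  thus "fy (cvec (coroot al)) * psub 0 (mat 1) (dqy al p) = p - psub (mat 1) (cmat (root_refl al)) p"
   unfolding dqy_eq[OF that] by (simp add: p 1[of "mat 1"])
 qed
qed

inductive xgen :: "'n::finite pfun => bool" where
 yonly: "yonly p ==> xgen p"
| add: "xgen p ==> xgen q ==> xgen (p + q)"
| mx: "xgen p ==> xgen (fx u * p)"

lemma xgen_fy: "xgen p ==> xgen (fy v * p)"
proof (induction rule: xgen.induct)
 case (yonly p)
 thus ?case using yonly_rules(3) xgen.yonly by blast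
next
 case (add p q)
 thus ?case using xgen.add by (simp add: distrib_left)
next
 case (mx p u)
 thus ?case using xgen.mx[of "fy v * p" u] by (simp add: mult.left_commute)
qed

lemma xgen_all: "xgen p"
proof (induction p rule: pfun_induct)
 case (const c)
 show ?case by (rule xgen.yonly) (simp add: yonly_def)
qed (auto intro: xgen.intros xgen_fy)

text \<open>The module is generated under multiplication by x from vectors free of x. Hence an
  operator identity needs only the commutators with \<open>Xo\<close> and a check on x-free vectors,
  where derivatives and divided differences in x vanish.\<close>

lemma op_zeroI:
 assumes "!!a. C * Xo a = Xo a * C" "!!k p. yonly p ==> app C (single k p) = 0"
 shows "C = 0"
proof (rule op_eqI)
 fix k :: "'a idx" and p
 show "app C (single k p) = app 0 (single k p)"
  using xgen_all[of p]
 proof (induction p rule: xgen.induct)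
  case (mx p u)
  have "app C (single k (fx u * p)) = app (C * Xo u) (single k p)" by simp
  also have "... = app (Xo u) (app C (single k p))" unfolding assms(1) by simp
  finally show ?case using mx by simp
 qed (auto simp: assms(2) single_add)
qed

definition vac :: "'n::finite M" where "vac = single (mat 1, {}) 1"

locale dunkl = dunkl_data R P c t y for R P :: "(real^'n::finite) set" and c t y +
 assumes card3: "CARD('n) \<ge> 3" and rsys: "root_system R" and pos: "positive_roots R P"
  and cinv: "W_invariant R c" and t0: "t ~= 0" and onb: "orthonormal_basis y"
begin

abbreviation "W == refl_group R"

lemma finite_R [simp]: "finite R" and R_nz: "al : R ==> al ~= 0"
 using rsys by (auto simp: root_system_def)

lemma refl_R: "al : R ==> \<beta> : R ==> root_refl al *v \<beta> : R"
 using rsys by (auto simp: root_system_def)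

lemma R_minus: "al : R ==> - al : R"
 using refl_R[of al al] root_refl_self[OF R_nz] by simp

lemma W_orth: "g : W ==> orthogonal_matrix g"
 by (induction rule: refl_group.induct)
  (auto intro: orthogonal_matrix_mul orthogonal_root_refl orthogonal_matrix_id dest: R_nz)

lemma W_R: "g : W ==> al : R ==> g *v al : R"
 by (induction rule: refl_group.induct) (auto simp: refl_R simp flip: matrix_vector_mul_assoc)

lemma W_refl: "al : R ==> root_refl al : W"
 using refl_group.step[OF _ refl_group.one, of al R] by simp

lemma W_mult: "g : W ==> h : W ==> g ** h : W"
 by (induction rule: refl_group.induct) (auto simp: matrix_mul_assoc[symmetric] intro: refl_group.step)

lemma c_W: "g : W ==> al : R ==> c (g *v al) = c al"
 using cinv by (auto simp: W_invariant_def)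

lemma c_minus: "al : R ==> c (- al) = c al"
 using c_W[OF W_refl, of al al] root_refl_self[OF R_nz] by simp

lemma sum_R_W:
 assumes "g : W" shows "(SUM al:R. f (g *v al)) = (SUM al:R. f al)"
proof -
 have "inj_on ((*v) g) R" by (rule inj_onI) (metis W_orth[OF assms] orthogonal_matrix_def matrix_vector_mul_assoc matrix_vector_mul_lid)
 moreover have "(*v) g ` R <= R" using W_R[OF assms] by auto
 ultimately have "bij_betw ((*v) g) R R" by (simp add: bij_betw_def endo_inj_surj)
 thus ?thesis by (rule sum.reindex_bij_betw)
qed

lemma P_props: "P <= R" "finite P" "(SUM al:R. f al) = (SUM al:P. f al + f (- al))"
proof -
 obtain v where v: "!!al. al : R ==> v \<bullet> al ~= 0" "P = {al\<in>R. v \<bullet> al > 0}"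
  using pos by (auto simp: positive_roots_def)
 show P: "P <= R" "finite P" using v by auto
 have "R = P \<union> uminus ` P"
 proof safe
  fix al assume "al : R" "al \<notin> uminus ` P"
  moreover have "al = - (- al)" by simp
  ultimately have "- al \<notin> P" by blast
  thus "al : P" using v \<open>al : R\<close> R_minus[of al] by (auto simp: not_less less_le)
 qed (use v R_minus in auto)
 moreover have "P \<inter> uminus ` P = {}" using v by auto
 ultimately have "(SUM al:R. f al) = (SUM al:P. f al) + (SUM al:uminus ` P. f al)"
  using P by (metis finite_imageI sum.union_disjoint)
 also have "(SUM al:uminus ` P. f al) = (SUM al:P. f (- al))"
  by (subst sum.reindex) (auto simp: inj_on_def)
 finally show "(SUM al:R. f al) = (SUM al:P. f al + f (- al))" by (simp add: sum.distrib)
qed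

text \<open>The sum runs over all roots with weight c/2 instead of over positive roots with weight
  c. It is then visibly W-invariant, and equivariance is a reindexing; \<open>Bo_P\<close> converts
  back.\<close>

definition T :: "complex^'n => 'n op" where
 "T u = Yo u + sc t * Dxo u - (SUM al:R. sc (c al / 2 * pairing u (cvec al)) * Tc al)"

definition rx :: "complex^'n => 'n op" where
 "rx u = rX u + sc t * rD u - (SUM al:R. sc (c al / 2) * rc u al)"

definition Bo :: "complex^'n => complex^'n => 'n op" where
 "Bo u a = sc (t * pairing u a) - (SUM al:R. sc (c al / 2 * pairing u (cvec al) * pairing (cvec (coroot al)) a) * gr (root_refl al))"

lemma T_lin: "T (u + v) = T u + T v" "T (k *s u) = sc k * T u"
proof -
 have m: "sc a * (sc b * x) = sc (a * b) * x" for a b and x :: "'n op" by (simp add: S.sc_mult m_ass)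
 show "T (u + v) = T u + T v"
  unfolding T_def by (simp add: Yo_lin Dxo_lin pairing_add S.sc_add add_dists sum.distrib)
 show "T (k *s u) = sc k * T u"
  unfolding T_def Yo_lin Dxo_lin pairing_scale right_diff_distrib distrib_left sum_distrib_left m
  by (simp add: mult_ac)
qed

lemma T_Xo: "T u * Xo a = Xo a * T u + Bo u a"
proof -
 have 1: "sc k * Tc al * Xo a = Xo a * (sc k * Tc al) + sc (k * pairing (cvec (coroot al)) a) * gr (root_refl al)" if "al : R" for al k
  unfolding m_ass Tc_Xo[OF R_nz[OF that]] distrib_left S.slc[of "Xo a"] by (simp add: S.sc_mult m_ass)
 have 2: "sc t * Dxo u * Xo a = Xo a * (sc t * Dxo u) + sc (t * pairing u a)"
  unfolding m_ass Dxo_Xo distrib_left S.slc[of "Xo a"] by (simp add: S.sc_mult)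
 have 3: "(SUM al:R. sc (c al / 2 * pairing u (cvec al)) * Tc al * Xo a)
  = (SUM al:R. Xo a * (sc (c al / 2 * pairing u (cvec al)) * Tc al))
  + (SUM al:R. sc (c al / 2 * pairing u (cvec al) * pairing (cvec (coroot al)) a) * gr (root_refl al))"
  unfolding sum.distrib[symmetric] by (rule sum.cong[OF refl 1])
 show ?thesis unfolding T_def Bo_def diff_dists add_dists
   sum_dists Yo_Xo 2 3
  by (simp only: algebra_simps)
qed

lemma gr_T:
 assumes "g : W" shows "gr g * T u = T (cmat g *v u) * gr g"
proof -
 note g = W_orth[OF assms]
 have "(SUM al:R. sc (c al / 2 * pairing (cmat g *v u) (cvec al)) * Tc al)
  = (SUM al:R. sc (c (g *v al) / 2 * pairing (cmat g *v u) (cvec (g *v al))) * Tc (g *v al))"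
  by (rule sum_R_W[OF assms, symmetric])
 also have "... = (SUM al:R. sc (c al / 2 * pairing u (cvec al)) * Tc (g *v al))"
  by (intro sum.cong refl) (simp add: c_W[OF assms] pairing_cmat_orthogonal[OF g] flip: cmat_simps(4))
 finally have 1: "(SUM al:R. sc (c al / 2 * pairing (cmat g *v u) (cvec al)) * Tc al) * gr g
  = (SUM al:R. gr g * (sc (c al / 2 * pairing u (cvec al)) * Tc al))"
  by (simp add: sum_distrib_right m_ass S.slc gr_Tc[OF g] R_nz)
 show ?thesis
  unfolding T_def diff_dists add_dists 1 sum_distrib_left
   gr_Yo[OF g] S.slc[of "gr g" t] gr_Dxo[OF g] by (simp add: m_ass)
qed

lemma T_single: "yonly p ==> app (T u) (single k p) = single k (fy u * p)"
 unfolding T_def by (simp add: yonly_rules R_nz)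

lemma T_gr_refl: "al : R ==> T u * gr (root_refl al) - gr (root_refl al) * T u
  = sc (pairing u (cvec al)) * (T (cvec (coroot al)) * gr (root_refl al))"
proof -
 assume a: "al : R"
 have "cmat (root_refl al) *v u = u + (- pairing u (cvec al)) *s cvec (coroot al)"
  unfolding cmat_refl_vec(1) by (simp add: vec_eq_iff)
 thus ?thesis unfolding gr_T[OF W_refl[OF a]]
  by (simp only: T_lin S.sc_minus) (simp add: algebra_simps)
qed

text \<open>The right side is symmetric in u and v, which is the Jacobi identity needed for the
  commutativity of the T's.\<close>

lemma T_Bo: "T u * Bo v a - Bo v a * T u
  = - (SUM al:R. sc (c al / 2 * pairing u (cvec al) * pairing v (cvec al) * pairing (cvec (coroot al)) a) * (T (cvec (coroot al)) * gr (root_refl al)))"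
proof -
 have "T u * (sc k * gr (root_refl al)) - sc k * gr (root_refl al) * T u
  = sc (k * pairing u (cvec al)) * (T (cvec (coroot al)) * gr (root_refl al))" if "al : R" for k al
  unfolding S.slc[of "T u"] m_ass right_diff_distrib[symmetric] T_gr_refl[OF that] by (simp add: S.sc_mult m_ass)
 hence "(SUM al:R. T u * (sc (c al / 2 * pairing v (cvec al) * pairing (cvec (coroot al)) a) * gr (root_refl al)))
  - (SUM al:R. sc (c al / 2 * pairing v (cvec al) * pairing (cvec (coroot al)) a) * gr (root_refl al) * T u)
  = (SUM al:R. sc (c al / 2 * pairing u (cvec al) * pairing v (cvec al) * pairing (cvec (coroot al)) a) * (T (cvec (coroot al)) * gr (root_refl al)))"
  by (simp add: sum_subtractf[symmetric] mult_ac)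
 thus ?thesis unfolding Bo_def diff_dists sum_dists
   S.sc_comm[of "T u" "t * pairing v a"] by (simp add: algebra_simps)
qed

text \<open>By the symmetry in \<open>T_Bo\<close> the commutator of two T's commutes with every x.
  It kills x-free vectors because there T acts as multiplication by y.\<close>

lemma T_T: "T u * T v = T v * T u"
proof -
 define C where "C = T u * T v - T v * T u"
 have "C = 0"
 proof (rule op_zeroI)
  fix a
  have 1: "T u * T v * Xo a = Xo a * (T u * T v) + Bo u a * T v + T u * Bo v a" for u v
   unfolding m_ass T_Xo distrib_left by (simp add: m_ass[symmetric] T_Xo distrib_right)
  have "T u * Bo v a - Bo v a * T u = T v * Bo u a - Bo u a * T v"
   unfolding T_Bo by (simp add: mult_ac)
  thus "C * Xo a = Xo a * C" unfolding C_def left_diff_distrib 1 right_diff_distrib by (simp add: algebra_simps)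
 next
  fix k :: "'n idx" and p :: "'n pfun" assume "yonly p"
  thus "app C (single k p) = 0"
   unfolding C_def by (simp add: T_single yonly_rules mult.left_commute)
 qed
 thus ?thesis by (simp add: C_def)
qed

lemma el_T: "el p * T u = T u * el p"
proof -
 have "el p * (sc k * a) = sc k * a * el p" if "el p * a = a * el p" for k and a :: "'n op"
  using that by (metis S.slc m_ass)
 thus ?thesis unfolding T_def diff_dists add_dists sum_dists
  by (simp add: el_comm R_nz)
qed

lemma par_T: "par * T u = T u * par"
proof -
 have "par * (sc k * a) = sc k * a * par" if "par * a = a * par" for k and a :: "'n op"
  using that by (metis S.slc m_ass)
 thus ?thesis unfolding T_def diff_dists add_dists sum_dists
  by (simp add: par_comm R_nz)
qed

subsection \<open>Right multiplications\<close>

text \<open>The commutant of the left action, tested on generators.\<close>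

definition rok :: "'n op => bool" where
 "rok r \<longleftrightarrow> (\<forall>u. r * Xo u = Xo u * r) & (\<forall>u. r * T u = T u * r) & (ALL g:W. r * gr g = gr g * r) & (ALL p:{1..CARD('n)}. r * el p = el p * r)"

lemma rok_T:
 assumes "!!u. r * Yo u = Yo u * r" "!!u. r * Dxo u = Dxo u * r" "!!al. al : R ==> r * Tc al = Tc al * r"
 shows "r * T u = T u * r"
proof -
 have "r * (sc k * a) = sc k * a * r" if "r * a = a * r" for k and a :: "'n op"
  using that by (metis S.slc m_ass)
 thus ?thesis unfolding T_def diff_dists add_dists sum_dists
  by (simp add: assms)
qed

lemma rok_re: "p : {1..CARD('n)} ==> rok (re p)"
 unfolding rok_def by (intro conjI allI ballI rok_T) (simp_all add: re_comm re_el R_nz)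

lemma rok_rg: "rok (rg g)"
 unfolding rok_def by (intro conjI allI ballI rok_T) (simp_all add: rg_comm R_nz)

lemma rok_rY: "rok (rY u)"
 unfolding rok_def by (intro conjI allI ballI rok_T) (simp_all add: rY_comm R_nz W_orth)

lemma rx_Xo: "rx u * Xo v = Xo v * rx u"
proof -
 have "(sc k * a) * Xo v = Xo v * (sc k * a)" if "a * Xo v = Xo v * a" for k and a :: "'n op"
  using that by (metis S.slc m_ass)
 thus ?thesis unfolding rx_def diff_dists add_dists sum_dists
  by (simp add: rXD_comm R_nz)
qed

lemma rx_el: "rx u * el p = el p * rx u"
proof -
 have "(sc k * a) * el p = el p * (sc k * a)" if "a * el p = el p * a" for k and a :: "'n op"
  using that by (metis S.slc m_ass)
 thus ?thesis unfolding rx_def diff_dists add_dists sum_dists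
  by (simp add: rXD_comm R_nz)
qed

lemma rx_gr: assumes "g : W" shows "rx u * gr g = gr g * rx u"
proof -
 note g = W_orth[OF assms]
 have "(SUM al:R. sc (c al / 2) * rc u al) * gr g = (SUM al:R. sc (c (g *v al) / 2) * rc u (g *v al)) * gr g"
  using sum_R_W[OF assms, of "%al. sc (c al / 2) * rc u al"] by simp
 also have "... = gr g * (SUM al:R. sc (c al / 2) * rc u al)"
  by (simp add: sum_distrib_right sum_distrib_left m_ass S.slc gr_rc[OF g] R_nz c_W[OF assms])
 finally have "(SUM al:R. sc (c al / 2) * rc u al) * gr g = gr g * (SUM al:R. sc (c al / 2) * rc u al)" .
 thus ?thesis unfolding rx_def diff_dists add_dists
  by (simp add: rXD_comm(4,5)[OF g] S.slc[of "gr g"] m_ass)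
qed

lemma Bo_comm: "(!!g. g : W ==> r * gr g = gr g * r) ==> r * Bo u a = Bo u a * r"
proof -
 assume *: "!!g. g : W ==> r * gr g = gr g * r"
 have "r * (sc k * gr g) = sc k * gr g * r" if "g : W" for k g
  using *[OF that] by (metis S.slc m_ass)
 thus ?thesis unfolding Bo_def diff_dists sum_dists
  by (simp add: W_refl S.sc_comm[of r])
qed

lemma rx_single:
 "app (rx u) (single k p) = app (Xo (cmat (fst k) *v u)) (single k p)
  + smul t (single k (Dd (0, cmat (fst k) *v u) p))
  - (SUM al:R. smul (c al / 2 * pairing (cvec (coroot al)) (cmat (fst k) *v u)) (single (root_refl al ** fst k, snd k) (dqy al p)))"
 unfolding rx_def by (simp add: R_nz)

text \<open>On an x-free vector, one order creates an x that T v must pass, which contributes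
  \<open>Bo v a\<close>; in the other order the right x passes one more y, which contributes through
  \<open>rD\<close> and \<open>rc\<close>. The two contributions coincide.\<close>

lemma rx_T: "rx u * T v = T v * rx u"
proof -
 define C where "C = rx u * T v - T v * rx u"
 have "C = 0"
 proof (rule op_zeroI)
  fix a
  have "rx u * T v * Xo a = Xo a * rx u * T v + rx u * Bo v a"
   unfolding m_ass T_Xo distrib_left by (simp add: m_ass[symmetric] rx_Xo)
  moreover have "T v * rx u * Xo a = Xo a * T v * rx u + Bo v a * rx u"
   unfolding m_ass rx_Xo by (simp add: m_ass[symmetric] T_Xo distrib_right)
  ultimately show "C * Xo a = Xo a * C"
   unfolding C_def diff_dists by (simp add: m_ass Bo_comm[OF rx_gr])
 next
  fix k :: "'n idx" and p :: "'n pfun" assume p: "yonly p"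
  define a where "a = cmat (fst k) *v u"
  have XT: "app (T v) (app (Xo a) F) = app (Xo a) (app (T v) F) + app (Bo v a) F" for F
   using arg_cong[OF T_Xo, of "%b. app b F"] by simp
  have ps: "psub g g p = psub (mat 1) g p" for g by (rule yonly_rules(1)[OF p])
  have *: "app (Bo v a) (single k p) = smul (t * pairing v a) (single k p)
   - (SUM al:R. smul (c al / 2 * pairing v (cvec al) * pairing (cvec (coroot al)) a) (single (root_refl al ** fst k, snd k) (psub (mat 1) (cmat (root_refl al)) p)))"
   unfolding Bo_def by (simp add: ps)
  let ?s = "single" and ?k = "%al. (root_refl al ** fst k, snd k)"
  define b where "b al = c al / 2 * pairing (cvec (coroot al)) a" for al
  have rx: "app (rx u) (?s k q) = app (Xo a) (?s k q) + smul t (?s k (Dd (0, a) q))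
   - (SUM al:R. smul (b al) (?s (?k al) (dqy al q)))" for q
   unfolding rx_single a_def b_def ..
  have Ts: "app (T v) (?s k (Dd (0, a) p)) = ?s k (fy v * Dd (0, a) p)"
   "!!al. al : R ==> app (T v) (?s (?k al) (dqy al p)) = ?s (?k al) (fy v * dqy al p)"
   using T_single[OF yonly_rules(5)[OF p]] T_single[OF yonly_rules(7)[OF p]] R_nz by auto
  have 1: "app (T v) (app (rx u) (?s k p)) = app (Xo a) (?s k (fy v * p)) + app (Bo v a) (?s k p)
    + smul t (?s k (fy v * Dd (0, a) p)) - (SUM al:R. smul (b al) (?s (?k al) (fy v * dqy al p)))"
   unfolding rx app_add app_diff XT T_single[OF p] app_smul app_sum Ts(1) by (simp add: Ts(2) del: smul_simps(5))
  have 2: "app (rx u) (app (T v) (?s k p)) = app (Xo a) (?s k (fy v * p))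
    + smul t (?s k (pconst (pairing a v) * p) + ?s k (fy v * Dd (0, a) p))
    - (SUM al:R. smul (b al) (?s (?k al) (pconst (pairing (cvec al) v) * psub (mat 1) (cmat (root_refl al)) p)
      + ?s (?k al) (fy v * dqy al p)))"
   unfolding T_single[OF p] rx
   by (simp add: Dd_mult dqy_fy R_nz add_dists single_add sum.distrib del: app_ops)
  show "app C (single k p) = 0"
   unfolding C_def app_simps 1 2 *
   by (simp add: sum.distrib b_def pairing_commute[of _ v] mult_ac[where 'a = complex])
 qed
 thus ?thesis by (simp add: C_def)
qed

lemma rok_rx: "rok (rx u)"
 unfolding rok_def using rx_Xo rx_T rx_gr rx_el by auto

lemma rok_sc: "rok (sc k)"
 unfolding rok_def by (intro conjI allI ballI S.sc_comm[symmetric])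

lemma rok_mult: "rok r ==> rok s ==> rok (r * s)"
proof -
 have "r * s * x = x * (r * s)" if "r * x = x * r" "s * x = x * s" for x
  using that by (metis m_ass)
 thus "rok r ==> rok s ==> rok (r * s)" unfolding rok_def by blast
qed

lemma rok_add: "rok r ==> rok s ==> rok (r + s)"
 unfolding rok_def by (simp add: add_dists)

lemma rok_diff: "rok r ==> rok s ==> rok (r - s)"
 unfolding rok_def by (simp add: diff_dists)

lemma rok_0: "rok 0"
 unfolding rok_def by simp

lemma dq_one [simp]: "al ~= 0 ==> dqx al 1 = 0" "al ~= 0 ==> dqy al 1 = 0"
 by (auto intro!: dqx_I dqy_I)

lemma yonly_1 [simp]: "yonly 1"
 by (simp add: yonly_def)

text \<open>The vacuum stands for the unit of the algebra, on which left and right multiplication by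
  a generator agree.\<close>

lemma vac_swap: "app (Xo u) vac = app (rx u) vac" "app (T u) vac = app (rY u) vac" "app (gr g) vac = app (rg g) vac"
 "app (el p) vac = app (re p) vac" "app par vac = vac"
 unfolding vac_def rx_single by (simp_all add: T_single R_nz sg_def del: smul_simps)
  (simp_all add: R_nz pconst_simps)

end

declare One_nat_def [simp del]

section \<open>The operators of osp(1|2), angular momenta, the Scasimir and the Dirac
  element\<close>

section \<open>The Lie superalgebra and its centraliser\<close>

text \<open>The grading automorphism. It expresses supercommutation uniformly, also for
  inhomogeneous elements.\<close>

definition hat :: "'n::finite op => 'n op" where "hat a = par * a * par"

lemma hat_simps [simp]: "hat (a + b) = hat a + hat b" "hat (a - b) = hat a - hat b" "hat (- a) = - hat a"
 "hat (hat a) = a" "hat 0 = 0" "hat 1 = 1"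
 unfolding hat_def by (simp_all add: add_dists diff_dists m_ass)
  (simp_all add: m_ass[symmetric])

lemma hat_scalar [simp]: "hat (sc k) = sc k"
 by (simp add: hat_def S.sc_comm[of par] m_ass)

lemma hat_mult: "hat (a * b) = hat a * hat b"
proof -
 have "par * a * (par * par) * b * par = hat (a * b)" by (simp add: hat_def m_ass)
 thus ?thesis unfolding hat_def by (simp only: m_ass)
qed

lemma hat_sc [simp]: "hat (sc k * a) = sc k * hat a"
 by (simp add: hat_mult)

lemma hat_sum: "hat (sum f J) = (SUM j:J. hat (f j))"
 by (induction J rule: infinite_finite_induct) auto

lemma hat_eqI: "par * a = b * par ==> hat a = b"
 by (simp add: hat_def m_ass)

lemma sc_sc [simp]: "sc a * (sc b * z) = sc (a * b) * z" "sc a * sc b = sc (a * b)"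
 by (simp_all add: S.sc_mult m_ass)

lemma half_double: "sc (1/2) * (a + a) = a"
 by (simp only: distrib_left distrib_right[symmetric] S.sc_add[symmetric]) simp

lemma sc_of_nat: "sc (of_nat m) = of_nat m"
 by (induction m) (simp_all add: S.sc_add)

context dunkl
begin

definition cl :: "complex^'n => 'n op" where
 "cl v = (SUM p:{1..CARD('n)}. sc (pairing v (cvec (y p))) * el p)"

lemma onb_delta: "p : {1..CARD('n)} ==> q : {1..CARD('n)} ==> pairing (cvec (y p)) (cvec (y q)) = (if p = q then 1 else 0)"
 using onb by (auto simp: orthonormal_basis_def pairing_cvec)

text \<open>For a square matrix, orthonormality of the rows gives orthonormality of the
  columns.\<close>

lemma onb_complete: "(SUM p:{1..CARD('n)}. cvec (y p) $ i * cvec (y p) $ j) = (if i = j then 1 else 0)"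
proof -
 obtain f where f: "bij_betw f (UNIV :: 'n set) {1..CARD('n)}"
  using finite_same_card_bij[of "UNIV :: 'n set" "{1..CARD('n)}"] by auto
 define Q :: "real^'n^'n" where "Q = (\<chi> k i. y (f k) $ i)"
 have fk: "f k : {1..CARD('n)}" for k using f by (auto simp: bij_betw_def)
 have "(Q ** transpose Q) $ k $ l = mat 1 $ k $ l" for k l
 proof -
  have "(Q ** transpose Q) $ k $ l = y (f k) \<bullet> y (f l)"
   by (simp add: matrix_matrix_mult_def Q_def transpose_def inner_vec_def)
  also have "... = (if f k = f l then 1 else 0)" using onb fk unfolding orthonormal_basis_def by blast
  finally show ?thesis using f by (auto simp: mat_def bij_betw_def inj_eq)
 qed
 hence "Q ** transpose Q = mat 1" by (simp add: vec_eq_iff)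
 hence "transpose Q ** Q = mat 1" by (simp add: matrix_left_right_inverse)
 hence "(SUM k:UNIV. y (f k) $ i * y (f k) $ j) = (if i = j then 1 else 0)" for i j
  by (simp add: matrix_matrix_mult_def Q_def transpose_def mat_def vec_eq_iff)
 moreover have "(SUM k:UNIV. y (f k) $ i * y (f k) $ j) = (SUM p:{1..CARD('n)}. y p $ i * y p $ j)"
  by (rule sum.reindex_bij_betw[OF f])
 ultimately have r: "(SUM p:{1..CARD('n)}. y p $ i * y p $ j) = (if i = j then 1 else 0)" by simp
 have "(SUM p:{1..CARD('n)}. cvec (y p) $ i * cvec (y p) $ j) = complex_of_real (SUM p:{1..CARD('n)}. y p $ i * y p $ j)"
  by (simp add: cvec_def)
 thus ?thesis unfolding r by simp
qed

lemma onb_expand: "(SUM p:{1..CARD('n)}. pairing u (cvec (y p)) *s cvec (y p)) = u"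
proof -
 have "(SUM p:{1..CARD('n)}. pairing u (cvec (y p)) * cvec (y p) $ i) = u $ i" for i
 proof -
  have "(SUM p:{1..CARD('n)}. pairing u (cvec (y p)) * cvec (y p) $ i)
   = (SUM p:{1..CARD('n)}. SUM j:UNIV. u $ j * (cvec (y p) $ j * cvec (y p) $ i))"
   by (simp add: pairing_def sum_distrib_right m_ass)
  also have "... = (SUM j:UNIV. u $ j * (SUM p:{1..CARD('n)}. cvec (y p) $ j * cvec (y p) $ i))"
   by (subst sum.swap) (simp add: sum_distrib_left)
  also have "... = u $ i" unfolding onb_complete by (simp add: if_distrib[of "%z. _ * z"] cong: if_cong)
  finally show ?thesis .
 qed
 thus ?thesis by (simp add: vec_eq_iff)
qed

lemma onb_pairing: "(SUM p:{1..CARD('n)}. pairing u (cvec (y p)) * pairing v (cvec (y p))) = pairing u v"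
proof -
 have "pairing (sum f J) v = (SUM p:J. pairing (f p) v)" for f and J :: "nat set" and v :: "complex^'n"
  by (induction J rule: infinite_finite_induct) (auto simp: pairing_add)
 thus ?thesis using arg_cong[OF onb_expand[of u], of "%u. pairing u v"]
  by (simp add: pairing_scale pairing_commute[of v])
qed

text \<open>Bilinear expressions are invariant under orthogonal changes of the basis.\<close>

lemma onb_linear:
 assumes "!!u v. f (u + v) = f u + f v" "!!k u. f (k *s u) = sc k * f u"
 shows "f u = (SUM p:{1..CARD('n)}. sc (pairing u (cvec (y p))) * (f (cvec (y p)) :: 'n op))"
proof -
 have "f 0 = 0" using assms(2)[of 0 0] by simp
 hence "f (sum g J) = (SUM p:J. f (g p))" for g and J :: "nat set"
  by (induction J rule: infinite_finite_induct) (auto simp: assms)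
 thus ?thesis using arg_cong[OF onb_expand[of u], of f] by (simp add: assms)
qed

lemma onb_invariant:
 assumes f: "!!u v. f (u + v) = f u + f v" "!!k u. f (k *s u) = sc k * (f u :: 'n op)"
  and h: "!!u v. h (u + v) = h u + h v" "!!k u. h (k *s u) = sc k * (h u :: 'n op)"
  and g: "orthogonal_matrix g"
 shows "(SUM p:{1..CARD('n)}. f (cmat g *v cvec (y p)) * h (cmat g *v cvec (y p))) = (SUM p:{1..CARD('n)}. f (cvec (y p)) * h (cvec (y p)))"
proof -
 let ?I = "{1..CARD('n)}" and ?y = "%p. cvec (y p)"
 have t: "pairing (cmat g *v u) v = pairing (transpose (cmat g) *v v) u" for u v
  by (rule trans[OF pairing_matrix pairing_commute])
 have "(SUM p:?I. f (cmat g *v ?y p) * h (cmat g *v ?y p))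
  = (SUM p:?I. SUM q:?I. SUM r:?I. sc (pairing (cmat g *v ?y p) (?y q) * pairing (cmat g *v ?y p) (?y r)) * (f (?y q) * h (?y r)))"
  unfolding onb_linear[of f, OF f, of "cmat g *v _"] onb_linear[of h, OF h, of "cmat g *v _"]
  by (simp add: sum_product S.sc_mult_mult)
 also have "... = (SUM q:?I. SUM r:?I. SUM p:?I. sc (pairing (cmat g *v ?y p) (?y q) * pairing (cmat g *v ?y p) (?y r)) * (f (?y q) * h (?y r)))"
  by (subst sum.swap, rule sum.cong[OF refl], rule sum.swap)
 also have "... = (SUM q:?I. SUM r:?I. sc (pairing (?y q) (?y r)) * (f (?y q) * h (?y r)))"
  using g unfolding t sum_distrib_right[symmetric] S.sc_sum[symmetric] onb_pairing
  by (simp add: pairing_matrix transpose_transpose orthogonal_matrix_transpose_iff)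
 also have "... = (SUM q:?I. SUM r:?I. if q = r then f (?y q) * h (?y r) else 0)"
  by (intro sum.cong refl) (simp add: onb_delta)
 also have "... = (SUM p:?I. f (?y p) * h (?y p))" by simp
 finally show ?thesis .
qed

lemma cl_lin: "cl (u + v) = cl u + cl v" "cl (k *s u) = sc k * cl u" "cl 0 = 0" "cl (- u) = - cl u" "cl (u - v) = cl u - cl v"
 by (simp_all add: cl_def pairing_add pairing_scale pairing_minus pairing_diff S.sc_add S.sc_minus S.sc_diff distrib_right
   sum.distrib sum_distrib_left sum_negf left_diff_distrib sum_subtractf)

lemma cl_y: "p : {1..CARD('n)} ==> cl (cvec (y p)) = el p"
proof -
 assume p: "p : {1..CARD('n)}"
 have "cl (cvec (y p)) = (SUM q:{1..CARD('n)}. if q = p then el p else 0)"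
  unfolding cl_def by (intro sum.cong refl) (use p in \<open>simp add: onb_delta\<close>)
 thus ?thesis using p by simp
qed

lemma cl_cl: "cl u * cl v + cl v * cl u = sc (2 * pairing u v)"
proof -
 let ?I = "{1..CARD('n)}" and ?y = "%p. cvec (y p)"
 have "cl u * cl v = (SUM p:?I. SUM q:?I. sc (pairing u (?y p) * pairing v (?y q)) * (el p * el q))"
  by (simp add: cl_def sum_product S.sc_mult_mult)
 moreover have "cl v * cl u = (SUM p:?I. SUM q:?I. sc (pairing u (?y p) * pairing v (?y q)) * (el q * el p))"
  by (subst sum.swap) (simp add: cl_def sum_product S.sc_mult_mult mult.commute[where 'a = complex])
 ultimately have "cl u * cl v + cl v * cl u
  = (SUM p:?I. SUM q:?I. sc (pairing u (?y p) * pairing v (?y q)) * (el p * el q + el q * el p))"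
  by (simp add: sum.distrib distrib_left)
 also have "... = (SUM p:?I. SUM q:?I. if p = q then sc (2 * (pairing u (?y p) * pairing v (?y q))) else 0)"
 proof (intro sum.cong refl)
  fix p q
  show "sc (pairing u (?y p) * pairing v (?y q)) * (el p * el q + el q * el p :: 'n op)
   = (if p = q then sc (2 * (pairing u (?y p) * pairing v (?y q))) else 0)"
  proof (cases "p = q")
   case True
   have "sc k * (1 + 1) = (sc (2 * k) :: 'n op)" for k by (simp only: distrib_left mult_1_right S.sc_add[symmetric] mult_2)
   thus ?thesis using True by (simp add: el_el del: one_add_one)
  qed (use el_el(2)[of p q, where 'n = 'n] in simp)
 qed
 also have "... = sc (2 * pairing u v)"
  by (simp add: S.sc_sum[symmetric] sum_distrib_left[symmetric] onb_pairing)
 finally show ?thesis .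
qed

lemma cl_sq: "cl v * cl v = sc (pairing v v)"
proof -
 have "cl v * cl v = sc (1/2) * (cl v * cl v + cl v * cl v)" by (rule half_double[symmetric])
 thus ?thesis unfolding cl_cl by simp
qed

lemma comm_sc_sum:
 assumes "!!p. p : J ==> f p * a = a * (f p :: 'n op)"
 shows "(SUM p:J. sc (k p) * f p) * a = a * (SUM p:J. sc (k p) * f p)"
 unfolding sum_dists
 by (intro sum.cong refl) (simp add: assms S.slc m_ass)

lemma cl_comm: "cl v * Xo u = Xo u * cl v" "cl v * T u = T u * cl v" "cl v * gr g = gr g * cl v" "cl v * Ho j = Ho j * cl v"
 unfolding cl_def by (rule comm_sc_sum; simp add: el_comm el_T Ho_shift)+

lemma par_cl: "par * cl v = - (cl v * par)"
 unfolding cl_def sum_dists sum_negf[symmetric]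
 by (intro sum.cong refl) (simp add: S.slc par_el m_ass)

lemma hat_basic [simp]: "hat (Xo u) = Xo u" "hat (T u) = T u" "hat (gr g) = gr g" "hat (cl v) = - cl v"
 by (rule hat_eqI; simp add: par_comm par_T par_cl)+

subsection \<open>The odd generators\<close>

text \<open>F+ and F- freed from the factor 1/sqrt(2 t). \<open>EE u\<close> is the commutator of
  \<open>YY\<close> with x_u, and minus that of \<open>XX\<close> with y_u; for c = 0 it is t times
  a Clifford vector.\<close>

definition XX :: "'n op" where "XX = (SUM p:{1..CARD('n)}. Xo (cvec (y p)) * cl (cvec (y p)))"
definition YY :: "'n op" where "YY = (SUM p:{1..CARD('n)}. T (cvec (y p)) * cl (cvec (y p)))"
definition EE :: "complex^'n => 'n op" where
 "EE u = sc t * cl u - (SUM al:R. sc (c al / 2 * pairing (cvec (coroot al)) u) * (gr (root_refl al) * cl (cvec al)))"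

lemma hat_XX [simp]: "hat XX = - XX" "hat YY = - YY"
 by (simp_all add: XX_def YY_def hat_sum hat_mult sum_negf)

lemma cl_XX: "cl v * XX = Xo v + Xo v - XX * cl v" "cl v * YY = T v + T v - YY * cl v"
proof -
 have *: "cl v * (SUM p:{1..CARD('n)}. f (cvec (y p)) * cl (cvec (y p))) = f v + f v - (SUM p:{1..CARD('n)}. f (cvec (y p)) * cl (cvec (y p))) * cl v"
  if f: "!!u v. f (u + v) = f u + f v" "!!k u. f (k *s u) = sc k * f u" and cf: "!!u. cl v * f u = f u * cl v" for f
 proof -
  have "cl v * (f u * cl u) = sc (2 * pairing v u) * f u - f u * cl u * cl v" for u
  proof -
   have "cl v * (f u * cl u) = f u * (cl v * cl u + cl u * cl v) - f u * cl u * cl v"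
    by (simp only: distrib_left m_ass[symmetric] cf) simp
   thus ?thesis unfolding cl_cl by (simp add: S.sc_comm[of "f u"])
  qed
  hence "cl v * (SUM p:{1..CARD('n)}. f (cvec (y p)) * cl (cvec (y p)))
   = (SUM p:{1..CARD('n)}. sc (2 * pairing v (cvec (y p))) * f (cvec (y p))) - (SUM p:{1..CARD('n)}. f (cvec (y p)) * cl (cvec (y p))) * cl v"
   by (simp add: sum_dists sum_subtractf)
  also have "(SUM p:{1..CARD('n)}. sc (2 * pairing v (cvec (y p))) * f (cvec (y p))) = f v + f v"
   unfolding onb_linear[of f v, OF f] sum.distrib[symmetric] distrib_right[symmetric] S.sc_add[symmetric]
   by (simp only: mult_2)
  finally show ?thesis .
 qed
 show "cl v * XX = Xo v + Xo v - XX * cl v" unfolding XX_def by (rule *) (auto simp: Xo_lin cl_comm)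
 show "cl v * YY = T v + T v - YY * cl v" unfolding YY_def by (rule *) (auto simp: T_lin cl_comm)
qed

text \<open>Supercommutation with F+ and F-, which generate osp(1|2); \<open>hat\<close> on the
  right supplies the sign for the odd part of \<open>a\<close>.\<close>

definition osp_ok :: "'n op => bool" where
 "osp_ok a \<longleftrightarrow> a * XX = XX * hat a & a * YY = YY * hat a"

lemma osp_ok_hat: "osp_ok a ==> hat a * XX = XX * a" "osp_ok a ==> hat a * YY = YY * a"
proof -
 assume a: "osp_ok a"
 have "hat (a * XX) = hat (XX * hat a)" "hat (a * YY) = hat (YY * hat a)" using a by (simp_all add: osp_ok_def)
 thus "hat a * XX = XX * a" "hat a * YY = YY * a" by (simp_all add: hat_mult)
qed

lemma osp_ok_mult: "osp_ok a ==> osp_ok b ==> osp_ok (a * b)"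
 unfolding osp_ok_def hat_mult by (metis m_ass)

lemma osp_ok_add: "osp_ok a ==> osp_ok b ==> osp_ok (a + b)"
 unfolding osp_ok_def by (simp add: add_dists)

lemma osp_ok_sc: "osp_ok (sc k)"
 unfolding osp_ok_def by (simp add: S.sc_comm)

lemma osp_ok_diff: "osp_ok a ==> osp_ok b ==> osp_ok (a - b)"
 unfolding osp_ok_def by (simp add: diff_dists)

lemma osp_ok_0_1: "osp_ok 0" "osp_ok 1"
 using osp_ok_sc[of 0] osp_ok_sc[of 1] by simp_all

text \<open>What is required of the Clifford factor of a double cover element over g with parity i:
  twisted conjugation implements g on vectors, and the Cherednik part is untouched.\<close>

definition pok :: "real^'n^'n => nat => 'n op => bool" where
 "pok g i b \<longleftrightarrow> (\<forall>v. b * cl v = sc ((-1) ^ i) * (cl (cmat g *v v) * b)) & hat b = sc ((-1) ^ i) * b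
  & (\<forall>u. b * Xo u = Xo u * b) & (\<forall>u. b * T u = T u * b) & (\<forall>h. b * gr h = gr h * b)"

text \<open>Moving g past x_p, and b past e_p, rotates both factors by g, and the sum over an
  orthonormal basis is invariant under this rotation.\<close>

lemma pok_osp_ok:
 assumes "g : W" "pok g i b" shows "osp_ok (gr g * b)" "hat (gr g * b) = sc ((-1) ^ i) * (gr g * b)"
proof -
 note b = assms(2)[unfolded pok_def]
 show h: "hat (gr g * b) = sc ((-1) ^ i) * (gr g * b)" using b by (simp add: hat_mult S.slc)
 have *: "gr g * b * (SUM p:{1..CARD('n)}. f (cvec (y p)) * cl (cvec (y p))) = (SUM p:{1..CARD('n)}. f (cvec (y p)) * cl (cvec (y p))) * hat (gr g * b)"
  if f: "!!u v. f (u + v) = f u + f v" "!!k u. f (k *s u) = sc k * f u" and cf: "!!u. b * f u = f u * b" "!!u. gr g * f u = f (cmat g *v u) * gr g" for f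
 proof -
  have "gr g * b * (f u * cl u) = sc ((-1) ^ i) * (f (cmat g *v u) * cl (cmat g *v u) * (gr g * b))" for u
  proof -
   have "gr g * b * (f u * cl u) = gr g * f u * (b * cl u)" by (simp add: m_ass cf(1)[symmetric]) (simp add: m_ass[symmetric] cf(1))
   also have "... = f (cmat g *v u) * gr g * (sc ((-1) ^ i) * (cl (cmat g *v u) * b))" using b cf(2) by simp
   also have "... = sc ((-1) ^ i) * (f (cmat g *v u) * (gr g * cl (cmat g *v u)) * b)" by (simp add: S.slc m_ass)
   also have "... = sc ((-1) ^ i) * (f (cmat g *v u) * cl (cmat g *v u) * (gr g * b))" by (simp add: cl_comm(3)[symmetric] m_ass)
   finally show ?thesis .
  qed
  hence "gr g * b * (SUM p:{1..CARD('n)}. f (cvec (y p)) * cl (cvec (y p)))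
   = sc ((-1) ^ i) * ((SUM p:{1..CARD('n)}. f (cmat g *v cvec (y p)) * cl (cmat g *v cvec (y p))) * (gr g * b))"
   by (simp add: sum_dists)
  thus ?thesis unfolding h onb_invariant[of f cl, OF f cl_lin(1,2) W_orth[OF assms(1)]] by (simp add: S.slc)
 qed
 have "gr g * b * XX = XX * hat (gr g * b)" unfolding XX_def
  by (rule *) (use b in \<open>auto simp: Xo_lin gr_Xo[OF W_orth[OF assms(1)]]\<close>)
 moreover have "gr g * b * YY = YY * hat (gr g * b)" unfolding YY_def
  by (rule *) (use b in \<open>auto simp: T_lin gr_T[OF assms(1)]\<close>)
 ultimately show "osp_ok (gr g * b)" by (simp add: osp_ok_def)
qed

text \<open>A root vector anticommutes with its orthogonal complement and commutes with itself, so
  conjugation by it is minus the reflection.\<close>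

lemma pok_refl: assumes "al : R" shows "pok (root_refl al) 1 (cl (cvec al))"
proof -
 have nz: "al ~= 0" using R_nz[OF assms] .
 have "cl (cvec al) * cl v = - (cl (cmat (root_refl al) *v v) * cl (cvec al))" for v
 proof -
  have "cl (cvec (coroot al)) * cl (cvec al) = sc 2"
   using nz by (simp add: coroot_def cvec_simps cl_lin m_ass cl_sq pairing_cvec)
  hence "cl (cmat (root_refl al) *v v) * cl (cvec al) = cl v * cl (cvec al) - sc (2 * pairing (cvec al) v)"
   unfolding cmat_refl_vec(1) by (simp add: cl_lin left_diff_distrib m_ass pairing_commute mult.commute[where 'a = complex])
  moreover have "cl (cvec al) * cl v = sc (2 * pairing (cvec al) v) - cl v * cl (cvec al)"
   using cl_cl[of "cvec al" v] by (simp add: eq_diff_eq)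
  ultimately show ?thesis by simp
 qed
 thus ?thesis by (simp add: pok_def cl_comm S.sc_minus del: cmat_simps)
qed

lemma refl_osp: "al : R ==> gr (root_refl al) * cl (cvec al) * XX = - (XX * (gr (root_refl al) * cl (cvec al)))"
 "al : R ==> gr (root_refl al) * cl (cvec al) * YY = - (YY * (gr (root_refl al) * cl (cvec al)))"
 using pok_osp_ok[OF W_refl pok_refl, of al] by (auto simp: osp_ok_def S.sc_minus)

text \<open>The reflection terms of \<open>EE\<close> are multiples of s_\<alpha> times the Clifford
  vector of \<alpha>, which anticommutes with F+ and F-. Only the term with \<open>cl u\<close>
  leaves a remainder.\<close>

lemma EE_XX: "EE u * XX = sc t * (Xo u + Xo u) - XX * EE u" "EE u * YY = sc t * (T u + T u) - YY * EE u"
 unfolding EE_def diff_dists m_ass[of "sc t"] cl_XX sum_dists S.slc[of XX t] S.slc[of YY t]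
 by (simp_all add: m_ass S.slc[of XX] S.slc[of YY] sum_negf right_diff_distrib
   refl_osp[unfolded m_ass] cong: sum.cong)

lemma sum_Bo_cl: "(SUM p:{1..CARD('n)}. Bo (cvec (y p)) u * cl (cvec (y p))) = EE u" "(SUM p:{1..CARD('n)}. Bo u (cvec (y p)) * cl (cvec (y p))) = EE u"
proof -
 let ?I = "{1..CARD('n)}" and ?y = "%p. cvec (y p)"
 have cs: "(SUM p:?I. sc (k * pairing v (?y p)) * (a * cl (?y p))) = sc k * (a * cl v)" for k v and a :: "'n op"
  unfolding onb_linear[of cl v, OF cl_lin(1,2)] sum_distrib_left by (simp add: S.slc[of a])
 have cs': "(SUM p:?I. sc (k * pairing v (?y p)) * cl (?y p)) = sc k * cl v" for k v
  using cs[of k v 1] by simp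
 have "(SUM p:?I. Bo (?y p) u * cl (?y p)) = (SUM p:?I. sc (t * pairing u (?y p)) * cl (?y p))
  - (SUM al:R. SUM p:?I. sc (c al / 2 * pairing (cvec (coroot al)) u * pairing (cvec al) (?y p)) * (gr (root_refl al) * cl (?y p)))"
  unfolding Bo_def left_diff_distrib sum_subtractf sum_distrib_right
  by (subst (2) sum.swap) (simp add: pairing_commute[of "?y _"] mult_ac[where 'a = complex] m_ass)
 thus "(SUM p:?I. Bo (?y p) u * cl (?y p)) = EE u" unfolding cs cs' EE_def .
 have "(SUM p:?I. Bo u (?y p) * cl (?y p)) = (SUM p:?I. sc (t * pairing u (?y p)) * cl (?y p))
  - (SUM al:R. SUM p:?I. sc (c al / 2 * pairing u (cvec al) * pairing (cvec (coroot al)) (?y p)) * (gr (root_refl al) * cl (?y p)))"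
  unfolding Bo_def left_diff_distrib sum_subtractf sum_distrib_right
  by (subst (2) sum.swap) (simp add: mult_ac[where 'a = complex] m_ass)
 hence "(SUM p:?I. Bo u (?y p) * cl (?y p)) = sc t * cl u - (SUM al:R. sc (c al / 2 * pairing u (cvec al)) * (gr (root_refl al) * cl (cvec (coroot al))))"
  unfolding cs cs' .
 moreover have "sc (c al / 2 * pairing u (cvec al)) * (gr (root_refl al) * cl (cvec (coroot al))) = sc (c al / 2 * pairing (cvec (coroot al)) u) * (gr (root_refl al) * cl (cvec al))" for al
  by (simp add: coroot_def cvec_simps cl_lin S.slc[of "gr _"] pairing_scale pairing_commute mult_ac[where 'a = complex])
 ultimately show "(SUM p:?I. Bo u (?y p) * cl (?y p)) = EE u" unfolding EE_def by simp
qed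

lemma YY_Xo: "YY * Xo u = Xo u * YY + EE u"
proof -
 have "YY * Xo u = (SUM p:{1..CARD('n)}. Xo u * (T (cvec (y p)) * cl (cvec (y p))) + Bo (cvec (y p)) u * cl (cvec (y p)))"
  unfolding YY_def sum_distrib_right by (intro sum.cong refl) (simp add: m_ass cl_comm, simp add: m_ass[symmetric] T_Xo distrib_right)
 thus ?thesis by (simp add: sum.distrib sum_Bo_cl YY_def sum_distrib_left)
qed

lemma XX_T: "XX * T u = T u * XX - EE u"
proof -
 have "T u * XX = (SUM p:{1..CARD('n)}. Xo (cvec (y p)) * cl (cvec (y p)) * T u + Bo u (cvec (y p)) * cl (cvec (y p)))"
  unfolding XX_def sum_distrib_left by (intro sum.cong refl) (simp add: m_ass cl_comm, simp add: m_ass[symmetric] T_Xo distrib_right)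
 thus ?thesis by (simp add: sum.distrib sum_Bo_cl XX_def sum_distrib_right)
qed

lemma XX_Xo: "XX * Xo u = Xo u * XX" "YY * T u = T u * YY"
 unfolding XX_def YY_def sum_dists
 by (simp_all add: m_ass cl_comm) (simp_all add: m_ass[symmetric] Xo_Xo[of _ u] T_T[of _ u])

text \<open>Total angular momentum in the plane of u and v: an orbital part plus a spin part, which
  for c = 0 is t/2 times the product of the two Clifford vectors.\<close>

definition AA :: "complex^'n => complex^'n => 'n op" where
 "AA u v = Xo u * T v - T u * Xo v + sc (1/2) * (cl u * EE v + EE u * cl v - sc t * (cl u * cl v))"

text \<open>The orbital part fails to commute with \<open>XX\<close> by x_u EE_v - EE_u x_v, and the
  spin part fails by the negative of this; for \<open>YY\<close> the same happens with y in place of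
  x.\<close>

lemma osp_ok_AA: "osp_ok (AA u v)" "hat (AA u v) = AA u v"
proof -
 have "hat (EE u) = - EE u" for u
  unfolding EE_def by (simp add: hat_sum hat_mult sum_negf)
 thus h: "hat (AA u v) = AA u v" unfolding AA_def by (simp add: hat_mult)
 define Q where "Q = cl u * EE v + EE u * cl v - sc t * (cl u * cl v)"
 have x: "Z1 * (Z2 * w) = (Z1 * Z2) * w" for Z1 Z2 w :: "'n op" by (simp add: m_ass)
 note cX = cl_XX(1) cl_XX(1)[THEN arg_cong[where f = "%z. a * z" for a]] EE_XX(1)
 have "Q * XX = XX * Q + ((EE u * Xo v - Xo u * EE v) + (EE u * Xo v - Xo u * EE v))"
 proof -
  have 1: "cl u * EE v * XX = sc t * (cl u * (Xo v + Xo v)) - (Xo u + Xo u) * EE v + XX * (cl u * EE v)"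
   by (simp add: m_ass EE_XX right_diff_distrib S.slc[of "cl u"]) (simp add: m_ass[symmetric] cl_XX left_diff_distrib)
  have 2: "EE u * cl v * XX = EE u * (Xo v + Xo v) - sc t * ((Xo u + Xo u) * cl v) + XX * (EE u * cl v)"
   by (simp add: m_ass cl_XX right_diff_distrib) (simp add: m_ass[symmetric] EE_XX left_diff_distrib)
  have 3: "cl u * cl v * XX = cl u * (Xo v + Xo v) - (Xo u + Xo u) * cl v + XX * (cl u * cl v)"
   by (simp add: m_ass cl_XX right_diff_distrib) (simp add: m_ass[symmetric] cl_XX left_diff_distrib)
  show ?thesis unfolding Q_def diff_dists distrib_right[of _ _ XX] distrib_left[of XX] m_ass[of "sc t"] 1 2 3
    S.slc[of XX]
   by (simp add: algebra_simps)
 qed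
 hence "sc (1/2) * Q * XX = XX * (sc (1/2) * Q) + (EE u * Xo v - Xo u * EE v)"
  by (simp add: m_ass distrib_left[of "sc _" "XX * Q"] half_double S.slc[of XX])
 moreover have "(Xo u * T v - T u * Xo v) * XX = XX * (Xo u * T v - T u * Xo v) + (Xo u * EE v - EE u * Xo v)"
 proof -
  have "XX * (Xo u * T v) = Xo u * T v * XX - Xo u * EE v"
   by (simp add: m_ass[symmetric] XX_Xo) (simp add: m_ass XX_T right_diff_distrib)
  moreover have "XX * (T u * Xo v) = T u * Xo v * XX - EE u * Xo v"
   by (simp add: m_ass[symmetric] XX_T left_diff_distrib) (simp add: m_ass XX_Xo)
  ultimately show ?thesis by (simp add: diff_dists)
 qed
 ultimately have X: "AA u v * XX = XX * AA u v" unfolding AA_def Q_def[symmetric] distrib_right distrib_left by simp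
 have "Q * YY = YY * Q + ((EE u * T v - T u * EE v) + (EE u * T v - T u * EE v))"
 proof -
  have 1: "cl u * EE v * YY = sc t * (cl u * (T v + T v)) - (T u + T u) * EE v + YY * (cl u * EE v)"
   by (simp add: m_ass EE_XX right_diff_distrib S.slc[of "cl u"]) (simp add: m_ass[symmetric] cl_XX left_diff_distrib)
  have 2: "EE u * cl v * YY = EE u * (T v + T v) - sc t * ((T u + T u) * cl v) + YY * (EE u * cl v)"
   by (simp add: m_ass cl_XX right_diff_distrib) (simp add: m_ass[symmetric] EE_XX left_diff_distrib)
  have 3: "cl u * cl v * YY = cl u * (T v + T v) - (T u + T u) * cl v + YY * (cl u * cl v)"
   by (simp add: m_ass cl_XX right_diff_distrib) (simp add: m_ass[symmetric] cl_XX left_diff_distrib)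
  show ?thesis unfolding Q_def diff_dists distrib_right[of _ _ YY] distrib_left[of YY] m_ass[of "sc t"] 1 2 3
    S.slc[of YY]
   by (simp add: algebra_simps)
 qed
 hence "sc (1/2) * Q * YY = YY * (sc (1/2) * Q) + (EE u * T v - T u * EE v)"
  by (simp add: m_ass distrib_left[of "sc _" "YY * Q"] half_double S.slc[of YY])
 moreover have "(Xo u * T v - T u * Xo v) * YY = YY * (Xo u * T v - T u * Xo v) + (T u * EE v - EE u * T v)"
 proof -
  have "YY * (Xo u * T v) = Xo u * T v * YY + EE u * T v"
   by (simp add: m_ass[symmetric] YY_Xo distrib_right) (simp add: m_ass XX_Xo)
  moreover have "YY * (T u * Xo v) = T u * Xo v * YY + T u * EE v"
   by (simp add: m_ass[symmetric] XX_Xo) (simp add: m_ass YY_Xo distrib_left)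
  ultimately show ?thesis by (simp add: diff_dists)
 qed
 ultimately have Y: "AA u v * YY = YY * AA u v" unfolding AA_def Q_def[symmetric] distrib_right distrib_left by simp
 show "osp_ok (AA u v)" unfolding osp_ok_def h using X Y by simp
qed

subsection \<open>The Scasimir element and the Dirac element\<close>

text \<open>Writing Z as the sum of f_p e_p, the rule e_p Z = 2 f_p - Z e_p gives Z Z = 2 (sum of
  f_p f_p) - Z Z, as Z commutes with each f_p.\<close>

lemma XX_sq: "XX * XX = (SUM p:{1..CARD('n)}. Xo (cvec (y p)) * Xo (cvec (y p)))"
 "YY * YY = (SUM p:{1..CARD('n)}. T (cvec (y p)) * T (cvec (y p)))"
proof -
 have *: "Z * Z = (SUM p:{1..CARD('n)}. f p * f p)"
  if Z: "Z = (SUM p:{1..CARD('n)}. f p * cl (cvec (y p)))" and c1: "!!p. cl (cvec (y p)) * Z = f p + f p - Z * cl (cvec (y p))"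
   and c2: "!!p. Z * f p = f p * Z" for Z and f :: "nat => 'n op"
 proof -
  have "Z * Z = (SUM p:{1..CARD('n)}. f p * (cl (cvec (y p)) * Z))" by (subst Z) (simp add: sum_distrib_right m_ass)
  also have "... = (SUM p:{1..CARD('n)}. f p * f p + f p * f p) - (SUM p:{1..CARD('n)}. Z * (f p * cl (cvec (y p))))"
   unfolding c1 right_diff_distrib sum_subtractf by (simp add: m_ass[symmetric] c2 distrib_left)
  also have "(SUM p:{1..CARD('n)}. Z * (f p * cl (cvec (y p)))) = Z * Z" by (subst (3) Z) (simp add: sum_distrib_left)
  finally have "Z * Z + Z * Z = (SUM p:{1..CARD('n)}. f p * f p) + (SUM p:{1..CARD('n)}. f p * f p)"
   by (simp only: eq_diff_eq sum.distrib)
  thus ?thesis by (metis half_double)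
 qed
 show "XX * XX = (SUM p:{1..CARD('n)}. Xo (cvec (y p)) * Xo (cvec (y p)))"
  by (rule *) (auto simp: XX_def[symmetric] cl_XX XX_Xo)
 show "YY * YY = (SUM p:{1..CARD('n)}. T (cvec (y p)) * T (cvec (y p)))"
  by (rule *) (auto simp: YY_def[symmetric] cl_XX XX_Xo)
qed

text \<open>The right side is the image of 2 t H. The constant t d comes from the squares of the
  e_p, and the weight c per root from the Clifford product of a root with its coroot, which is
  2.\<close>

lemma XX_YY: "XX * YY + YY * XX = (SUM p:{1..CARD('n)}. Xo (cvec (y p)) * T (cvec (y p)) + Xo (cvec (y p)) * T (cvec (y p)))
  + sc (t * of_nat CARD('n)) - (SUM al:R. sc (c al) * gr (root_refl al))"
proof -
 let ?I = "{1..CARD('n)}" and ?y = "%p. cvec (y p)"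
 have "YY * XX = (SUM p:?I. (YY * Xo (?y p)) * cl (?y p))" by (simp add: XX_def sum_distrib_left m_ass)
 also have "... = (SUM p:?I. Xo (?y p) * (T (?y p) + T (?y p) - cl (?y p) * YY) + EE (?y p) * cl (?y p))"
  unfolding cl_XX YY_Xo distrib_right by (simp add: m_ass)
 also have "... = (SUM p:?I. Xo (?y p) * T (?y p) + Xo (?y p) * T (?y p)) - XX * YY + (SUM p:?I. EE (?y p) * cl (?y p))"
  by (simp add: right_diff_distrib distrib_left sum.distrib sum_subtractf XX_def sum_distrib_right m_ass)
 finally have 1: "XX * YY + YY * XX = (SUM p:?I. Xo (?y p) * T (?y p) + Xo (?y p) * T (?y p)) + (SUM p:?I. EE (?y p) * cl (?y p))"
  by simp
 have cs: "(SUM p:?I. sc (k * pairing v (?y p)) * (a * cl (?y p))) = sc k * (a * cl v)" for k v and a :: "'n op"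
  unfolding onb_linear[of cl v, OF cl_lin(1,2)] sum_distrib_left by (simp add: S.slc[of a])
 have "(SUM p:?I. EE (?y p) * cl (?y p)) = (SUM p:?I. sc t * (cl (?y p) * cl (?y p)))
  - (SUM al:R. SUM p:?I. sc (c al / 2 * pairing (cvec (coroot al)) (?y p)) * (gr (root_refl al) * cl (cvec al) * cl (?y p)))"
  unfolding EE_def left_diff_distrib sum_subtractf sum_distrib_right
  by (subst (2) sum.swap) (simp add: m_ass)
 also have "(SUM p:?I. sc t * (cl (?y p) * cl (?y p))) = sc (t * of_nat CARD('n))"
  by (simp add: cl_sq onb_delta S.sc_mult sc_of_nat S.sc_comm[of "of_nat _"])
 also have "(SUM al:R. SUM p:?I. sc (c al / 2 * pairing (cvec (coroot al)) (?y p)) * (gr (root_refl al) * cl (cvec al) * cl (?y p)))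
   = (SUM al:R. sc (c al) * gr (root_refl al))"
 proof (rule sum.cong[OF refl])
  fix al assume "al : R"
  hence "cl (cvec al) * cl (cvec (coroot al)) = sc 2"
   using R_nz by (simp add: coroot_def cvec_simps cl_lin S.slc[of "cl _"] cl_sq pairing_cvec)
  thus "(SUM p:?I. sc (c al / 2 * pairing (cvec (coroot al)) (?y p)) * (gr (root_refl al) * cl (cvec al) * cl (?y p))) = sc (c al) * gr (root_refl al)"
   unfolding cs by (simp add: m_ass S.sc_comm[of "gr _"])
 qed
 finally show ?thesis unfolding 1 by simp
qed

text \<open>Summation over the basis turns each reflection term into an anticommutator with the
  coordinate along the coroot. This coordinate is negated by s_\<alpha>, so the term vanishes and
  only the part with t remains.\<close>

lemma EE_anti: "(SUM p:{1..CARD('n)}. EE (cvec (y p)) * Xo (cvec (y p)) + Xo (cvec (y p)) * EE (cvec (y p))) = sc t * (XX + XX)"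
  "(SUM p:{1..CARD('n)}. EE (cvec (y p)) * T (cvec (y p)) + T (cvec (y p)) * EE (cvec (y p))) = sc t * (YY + YY)"
proof -
 let ?I = "{1..CARD('n)}" and ?y = "%p. cvec (y p)"
 have *: "(SUM p:?I. EE (?y p) * f (?y p) + f (?y p) * EE (?y p)) = sc t * ((SUM p:?I. f (?y p) * cl (?y p)) + (SUM p:?I. f (?y p) * cl (?y p)))"
  if f: "!!u v. f (u + v) = f u + f v" "!!k u. f (k *s u) = sc k * f u" and cf: "!!u v. cl v * f u = f u * cl v"
   "!!g u. g : W ==> gr g * f u = f (cmat g *v u) * gr g" for f
 proof -
  have fm: "f (- u) = - f u" for u using f(2)[of "-1" u] by (simp add: S.sc_minus)
  have 1: "EE v * f v + f v * EE v = sc t * (f v * cl v + f v * cl v)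
   - (SUM al:R. sc (c al / 2 * pairing (cvec (coroot al)) v) * (gr (root_refl al) * cl (cvec al) * f v + f v * (gr (root_refl al) * cl (cvec al))))" for v
   unfolding EE_def diff_dists sum_distrib_right sum_distrib_left
   by (simp add: m_ass distrib_left S.slc[of "f v"] sum.distrib cf(1))
  have "(SUM p:?I. EE (?y p) * f (?y p) + f (?y p) * EE (?y p)) = (SUM p:?I. sc t * (f (?y p) * cl (?y p) + f (?y p) * cl (?y p)))
   - (SUM al:R. SUM p:?I. sc (c al / 2 * pairing (cvec (coroot al)) (?y p)) * (gr (root_refl al) * cl (cvec al) * f (?y p) + f (?y p) * (gr (root_refl al) * cl (cvec al))))"
   unfolding 1 sum_subtractf by (subst sum.swap[of _ R]) (rule refl)
  moreover have "(SUM p:?I. sc (c al / 2 * pairing (cvec (coroot al)) (?y p)) * (gr (root_refl al) * cl (cvec al) * f (?y p) + f (?y p) * (gr (root_refl al) * cl (cvec al)))) = 0" if a: "al : R" for al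
  proof -
   let ?g = "gr (root_refl al) * cl (cvec al)" and ?u = "cvec (coroot al)"
   have "(SUM p:?I. sc (c al / 2 * pairing ?u (?y p)) * (?g * f (?y p) + f (?y p) * ?g))
    = sc (c al / 2) * (?g * f ?u + f ?u * ?g)"
    unfolding onb_linear[of f ?u, OF f] sum_dists sum.distrib[symmetric]
    by (simp add: S.slc[of "cl (cvec al)"] S.slc[of "gr (root_refl al)"] distrib_left m_ass)
   moreover have "?g * f ?u = - (f ?u * ?g)"
   proof -
    have "cmat (root_refl al) *v ?u = - ?u"
     using coroot_inner[OF R_nz[OF a]] unfolding cmat_refl_vec(1) pairing_cvec by (simp add: vec_eq_iff)
    hence "gr (root_refl al) * f ?u = - (f ?u * gr (root_refl al))" using cf(2)[OF W_refl[OF a], of ?u] by (simp add: fm)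
    thus ?thesis by (simp add: m_ass cf(1)) (simp add: m_ass[symmetric])
   qed
   ultimately show ?thesis by simp
  qed
  ultimately show ?thesis by (simp add: sum_distrib_left[symmetric] sum.distrib)
 qed
 show "(SUM p:?I. EE (?y p) * Xo (?y p) + Xo (?y p) * EE (?y p)) = sc t * (XX + XX)"
  unfolding XX_def by (rule *) (auto simp: Xo_lin cl_comm gr_Xo W_orth)
 show "(SUM p:?I. EE (?y p) * T (?y p) + T (?y p) * EE (?y p)) = sc t * (YY + YY)"
  unfolding YY_def by (rule *) (auto simp: T_lin cl_comm gr_T)
qed

lemma YY_XX_sq: "YY * (XX * XX) = XX * XX * YY + sc t * (XX + XX)" "XX * (YY * YY) = YY * YY * XX - sc t * (YY + YY)"
proof -
 have 1: "YY * (Xo u * Xo u) = Xo u * Xo u * YY + (EE u * Xo u + Xo u * EE u)" for u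
  by (simp add: m_ass[symmetric] YY_Xo distrib_right) (simp add: m_ass YY_Xo distrib_left)
 show "YY * (XX * XX) = XX * XX * YY + sc t * (XX + XX)"
  unfolding EE_anti[symmetric] XX_sq by (simp add: sum_dists 1 sum.distrib)
 have 2: "XX * (T u * T u) = T u * T u * XX - (EE u * T u + T u * EE u)" for u
  by (simp add: m_ass[symmetric] XX_T left_diff_distrib) (simp add: m_ass XX_T right_diff_distrib)
 show "XX * (YY * YY) = YY * YY * XX - sc t * (YY + YY)"
  unfolding EE_anti[symmetric] XX_sq by (simp add: sum_dists 2 sum.distrib sum_subtractf)
qed

definition SS :: "'n op" where "SS = sc (1 / (2 * t)) * (YY * XX - XX * YY) - sc (1/2)"

text \<open>For Z = YY XX - XX YY the relations \<open>YY_XX_sq\<close> say XX Z + Z XX = 2 t XX,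
  and likewise for \<open>YY\<close>. The shift by 1/2 in the Scasimir removes exactly this
  remainder.\<close>

lemma SS_anti: "XX * SS = - (SS * XX)" "YY * SS = - (SS * YY)"
proof -
 have h: "sc (1 / (2 * t)) * (sc t * (Z + Z)) = Z" for Z :: "'n op"
  using t0 by (simp add: half_double)
 have h2: "sc (1/2) * Z + sc (1/2) * Z = Z" for Z :: "'n op"
  using half_double[of Z] by (simp add: distrib_left)
 let ?Z = "YY * XX - XX * YY"
 have "XX * ?Z + ?Z * XX = sc t * (XX + XX)"
  using YY_XX_sq(1) by (simp add: algebra_simps)
 hence F: "sc (1 / (2 * t)) * (XX * ?Z) + sc (1 / (2 * t)) * (?Z * XX) = XX"
  unfolding distrib_left[symmetric] by (simp only: h)
 have 1: "XX * SS = sc (1 / (2 * t)) * (XX * ?Z) - sc (1/2) * XX"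
  by (simp only: SS_def right_diff_distrib S.slc[of XX] S.sc_comm[of XX])
 have 2: "SS * XX = sc (1 / (2 * t)) * (?Z * XX) - sc (1/2) * XX"
  by (simp only: SS_def left_diff_distrib m_ass)
 have "XX * SS + SS * XX = (sc (1 / (2 * t)) * (XX * ?Z) + sc (1 / (2 * t)) * (?Z * XX)) - (sc (1/2) * XX + sc (1/2) * XX)"
  unfolding 1 2 by simp
 also have "... = 0" unfolding F h2 by simp
 finally show "XX * SS = - (SS * XX)" by (simp add: eq_neg_iff_add_eq_0)
 have "YY * ?Z + ?Z * YY = sc t * (YY + YY)"
  using YY_XX_sq(2) by (simp add: algebra_simps)
 hence F: "sc (1 / (2 * t)) * (YY * ?Z) + sc (1 / (2 * t)) * (?Z * YY) = YY"
  unfolding distrib_left[symmetric] by (simp only: h)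
 have 1: "YY * SS = sc (1 / (2 * t)) * (YY * ?Z) - sc (1/2) * YY"
  by (simp only: SS_def right_diff_distrib S.slc[of YY] S.sc_comm[of YY])
 have 2: "SS * YY = sc (1 / (2 * t)) * (?Z * YY) - sc (1/2) * YY"
  by (simp only: SS_def left_diff_distrib m_ass)
 have "YY * SS + SS * YY = (sc (1 / (2 * t)) * (YY * ?Z) + sc (1 / (2 * t)) * (?Z * YY)) - (sc (1/2) * YY + sc (1/2) * YY)"
  unfolding 1 2 by simp
 also have "... = 0" unfolding F h2 by simp
 finally show "YY * SS = - (SS * YY)" by (simp add: eq_neg_iff_add_eq_0)
qed

lemma hat_SS: "hat SS = SS"
 by (simp add: SS_def hat_mult)

text \<open>The Scasimir is built from products of two odd generators, past which the two twists by
  \<open>hat\<close> cancel.\<close>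

lemma osp_ok_SS: assumes "osp_ok a" shows "a * SS = SS * a"
proof -
 have a: "a * XX = XX * hat a" "a * YY = YY * hat a" using assms by (simp_all add: osp_ok_def)
 have "a * (YY * XX) = YY * XX * a" "a * (XX * YY) = XX * YY * a"
  by (simp_all only: m_ass[symmetric] a) (simp_all only: m_ass osp_ok_hat[OF assms])
 thus ?thesis unfolding SS_def
  by (simp add: right_diff_distrib left_diff_distrib S.slc[of a] S.sc_comm[of a] m_ass)
qed

definition GG :: "'n op" where
 "GG = sc (\<i> ^ (CARD('n) * (CARD('n) - 1) div 2)) * foldr (%p u. el p * u) [1..<CARD('n) + 1] 1"

text \<open>Passing e_q through the word costs one sign for each factor different from e_q.\<close>

lemma el_foldr:
 assumes "distinct l"
 shows "foldr (%p u. el p * u) l 1 * el q = (-1) ^ (length l + (if q : set l then 1 else 0)) * (el q * foldr (%p u. el p * u) l (1 :: 'n op))"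
 using assms
proof (induction l)
 case (Cons p l)
 let ?f = "foldr (%p u. el p * u) l (1 :: 'n op)"
 have sgn: "a * ((-1) ^ m * b) = (-1) ^ m * (a * b)" for a b :: "'n op" and m
  by (cases "even m") auto
 have "foldr (%p u. el p * u) (p # l) 1 * el q = el p * (?f * el q)" by (simp add: m_ass)
 also have "... = (-1) ^ (length l + (if q : set l then 1 else 0)) * ((el p * el q) * ?f)"
  using Cons by (simp add: sgn m_ass)
 also have "... = (-1) ^ (length (p # l) + (if q : set (p # l) then 1 else 0)) * ((el q * el p) * ?f)"
  using Cons.prems el_el(2)[of p q, where 'n = 'n] by (cases "p = q") (auto simp: power_add)
 finally show ?case by (simp add: m_ass)
qed simp

lemma GG_cl: "GG * cl v = sc ((-1) ^ (CARD('n) - 1)) * (cl v * GG)"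
proof -
 have *: "foldr (%p u. el p * u) [1..<CARD('n) + 1] 1 * el q = sc ((-1) ^ (CARD('n) - 1)) * (el q * foldr (%p u. el p * u) [1..<CARD('n) + 1] (1 :: 'n op))"
  if "q : {1..CARD('n)}" for q
 proof -
  have "(-1) ^ (CARD('n) + 1) = (sc ((-1) ^ (CARD('n) - 1)) :: 'n op)"
   using card3 by (cases "even (CARD('n) - 1)") (auto simp: S.sc_minus)
  thus ?thesis using el_foldr[of "[1..<CARD('n) + 1]" q] that by simp
 qed
 show ?thesis unfolding GG_def cl_def sum_dists
  by (intro sum.cong refl) (simp add: m_ass S.slc[of "foldr _ _ _"] S.slc[of "el _"] * mult_ac[where 'a = complex] del: upt_Suc)
qed

lemma comm_foldr: "(!!p. p : set l ==> el p * a = a * el p) ==> foldr (%p u. el p * u) l 1 * a = a * foldr (%p u. el p * u) l (1 :: 'n op)"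
proof (induction l)
 case (Cons p l)
 thus ?case by (simp add: m_ass) (simp add: m_ass[symmetric])
qed simp

lemma GG_comm: "(!!p. el p * a = a * el p) ==> GG * a = a * GG"
 unfolding GG_def by (simp add: m_ass S.slc[of a] comm_foldr del: upt_Suc)

lemma GG_comms: "GG * Xo u = Xo u * GG" "GG * T u = T u * GG" "GG * gr g = gr g * GG" "GG * Ho j = Ho j * GG"
 by (rule GG_comm; simp add: el_comm el_T Ho_shift)+

lemma hat_GG: "hat GG = sc ((-1) ^ CARD('n)) * GG"
proof -
 have "hat (foldr (%p u. el p * u) l 1) = sc ((-1) ^ length l) * foldr (%p u. el p * u) l (1 :: 'n op)"
  if "set l <= {1..CARD('n)}" for l
  using that
 proof (induction l)
  case (Cons p l)
  have "hat (el p :: 'n op) = - el p" by (rule hat_eqI) (use Cons in \<open>simp add: par_el\<close>)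
  thus ?case using Cons by (simp add: hat_mult S.sc_minus S.slc[of "el p"] m_ass)
 qed simp
 moreover have "set [1..<CARD('n) + 1] <= {1..CARD('n)}" by auto
 ultimately have "hat (foldr (%p u. el p * u) [1..<CARD('n) + 1] 1) = sc ((-1) ^ CARD('n)) * foldr (%p u. el p * u) [1..<CARD('n) + 1] (1 :: 'n op)"
  by (metis length_upt add_diff_cancel_right')
 thus ?thesis unfolding GG_def by (simp add: mult.commute[where 'a = complex] del: upt_Suc)
qed

lemma GG_inv: "\<exists>G'. G' * GG = 1"
proof -
 have "\<exists>G. G * foldr (%p u. el p * u) l 1 = (1 :: 'n op)" for l
 proof (induction l)
  case Nil
  show ?case by (rule exI[of _ 1]) simp
 next
  case (Cons p l)
  then obtain G where "G * foldr (%p u. el p * u) l 1 = (1 :: 'n op)" by blast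
  hence "(G * el p) * (el p * foldr (%p u. el p * u) l 1) = (1 :: 'n op)"
   using el_el(1)[of p, where 'n = 'n] by (metis m_ass mult.left_neutral)
  thus ?case by auto
 qed
 then obtain G where G: "G * foldr (%p u. el p * u) [1..<CARD('n) + 1] 1 = (1 :: 'n op)" by blast
 let ?k = "\<i> ^ (CARD('n) * (CARD('n) - 1) div 2)"
 have "(sc (1 / ?k) * G) * GG = 1" unfolding GG_def
  by (simp only: S.sc_mult_mult G) simp
 thus ?thesis by blast
qed

definition DD :: "'n op" where "DD = GG * SS"

lemma GG_XX: "GG * XX = sc ((-1) ^ (CARD('n) - 1)) * (XX * GG)" "GG * YY = sc ((-1) ^ (CARD('n) - 1)) * (YY * GG)"
proof -
 have *: "GG * (f * cl v) = sc ((-1) ^ (CARD('n) - 1)) * (f * cl v * GG)" if "GG * f = f * GG" for f v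
 proof -
  have "GG * (f * cl v) = f * (GG * cl v)" using that by (metis m_ass)
  thus ?thesis unfolding GG_cl by (simp add: S.slc[of f] m_ass)
 qed
 show "GG * XX = sc ((-1) ^ (CARD('n) - 1)) * (XX * GG)" "GG * YY = sc ((-1) ^ (CARD('n) - 1)) * (YY * GG)"
  unfolding XX_def YY_def sum_dists by (simp_all add: * GG_comms)
qed

lemma hat_DD: "hat DD = sc ((-1) ^ CARD('n)) * DD"
 by (simp add: DD_def hat_mult hat_SS hat_GG m_ass)

text \<open>Passing F+ or F-, the Scasimir gives -1 and \<Gamma> gives (-1)^(d-1). The product
  (-1)^d is the parity sign of D, so D supercommutes.\<close>

lemma osp_ok_DD: "osp_ok DD"
proof -
 have e: "- ((-1) ^ (CARD('n) - 1)) = ((-1) ^ CARD('n) :: complex)" using card3 by (cases "CARD('n)") auto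
 have "SS * XX = - (XX * SS)" "SS * YY = - (YY * SS)" using SS_anti by simp_all
 hence "GG * SS * XX = - (GG * XX * SS)" "GG * SS * YY = - (GG * YY * SS)" by (simp_all add: m_ass)
 hence "GG * SS * XX = sc ((-1) ^ CARD('n)) * (XX * (GG * SS))" "GG * SS * YY = sc ((-1) ^ CARD('n)) * (YY * (GG * SS))"
  unfolding GG_XX e[symmetric] S.sc_minus by (simp_all add: m_ass)
 thus ?thesis unfolding osp_ok_def hat_DD by (simp add: DD_def S.slc[of XX] S.slc[of YY])
qed

end

section \<open>Degrees, leading parts of operators, and commutation relations read on the
  vacuum\<close>

section \<open>Leading symbols\<close>

abbreviation lk :: "'n::finite M => real^'n^'n => nat set => 'n pfun" where
 "lk F w S == lookup F (w, S)"

lemma lk_diag [simp]: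
 "lk (app (Xo u) F) w S = fx u * lk F w S"
 "lk (app (Yo u) F) w S = fy u * lk F w S"
 "lk (app (Dxo u) F) w S = Dd (u, 0) (lk F w S)"
 "lk (app (rX u) F) w S = fx (cmat w *v u) * lk F w S"
 "lk (app (rY u) F) w S = fy (cmat w *v u) * lk F w S"
 "lk (app (rD u) F) w S = Dd (0, cmat w *v u) (lk F w S)"
 "lk (app (Ho j) F) w S = hcp j (lk F w S)"
 "lk (app (par :: 'n::finite op) F) w S = pconst (sg {1..CARD('n)} S) * lk F w S"
 unfolding Xo_def Yo_def Dxo_def rX_def rY_def rD_def Ho_def par_def
 by (subst lookup_mop[where \<sigma>' = "%k. k"]; simp)+

lemma lk_el [simp]:
 "lk (app (el p) F) w S = pconst (sg {..<p} S) * lk F w (sd S p)"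
 "lk (app (re p :: 'n::finite op) F) w S = pconst (sg {p<..CARD('n)} S) * lk F w (sd S p)"
 unfolding el_def re_def
 by (subst lookup_mop[where \<sigma>' = "%k. (fst k, sd (snd k) p)"]; simp add: sg_sd)+

lemma lk_refl:
 assumes "al ~= 0"
 shows "lk (app (Tc al) F) w S = psub (mat 1) (cmat (root_refl al)) (dqx al (lk F (root_refl al ** w) S))"
  "lk (app (rc u al) F) w S = pconst (pairing (cvec (coroot al)) (cmat (root_refl al ** w) *v u)) * dqy al (lk F (root_refl al ** w) S)"
  "lk (app (gr (root_refl al)) F) w S = psub (cmat (root_refl al)) (cmat (root_refl al)) (lk F (root_refl al ** w) S)"
  "lk (app (rg (root_refl al)) F) w S = lk F (w ** root_refl al) S"
proof -
 show "lk (app (Tc al) F) w S = psub (mat 1) (cmat (root_refl al)) (dqx al (lk F (root_refl al ** w) S))"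
  "lk (app (rc u al) F) w S = pconst (pairing (cvec (coroot al)) (cmat (root_refl al ** w) *v u)) * dqy al (lk F (root_refl al ** w) S)"
  "lk (app (gr (root_refl al)) F) w S = psub (cmat (root_refl al)) (cmat (root_refl al)) (lk F (root_refl al ** w) S)"
  unfolding Tc_def rc_def gr_def
  by (subst lookup_mop[where \<sigma>' = "%k. (root_refl al ** fst k, snd k)"]; simp add: assms del: cmat_simps(2))+
 show "lk (app (rg (root_refl al)) F) w S = lk F (w ** root_refl al) S"
  unfolding rg_def
  by (subst lookup_mop[where \<sigma>' = "%k. (fst k ** root_refl al, snd k)"]) (simp_all add: assms matrix_mul_assoc[symmetric])
qed

lemma lk_smul [simp]: "lk (smul k F) w S = pconst k * lk F w S"
 by simp

lemma lk_simps: "lk (F + G) w S = lk F w S + lk G w S" "lk (F - G) w S = lk F w S - lk G w S"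
 "lk (sum f J) w S = (SUM j:J. lk (f j) w S)" "lk (- F) w S = - lk F w S"
 by (auto simp: lookup_add lookup_minus lookup_sum)

definition degle :: "nat => 'n::finite M => bool" where
 "degle k F \<longleftrightarrow> (\<forall>j>k. app (Ho j) F = 0)"

text \<open>\<open>a\<close> raises the degree by at most \<open>s\<close>, and \<open>b\<close> is
  its effect on top components. Allowing \<open>b\<close> = 0 lets operators of lower order be
  discarded through \<open>tops_lower\<close>.\<close>

definition tops :: "nat => 'n::finite op => 'n op => bool" where
 "tops s a b \<longleftrightarrow> (\<forall>F k. degle k F --> degle (k + s) (app a F) & app (Ho (k + s)) (app a F) = app b (app (Ho k) F))"

lemma tops_mult: "tops s a b ==> tops s' a' b' ==> tops (s + s') (a * a') (b * b')"
 unfolding tops_def by (simp add: add.assoc add.commute[of s s'] flip: add.assoc)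

lemma tops_add: "tops s a b ==> tops s a' b' ==> tops s (a + a') (b + b')"
 unfolding tops_def degle_def by simp

lemma tops_lower: "tops s' a b ==> s' < s ==> tops s a 0"
 unfolding tops_def degle_def by simp

lemma tops_diff: "tops s a b ==> tops s a' b' ==> tops s (a - a') (b - b')"
 unfolding tops_def degle_def by simp

lemma tops_add_lower: "tops s a b ==> tops 0 a' b' ==> 0 < s ==> tops s (a + a') b"
 using tops_add[OF _ tops_lower] by fastforce

lemma tops_mult_00: "tops 0 a b ==> tops 0 a' b' ==> tops 0 (a * a') (b * b')"
 and tops_mult_01: "tops 0 a b ==> tops 1 a' b' ==> tops 1 (a * a') (b * b')"
 and tops_mult_10: "tops 1 a b ==> tops 0 a' b' ==> tops 1 (a * a') (b * b')"
 and tops_mult_11: "tops 1 a b ==> tops 1 a' b' ==> tops 2 (a * a') (b * b')"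
 using tops_mult[of 0 a b 0 a' b'] tops_mult[of 0 a b 1 a' b'] tops_mult[of 1 a b 0 a' b'] tops_mult[of 1 a b 1 a' b'] by auto

lemma tops_0I: "(!!j. Ho j * a = a * Ho j) ==> tops 0 a a"
 unfolding tops_def degle_def by (metis add.right_neutral app_0 app_simps(4))

lemma tops_1I: "(!!j. Ho (Suc j) * a = a * Ho j) ==> tops 1 a a"
proof -
 assume *: "!!j. Ho (Suc j) * a = a * Ho j"
 hence "app (Ho (Suc j)) (app a F) = app a (app (Ho j) F)" for j F by (metis app_simps(4))
 thus ?thesis unfolding tops_def degle_def by (auto simp: One_nat_def Suc_less_eq2)
qed

lemma tops_m1I: "(!!j. Ho j * a = a * Ho (Suc j)) ==> tops 0 a 0"
proof -
 assume *: "!!j. Ho j * a = a * Ho (Suc j)"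
 hence "app (Ho j) (app a F) = app a (app (Ho (Suc j)) F)" for j F by (metis app_simps(4))
 thus ?thesis unfolding tops_def degle_def by auto
qed

context dunkl
begin

text \<open>The part of T, respectively of right multiplication by x, that lowers the degree by one;
  the complementary part raises it by one.\<close>

definition Tm :: "complex^'n => 'n op" where "Tm u = T u - Yo u"
definition rxm :: "complex^'n => 'n op" where "rxm u = rx u - rX u"

lemma Tm_def2: "Tm u = sc t * Dxo u - (SUM al:R. sc (c al / 2 * pairing u (cvec al)) * Tc al)"
 by (simp add: Tm_def T_def)

lemma rxm_def2: "rxm u = sc t * rD u - (SUM al:R. sc (c al / 2) * rc u al)"
 by (simp add: rxm_def rx_def)

lemma T_split: "T u = Yo u + Tm u" "rx u = rX u + rxm u"
 by (simp_all add: Tm_def rxm_def)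

lemma Ho_Tm: "Ho j * Tm u = Tm u * Ho (Suc j)" "Ho j * rxm u = rxm u * Ho (Suc j)"
 unfolding Tm_def2 rxm_def2 diff_dists sum_dists S.slc[of "Ho j"] m_ass
 by (simp_all add: Ho_shift R_nz cong: sum.cong)

lemma tops_basic:
 "tops 1 (Xo u) (Xo u)" "tops 1 (Yo u) (Yo u)" "tops 1 (T u) (Yo u)" "tops 1 (rX u) (rX u)" "tops 1 (rY u) (rY u)"
 "tops 1 (rx u) (rX u)" "tops 0 (Tm u) 0" "tops 0 (rxm u) 0" "tops 0 (cl v) (cl v)" "tops 0 (gr g) (gr g)" "tops 0 (re p) (re p)"
 "tops 0 (sc k) (sc k)" "tops 0 (rg g) (rg g)" "tops 0 GG GG"
proof -
 show m: "tops 0 (Tm u) 0" "tops 0 (rxm u) 0" by (rule tops_m1I[OF Ho_Tm(1)], rule tops_m1I[OF Ho_Tm(2)])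
 show Y: "tops 1 (Yo u) (Yo u)" and X: "tops 1 (rX u) (rX u)" by (auto intro!: tops_1I simp: Ho_shift)
 show "tops 1 (T u) (Yo u)" "tops 1 (rx u) (rX u)"
  unfolding T_split using tops_add[OF Y tops_lower[OF m(1)]] tops_add[OF X tops_lower[OF m(2)]] by simp_all
qed (auto intro!: tops_1I tops_0I simp: Ho_shift cl_comm GG_comms)

lemma tops_sum: "(!!p. p : J ==> tops s (f p) (g p)) ==> tops s (sum f J) (sum g J)"
proof (induction J rule: infinite_finite_induct)
 case (insert x F)
 thus ?case by (simp add: tops_add)
qed (auto simp: tops_def degle_def)

text \<open>The algebra of left multiplications, later identified with the full image of H (x)
  C.\<close>

inductive_set Alg :: "'n op set" where
 sc: "sc k : Alg"
| Xo: "Xo u : Alg"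
| T: "T u : Alg"
| gr: "g : W ==> gr g : Alg"
| cl: "cl v : Alg"
| add: "a : Alg ==> b : Alg ==> a + b : Alg"
| mult: "a : Alg ==> b : Alg ==> a * b : Alg"

lemma Alg_simps: "0 : Alg" "1 : Alg" "a : Alg ==> - a : Alg" "a : Alg ==> b : Alg ==> a - b : Alg"
proof -
 show "0 : Alg" "1 : Alg" using Alg.sc[of 0] Alg.sc[of 1] by auto
 show m: "- a : Alg" if "a : Alg" for a using Alg.mult[OF Alg.sc[of "-1"] that] by (simp add: S.sc_minus)
 show "a : Alg ==> b : Alg ==> a - b : Alg" using Alg.add[OF _ m, of a b] by simp
qed

lemma Alg_sum: "(!!j. j : J ==> f j : Alg) ==> sum f J : Alg"
 by (induction J rule: infinite_finite_induct) (auto intro: Alg.add Alg_simps)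

lemma Alg_el: "p : {1..CARD('n)} ==> el p : Alg"
 using Alg.cl[of "cvec (y p)"] by (simp add: cl_y)

lemma Alg_rok: "z : Alg ==> rok r ==> z * r = r * z"
proof (induction rule: Alg.induct)
 case (cl v)
 have "r * cl v = cl v * r" unfolding cl_def
  by (rule comm_sc_sum[symmetric]) (use cl in \<open>simp add: rok_def\<close>)
 thus ?case by simp
next
 case (mult a b)
 hence a: "a * r = r * a" and b: "b * r = r * b" by auto
 have "a * b * r = a * (r * b)" by (simp add: m_ass b)
 also have "... = r * (a * b)" by (simp add: m_ass[symmetric] a)
 finally show ?case .
qed (auto simp: rok_def add_dists S.sc_comm)

text \<open>The index type admits all matrices and all sets of numbers. Vectors generated from the
  vacuum stay within W and within subsets of 1..d.\<close>

definition suppW :: "'n M => bool" where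
 "suppW F \<longleftrightarrow> (\<forall>w S. lk F w S ~= 0 --> w : W & S <= {1..CARD('n)})"

lemma suppW_mop:
 assumes "!!k. plin (\<psi> k)" "!!w S. w : W ==> S <= {1..CARD('n)} ==> fst (\<sigma> (w, S)) : W & snd (\<sigma> (w, S)) <= {1..CARD('n)}"
  and "suppW F"
 shows "suppW (app (mop \<sigma> \<psi>) F)"
proof -
 have "keys F <= {k. fst k : W & snd k <= {1..CARD('n)}}"
  using assms(3) unfolding suppW_def by (force simp: in_keys_iff)
 hence "suppW (app (mop \<sigma> \<psi>) F)"
 proof (induction rule: pm_induct_on)
  case zero
  thus ?case by (simp add: suppW_def)
 next
  case (add k v f)
  have "suppW (app (mop \<sigma> \<psi>) (single k v))"
   using assms(1) assms(2)[of "fst k" "snd k"] add(1) by (auto simp: suppW_def lookup_single when_def)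
  thus ?case using add(3) unfolding suppW_def app_add lk_simps
   by (metis add_cancel_right_right)
 qed
 thus ?thesis .
qed

lemma suppW_lin: "suppW F ==> suppW G ==> suppW (F + G)" "suppW F ==> suppW G ==> suppW (F - G)" "suppW F ==> suppW (smul k F)"
 "suppW 0"
 unfolding suppW_def lk_simps lk_smul by (metis add_cancel_right_right, metis diff_zero diff_self eq_iff_diff_eq_0, auto)

lemma suppW_sum: "(!!j. j : J ==> suppW (f j)) ==> suppW (sum f J)"
 by (induction J rule: infinite_finite_induct) (auto intro: suppW_lin)

lemma Alg_suppW: "z : Alg ==> suppW F ==> suppW (app z F)"
proof (induction arbitrary: F rule: Alg.induct)
 case (T u)
 have "suppW (app (Yo u) F)" "suppW (app (Dxo u) F)" unfolding Yo_def Dxo_def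
  by (rule suppW_mop; use T in simp)+
 moreover have "suppW (app (Tc al) F)" if "al : R" for al unfolding Tc_def
  by (rule suppW_mop) (use T that R_nz W_refl W_mult in simp_all)
 ultimately show ?case unfolding T_def by (auto intro!: suppW_lin suppW_sum)
next
 case (cl v)
 have "suppW (app (el p) F)" if "p : {1..CARD('n)}" for p unfolding el_def
  by (rule suppW_mop) (use cl that in \<open>auto simp: sd_def\<close>)
 thus ?case unfolding cl_def by (auto intro!: suppW_lin suppW_sum)
next
 case (Xo u)
 show ?case unfolding Xo_def by (rule suppW_mop) (use Xo in simp_all)
next
 case (gr g)
 show ?case unfolding gr_def by (rule suppW_mop) (use gr W_mult in simp_all)
qed (auto intro: suppW_lin)

lemma suppW_vac: "suppW vac"
 by (auto simp: suppW_def vac_def lookup_single when_def refl_group.one)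

subsection \<open>Left and right multiplications agree on the vacuum\<close>

text \<open>\<open>r\<close> is right multiplication by \<open>a\<close>: as r commutes with the
  left action, z a vac = z r vac = r z vac. Products are therefore reversed under this
  correspondence.\<close>

definition rt :: "'n op => 'n op => bool" where
 "rt a r \<longleftrightarrow> a : Alg & rok r & app a vac = app r vac"

lemma rt_apply: "z : Alg ==> rt a r ==> app (z * a) vac = app r (app z vac)"
 unfolding rt_def using Alg_rok[of z r] by (metis app_simps(4))

lemma rt_mult: "rt a r ==> rt b s ==> rt (a * b) (s * r)"
 using rt_apply[of a b s] unfolding rt_def by (auto intro: Alg.mult rok_mult)

lemma rt_lin: "rt a r ==> rt b s ==> rt (a + b) (r + s)" "rt a r ==> rt b s ==> rt (a - b) (r - s)"
 "rt a r ==> rt (sc k * a) (sc k * r)" "rt 0 0"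
 unfolding rt_def by (auto intro: Alg.add Alg_simps Alg.mult Alg.sc rok_add rok_diff rok_mult rok_sc rok_0)

lemma rt_sum: "(!!p. p : J ==> rt (f p) (g p)) ==> rt (sum f J) (sum g J)"
 by (induction J rule: infinite_finite_induct) (auto intro: rt_lin)

definition rcl :: "complex^'n => 'n op" where
 "rcl v = (SUM p:{1..CARD('n)}. sc (pairing v (cvec (y p))) * re p)"

lemma rt_basic: "rt (Xo u) (rx u)" "rt (T u) (rY u)" "g : W ==> rt (gr g) (rg g)" "p : {1..CARD('n)} ==> rt (el p) (re p)"
 "rt (cl v) (rcl v)"
proof -
 show "rt (Xo u) (rx u)" "rt (T u) (rY u)" "g : W ==> rt (gr g) (rg g)" and el: "p : {1..CARD('n)} ==> rt (el p) (re p)" for p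
  unfolding rt_def using vac_swap by (auto intro: Alg.intros Alg_el rok_rx rok_rY rok_rg rok_re)
 show "rt (cl v) (rcl v)" unfolding cl_def rcl_def by (intro rt_sum rt_lin(3) el)
qed

lemma rcl_y: "p : {1..CARD('n)} ==> rcl (cvec (y p)) = re p"
proof -
 assume p: "p : {1..CARD('n)}"
 have "rcl (cvec (y p)) = (SUM q:{1..CARD('n)}. if q = p then re p else 0)"
  unfolding rcl_def by (intro sum.cong refl) (use p in \<open>simp add: onb_delta\<close>)
 thus ?thesis using p by simp
qed

definition rEE :: "complex^'n => 'n op" where
 "rEE u = sc t * rcl u - (SUM al:R. sc (c al / 2 * pairing (cvec (coroot al)) u) * (rcl (cvec al) * rg (root_refl al)))"

definition rAA :: "complex^'n => complex^'n => 'n op" where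
 "rAA u v = rY v * rx u - rx v * rY u + sc (1/2) * (rEE v * rcl u + rcl v * rEE u - sc t * (rcl v * rcl u))"

lemma rt_EE: "rt (EE u) (rEE u)"
 unfolding EE_def rEE_def by (intro rt_lin rt_sum rt_mult rt_basic W_refl)

lemma rt_AA: "rt (AA u v) (rAA u v)"
 unfolding AA_def rAA_def by (intro rt_lin rt_mult rt_basic rt_EE)

lemma rt_XX: "rt XX (SUM p:{1..CARD('n)}. re p * rx (cvec (y p)))" "rt YY (SUM p:{1..CARD('n)}. re p * rY (cvec (y p)))"
 unfolding XX_def YY_def by (intro rt_sum; use rt_mult[OF rt_basic(1) rt_basic(4)] rt_mult[OF rt_basic(2) rt_basic(4)] in \<open>simp add: cl_y\<close>)+

text \<open>The elements among which the graded centre is found: the centraliser of the \<open>AA u v\<close>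
 in the centraliser of the Lie superalgebra.\<close>

definition ZZ :: "'n op => bool" where
 "ZZ z \<longleftrightarrow> z : Alg & osp_ok z & (\<forall>u v. z * AA u v = AA u v * z)"

lemma ZZ_AA:
 assumes "ZZ z" shows "app (AA u v) (app z vac) = app (rAA u v) (app z vac)"
 using rt_apply[OF _ rt_AA, of z u v] assms unfolding ZZ_def by (metis app_simps(4))

text \<open>Supercommutation replaces z by \<open>hat z\<close>, and on the vacuum
  \<open>hat z\<close> amounts to applying \<open>par\<close> to z vac.\<close>

lemma ZZ_odd:
 assumes "ZZ z"
 shows "app XX (app par (app z vac)) = app (SUM p:{1..CARD('n)}. re p * rx (cvec (y p))) (app z vac)"
  "app YY (app par (app z vac)) = app (SUM p:{1..CARD('n)}. re p * rY (cvec (y p))) (app z vac)"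
proof -
 have h: "app (hat z) vac = app par (app z vac)" by (simp add: hat_def vac_swap)
 have z: "z : Alg" "z * XX = XX * hat z" "z * YY = YY * hat z" using assms by (auto simp: ZZ_def osp_ok_def)
 show "app XX (app par (app z vac)) = app (SUM p:{1..CARD('n)}. re p * rx (cvec (y p))) (app z vac)"
  unfolding h[symmetric] rt_apply[OF z(1) rt_XX(1), symmetric] z(2) by simp
 show "app YY (app par (app z vac)) = app (SUM p:{1..CARD('n)}. re p * rY (cvec (y p))) (app z vac)"
  unfolding h[symmetric] rt_apply[OF z(1) rt_XX(2), symmetric] z(3) by simp
qed

lemma ZZ_even:
 assumes "ZZ z"
 shows "app (XX * XX) (app z vac) = app (SUM p:{1..CARD('n)}. rx (cvec (y p)) * rx (cvec (y p))) (app z vac)"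
  "app (YY * YY) (app z vac) = app (SUM p:{1..CARD('n)}. rY (cvec (y p)) * rY (cvec (y p))) (app z vac)"
proof -
 have o: "osp_ok z" and zA: "z : Alg" using assms by (auto simp: ZZ_def)
 have z: "z * (XX * XX) = XX * XX * z" "z * (YY * YY) = YY * YY * z"
  using o[unfolded osp_ok_def] osp_ok_hat[OF o] by (simp_all add: m_ass[symmetric]) (simp_all add: m_ass)
 have r: "rt (XX * XX) (SUM p:{1..CARD('n)}. rx (cvec (y p)) * rx (cvec (y p)))" "rt (YY * YY) (SUM p:{1..CARD('n)}. rY (cvec (y p)) * rY (cvec (y p)))"
  unfolding XX_sq by (intro rt_sum rt_mult rt_basic)+
 show "app (XX * XX) (app z vac) = app (SUM p:{1..CARD('n)}. rx (cvec (y p)) * rx (cvec (y p))) (app z vac)"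
  using rt_apply[OF zA r(1)] unfolding z by simp
 show "app (YY * YY) (app z vac) = app (SUM p:{1..CARD('n)}. rY (cvec (y p)) * rY (cvec (y p))) (app z vac)"
  using rt_apply[OF zA r(2)] unfolding z by simp
qed

lemma Ho_EE: "Ho j * EE u = EE u * Ho j" "Ho j * rcl u = rcl u * Ho j" "Ho j * rEE u = rEE u * Ho j"
proof -
 show "Ho j * EE u = EE u * Ho j"
  unfolding EE_def diff_dists sum_dists S.slc[of "Ho j"] m_ass cl_comm
  by (simp add: m_ass[symmetric] Ho_shift)
 have r: "Ho j * rcl u = rcl u * Ho j" for u
  unfolding rcl_def by (rule comm_sc_sum[symmetric]) (simp add: Ho_shift)
 thus "Ho j * rcl u = rcl u * Ho j" .
 show "Ho j * rEE u = rEE u * Ho j"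
  unfolding rEE_def diff_dists sum_dists S.slc[of "Ho j"] m_ass Ho_shift(16)[symmetric]
  by (simp add: m_ass[symmetric] r)
qed

lemma tops_EE: "tops 0 (EE u) (EE u)" "tops 0 (rcl u) (rcl u)" "tops 0 (rEE u) (rEE u)"
 by (rule tops_0I, rule Ho_EE)+

text \<open>The leading symbol of an element of the centraliser is supported on those \<open>w\<close> which act
 trivially on bivectors.\<close>

lemma bivector_rigid:
 assumes w: "orthogonal_matrix (w :: real^'n^'n)"
  and minors: "!!i j a b. w $ a $ i * w $ b $ j - w $ a $ j * w $ b $ i
    = (if a = i & b = j then 1 else 0) - (if a = j & b = i then 1 else 0)"
 shows "w = mat 1 \<or> w = - mat 1"
proof -
 have o: "(SUM b:UNIV. w $ b $ i * w $ b $ j) = (if i = j then 1 else 0)" for i j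
 proof -
  have "(transpose w ** w) $ i $ j = mat 1 $ i $ j" using w by (simp add: orthogonal_matrix_def)
  thus ?thesis by (simp add: matrix_matrix_mult_def transpose_def mat_def)
 qed
 \<comment> \<open>Contracting the minors with column j of w, and using orthogonality, isolates
   single entries of w.\<close>
 have 1: "w $ a $ i - (if i = j then 1 else 0) * w $ a $ j = (if a = i then w $ j $ j else 0) - (if a = j then w $ i $ j else 0)" for a i j
 proof -
  have "(SUM b:UNIV. (w $ a $ i * w $ b $ j - w $ a $ j * w $ b $ i) * w $ b $ j)
   = w $ a $ i * (SUM b:UNIV. w $ b $ j * w $ b $ j) - w $ a $ j * (SUM b:UNIV. w $ b $ i * w $ b $ j)"
   by (simp add: sum_distrib_left sum_subtractf algebra_simps)
  also have "... = w $ a $ i - (if i = j then 1 else 0) * w $ a $ j" unfolding o by simp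
  finally have "w $ a $ i - (if i = j then 1 else 0) * w $ a $ j = (SUM b:UNIV. (w $ a $ i * w $ b $ j - w $ a $ j * w $ b $ i) * w $ b $ j)" ..
  also have "... = (SUM b:UNIV. if b = j then (if a = i then w $ b $ j else 0) else 0) - (SUM b:UNIV. if b = i then (if a = j then w $ b $ j else 0) else 0)"
   unfolding minors left_diff_distrib sum_subtractf by (intro arg_cong2[of _ _ _ _ "(-)"] sum.cong refl) auto
  also have "... = (if a = i then w $ j $ j else 0) - (if a = j then w $ i $ j else 0)" by simp
  finally show ?thesis .
 qed
 have off: "w $ a $ i = 0" if "a ~= i" for a i
 proof -
  \<comment> \<open>This is where d >= 3 matters: for an index j different from a and i, the right
    side of \<open>1\<close> is 0.\<close>
  have "card {a, i} < CARD('n)" using card3 that by simp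
  then obtain j where "j \<notin> {a, i}" by (metis UNIV_I card_mono finite leD subsetI finite_class.finite_UNIV)
  thus ?thesis using 1[of a i j] that by auto
 qed
 have diag: "w $ i $ i = w $ j $ j" for i j
  using 1[of i i j] by (cases "i = j") auto
 have sq: "w $ i $ i * w $ i $ i = 1" for i
 proof -
  have "(SUM b:UNIV. w $ b $ i * w $ b $ i) = (SUM b:UNIV. if b = i then w $ i $ i * w $ i $ i else 0)"
   by (intro sum.cong refl) (auto simp: off)
  thus ?thesis using o[of i i] by simp
 qed
 show ?thesis
 proof (cases "w $ undefined $ undefined = 1")
  case True
  hence "w = mat 1" unfolding vec_eq_iff mat_def using off diag by (metis (mono_tags, lifting) vec_lambda_beta)
  thus ?thesis ..
 next
  case False
  hence "w $ undefined $ undefined = -1" using sq[of undefined] by (simp add: square_eq_1_iff)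
  hence "w $ i $ j = (- mat 1) $ i $ j" for i j using off[of i j] diag[of i undefined] by (auto simp: mat_def)
  hence "w = - mat 1" by (simp add: vec_eq_iff)
  thus ?thesis ..
 qed
qed

text \<open>Only the orbital parts raise the degree by 2. Spin parts and the degree lowering parts
  of T and \<open>rx\<close> drop out of the top degree.\<close>

lemma top_AA:
 assumes "ZZ z" "degle k (app z vac)"
 shows "app (Xo u * Yo v - Yo u * Xo v) (app (Ho k) (app z vac)) = app (rY v * rX u - rX v * rY u) (app (Ho k) (app z vac))"
proof -
 have 1: "tops 2 (AA u v) (Xo u * Yo v - Yo u * Xo v)"
 proof -
  have "tops 0 (sc (1/2) * (cl u * EE v + EE u * cl v - sc t * (cl u * cl v))) (sc (1/2) * (cl u * EE v + EE u * cl v - sc t * (cl u * cl v)))"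
   by (intro tops_mult_00 tops_add tops_diff tops_basic tops_EE)
  moreover have "tops 2 (Xo u * T v - T u * Xo v) (Xo u * Yo v - Yo u * Xo v)"
   by (intro tops_diff tops_mult_11 tops_basic)
  ultimately show ?thesis unfolding AA_def by (intro tops_add_lower) auto
 qed
 have 2: "tops 2 (rAA u v) (rY v * rX u - rX v * rY u)"
 proof -
  have "tops 0 (sc (1/2) * (rEE v * rcl u + rcl v * rEE u - sc t * (rcl v * rcl u))) (sc (1/2) * (rEE v * rcl u + rcl v * rEE u - sc t * (rcl v * rcl u)))"
   by (intro tops_mult_00 tops_add tops_diff tops_basic tops_EE)
  moreover have "tops 2 (rY v * rx u - rx v * rY u) (rY v * rX u - rX v * rY u)"
   by (intro tops_diff tops_mult_11 tops_basic)
  ultimately show ?thesis unfolding rAA_def by (intro tops_add_lower) auto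
 qed
 show ?thesis using 1 2 assms(2) ZZ_AA[OF assms(1), of u v] unfolding tops_def by metis
qed

text \<open>Two quadratic polynomials have the same product with a nonzero component, so they are
  equal, there being no zero divisors. Evaluated at pairs of axis vectors they give the 2 x 2 minors
  of 1 and of w.\<close>

lemma top_support:
 assumes "ZZ z" "degle k (app z vac)" "hcp k (lk (app z vac) w S) ~= 0"
 shows "w = mat 1 \<or> w = - mat 1" "w : W" "S <= {1..CARD('n)}"
proof -
 have "lk (app z vac) w S ~= 0" using assms(3) by auto
 thus w: "w : W" "S <= {1..CARD('n)}"
  using Alg_suppW[OF _ suppW_vac, of z] assms(1) by (auto simp: suppW_def ZZ_def)
 have *: "fx u * fy v - fy u * fx v = fy (cmat w *v v) * fx (cmat w *v u) - fx (cmat w *v v) * fy (cmat w *v u)" for u v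
 proof -
  have "(fx u * fy v - fy u * fx v) * hcp k (lk (app z vac) w S)
   = (fy (cmat w *v v) * fx (cmat w *v u) - fx (cmat w *v v) * fy (cmat w *v u)) * hcp k (lk (app z vac) w S)"
   using arg_cong[OF top_AA[OF assms(1,2), of u v], of "%F. lk F w S"] by (simp add: lk_simps algebra_simps)
  thus ?thesis using assms(3) by simp
 qed
 have cw: "(cmat w *v axis i 1) $ a = complex_of_real (w $ a $ i)" for i a
  by (simp add: matrix_vector_mult_def axis_def cmat_def if_distrib cong: if_cong)
 show "w = mat 1 \<or> w = - mat 1"
 proof (rule bivector_rigid[OF W_orth[OF w(1)]])
  fix i j a b
  have ax: "(axis a 1 :: complex^'n) $ i = (if a = i then 1 else 0)" for a i by (simp add: axis_def)
  have "(axis a 1 :: complex^'n) $ i * (axis b 1 :: complex^'n) $ j - (axis b 1 :: complex^'n) $ i * (axis a 1 :: complex^'n) $ j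
    = complex_of_real (w $ b $ j) * complex_of_real (w $ a $ i) - complex_of_real (w $ a $ j) * complex_of_real (w $ b $ i)"
   using arg_cong[OF *[of "axis i 1" "axis j 1"], of "%p. pev p (axis a 1, axis b 1)"] by (simp add: cw)
  hence "complex_of_real (w $ a $ i * w $ b $ j - w $ a $ j * w $ b $ i) = complex_of_real ((if a = i & b = j then 1 else 0) - (if a = j & b = i then 1 else 0))"
   unfolding ax by (cases "a = i"; cases "b = j"; cases "a = j"; cases "b = i"; simp add: mult.commute)
  thus "w $ a $ i * w $ b $ j - w $ a $ j * w $ b $ i = (if a = i & b = j then 1 else 0) - (if a = j & b = i then 1 else 0)"
   by (simp only: of_real_eq_iff)
 qed
qed

text \<open>Combined with \<open>top_support\<close>, this shows that a symbol has no component at a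
  reflection. Consequently divided differences do not enter the equations for the symbol at
  1.\<close>

lemma refl_not_pm1: assumes "al : R" shows "root_refl al ~= mat 1" "root_refl al ~= - mat 1"
proof -
 note nz = R_nz[OF assms]
 show "root_refl al ~= mat 1"
 proof
  assume "root_refl al = mat 1"
  hence "al = - al" using root_refl_self[OF nz] by simp
  hence "al $ i = - (al $ i)" for i by (metis vector_uminus_component)
  thus False using nz by (simp add: vec_eq_iff)
 qed
 show "root_refl al ~= - mat 1"
 proof
  assume m: "root_refl al = - mat 1"
  have "al $ i * al $ j = 0" if "i ~= j" for i j
   using arg_cong[OF m, of "%m. m $ i $ j"] that nz by (simp add: root_refl_nth mat_def)
  moreover obtain i where i: "al $ i ~= 0" using nz by (auto simp: vec_eq_iff)
  moreover obtain j where "j ~= i"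
  proof -
   have "card {i} < CARD('n)" using card3 by simp
   hence "\<exists>j. j \<notin> {i}" by (metis UNIV_I card_mono finite leD subsetI)
   thus ?thesis using that by blast
  qed
  ultimately have j: "al $ j = 0" by (metis mult_eq_0_iff)
  have "root_refl al $ j $ j = 1" unfolding root_refl_nth by (simp add: j)
  thus False unfolding m by (simp add: mat_def)
 qed
qed

end

lemma sg_split:
 assumes "T <= {1..d}"
 shows "sg {1..d} T = (if p : T then -1 else 1) * (sg {..<p} T * sg {p<..d} T)"
proof -
 have T: "finite T" using assms finite_subset by blast
 have 1: "T \<inter> {1..d} = (T \<inter> {p}) \<union> ((T \<inter> {..<p}) \<union> (T \<inter> {p<..d}))" using assms by (auto simp: not_less_iff_gr_or_eq)
 have "card (T \<inter> {1..d}) = card (T \<inter> {p}) + (card (T \<inter> {..<p}) + card (T \<inter> {p<..d}))"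
  unfolding 1 using T by (subst card_Un_disjoint; (subst card_Un_disjoint)?) auto
 thus ?thesis by (auto simp: sg_def power_add)
qed

lemma hcp_sum: "hcp k (sum f J) = (SUM j:J. hcp k (f j))"
 by (induction J rule: infinite_finite_induct) auto

lemma sg_cancel [simp]: "sg K S * (sg K S * x) = x"
 by (simp add: m_ass[symmetric])

lemma sg_nz [simp]: "sg K S ~= 0"
 by (simp add: sg_def)

section \<open>Differential equations satisfied by the symbol at the identity of W\<close>

context dunkl
begin

lemma hcp_0_const: "\<exists>k. hcp 0 p = pconst k"
 using Dd_all_zero_const[of "hcp 0 p"] by auto

lemma dq_const: "al ~= 0 ==> dqx al (pconst k) = 0" "al ~= 0 ==> dqy al (pconst k) = 0"
 by (auto intro!: dqx_I dqy_I)

lemma Tm_Ho_0: "Tm u * Ho 0 = 0" "rxm u * Ho 0 = 0"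
proof -
 have d0: "dqx al (hcp 0 p) = 0" "dqy al (hcp 0 p) = 0" if "al ~= 0" for al p
  using hcp_0_const[of p] dq_const[OF that] by auto
 have "Tc al * Ho 0 = 0" "rc u al * Ho 0 = 0" if "al ~= 0" for al
  by (rule op_eqI; simp add: that d0)+
 moreover have "Dxo u * Ho 0 = 0" "rD u * Ho 0 = 0" by (rule op_eqI; simp)+
 ultimately show "Tm u * Ho 0 = 0" "rxm u * Ho 0 = 0"
  unfolding Tm_def2 rxm_def2 by (simp_all add: left_diff_distrib sum_distrib_right m_ass R_nz)
qed

text \<open>One factor raises the degree by one and the other lowers it. If the lowering factor acts
  first, degree 0 is separate and needs that lowering parts kill constants.\<close>

lemma Ho_bal: "Ho k * (Xo u * Tm v) = Xo u * Tm v * Ho k" "Ho k * (Tm v * Xo u) = Tm v * Xo u * Ho k"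
 "Ho k * (Yo u * Tm v) = Yo u * Tm v * Ho k" "Ho k * (Tm v * Yo u) = Tm v * Yo u * Ho k"
 "Ho k * (rX u * rxm v) = rX u * rxm v * Ho k" "Ho k * (rxm v * rX u) = rxm v * rX u * Ho k"
 "Ho k * (rY u * rxm v) = rY u * rxm v * Ho k" "Ho k * (rxm v * rY u) = rxm v * rY u * Ho k"
proof -
 have A: "Ho k * (a * b) = a * b * Ho k" "Ho k * (b * a) = b * a * Ho k"
  if a: "!!j. Ho (Suc j) * a = a * Ho j" "Ho 0 * a = 0" and b: "!!j. Ho j * b = b * Ho (Suc j)" "b * Ho 0 = 0" for a b :: "'n op"
 proof -
  show "Ho k * (a * b) = a * b * Ho k"
  proof (cases k)
   case 0
   thus ?thesis using a(2) b(2) by (metis m_ass mult_zero_left mult_zero_right)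
  next
   case (Suc j)
   thus ?thesis using a(1) b(1) by (metis m_ass)
  qed
  show "Ho k * (b * a) = b * a * Ho k" using a(1) b(1) by (metis m_ass)
 qed
 show "Ho k * (Xo u * Tm v) = Xo u * Tm v * Ho k" "Ho k * (Tm v * Xo u) = Tm v * Xo u * Ho k"
  "Ho k * (Yo u * Tm v) = Yo u * Tm v * Ho k" "Ho k * (Tm v * Yo u) = Tm v * Yo u * Ho k"
  "Ho k * (rX u * rxm v) = rX u * rxm v * Ho k" "Ho k * (rxm v * rX u) = rxm v * rX u * Ho k"
  "Ho k * (rY u * rxm v) = rY u * rxm v * Ho k" "Ho k * (rxm v * rY u) = rxm v * rY u * Ho k"
  by (rule A; simp add: Ho_shift Ho_Tm Tm_Ho_0)+
qed

text \<open>Divided differences carry the component at s_\<alpha> to the one at 1. Without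
  components at reflections, the component at 1 therefore sees Dunkl operators as plain
  derivatives.\<close>

definition nice :: "'n M => bool" where "nice G \<longleftrightarrow> (ALL al:R. \<forall>S. lk G (root_refl al) S = 0)"

lemma lk_cl: "lk (app (cl v) H) w S = (SUM p:{1..CARD('n)}. pconst (pairing v (cvec (y p))) * (pconst (sg {..<p} S) * lk H w (sd S p)))"
 "lk (app (rcl v) H) w S = (SUM p:{1..CARD('n)}. pconst (pairing v (cvec (y p))) * (pconst (sg {p<..CARD('n)} S) * lk H w (sd S p)))"
 unfolding cl_def rcl_def by (simp_all add: lk_simps del: pc_pc)

lemma nice_ops: "nice G ==> nice (app (Xo u) G)" "nice G ==> nice (app (Yo u) G)" "nice G ==> nice (app (rX u) G)" "nice G ==> nice (app (rY u) G)"
 "nice G ==> nice (app (cl v) G)" "nice G ==> nice (app (rcl v) G)"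
 unfolding nice_def by (simp_all add: lk_cl)

lemma dq_0 [simp]: "al ~= 0 ==> dqx al 0 = 0" "al ~= 0 ==> dqy al 0 = 0"
 using dq_const[of al 0] by (simp_all add: pconst_simps)

lemma lk_Tm: "nice G ==> lk (app (Tm u) G) (mat 1) S = pconst t * Dd (u, 0) (lk G (mat 1) S)"
 "nice G ==> lk (app (rxm u) G) (mat 1) S = pconst t * Dd (0, u) (lk G (mat 1) S)"
 unfolding Tm_def2 rxm_def2 nice_def by (simp_all add: lk_simps lk_refl R_nz)

lemma lk_EE: "nice G ==> lk (app (EE u) G) (mat 1) S = pconst t * lk (app (cl u) G) (mat 1) S"
 "nice G ==> lk (app (rEE u) G) (mat 1) S = pconst t * lk (app (rcl u) G) (mat 1) S"
proof -
 assume G: "nice G"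
 show "lk (app (EE u) G) (mat 1) S = pconst t * lk (app (cl u) G) (mat 1) S"
  using nice_ops(5)[OF G] unfolding EE_def nice_def by (simp add: lk_simps lk_refl R_nz)
 have "lk (app (rcl (cvec al)) (app (rg (root_refl al)) G)) (mat 1) S = 0" if "al : R" for al
  using G that unfolding nice_def by (simp add: lk_cl lk_refl R_nz)
 thus "lk (app (rEE u) G) (mat 1) S = pconst t * lk (app (rcl u) G) (mat 1) S"
  unfolding rEE_def by (simp add: lk_simps)
qed

lemma nice_top:
 assumes "ZZ z" "degle k (app z vac)" shows "nice (app (Ho k) (app z vac))"
 unfolding nice_def
proof (intro ballI allI)
 fix al S assume a: "al : R"
 show "lk (app (Ho k) (app z vac)) (root_refl al) S = 0"
  using top_support(1)[OF assms, of "root_refl al" S] refl_not_pm1[OF a] by auto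
qed

abbreviation "smb k z S == hcp k (lk (app z vac) (mat 1) S)"
abbreviation "fxp p == fx (cvec (y p))"
abbreviation "fyp p == fy (cvec (y p))"
abbreviation "Dxp p == Dd (cvec (y p), 0)"
abbreviation "Dyp p == Dd (0, cvec (y p))"

lemma Ho_app: "Ho k * a = a * Ho k ==> hcp k (lk (app a F) w S) = lk (app a (app (Ho k) F)) w S"
 by (metis app_simps(4) lk_diag(7))

lemma pconst_cancel: "pconst k * p = 0 ==> k ~= 0 ==> p = 0"
proof -
 assume "pconst k * p = 0" "k ~= 0"
 moreover have "pconst (1 / k) * (pconst k * p) = p" if "k ~= 0" using that by simp
 ultimately show ?thesis by (metis mult_zero_right)
qed

text \<open>At w = 1 multiplying by x twice gives the same from the left and from the right, so
  these terms cancel in the relation with \<open>XX * XX\<close>. In degree k the mixed terms give 2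
  t times the sum of x_p d/dy_p, and the terms lowering the degree by 2 act on a vanishing
  component. The relation with \<open>YY * YY\<close> is treated in the same way.\<close>

lemma sym_sl2:
 assumes z: "ZZ z" "degle k (app z vac)"
 shows "(SUM p:{1..CARD('n)}. fxp p * Dyp p (smb k z S)) = 0" "(SUM p:{1..CARD('n)}. fyp p * Dxp p (smb k z S)) = 0"
proof -
 let ?F = "app z vac" and ?G = "app (Ho k) (app z vac)" and ?I = "{1..CARD('n)}" and ?y = "%p. cvec (y p)"
 note n = nice_top[OF z]
 have pc2: "pconst (2 * t) * q = pconst t * q + pconst t * q" for q :: "'n pfun"
  by (simp only: mult_2 pconst_simps(3) distrib_right)
 have hi: "app (Ho (Suc (Suc k))) ?F = 0" using z(2) by (simp add: degle_def)
 have "(SUM p:?I. lk (app (Xo (?y p) * Xo (?y p)) ?F) (mat 1) S) = (SUM p:?I. lk (app (rx (?y p) * rx (?y p)) ?F) (mat 1) S)"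
  using arg_cong[OF ZZ_even(1)[OF z(1)], of "%F. lk F (mat 1) S"] unfolding XX_sq by (simp add: lk_simps)
 hence "(SUM p:?I. lk (app (rX (?y p) * rxm (?y p)) ?F) (mat 1) S + lk (app (rxm (?y p) * rX (?y p)) ?F) (mat 1) S) + (SUM p:?I. lk (app (rxm (?y p) * rxm (?y p)) ?F) (mat 1) S) = 0"
  unfolding T_split by (simp add: lk_simps sum.distrib distrib_left add_ac)
 from arg_cong[OF this, of "hcp k"]
 have "(SUM p:?I. hcp k (lk (app (rX (?y p) * rxm (?y p)) ?F) (mat 1) S) + hcp k (lk (app (rxm (?y p) * rX (?y p)) ?F) (mat 1) S)) + (SUM p:?I. hcp k (lk (app (rxm (?y p) * rxm (?y p)) ?F) (mat 1) S)) = 0"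
  by (simp only: hcp_simps hcp_sum)
 moreover have "hcp k (lk (app (rxm (?y p) * rxm (?y p)) ?F) (mat 1) S) = 0" for p
 proof -
  have "Ho k * (rxm (?y p) * rxm (?y p)) = rxm (?y p) * rxm (?y p) * Ho (Suc (Suc k))"
   by (simp only: m_ass[symmetric] Ho_Tm) (simp only: m_ass Ho_Tm)
  hence "app (Ho k) (app (rxm (?y p) * rxm (?y p)) ?F) = 0" using hi by (metis app_simps(4) app_0)
  thus ?thesis by (metis lk_diag(7) lookup_zero)
 qed
 ultimately have "(SUM p:?I. lk (app (rX (?y p) * rxm (?y p)) ?G) (mat 1) S + lk (app (rxm (?y p) * rX (?y p)) ?G) (mat 1) S) = 0"
  by (simp only: Ho_app[OF Ho_bal(5)] Ho_app[OF Ho_bal(6)] sum.neutral_const add_0_right)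
 moreover have "lk (app (rX (?y p) * rxm (?y p)) ?G) (mat 1) S + lk (app (rxm (?y p) * rX (?y p)) ?G) (mat 1) S = pconst (2 * t) * (fxp p * Dyp p (smb k z S))" for p
  using n by (simp add: lk_Tm nice_ops Dd_mult pconst_simps(1) pc2 mult.left_commute)
 ultimately have "pconst (2 * t) * (SUM p:?I. fxp p * Dyp p (smb k z S)) = 0" by (simp only: sum_distrib_left)
 thus "(SUM p:?I. fxp p * Dyp p (smb k z S)) = 0" by (rule pconst_cancel) (use t0 in simp)
 have "(SUM p:?I. lk (app (T (?y p) * T (?y p)) ?F) (mat 1) S) = (SUM p:?I. lk (app (rY (?y p) * rY (?y p)) ?F) (mat 1) S)"
  using arg_cong[OF ZZ_even(2)[OF z(1)], of "%F. lk F (mat 1) S"] unfolding XX_sq by (simp add: lk_simps)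
 hence "(SUM p:?I. lk (app (Yo (?y p) * Tm (?y p)) ?F) (mat 1) S + lk (app (Tm (?y p) * Yo (?y p)) ?F) (mat 1) S) + (SUM p:?I. lk (app (Tm (?y p) * Tm (?y p)) ?F) (mat 1) S) = 0"
  unfolding T_split by (simp add: lk_simps sum.distrib distrib_left add_ac)
 from arg_cong[OF this, of "hcp k"]
 have "(SUM p:?I. hcp k (lk (app (Yo (?y p) * Tm (?y p)) ?F) (mat 1) S) + hcp k (lk (app (Tm (?y p) * Yo (?y p)) ?F) (mat 1) S)) + (SUM p:?I. hcp k (lk (app (Tm (?y p) * Tm (?y p)) ?F) (mat 1) S)) = 0"
  by (simp only: hcp_simps hcp_sum)
 moreover have "hcp k (lk (app (Tm (?y p) * Tm (?y p)) ?F) (mat 1) S) = 0" for p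
 proof -
  have "Ho k * (Tm (?y p) * Tm (?y p)) = Tm (?y p) * Tm (?y p) * Ho (Suc (Suc k))"
   by (simp only: m_ass[symmetric] Ho_Tm) (simp only: m_ass Ho_Tm)
  hence "app (Ho k) (app (Tm (?y p) * Tm (?y p)) ?F) = 0" using hi by (metis app_simps(4) app_0)
  thus ?thesis by (metis lk_diag(7) lookup_zero)
 qed
 ultimately have "(SUM p:?I. lk (app (Yo (?y p) * Tm (?y p)) ?G) (mat 1) S + lk (app (Tm (?y p) * Yo (?y p)) ?G) (mat 1) S) = 0"
  by (simp only: Ho_app[OF Ho_bal(3)] Ho_app[OF Ho_bal(4)] sum.neutral_const add_0_right)
 moreover have "lk (app (Yo (?y p) * Tm (?y p)) ?G) (mat 1) S + lk (app (Tm (?y p) * Yo (?y p)) ?G) (mat 1) S = pconst (2 * t) * (fyp p * Dxp p (smb k z S))" for p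
  using n by (simp add: lk_Tm nice_ops Dd_mult pconst_simps(1) pc2 mult.left_commute)
 ultimately have "pconst (2 * t) * (SUM p:?I. fyp p * Dxp p (smb k z S)) = 0" by (simp only: sum_distrib_left)
 thus "(SUM p:?I. fyp p * Dxp p (smb k z S)) = 0" by (rule pconst_cancel) (use t0 in simp)
qed

text \<open>Left minus right multiplication by e_i e_j: the coefficient with which the component at
  \<open>sd (sd S i) j\<close> enters the component at S of this commutator.\<close>

definition kap :: "nat => nat => nat set => complex" where
 "kap i j S = sg {..<i} S * sg {..<j} (sd S i) - sg {j<..CARD('n)} S * sg {i<..CARD('n)} (sd S j)"

text \<open>The relation with \<open>AA\<close> in degree k: the infinitesimal rotation of both
  points plus half a Clifford commutator. Since the latter has constant coefficients, rotations act
  on the family of components by constant matrices.\<close>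

lemma sym_so:
 assumes z: "ZZ z" "degle k (app z vac)" and ij: "i : {1..CARD('n)}" "j : {1..CARD('n)}" "i ~= j"
 shows "fxp i * Dxp j (smb k z S) - fxp j * Dxp i (smb k z S) + fyp i * Dyp j (smb k z S) - fyp j * Dyp i (smb k z S)
  = pconst (- kap i j S / 2) * smb k z (sd (sd S i) j)"
proof -
 let ?F = "app z vac" and ?G = "app (Ho k) (app z vac)"
 define u v where "u = cvec (y i)" and "v = cvec (y j)"
 define B where "B = sc (1/2) * (cl u * EE v + EE u * cl v - sc t * (cl u * cl v))"
 define rB where "rB = sc (1/2) * (rEE v * rcl u + rcl v * rEE u - sc t * (rcl v * rcl u))"
 note n = nice_top[OF z]
 have "lk (app (AA u v) ?F) (mat 1) S = lk (app (rAA u v) ?F) (mat 1) S"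
  using ZZ_AA[OF z(1), of u v] by simp
 hence "lk (app (Xo u * Tm v) ?F) (mat 1) S - lk (app (Tm u * Xo v) ?F) (mat 1) S + lk (app B ?F) (mat 1) S
  = lk (app (rY v * rxm u) ?F) (mat 1) S - lk (app (rxm v * rY u) ?F) (mat 1) S + lk (app rB ?F) (mat 1) S"
  unfolding AA_def rAA_def B_def[symmetric] rB_def[symmetric] T_split
  by (simp add: lk_simps distrib_left algebra_simps)
 from arg_cong[OF this, of "hcp k"]
 have M: "lk (app (Xo u * Tm v) ?G) (mat 1) S - lk (app (Tm u * Xo v) ?G) (mat 1) S + lk (app B ?G) (mat 1) S
  = lk (app (rY v * rxm u) ?G) (mat 1) S - lk (app (rxm v * rY u) ?G) (mat 1) S + lk (app rB ?G) (mat 1) S"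
 proof -
  have "Ho k * B = B * Ho k" "Ho k * rB = rB * Ho k"
  proof -
   have c1: "Ho k * (a + b) = (a + b) * Ho k" "Ho k * (a - b) = (a - b) * Ho k" "Ho k * (a * b) = a * b * Ho k"
    if "Ho k * a = a * Ho k" "Ho k * b = b * Ho k" for a b :: "'n op"
    using that by (simp_all add: add_dists diff_dists) (metis m_ass)
   show "Ho k * B = B * Ho k" "Ho k * rB = rB * Ho k" unfolding B_def rB_def
    by (intro c1 Ho_EE Ho_shift(18) cl_comm(4)[symmetric])+
  qed
  from Ho_app[OF this(1), of ?F] Ho_app[OF this(2), of ?F] show ?thesis
   using \<open>hcp k _ = hcp k _\<close> by (simp add: Ho_app[OF Ho_bal(1)] Ho_app[OF Ho_bal(2)] Ho_app[OF Ho_bal(7)] Ho_app[OF Ho_bal(8)] del: app_simps)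
 qed
 have uv: "pairing u v = 0" "pairing v u = 0" using ij by (auto simp: u_def v_def onb_delta)
 have b: "lk (app B ?G) (mat 1) S = pconst (t / 2) * lk (app (cl u) (app (cl v) ?G)) (mat 1) S"
 proof -
  have "lk (app (cl u) (app (EE v) ?G)) (mat 1) S = pconst t * lk (app (cl u) (app (cl v) ?G)) (mat 1) S"
   by (simp add: lk_cl(1)[of u] lk_EE[OF n] sum_distrib_left mult_ac del: pc_pc)
  thus ?thesis unfolding B_def
   by (simp add: lk_simps lk_EE nice_ops n distrib_left right_diff_distrib)
 qed
 have rb: "lk (app rB ?G) (mat 1) S = pconst (t / 2) * lk (app (rcl v) (app (rcl u) ?G)) (mat 1) S"
 proof -
  have "lk (app (rcl v) (app (rEE u) ?G)) (mat 1) S = pconst t * lk (app (rcl v) (app (rcl u) ?G)) (mat 1) S"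
   by (simp add: lk_cl(2)[of v] lk_EE[OF n] sum_distrib_left mult_ac del: pc_pc)
  thus ?thesis unfolding rB_def
   by (simp add: lk_simps lk_EE nice_ops n distrib_left right_diff_distrib)
 qed
 have c: "lk (app (cl u) (app (cl v) ?G)) (mat 1) S = pconst (sg {..<i} S * sg {..<j} (sd S i)) * smb k z (sd (sd S i) j)"
  using ij by (simp add: u_def v_def cl_y)
 have rc0: "lk (app (rcl v) (app (rcl u) ?G)) (mat 1) S = pconst (sg {j<..CARD('n)} S * sg {i<..CARD('n)} (sd S j)) * smb k z (sd (sd S i) j)"
  using ij by (simp add: u_def v_def rcl_y sd_commute[of S j i])
 have x1: "lk (app (Xo u * Tm v) ?G) (mat 1) S = pconst t * (fx u * Dd (v, 0) (smb k z S))"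
  by (simp add: lk_Tm n mult.left_commute)
 have x2: "lk (app (Tm u * Xo v) ?G) (mat 1) S = pconst t * (fx v * Dd (u, 0) (smb k z S))"
  using uv by (simp add: lk_Tm nice_ops n Dd_mult pconst_simps(1))
 have y1: "lk (app (rY v * rxm u) ?G) (mat 1) S = pconst t * (fy v * Dd (0, u) (smb k z S))"
  by (simp add: lk_Tm n mult.left_commute)
 have y2: "lk (app (rxm v * rY u) ?G) (mat 1) S = pconst t * (fy u * Dd (0, v) (smb k z S))"
  using uv by (simp add: lk_Tm nice_ops n Dd_mult pconst_simps(1))
 have m: "pconst t * (pconst (kap i j S / 2) * h) = pconst (t / 2) * (pconst (sg {..<i} S * sg {..<j} (sd S i)) * h)
   - pconst (t / 2) * (pconst (sg {j<..CARD('n)} S * sg {i<..CARD('n)} (sd S j)) * h)" for h :: "'n pfun"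
  unfolding kap_def pc_pc left_diff_distrib[symmetric] pconst_simps(6)[symmetric]
  by (simp add: right_diff_distrib diff_divide_distrib)
 have lin: "x1 - x2 + p = y1 - y2 + q ==> x1 - x2 + y2 - y1 + (p - q) = 0" for x1 x2 y1 y2 p q :: "'n pfun"
  by (simp add: algebra_simps)
 have e: "pconst t * (fx u * Dd (v, 0) (smb k z S) - fx v * Dd (u, 0) (smb k z S) + fy u * Dd (0, v) (smb k z S) - fy v * Dd (0, u) (smb k z S)
   + pconst (kap i j S / 2) * smb k z (sd (sd S i) j)) = 0"
  unfolding distrib_left right_diff_distrib m
  by (rule lin) (use M in \<open>simp only: x1 x2 y1 y2 b rb c rc0\<close>)
 show ?thesis using pconst_cancel[OF e t0] unfolding u_def v_def by (simp add: eq_neg_iff_add_eq_0)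
qed

text \<open>At (y_1, y_2) the leading parts of \<open>XX\<close> and \<open>YY\<close> become e_1
  and e_2, so the value of the symbol there supercommutes with both. A monomial e_S containing e_1
  or e_2 violates this.\<close>

lemma sym_p0:
 assumes z: "ZZ z" "degle k (app z vac)" and S: "S <= {1..CARD('n)}"
 shows "1 : S ==> pev (smb k z S) (cvec (y 1), cvec (y 2)) = 0" "2 : S ==> pev (smb k z S) (cvec (y 1), cvec (y 2)) = 0"
proof -
 let ?F = "app z vac" and ?G = "app (Ho k) (app z vac)" and ?I = "{1..CARD('n)}" and ?y = "%p. cvec (y p)"
 have par: "tops 0 par par" by (rule tops_0I) (simp add: Ho_shift)
 have p: "tops 1 (XX * par) (XX * par)" "tops 1 (YY * par) ((SUM p:?I. Yo (?y p) * cl (?y p)) * par)"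
  unfolding XX_def YY_def
  by (rule tops_mult_10[OF tops_sum[OF tops_mult_10[OF tops_basic(1) tops_basic(9)]] par],
    rule tops_mult_10[OF tops_sum[OF tops_mult_10[OF tops_basic(3) tops_basic(9)]] par])
 have q: "tops 1 (SUM p:?I. re p * rx (?y p)) (SUM p:?I. re p * rX (?y p))" "tops 1 (SUM p:?I. re p * rY (?y p)) (SUM p:?I. re p * rY (?y p))"
  by (rule tops_sum[OF tops_mult_01[OF tops_basic(11) tops_basic(6)]], rule tops_sum[OF tops_mult_01[OF tops_basic(11) tops_basic(5)]])
 have tt: "tops 1 a a' ==> tops 1 b b' ==> app a ?F = app b ?F ==> app a' ?G = app b' ?G" for a a' b b'
  using z(2) unfolding tops_def by fastforce
 have X: "app (XX * par) ?G = app (SUM p:?I. re p * rX (?y p)) ?G"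
  by (rule tt[OF p(1) q(1)]) (simp only: app_simps(4) ZZ_odd(1)[OF z(1)])
 have Y: "app ((SUM p:?I. Yo (?y p) * cl (?y p)) * par) ?G = app (SUM p:?I. re p * rY (?y p)) ?G"
  by (rule tt[OF p(2) q(2)]) (simp only: app_simps(4) ZZ_odd(2)[OF z(1)])
 \<comment> \<open>The two terms do not cancel: the total sign of S also counts the factor e_i
   itself, which makes the subtracted product the negative of the first sign.\<close>
 have nz: "sg {i<..CARD('n)} (sd S i) - sg {..<i} (sd S i) * sg ?I S ~= 0" if "i : S" for i
  using that by (simp add: sg_sd sg_split[OF S, of i])
 have I: "1 : ?I" "2 : ?I" using card3 by auto
 have ps: "(SUM p:?I. pairing (?y q) (?y p) * h p) = h q" if "q : ?I" for q and h :: "nat => complex"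
 proof -
  have "(SUM p:?I. pairing (?y q) (?y p) * h p) = (SUM p:?I. if p = q then h p else 0)"
   by (intro sum.cong refl) (use that in \<open>auto simp: onb_delta\<close>)
  thus ?thesis using that by simp
 qed
 note ml = mult.left_commute[of "sg _ _" "pairing _ _"]
 show "pev (smb k z S) (?y 1, ?y 2) = 0" if "1 : S"
 proof -
  have "pev (lk (app (XX * par) ?G) (mat 1) (sd S 1)) (?y 1, ?y 2) = sg {..<1} (sd S 1) * (sg ?I S * pev (smb k z S) (?y 1, ?y 2))"
   unfolding XX_def using ps[OF I(1)] by (simp add: lk_simps cl_y)
  moreover have "pev (lk (app (SUM p:?I. re p * rX (?y p)) ?G) (mat 1) (sd S 1)) (?y 1, ?y 2) = sg {1<..CARD('n)} (sd S 1) * pev (smb k z S) (?y 1, ?y 2)"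
   using ps[OF I(1)] by (simp add: lk_simps ml)
  ultimately have "(sg {1<..CARD('n)} (sd S 1) - sg {..<1} (sd S 1) * sg ?I S) * pev (smb k z S) (?y 1, ?y 2) = 0"
   using X I by (simp add: left_diff_distrib m_ass)
  thus ?thesis using nz[OF that] by simp
 qed
 show "pev (smb k z S) (?y 1, ?y 2) = 0" if "2 : S"
 proof -
  have "pev (lk (app ((SUM p:?I. Yo (?y p) * cl (?y p)) * par) ?G) (mat 1) (sd S 2)) (?y 1, ?y 2) = sg {..<2} (sd S 2) * (sg ?I S * pev (smb k z S) (?y 1, ?y 2))"
   using ps[OF I(2)] by (simp add: lk_simps cl_y)
  moreover have "pev (lk (app (SUM p:?I. re p * rY (?y p)) ?G) (mat 1) (sd S 2)) (?y 1, ?y 2) = sg {2<..CARD('n)} (sd S 2) * pev (smb k z S) (?y 1, ?y 2)"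
   using ps[OF I(2)] by (simp add: lk_simps ml)
  ultimately have "(sg {2<..CARD('n)} (sd S 2) - sg {..<2} (sd S 2) * sg ?I S) * pev (smb k z S) (?y 1, ?y 2) = 0"
   using Y I by (simp add: left_diff_distrib m_ass)
  thus ?thesis using nz[OF that] by simp
 qed
qed

end

section \<open>Rigidity: the family of symbols is fixed by its value at one point\<close>

section \<open>Invariant polynomials are determined by one value\<close>

text \<open>The complex span of all r-th order derivatives of the members of
  \<open>g\<close>.\<close>

inductive dspan :: "('i => 'n::finite pfun) => nat => 'n pfun => bool" for g where
 base: "dspan g 0 (g i)"
| zero: "dspan g r 0"
| add: "dspan g r p ==> dspan g r q ==> dspan g r (p + q)"
| mult: "dspan g r p ==> dspan g r (pconst k * p)"
| der: "dspan g r p ==> dspan g (Suc r) (Dd h p)"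

text \<open>The bracket with a constant derivation is again one, as for vector fields with affine
  coefficients. Such operators preserve spans of derivatives of fixed order.\<close>

definition vfield :: "('n::finite pfun => 'n pfun) => bool" where
 "vfield X \<longleftrightarrow> plin X & (\<forall>h. \<exists>h'. \<forall>p. Dd h (X p) = X (Dd h p) + Dd h' p)"

lemma vfield_dspan:
 assumes X: "vfield X" and g: "!!i. dspan g 0 (X (g i))" shows "dspan g r p ==> dspan g r (X p)"
proof (induction rule: dspan.induct)
 case (zero r)
 thus ?case using X plin_0[of X] by (simp add: vfield_def dspan.zero)
next
 case (der r p h)
 obtain h' where "Dd h (X p) = X (Dd h p) + Dd h' p" using X unfolding vfield_def by blast
 hence "X (Dd h p) = Dd h (X p) + pconst (-1) * Dd h' p" by simp
 thus ?case using der dspan.intros by metis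
qed (use X g in \<open>auto simp: vfield_def plin_def intro: dspan.intros\<close>)

text \<open>Induction on the degree: all first derivatives vanish by the induction hypothesis, so q
  is the constant q(a), which is 0.\<close>

lemma vanish_taylor:
 assumes "!!q h. C q ==> C (Dd h q)" "!!q. C q ==> pev q a = 0" "C q" shows "q = 0"
proof -
 have "\<forall>j\<ge>N. hcp j q = 0 ==> C q ==> q = 0" for N
 proof (induction N arbitrary: q)
  case 0
  thus ?case using hcp_all_0 by blast
 next
  case (Suc N)
  have "Dd h q = 0" for h
   by (rule Suc.IH) (use Suc.prems assms in \<open>auto simp: hcp_Dd\<close>)
  hence "q = pconst (pev q a)" by (rule Dd_all_zero_const)
  thus ?case using assms(2)[OF Suc.prems(2)] by (simp add: pconst_simps)
 qed
 moreover obtain N where "\<forall>j>N. hcp j q = 0" using hcp_bounded by blast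
 ultimately show ?thesis using assms(3) by (metis Suc_le_lessD)
qed

text \<open>If the vector fields \<open>XS\<close> span the tangent space at \<open>a\<close> and act on the family \<open>g\<close> by
 constant matrices, all derivatives of \<open>g\<close> at \<open>a\<close> are determined by its values there.\<close>

lemma vanish_of_vfields:
 assumes XS: "!!X. X : XS ==> vfield X" "!!X i. X : XS ==> dspan g 0 (X (g i))"
  and span: "!!h q. (!!X. X : XS ==> pev (X q) a = 0) ==> pev (Dd h q) a = 0"
  and g: "!!i. pev (g i) a = 0"
 shows "g i = 0"
proof -
 have "dspan g r q ==> pev q a = 0" for r q
 proof (induction r arbitrary: q)
  case 0
  have "dspan g r q ==> r = 0 ==> pev q a = 0" for r q
   by (induction rule: dspan.induct) (auto simp: g)
  thus ?case using 0 by blast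
 next
  case (Suc r)
  have "dspan g r' q ==> r' = Suc r ==> pev q a = 0" for r' q
  proof (induction rule: dspan.induct)
   case (der r'' p h)
   \<comment> \<open>X p is again a combination of derivatives of order r, hence vanishes at a. As
     the fields span the tangent space at a, every first derivative of p vanishes there as
     well.\<close>
   have "pev (X p) a = 0" if "X : XS" for X
    using Suc.IH vfield_dspan[OF XS(1)[OF that] XS(2)[OF that]] der by blast
   thus ?case by (rule span)
  qed (auto simp: g)
  thus ?case using Suc.prems by blast
 qed
 thus ?thesis
  by (intro vanish_taylor[of "%q. \<exists>r. dspan g r q" a]) (blast intro: dspan.intros)+
qed

lemma vfield_mono:
 assumes "!!h. \<exists>k. Dd h l = pconst k" shows "vfield (%p. l * Dd d p)"
 unfolding vfield_def
proof (intro conjI allI)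
 show "plin (%p. l * Dd d p)" by simp
 fix h
 obtain k where "Dd h l = pconst k" using assms by blast
 thus "\<exists>h'. \<forall>p. Dd h (l * Dd d p) = l * Dd d (Dd h p) + Dd h' p"
  by (intro exI[of _ "(k *s fst d, k *s snd d)"]) (simp add: Dd_mult Dd_dir Dd_commute[of h d])
qed

lemma vfield_fx: "vfield (%p. fx u * Dd d p)" "vfield (%p. fy u * Dd d p)"
 by (rule vfield_mono; auto)+

lemma vfield_add: assumes "vfield X" "vfield Y" shows "vfield (%p. X p + Y p)"
 unfolding vfield_def
proof (intro conjI allI)
 show "plin (%p. X p + Y p)" using assms by (simp add: plin_def vfield_def algebra_simps)
 fix h
 obtain a b where "!!p. Dd h (X p) = X (Dd h p) + Dd a p" "!!p. Dd h (Y p) = Y (Dd h p) + Dd b p"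
  using assms unfolding vfield_def by blast
 thus "\<exists>h'. \<forall>p. Dd h (X p + Y p) = X (Dd h p) + Y (Dd h p) + Dd h' p"
  by (intro exI[of _ "(fst a + fst b, snd a + snd b)"]) (simp add: Dd_add Dd_dir)
qed

lemma vfield_minus: assumes "vfield X" shows "vfield (%p. - X p)"
 unfolding vfield_def
proof (intro conjI allI)
 show "plin (%p. - X p)" using assms by (simp add: plin_def vfield_def)
 fix h
 obtain a where "!!p. Dd h (X p) = X (Dd h p) + Dd a p" using assms unfolding vfield_def by blast
 thus "\<exists>h'. \<forall>p. Dd h (- X p) = - X (Dd h p) + Dd h' p"
  using Dd_dir(2)[of "-1" a] by (intro exI[of _ "(-1 *s fst a, -1 *s snd a)"]) (simp add: Dd_minus)
qed

lemma vfield_diff: "vfield X ==> vfield Y ==> vfield (%p. X p - Y p)"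
 using vfield_add[OF _ vfield_minus, of X Y] by simp

lemma vfield_zero: "vfield (%p. 0)"
 unfolding vfield_def
proof (intro conjI allI)
 show "\<exists>h'. \<forall>p. Dd h 0 = 0 + Dd h' p" for h by (intro exI[of _ "(0, 0)"]) (simp add: Dd_dir)
qed (simp add: plin_def)

lemma vfield_sum: "(!!i. i : J ==> vfield (X i)) ==> vfield (%p. SUM i:J. X i p)"
proof (induction J rule: infinite_finite_induct)
 case (insert x F)
 thus ?case using vfield_add[of "X x" "%p. SUM i:F. X i p"] by simp
qed (simp_all add: vfield_zero)

context dunkl
begin

text \<open>The x part and the y part are linearly independent, so that sl2, the Euler field and the
  rotations together span the tangent space at this point.\<close>

abbreviation "p0 == (cvec (y 1), cvec (y 2))"

definition XD :: "'n pfun => 'n pfun" where "XD p = (SUM i:{1..CARD('n)}. fxp i * Dyp i p)"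
definition YD :: "'n pfun => 'n pfun" where "YD p = (SUM i:{1..CARD('n)}. fyp i * Dxp i p)"
definition HD :: "'n pfun => 'n pfun" where "HD p = (SUM i:{1..CARD('n)}. fxp i * Dxp i p - fyp i * Dyp i p)"
definition EU :: "'n pfun => 'n pfun" where "EU p = (SUM i:{1..CARD('n)}. fxp i * Dxp i p + fyp i * Dyp i p)"
definition LL :: "nat => nat => 'n pfun => 'n pfun" where
 "LL i j p = fxp i * Dxp j p - fxp j * Dxp i p + fyp i * Dyp j p - fyp j * Dyp i p"

lemma vfields: "vfield XD" "vfield YD" "vfield HD" "vfield EU" "vfield (LL i j)"
 unfolding XD_def[abs_def] YD_def[abs_def] HD_def[abs_def] EU_def[abs_def] LL_def[abs_def]
 by (intro vfield_sum vfield_add vfield_diff vfield_fx)+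

lemma psum: "q : {1..CARD('n)} ==> (SUM p:{1..CARD('n)}. pairing (cvec (y q)) (cvec (y p)) * h p) = h q"
proof -
 assume q: "q : {1..CARD('n)}"
 have "(SUM p:{1..CARD('n)}. pairing (cvec (y q)) (cvec (y p)) * h p) = (SUM p:{1..CARD('n)}. if p = q then h p else 0)"
  by (intro sum.cong refl) (use q in \<open>auto simp: onb_delta\<close>)
 thus ?thesis using q by simp
qed

text \<open>The torus field thus kills whatever \<open>XD\<close> and \<open>YD\<close>
  kill.\<close>

lemma HD_eq: "HD p = XD (YD p) - YD (XD p)"
proof -
 let ?I = "{1..CARD('n)}"
 have "XD (YD p) = (SUM i:?I. SUM j:?I. fxp i * (pconst (pairing (cvec (y i)) (cvec (y j))) * Dxp j p + fyp j * Dyp i (Dxp j p)))"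
  unfolding XD_def YD_def by (simp add: Dd_sum Dd_mult sum_distrib_left)
 also have "... = (SUM i:?I. SUM j:?I. (if i = j then fxp i * Dxp j p else 0)) + (SUM i:?I. SUM j:?I. fxp i * (fyp j * Dyp i (Dxp j p)))"
  unfolding sum.distrib[symmetric] by (intro sum.cong refl) (auto simp: onb_delta pconst_simps distrib_left)
 also have "(SUM i:?I. SUM j:?I. (if i = j then fxp i * Dxp j p else 0)) = (SUM i:?I. fxp i * Dxp i p)" by simp
 finally have 1: "XD (YD p) = (SUM i:?I. fxp i * Dxp i p) + (SUM i:?I. SUM j:?I. fxp i * (fyp j * Dyp i (Dxp j p)))" .
 have "YD (XD p) = (SUM j:?I. SUM i:?I. fyp j * (pconst (pairing (cvec (y j)) (cvec (y i))) * Dyp i p + fxp i * Dxp j (Dyp i p)))"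
  unfolding XD_def YD_def by (simp add: Dd_sum Dd_mult sum_distrib_left)
 also have "... = (SUM j:?I. SUM i:?I. (if j = i then fyp j * Dyp i p else 0)) + (SUM j:?I. SUM i:?I. fyp j * (fxp i * Dxp j (Dyp i p)))"
  unfolding sum.distrib[symmetric] by (intro sum.cong refl) (auto simp: onb_delta pconst_simps distrib_left)
 also have "(SUM j:?I. SUM i:?I. (if j = i then fyp j * Dyp i p else 0)) = (SUM i:?I. fyp i * Dyp i p)" by simp
 also have "(SUM j:?I. SUM i:?I. fyp j * (fxp i * Dxp j (Dyp i p))) = (SUM i:?I. SUM j:?I. fxp i * (fyp j * Dyp i (Dxp j p)))"
  by (subst sum.swap) (simp add: Dd_commute[of "(cvec _, 0)"] mult.left_commute)
 finally have 2: "YD (XD p) = (SUM i:?I. fyp i * Dyp i p) + (SUM i:?I. SUM j:?I. fxp i * (fyp j * Dyp i (Dxp j p)))" .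
 show ?thesis unfolding 1 2 HD_def by (simp add: sum_subtractf)
qed

lemma onb_fx: "(SUM i:{1..CARD('n)}. pconst (pairing u (cvec (y i))) * fxp i) = fx u" "(SUM i:{1..CARD('n)}. pconst (pairing u (cvec (y i))) * fyp i) = fy u"
 by (rule pfun_eqI; use onb_pairing[of u] in \<open>simp add: pairing_commute\<close>)+

lemma EU_hcp: "EU (hcp k p) = pconst (of_nat k) * hcp k p"
proof -
 have add: "EU (p + q) = EU p + EU q" for p q unfolding EU_def by (simp add: Dd_add algebra_simps sum.distrib)
 have mul: "EU (p * q) = EU p * q + p * EU q" for p q
  unfolding EU_def by (simp add: Dd_mult algebra_simps sum.distrib sum_dists)
 have 1: "EU (fx u) = fx u" "EU (fy u) = fy u" "EU (pconst c) = 0" "EU 0 = 0" for u c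
  using onb_fx[of u] unfolding EU_def by (simp_all add: pconst_simps mult.commute pairing_commute)
 show ?thesis
 proof (induction p arbitrary: k rule: pfun_induct)
  case (const c)
  thus ?case by (cases k) (auto simp: 1 pconst_simps)
 next
  case (mx u p)
  thus ?case by (cases k) (auto simp: 1 mul pconst_simps(1-3) distrib_right distrib_left mult.left_commute)
 next
  case (my u p)
  thus ?case by (cases k) (auto simp: 1 mul pconst_simps(1-3) distrib_right distrib_left mult.left_commute)
 qed (auto simp: add algebra_simps)
qed

lemma I3: "1 : {1..CARD('n)}" "2 : {1..CARD('n)}" "3 : {1..CARD('n)}"
 using card3 by auto

lemma pev_p0: "pev (XD q) p0 = pev (Dyp 1 q) p0" "pev (YD q) p0 = pev (Dxp 2 q) p0"
 "pev (HD q) p0 = pev (Dxp 1 q) p0 - pev (Dyp 2 q) p0" "pev (EU q) p0 = pev (Dxp 1 q) p0 + pev (Dyp 2 q) p0"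
 unfolding XD_def YD_def HD_def EU_def
 by (simp_all add: psum[OF I3(1)] psum[OF I3(2)] sum.distrib sum_subtractf)

lemma Dd_onb: "pev (Dd (u, v) q) a = (SUM j:{1..CARD('n)}. pairing u (cvec (y j)) * pev (Dxp j q) a + pairing v (cvec (y j)) * pev (Dyp j q) a)"
proof -
 have 1: "Dd (sum f J, 0) q = (SUM j:J. Dd (f j, 0) q)" "Dd (0, sum f J) q = (SUM j:J. Dd (0, f j) q)" for f and J :: "nat set"
  by (induction J rule: infinite_finite_induct) (auto simp: Dd_dir' Dd_dir)
 have "Dd (u, 0) q = (SUM j:{1..CARD('n)}. pconst (pairing u (cvec (y j))) * Dxp j q)"
  using arg_cong[OF onb_expand[of u], of "%u. Dd (u, 0) q"] unfolding 1 Dd_dir' by simp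
 moreover have "Dd (0, v) q = (SUM j:{1..CARD('n)}. pconst (pairing v (cvec (y j))) * Dyp j q)"
  using arg_cong[OF onb_expand[of v], of "%u. Dd (0, u) q"] unfolding 1 Dd_dir' by simp
 moreover have "Dd (u, v) q = Dd (u, 0) q + Dd (0, v) q" using Dd_dir'(1)[of u 0 0 v] by simp
 ultimately show ?thesis by (simp add: sum.distrib)
qed

text \<open>The fields act on the symbols by constants: 0 for sl2, k for the Euler field, spin
  constants for rotations. At \<open>p0\<close> the first four fields yield the derivatives along
  y_1 and y_2, and rotations in the planes (1, j) and (2, j) yield the remaining directions in x and
  in y.\<close>

lemma smb_unique:
 assumes z: "ZZ z" "degle k (app z vac)" and v: "!!S. pev (smb k z S) p0 = 0"
 shows "smb k z S = 0"
proof (rule vanish_of_vfields[where g = "smb k z" and i = S and XS = "{XD, YD, HD, EU} \<union> {LL i j | i j. i : {1..CARD('n)} & j : {1..CARD('n)} & i ~= j}"])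
 let ?I = "{1..CARD('n)}"
 let ?XS = "{XD, YD, HD, EU} \<union> {LL i j | i j. i : ?I & j : ?I & i ~= j}"
 show "X : ?XS ==> vfield X" for X using vfields by auto
 have sl: "XD (smb k z S) = 0" "YD (smb k z S) = 0" for S using sym_sl2[OF z] by (simp_all add: XD_def YD_def)
 have "XD 0 = 0" "YD 0 = 0" by (simp_all add: XD_def YD_def)
 hence "HD (smb k z S) = 0" for S unfolding HD_eq sl by simp
 moreover have "dspan (smb k z) 0 (EU (smb k z S))" for S unfolding EU_hcp by (intro dspan.mult dspan.base[of "smb k z"])
 moreover have "dspan (smb k z) 0 (LL i j (smb k z S))" if "i : ?I" "j : ?I" "i ~= j" for i j S
  unfolding LL_def sym_so[OF z that] by (intro dspan.mult dspan.base[of "smb k z"])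
 ultimately have "dspan (smb k z) 0 (X (smb k z S))" if "X : ?XS" for X S
  using that sl dspan.zero by auto
 thus "X : ?XS ==> dspan (smb k z) 0 (X (smb k z S))" for X S .
 show "pev (Dd h q) p0 = 0" if q: "!!X. X : ?XS ==> pev (X q) p0 = 0" for h q
 proof -
  have e: "pev (Dyp 1 q) p0 = 0" "pev (Dxp 2 q) p0 = 0" "pev (Dxp 1 q) p0 = 0" "pev (Dyp 2 q) p0 = 0"
   using q[of XD] q[of YD] q[of HD] q[of EU] unfolding pev_p0 by auto
  have "pev (LL 1 j q) p0 = 0" "pev (LL 2 j q) p0 = 0" if "j : ?I" "j ~= 1" "j ~= 2" for j
   using q[of "LL 1 j"] q[of "LL 2 j"] I3 that by blast+
  hence "pev (Dxp j q) p0 = 0" "pev (Dyp j q) p0 = 0" if "j : ?I" "j ~= 1" "j ~= 2" for j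
   using that I3 by (auto simp: LL_def onb_delta)
  hence "pev (Dxp j q) p0 = 0" "pev (Dyp j q) p0 = 0" if "j : ?I" for j
   using e that by (cases "j = 1"; cases "j = 2"; auto)+
  thus ?thesis using Dd_onb[of "fst h" "snd h" q p0] by simp
 qed
qed (rule v)

text \<open>If exactly one of i and j lies in S, the product e_i e_j anticommutes with e_S, so left
  and right multiplication add up instead of cancelling.\<close>

lemma kap_nz:
 assumes "S <= {1..CARD('n)}" "i ~= j" "i : {1..CARD('n)}" "j : {1..CARD('n)}" "(i : S) ~= (j : S)" shows "kap i j S ~= 0"
proof -
 let ?a = "sg {..<i} S" and ?b = "sg {..<j} S" and ?A = "sg {i<..CARD('n)} S" and ?B = "sg {j<..CARD('n)} S"
 let ?e = "sg {1..CARD('n)} S"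
 have "?e = (if i : S then -1 else 1) * (?a * ?A)" "?e = (if j : S then -1 else 1) * (?b * ?B)"
  using sg_split[OF assms(1)] by blast+
 hence "?a * ?A = - (?b * ?B)" using assms(5) by (auto split: if_splits)
 hence "?a * (?a * ?A) * ?B = - (?a * ?b * (?B * ?B))" by (simp add: m_ass)
 hence "?A * ?B = - (?a * ?b)" by (simp add: mult_ac)
 thus ?thesis using assms(2-4) unfolding kap_def by (cases "i < j") (auto simp: sg_sd mult.commute)
qed

text \<open>Rotations in planes with indices at least 3 fix \<open>p0\<close>, so at this point only
  the spin term of \<open>sym_so\<close> remains and must vanish. Its constant is nonzero as soon as
  S separates two such indices; indices 1 and 2 are excluded by \<open>sym_p0\<close>.\<close>

lemma smb_p0_support:
 assumes z: "ZZ z" "degle k (app z vac)" and S: "S ~= {}" "S ~= {3..CARD('n)}"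
 shows "pev (smb k z S) p0 = 0"
proof (cases "S <= {1..CARD('n)} & 1 \<notin> S & 2 \<notin> S")
 case False
 thus ?thesis using sym_p0[OF z, of S] top_support(3)[OF z, of "mat 1" S] by (metis pev_simps(1))
next
 case True
 have r: "x : {3..CARD('n)}" if "x : {1..CARD('n)}" "x ~= 1" "x ~= 2" for x
  using that by auto
 have sub: "S <= {3..CARD('n)}" using True r by blast
 obtain i where i: "i : S" using S by auto
 obtain j where j: "j : {3..CARD('n)}" "j \<notin> S" using S sub by blast
 have i3: "i : {3..CARD('n)}" and ij: "i ~= j" using sub i j by auto
 \<comment> \<open>T is chosen such that the rotation equation at T has the component at S in its
   spin term.\<close>
 define T where "T = sd (sd S j) i"
 have T: "sd (sd T i) j = S" by (simp add: T_def)
 have I: "i : {1..CARD('n)}" "j : {1..CARD('n)}" using i3 j by auto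
 have "pairing (cvec (y 1)) (cvec (y q)) = 0" "pairing (cvec (y 2)) (cvec (y q)) = 0" if "q : {3..CARD('n)}" for q
  using that onb_delta[OF I3(1), of q] onb_delta[OF I3(2), of q] by auto
 hence "kap i j T * pev (smb k z S) p0 = 0"
  using arg_cong[OF sym_so[OF z I ij, of T], of "%p. pev p p0"] i3 j(1) unfolding T by simp
 moreover have "kap i j T ~= 0"
  by (rule kap_nz) (use True i i3 j ij in \<open>auto simp: T_def sd_def\<close>)
 ultimately show ?thesis by simp
qed

lemma const_of_deriv_0:
 fixes f :: "real => complex"
 assumes "!!s. (f has_vector_derivative 0) (at s)" shows "f a = f b"
proof -
 have "(f has_derivative (%h. 0)) (at s within UNIV)" for s
  using assms[of s] by (simp add: has_vector_derivative_def)
 then obtain c where "!!x. f x = c"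
  using has_derivative_zero_constant[of UNIV f] by auto
 thus ?thesis by simp
qed

text \<open>The symbol is killed by \<open>HD\<close>, hence constant along (e^(is) y_1, e^(-is)
  y_2). At s = pi/2 this point is i times (y_1, -y_2), and homogeneity of degree k produces
  i^k.\<close>

lemma smb_scale:
 assumes z: "ZZ z" "degle k (app z vac)"
 shows "\<i> ^ k * pev (smb k z S) (cvec (y 1), - cvec (y 2)) = pev (smb k z S) p0"
proof -
 let ?g = "smb k z S"
 define \<gamma> where "\<gamma> s = (exp (\<i> * complex_of_real s) *s cvec (y 1), exp (- \<i> * complex_of_real s) *s cvec (y 2))" for s
 have "XD ?g = 0" "YD ?g = 0" using sym_sl2[OF z] by (simp_all add: XD_def YD_def)
 moreover have "XD 0 = 0" "YD 0 = 0" by (simp_all add: XD_def YD_def)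
 ultimately have HD: "HD ?g = 0" unfolding HD_eq by simp
 have "((%s. pev ?g (\<gamma> s)) has_vector_derivative 0) (at s)" for s
 proof -
  let ?e = "exp (\<i> * complex_of_real s)" and ?f = "exp (- \<i> * complex_of_real s)"
  let ?d = "((\<i> * ?e) *s cvec (y 1), (- \<i> * ?f) *s cvec (y 2))"
  have d: "((%s. exp (a * complex_of_real s) * b) has_vector_derivative a * exp (a * complex_of_real s) * b) (at s)" for a b
  proof -
   have "((%z. exp (a * z) * b) has_field_derivative a * exp (a * complex_of_real s) * b) (at (complex_of_real s))"
    by (rule derivative_eq_intros refl | simp)+
   thus ?thesis by (rule has_vector_derivative_real_field)
  qed
  have "((%s. pev ?g (\<gamma> s)) has_vector_derivative pev (Dd ?d ?g) (\<gamma> s)) (at s)"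
   by (rule pev_curve) (use d[of \<i>] d[of "- \<i>"] in \<open>simp_all only: \<gamma>_def fst_conv snd_conv pairing_scale\<close>)
  moreover have "pev (Dd ?d ?g) (\<gamma> s) = \<i> * pev (HD ?g) (\<gamma> s)"
  proof -
   have "Dd ?d ?g = pconst (\<i> * ?e) * Dxp 1 ?g + pconst (- \<i> * ?f) * Dyp 2 ?g"
    using Dd_dir'(1)[of "(\<i> * ?e) *s cvec (y 1)" 0 0 "(- \<i> * ?f) *s cvec (y 2)" ?g] by (simp only: Dd_dir' add_0_left add_0_right)
   moreover have "pev (HD ?g) (\<gamma> s) = ?e * pev (Dxp 1 ?g) (\<gamma> s) - ?f * pev (Dyp 2 ?g) (\<gamma> s)"
    unfolding HD_def by (simp add: \<gamma>_def pairing_scale sum_subtractf m_ass sum_distrib_left[symmetric] psum[OF I3(1)] psum[OF I3(2)])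
   ultimately show ?thesis by (simp only: pev_simps pev_basic) (simp add: algebra_simps)
  qed
  ultimately show ?thesis unfolding HD by simp
 qed
 hence "pev ?g (\<gamma> (pi / 2)) = pev ?g (\<gamma> 0)" by (rule const_of_deriv_0)
 moreover have "\<gamma> (pi / 2) = (\<i> *s cvec (y 1), \<i> *s (- cvec (y 2)))"
 proof -
  have "exp (\<i> * complex_of_real (pi / 2)) = \<i>" by (metis cis_conv_exp cis_pi_half)
  moreover have "exp (- \<i> * complex_of_real (pi / 2)) = - \<i>"
   using calculation by (simp add: exp_minus)
  ultimately show ?thesis unfolding \<gamma>_def by (simp add: vec_eq_iff)
 qed
 moreover have "\<gamma> 0 = p0" by (simp add: \<gamma>_def)
 ultimately show ?thesis using hcp_scale[of k "lk (app z vac) (mat 1) S" \<i> "cvec (y 1)" "- cvec (y 2)"] by simp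
qed

text \<open>Rotation by pi in the plane of y_2 and y_3 takes \<open>p0\<close> to (y_1, -y_2). The
  component at the empty set has spin constant 0 and is unchanged; the one at {3..d} is coupled to
  {2, 4..d} as cosine is to sine, and changes sign.\<close>

lemma smb_rotate:
 assumes z: "ZZ z" "degle k (app z vac)"
 shows "pev (smb k z {}) (cvec (y 1), - cvec (y 2)) = pev (smb k z {}) p0"
  "pev (smb k z {3..CARD('n)}) (cvec (y 1), - cvec (y 2)) = - pev (smb k z {3..CARD('n)}) p0"
proof -
 let ?E = "{3..CARD('n)}" and ?E' = "insert 2 {4..CARD('n)}"
 define \<gamma> where "\<gamma> s = (cvec (y 1), complex_of_real (cos s) *s cvec (y 2) + complex_of_real (sin s) *s cvec (y 3))" for s
 have D: "((%s. pev (smb k z S) (\<gamma> s)) has_vector_derivative - kap 2 3 S / 2 * pev (smb k z (sd (sd S 2) 3)) (\<gamma> s)) (at s)" for S s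
 proof -
  let ?d = "(0, complex_of_real (- sin s) *s cvec (y 2) + complex_of_real (cos s) *s cvec (y 3))"
  have c: "((%s. complex_of_real (cos s)) has_vector_derivative complex_of_real (- sin s)) (at s)"
   "((%s. complex_of_real (sin s)) has_vector_derivative complex_of_real (cos s)) (at s)"
   by (rule has_vector_derivative_of_real; (rule derivative_eq_intros | simp)+)+
  have "((%s. pev (smb k z S) (\<gamma> s)) has_vector_derivative pev (Dd ?d (smb k z S)) (\<gamma> s)) (at s)"
  proof (rule pev_curve)
   fix u
   have "((%s. complex_of_real (cos s) * pairing (cvec (y 2)) u + complex_of_real (sin s) * pairing (cvec (y 3)) u) has_vector_derivative
    complex_of_real (- sin s) * pairing (cvec (y 2)) u + complex_of_real (cos s) * pairing (cvec (y 3)) u) (at s)"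
    by (intro has_vector_derivative_add has_vector_derivative_mult_left c)
   thus "((%s. pairing (snd (\<gamma> s)) u) has_vector_derivative pairing (snd ?d) u) (at s)"
    by (simp only: \<gamma>_def snd_conv pairing_add pairing_scale)
  qed (simp add: \<gamma>_def)
  moreover have "pev (Dd ?d (smb k z S)) (\<gamma> s) = pev (LL 2 3 (smb k z S)) (\<gamma> s)"
   using I3 unfolding LL_def Dd_dir'(6) Dd_dir'(4) by (simp add: \<gamma>_def pairing_add pairing_scale onb_delta)
  moreover have "pev (LL 2 3 (smb k z S)) (\<gamma> s) = - kap 2 3 S / 2 * pev (smb k z (sd (sd S 2) 3)) (\<gamma> s)"
   using sym_so[OF z I3(2,3), of S] unfolding LL_def by simp
  ultimately show ?thesis by simp
 qed
 have \<gamma>: "\<gamma> 0 = p0" "\<gamma> pi = (cvec (y 1), - cvec (y 2))" by (auto simp: \<gamma>_def vec_eq_iff)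
 have k0: "kap 2 3 {} = 0" using card3 by (simp add: kap_def sg_sd) (simp add: sg_def)
 have "pev (smb k z {}) (\<gamma> pi) = pev (smb k z {}) (\<gamma> 0)"
  by (rule const_of_deriv_0) (use D[of "{}"] k0 in simp)
 thus "pev (smb k z {}) (cvec (y 1), - cvec (y 2)) = pev (smb k z {}) p0" unfolding \<gamma> .
 have "{3..CARD('n)} = insert 3 {4..CARD('n)}" using card3 by auto
 hence EE': "sd (sd ?E 2) 3 = ?E'" "sd (sd ?E' 2) 3 = ?E" by (auto simp: sd_def)
 have ab: "sg {..<2} ?E = 1" "sg {..<3} ?E = 1" "sg {..<2} ?E' = 1" "sg {..<3} ?E' = - 1"
 proof -
  have "?E \<inter> {..<2} = {}" "?E \<inter> {..<3} = {}" "?E' \<inter> {..<2} = {}" "?E' \<inter> {..<3} = {2}" by auto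
  thus "sg {..<2} ?E = 1" "sg {..<3} ?E = 1" "sg {..<2} ?E' = 1" "sg {..<3} ?E' = - 1" unfolding sg_def by (simp_all only: card.empty card.insert power_0) simp_all
 qed
 have AB: "sg {3<..CARD('n)} ?E = - sg {2<..CARD('n)} ?E" "sg {3<..CARD('n)} ?E' = sg {2<..CARD('n)} ?E'"
 proof -
  have "?E \<inter> {2<..CARD('n)} = insert 3 (?E \<inter> {3<..CARD('n)})" using card3 by auto
  moreover have "3 \<notin> ?E \<inter> {3<..CARD('n)}" by auto
  ultimately have "card (?E \<inter> {2<..CARD('n)}) = Suc (card (?E \<inter> {3<..CARD('n)}))" by simp
  thus "sg {3<..CARD('n)} ?E = - sg {2<..CARD('n)} ?E" by (simp add: sg_def)
  have "?E' \<inter> {2<..CARD('n)} = ?E' \<inter> {3<..CARD('n)}" by auto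
  thus "sg {3<..CARD('n)} ?E' = sg {2<..CARD('n)} ?E'" by (simp add: sg_def)
 qed
 have k: "kap 2 3 ?E = -2" "kap 2 3 ?E' = 2" using card3 by (simp_all add: kap_def sg_sd ab AB)
 let ?G = "%s. pev (smb k z ?E) (\<gamma> s)" and ?G' = "%s. pev (smb k z ?E') (\<gamma> s)"
 have dG: "(?G has_vector_derivative ?G' s) (at s)" "(?G' has_vector_derivative - ?G s) (at s)" for s
  using D[of ?E s] D[of ?E' s] unfolding EE' k by simp_all
 have G'0: "?G' 0 = 0" unfolding \<gamma>
 proof (rule smb_p0_support[OF z])
  have "2 : ?E'" "2 \<notin> ?E" by simp_all
  thus "?E' ~= ?E" by metis
 qed simp
 \<comment> \<open>An integral of the linear system in \<open>dG\<close>. At 0 and at pi the sine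
   vanishes, so it compares two values of \<open>?G\<close>.\<close>
 have "((%s. ?G s * complex_of_real (cos s) - ?G' s * complex_of_real (sin s)) has_vector_derivative 0) (at s)" for s
 proof -
  have c: "((%s. complex_of_real (cos s)) has_vector_derivative complex_of_real (- sin s)) (at s)"
   "((%s. complex_of_real (sin s)) has_vector_derivative complex_of_real (cos s)) (at s)"
   by (rule has_vector_derivative_of_real; (rule derivative_eq_intros | simp)+)+
  show ?thesis
   using has_vector_derivative_diff[OF has_vector_derivative_mult[OF dG(1) c(1)] has_vector_derivative_mult[OF dG(2) c(2)]]
   by (simp add: algebra_simps)
 qed
 hence "(%s. ?G s * complex_of_real (cos s) - ?G' s * complex_of_real (sin s)) pi
  = (%s. ?G s * complex_of_real (cos s) - ?G' s * complex_of_real (sin s)) 0"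
  by (rule const_of_deriv_0)
 hence "- ?G pi = ?G 0" by simp
 hence "?G pi = - ?G 0" by (metis minus_minus)
 thus "pev (smb k z ?E) (cvec (y 1), - cvec (y 2)) = - pev (smb k z ?E) p0" unfolding \<gamma> .
qed

text \<open>A nonzero value at the empty set forces i^k = 1, one at {3..d} forces i^k = -1. So even
  degrees leave one free scalar and odd degrees none.\<close>

lemma smb_parity:
 assumes z: "ZZ z" "degle k (app z vac)"
 shows "\<i> ^ k * pev (smb k z {}) p0 = pev (smb k z {}) p0"
  "\<i> ^ k * pev (smb k z {3..CARD('n)}) p0 = - pev (smb k z {3..CARD('n)}) p0"
proof -
 show "\<i> ^ k * pev (smb k z {}) p0 = pev (smb k z {}) p0" using smb_scale[OF z, of "{}"] unfolding smb_rotate[OF z] .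
 have "- (\<i> ^ k * pev (smb k z {3..CARD('n)}) p0) = pev (smb k z {3..CARD('n)}) p0"
  using smb_scale[OF z, of "{3..CARD('n)}"] unfolding smb_rotate[OF z] by simp
 thus "\<i> ^ k * pev (smb k z {3..CARD('n)}) p0 = - pev (smb k z {3..CARD('n)}) p0" by (metis minus_minus)
qed

end

section \<open>Existence and uniqueness of the presentation by polynomials in D and a lift of
  -1\<close>

section \<open>The graded centre\<close>

text \<open>Horner evaluation of a complex polynomial at an element of a noncommutative ring, with
  scalars entering through \<open>sc\<close>.\<close>

definition pe :: "complex poly => 'n::finite op => 'n op" where
 "pe p a = fold_coeffs (%k b. sc k + a * b) p 0"

lemma pe_pCons: "pe (pCons k p) a = sc k + a * pe p a"
 by (cases "k = 0"; cases "p = 0") (simp_all add: pe_def)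

lemma pe_0 [simp]: "pe 0 a = 0"
 by (simp add: pe_def)

lemma pe_add: "pe (p + q) a = pe p a + pe q a"
 by (induction p q rule: poly_induct2) (simp_all add: pe_pCons S.sc_add algebra_simps)

lemma pe_comm: "a * b = b * a ==> pe p a * b = b * pe p a"
proof (induction p)
 case (pCons k p)
 have "a * pe p a * b = b * (a * pe p a)" using pCons by (metis m_ass)
 thus ?case by (simp add: pe_pCons add_dists S.sc_comm)
qed simp

lemma pe_smult: "pe (Polynomial.smult k p) a = sc k * pe p a"
proof (induction p)
 case (pCons l p)
 have "a * (sc k * pe p a) = sc k * (a * pe p a)" using S.slc[of a] by simp
 thus ?case using pCons by (simp add: pe_pCons distrib_left)
qed simp

lemma pe_minus: "pe (- p) a = - pe p a"
 using pe_smult[of "-1" p a] by (simp add: S.sc_minus)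

lemma pe_mult: "pe (p * q) a = pe p a * pe q a"
 by (induction p) (simp_all add: pe_pCons pe_add pe_smult distrib_right m_ass)

lemma pe_monom: "pe (monom k m) a = sc k * a ^ m"
proof (induction m)
 case (Suc m)
 have "a * (sc k * a ^ m) = sc k * (a * a ^ m)" using S.slc[of a] by simp
 thus ?case using Suc by (simp add: pe_pCons monom_Suc)
qed (simp add: monom_0 pe_pCons)

lemma pe_pcompose_minus: "pe (pcompose p [:0, -1:]) a = pe p (- a)"
 by (induction p) (simp_all add: pe_pCons pcompose_pCons pe_mult pe_add pe_minus)

text \<open>The quotient is a polynomial in a and b. The two further clauses record this without
  naming it: it commutes with whatever commutes with both, and lies in every subalgebra containing
  both, in particular in the centraliser of osp(1|2).\<close>

lemma pe_diff_factor:
 "a * b = b * a ==> \<exists>r. pe p a - pe p b = (a - b) * r & (\<forall>e. a * e = e * a --> b * e = e * b --> r * e = e * r)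
  & (\<forall>A. (\<forall>k. sc k : A) --> (ALL x:A. ALL y:A. x + y : A & x * y : A) --> a : A --> b : A --> r : A)"
proof (induction p)
 case 0
 have "0 : A" if "\<forall>k. sc k : A" for A :: "'a op set" using that[rule_format, of 0] by simp
 thus ?case by (intro exI[of _ 0]) simp
next
 case (pCons k p)
 then obtain r where r: "pe p a - pe p b = (a - b) * r" "!!e. a * e = e * a ==> b * e = e * b ==> r * e = e * r"
  "!!A. \<forall>k. sc k : A ==> ALL x:A. ALL y:A. x + y : A & x * y : A ==> a : A ==> b : A ==> r : A"
  by blast
 have "pe (pCons k p) a - pe (pCons k p) b = (a - b) * pe p a + b * (pe p a - pe p b)"
  by (simp add: pe_pCons diff_dists)
 also have "... = (a - b) * (pe p a + b * r)"
  using pCons.prems by (simp add: r(1) diff_dists distrib_left m_ass[symmetric])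
 finally have 1: "pe (pCons k p) a - pe (pCons k p) b = (a - b) * (pe p a + b * r)" .
 have 2: "(pe p a + b * r) * e = e * (pe p a + b * r)" if e: "a * e = e * a" "b * e = e * b" for e
 proof -
  have "b * r * e = e * (b * r)" using r(2)[OF e] e(2) by (metis m_ass)
  thus ?thesis by (simp add: add_dists pe_comm[OF e(1)])
 qed
 have pA: "pe q a : A" if "\<forall>k. sc k : A" "ALL x:A. ALL y:A. x + y : A & x * y : A" "a : A" for A q
 proof (induction q)
  case 0
  thus ?case using that(1)[rule_format, of 0] by simp
 qed (use that in \<open>simp add: pe_pCons\<close>)
 have "pe p a + b * r : A" if "\<forall>k. sc k : A" "ALL x:A. ALL y:A. x + y : A & x * y : A" "a : A" "b : A" for A
  using pA[OF that(1-3)] r(3)[OF that] that by blast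
 with 1 2 show ?case by blast
qed

context dunkl
begin

lemma ZZ_sc: "ZZ (sc k)"
 by (simp add: ZZ_def Alg.sc osp_ok_sc S.sc_comm)

lemma ZZ_add: "ZZ a ==> ZZ b ==> ZZ (a + b)"
 by (simp add: ZZ_def Alg.add osp_ok_add add_dists)

lemma ZZ_mult: "ZZ a ==> ZZ b ==> ZZ (a * b)"
proof -
 assume a: "ZZ a" "ZZ b"
 have "a * b * AA u v = a * (AA u v * b)" for u v using a(2) by (simp add: ZZ_def m_ass)
 hence "a * b * AA u v = AA u v * (a * b)" for u v using a(1) by (simp add: ZZ_def flip: m_ass)
 thus ?thesis using a Alg.mult osp_ok_mult unfolding ZZ_def by blast
qed

lemma ZZ_diff: "ZZ a ==> ZZ b ==> ZZ (a - b)"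
 using ZZ_add[OF _ ZZ_mult[OF ZZ_sc[of "-1"]], of a b] by (simp add: S.sc_minus)

lemma ZZ_power: "ZZ a ==> ZZ (a ^ m)"
 by (induction m) (use ZZ_sc[of 1] ZZ_mult in auto)

lemma GG_Alg: "GG : Alg"
proof -
 have f: "set l <= {1..CARD('n)} ==> foldr (%p u. el p * u) l 1 : Alg" for l
  by (induction l) (auto intro!: Alg.mult Alg_el Alg_simps)
 thus ?thesis unfolding GG_def by (intro Alg.mult Alg.sc f) auto
qed

lemma DD_Alg: "XX : Alg" "YY : Alg" "SS : Alg" "DD : Alg"
proof -
 show 1: "XX : Alg" "YY : Alg" unfolding XX_def YY_def by (intro Alg_sum Alg.intros)+
 show 2: "SS : Alg" unfolding SS_def by (intro Alg_simps Alg.mult Alg.sc 1)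
 show "DD : Alg" unfolding DD_def by (intro Alg.mult GG_Alg 2)
qed

lemma EE_Alg: "EE u : Alg"
 unfolding EE_def by (intro Alg_simps Alg_sum Alg.intros W_refl)

lemma AA_Alg: "AA u v : Alg"
 unfolding AA_def by (intro Alg_simps Alg.intros EE_Alg)

text \<open>\<Gamma> passes a Clifford vector with the sign (-1)^(d-1), and every term of
  \<open>AA\<close> contains an even number of Clifford vectors.\<close>

lemma GG_AA: "GG * AA u v = AA u v * GG"
proof -
 let ?s = "(-1) ^ (CARD('n) - 1) :: complex"
 have s: "?s * ?s = 1" by (simp flip: power_mult_distrib)
 have E: "GG * EE w = sc ?s * (EE w * GG)" for w
 proof -
  have "GG * (gr g * cl v) = sc ?s * (gr g * cl v * GG)" for g v
  proof -
   have "GG * (gr g * cl v) = gr g * (GG * cl v)" by (simp add: m_ass[symmetric] GG_comms)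
   thus ?thesis unfolding GG_cl using S.slc[of "gr g"] by (simp add: m_ass)
  qed
  hence "GG * (sc k * (gr g * cl v)) = sc ?s * (sc k * (gr g * cl v) * GG)" for k g v
   using S.slc[of GG k] S.sc_mult_mult by (simp add: m_ass mult.commute)
  moreover have "GG * (sc t * cl w) = sc ?s * (sc t * cl w * GG)"
   using S.slc[of GG t] by (simp add: GG_cl m_ass mult.commute)
  ultimately show ?thesis unfolding EE_def
   by (simp only: diff_dists sum_dists)
 qed
 have 2: "GG * (a * b) = a * b * GG" if "GG * a = sc k * (a * GG)" "GG * b = sc k * (b * GG)" "k * k = 1" for a b k
 proof -
  have "GG * (a * b) = sc k * (a * (GG * b))" by (simp only: m_ass[symmetric] that(1))
  also have "... = sc (k * k) * (a * b * GG)" unfolding that(2) using S.slc[of a k] by (simp add: m_ass)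
  finally show ?thesis by (simp add: that(3))
 qed
 have 1: "GG * (a * b) = a * b * GG" if "GG * a = a * GG" "GG * b = b * GG" for a b
  using that by (metis m_ass)
 have "GG * (cl u * EE v) = cl u * EE v * GG" "GG * (EE u * cl v) = EE u * cl v * GG" "GG * (cl u * cl v) = cl u * cl v * GG"
  using s by (auto intro!: 2[of _ ?s] E GG_cl)
 moreover have "GG * sc k = sc k * GG" for k by (rule S.sc_comm)
 ultimately show ?thesis unfolding AA_def
  by (simp add: 1 GG_comms add_dists diff_dists)
qed

text \<open>D itself need not be graded central. \<open>ZZ\<close> is wide enough to contain its
  powers, which serve as comparison elements for the symbols.\<close>

lemma ZZ_DD: "ZZ DD"
proof -
 have "SS * AA u v = AA u v * SS" for u v using osp_ok_SS[OF osp_ok_AA(1)] by simp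
 hence "DD * AA u v = AA u v * DD" for u v unfolding DD_def using GG_AA by (metis m_ass)
 thus ?thesis by (simp add: ZZ_def DD_Alg osp_ok_DD)
qed

definition YY2 :: "'n op" where "YY2 = (SUM p:{1..CARD('n)}. Yo (cvec (y p)) * cl (cvec (y p)))"
definition D2 :: "'n op" where "D2 = GG * (sc (1 / (2 * t)) * (YY2 * XX - XX * YY2))"

lemma tops_DD: "tops 2 DD D2"
proof -
 have X: "tops 1 XX XX" unfolding XX_def by (intro tops_sum tops_mult_10 tops_basic)
 have Y: "tops 1 YY YY2" unfolding YY_def YY2_def by (intro tops_sum tops_mult_10 tops_basic)
 have "tops (0 + 2) (sc (1 / (2 * t)) * (YY * XX - XX * YY)) (sc (1 / (2 * t)) * (YY2 * XX - XX * YY2))"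
  by (rule tops_mult[OF tops_basic(12)]) (intro tops_diff tops_mult_11 X Y)
 hence "tops 2 SS (sc (1 / (2 * t)) * (YY2 * XX - XX * YY2))"
  unfolding SS_def add_0_left using tops_diff[OF _ tops_lower[OF tops_basic(12)], of 2 _ _ "1/2"] by fastforce
 from tops_mult[OF tops_basic(14) this] show ?thesis unfolding add_0_left DD_def D2_def .
qed

lemma tops_DD_power: "tops (2 * m) (DD ^ m) (D2 ^ m)"
proof (induction m)
 case 0
 show ?case by (auto simp: tops_def)
next
 case (Suc m)
 from tops_mult[OF tops_DD Suc] show ?case by simp
qed

lemma degle_vac: "degle 0 (vac :: 'n M)" "app (Ho 0) (vac :: 'n M) = vac"
 by (auto simp: degle_def vac_def gr0_conv_Suc)

lemma top_DD_power: "degle (2 * m) (app (DD ^ m) vac)" "app (Ho (2 * m)) (app (DD ^ m) vac) = app (D2 ^ m) vac"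
 using tops_DD_power[of m, unfolded tops_def, rule_format, OF degle_vac(1)] degle_vac(2) by simp_all

text \<open>The operator does not mix the components of different group elements. The leading part
  of D has this property, since it involves no divided differences.\<close>

definition wloc :: "'n op => bool" where
 "wloc a \<longleftrightarrow> (\<forall>F w. (\<forall>S. lk F w S = 0) --> (\<forall>S. lk (app a F) w S = 0))"

lemma wloc_rules: "wloc a ==> wloc b ==> wloc (a * b)" "wloc a ==> wloc b ==> wloc (a + b)" "wloc a ==> wloc b ==> wloc (a - b)"
 "wloc (sc k)" "wloc 0" "wloc 1" "wloc (Xo u)" "wloc (Yo u)" "wloc (el p)"
 unfolding wloc_def by (auto simp: lk_simps)

lemma wloc_sum: "(!!j. j : J ==> wloc (f j)) ==> wloc (sum f J)"
 by (induction J rule: infinite_finite_induct) (auto intro: wloc_rules)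

lemma wloc_D2: "wloc (D2 ^ m)"
proof -
 have c: "wloc (cl v)" for v unfolding cl_def by (intro wloc_sum wloc_rules)
 have "wloc (foldr (%p u. el p * u) l 1)" for l by (induction l) (auto intro: wloc_rules)
 hence "wloc D2" unfolding D2_def GG_def YY2_def XX_def by (intro wloc_rules wloc_sum c)
 thus ?thesis by (induction m) (auto intro: wloc_rules)
qed

lemma D2_support: "w ~= mat 1 ==> lk (app (D2 ^ m) vac) w S = 0"
 using wloc_D2[of m] unfolding wloc_def by (auto simp: vac_def lookup_single)

definition EV :: "'n op" where "EV = mop (%k. k) (%_ p. pconst (pev p p0))"

lemma EV_single [simp]: "app EV (single k p) = single k (pconst (pev p p0))"
 by (simp add: EV_def)

lemma lk_EV: "lk (app EV F) w S = pconst (pev (lk F w S) p0)"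
 unfolding EV_def using lookup_mop[of "%_ p. pconst (pev p p0)" "%k. k" "%k. k" F "(w, S)"] by simp

text \<open>Evaluation at \<open>p0\<close> turns x_p and y_p into scalars and intertwines the
  leading part of D with \<Gamma> e_2 e_1 / t. This Clifford element is invertible, so none of its
  powers kills the vacuum.\<close>

lemma D2_nonzero: "\<exists>S. pev (lk (app (D2 ^ m) vac) (mat 1) S) p0 ~= 0"
proof -
 let ?I = "{1..CARD('n)}"
 have b: "EV * Xo u = sc (pairing (cvec (y 1)) u) * EV" "EV * Yo u = sc (pairing (cvec (y 2)) u) * EV" "EV * el p = el p * EV" for u p
  by (rule op_eqI; simp add: pconst_simps(4) del: pc_pc)+
 have c: "EV * cl v = cl v * EV" for v
  unfolding cl_def by (rule comm_sc_sum[symmetric]) (simp add: b)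
 have "EV * (sc k * a) = sc k * (EV * a)" for k a by (rule S.slc)
 note sc_EV = this
 have XY: "EV * XX = cl (cvec (y 1)) * EV" "EV * YY2 = cl (cvec (y 2)) * EV"
  unfolding XX_def YY2_def sum_distrib_left m_ass[symmetric] b
  by (simp_all only: m_ass c) (simp_all only: m_ass[symmetric] sum_distrib_right[symmetric] onb_linear[of cl, OF cl_lin(1,2), symmetric])
 define Q where "Q = GG * (sc (1 / t) * (cl (cvec (y 2)) * cl (cvec (y 1))))"
 have GG: "EV * GG = GG * EV" by (rule GG_comm[symmetric]) (simp add: b)
 have D2: "EV * D2 = Q * EV"
 proof -
  have "EV * (YY2 * XX - XX * YY2) = (cl (cvec (y 2)) * cl (cvec (y 1)) - cl (cvec (y 1)) * cl (cvec (y 2))) * EV"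
   by (simp add: right_diff_distrib left_diff_distrib) (simp add: m_ass[symmetric] XY, simp add: m_ass XY c)
  also have "cl (cvec (y 1)) * cl (cvec (y 2)) = - (cl (cvec (y 2)) * cl (cvec (y 1)))"
   using cl_cl[of "cvec (y 1)" "cvec (y 2)"] onb_delta[OF I3(1) I3(2)] by (simp add: eq_neg_iff_add_eq_0)
  finally have "EV * (YY2 * XX - XX * YY2) = sc 2 * (cl (cvec (y 2)) * cl (cvec (y 1)) * EV)"
   using arg_cong[OF S.sc_add[of 1 1], of "%s. s * (cl (cvec (y 2)) * cl (cvec (y 1)) * EV)"] by (simp add: distrib_right mult_2)
  thus ?thesis unfolding D2_def Q_def
   by (simp add: m_ass[symmetric] GG) (simp add: m_ass sc_EV)
 qed
 have pow: "EV * D2 ^ m = Q ^ m * EV"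
 proof (induction m)
  case (Suc m)
  have "EV * D2 ^ Suc m = Q * (EV * D2 ^ m)" by (simp add: m_ass[symmetric] D2)
  thus ?case by (simp add: Suc m_ass)
 qed simp
 obtain G' where G': "G' * GG = 1" using GG_inv by blast
 define Q' where "Q' = sc t * (cl (cvec (y 1)) * cl (cvec (y 2))) * G'"
 have "cl (cvec (y 1)) * (cl (cvec (y 2)) * (cl (cvec (y 2)) * cl (cvec (y 1)))) = 1"
  using cl_sq[of "cvec (y 1)"] cl_sq[of "cvec (y 2)"] onb_delta[OF I3(1) I3(1)] onb_delta[OF I3(2) I3(2)]
  by (simp flip: m_ass[of "cl (cvec (y 2))"])
 moreover have "Q' * Q = sc t * (cl (cvec (y 1)) * (cl (cvec (y 2)) * ((G' * GG) * (sc (1 / t) * (cl (cvec (y 2)) * cl (cvec (y 1)))))))"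
  by (simp only: Q'_def Q_def m_ass)
 moreover have "cl u * (cl v * (sc k * a)) = sc k * (cl u * (cl v * a))" for u v k a
  using S.slc[of "cl v" k] S.slc[of "cl u" k] by simp
 ultimately have Q'Q: "Q' * Q = 1" using t0 by (simp add: G')
 have inv: "Q' ^ m * Q ^ m = 1"
 proof (induction m)
  case (Suc m)
  have "Q' ^ Suc m * Q ^ Suc m = Q' ^ m * (Q' * Q) * Q ^ m" by (simp only: power_Suc2[of Q'] power_Suc[of Q] m_ass)
  thus ?case using Suc Q'Q by simp
 qed simp
 have "app EV vac = vac" by (simp add: vac_def pconst_simps(2))
 hence "app EV (app (D2 ^ m) vac) = app (Q ^ m) vac" using pow by (metis app_simps(4))
 moreover have "app (Q ^ m) vac ~= 0"
 proof
  assume "app (Q ^ m) vac = 0"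
  hence "vac = (0 :: 'n M)" using arg_cong[OF inv, of "%a. app a vac"] by simp
  from arg_cong[OF this, of "%F. lk F (mat 1) {}"] show False by (simp add: vac_def)
 qed
 ultimately obtain w S where "lk (app EV (app (D2 ^ m) vac)) w S ~= 0"
  by (metis poly_mapping_eqI lookup_zero surj_pair)
 hence "pev (lk (app (D2 ^ m) vac) w S) p0 ~= 0" unfolding lk_EV by (metis pconst_simps(1))
 moreover hence "w = mat 1" using D2_support by (metis pev_simps(1))
 ultimately show ?thesis by blast
qed

lemma ZZ_degle_lin: "degle k (app a vac) ==> degle k (app b vac) ==> degle k (app (a - b) vac)"
 "degle k (app a vac) ==> degle k (app (sc s * a) vac)"
 by (auto simp: degle_def)

text \<open>In odd degree the value at \<open>p0\<close> is 0 by \<open>smb_parity\<close>. In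
  degree 2m the values for z and for D^m sit on the same subset, where that of D^m is nonzero; a
  scalar multiple then matches z at \<open>p0\<close>, hence everywhere by
  \<open>smb_unique\<close>.\<close>

lemma top_at_one:
 assumes z: "ZZ z" "degle k (app z vac)"
 shows "\<exists>s m. degle k (app (sc s * DD ^ m) vac) & (\<forall>w S. w ~= mat 1 --> hcp k (lk (app (sc s * DD ^ m) vac) w S) = 0)
  & (\<forall>S. smb k (z - sc s * DD ^ m) S = 0)"
proof -
 let ?T = "{3..CARD('n)}"
 have T: "?T ~= {}" using I3 by auto
 note pz = smb_parity[OF z]
 show ?thesis
 proof (cases "even k")
  case False
  hence "\<i> ^ k = \<i> \<or> \<i> ^ k = - \<i>"
   by (elim oddE) (simp add: power_add power_mult minus_one_power_iff)
  hence ne: "\<i> ^ k ~= 1" "\<i> ^ k ~= -1" by (auto simp: complex_eq_iff)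
  have "pev (smb k z S) p0 = 0" for S
  proof (cases "S = {} \<or> S = ?T")
   case True
   moreover have "x = 0" if "\<i> ^ k * x = x" for x using that ne by (metis mult_cancel_right2)
   moreover have "x = 0" if "\<i> ^ k * x = - x" for x using that ne by (metis mult_cancel_right mult_minus1)
   ultimately show ?thesis using pz by blast
  qed (use smb_p0_support[OF z] in blast)
  hence "smb k z S = 0" for S by (rule smb_unique[OF z])
  thus ?thesis by (intro exI[of _ 0]) (simp add: degle_def)
 next
  case True
  then obtain m where k: "k = 2 * m" by blast
  let ?b = "DD ^ m"
  have b: "ZZ ?b" "degle k (app ?b vac)" using ZZ_power[OF ZZ_DD] top_DD_power(1) k by auto
  have hb: "hcp k (lk (app ?b vac) w S) = lk (app (D2 ^ m) vac) w S" for w S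
   using arg_cong[OF top_DD_power(2)[of m], of "%F. lk F w S"] k by simp
  obtain S0 where S0: "pev (smb k ?b S0) p0 ~= 0" unfolding hb using D2_nonzero by blast
  hence S0': "S0 = {} \<or> S0 = ?T" using smb_p0_support[OF b] by blast
  have "\<exists>s. pev (smb k z {}) p0 = s * pev (smb k ?b {}) p0 & pev (smb k z ?T) p0 = s * pev (smb k ?b ?T) p0"
  proof -
   have e: "x = 0" if "\<i> ^ k * x = x" "\<i> ^ k * x' = - x'" "x' ~= 0" for x x'
   proof -
    have "\<i> ^ k = -1" using that(2,3) by (metis mult_cancel_right mult_minus1)
    thus ?thesis using that(1) by simp
   qed
   show ?thesis using S0'
   proof
    assume "S0 = {}"
    hence "pev (smb k z ?T) p0 = 0" "pev (smb k ?b ?T) p0 = 0" "pev (smb k ?b {}) p0 ~= 0"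
     using e smb_parity[OF b] pz S0 by metis+
    thus ?thesis by (intro exI[of _ "pev (smb k z {}) p0 / pev (smb k ?b {}) p0"]) simp
   next
    assume "S0 = ?T"
    hence "pev (smb k z {}) p0 = 0" "pev (smb k ?b {}) p0 = 0" "pev (smb k ?b ?T) p0 ~= 0"
     using e smb_parity[OF b] pz S0 by metis+
    thus ?thesis by (intro exI[of _ "pev (smb k z ?T) p0 / pev (smb k ?b ?T) p0"]) simp
   qed
  qed
  then obtain s where s: "pev (smb k z {}) p0 = s * pev (smb k ?b {}) p0" "pev (smb k z ?T) p0 = s * pev (smb k ?b ?T) p0"
   by blast
  have d: "ZZ (z - sc s * ?b)" "degle k (app (z - sc s * ?b) vac)"
   by (intro ZZ_diff ZZ_mult ZZ_sc z b ZZ_degle_lin)+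
  have "pev (smb k (z - sc s * ?b) S) p0 = 0" for S
  proof (cases "S = {} \<or> S = ?T")
   case True
   thus ?thesis using s by (auto simp: lk_simps)
  qed (use smb_p0_support[OF d] in blast)
  hence "smb k (z - sc s * ?b) S = 0" for S by (rule smb_unique[OF d])
  moreover have "hcp k (lk (app (sc s * ?b) vac) w S) = 0" if "w ~= mat 1" for w S
   using D2_support[OF that] hb by simp
  ultimately show ?thesis using ZZ_degle_lin(2)[OF b(2)] by blast
 qed
qed

text \<open>\<open>flipper n \<nu> r\<close>: the operator \<open>n\<close> represents a lift of \<open>-1\<close> to the double cover,
 with square \<open>\<nu>\<close> and right multiplication \<open>r\<close>.\<close>

definition flipper :: "'n op => complex => 'n op => bool" where
 "flipper n \<nu> r \<longleftrightarrow> ZZ n & n * n = sc \<nu> & \<nu> ~= 0 & rt n r & (\<forall>j. Ho j * r = r * Ho j)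
  & (\<forall>F w. (\<forall>S. lk F (- w) S = 0) --> (\<forall>S. lk (app r F) w S = 0))"

lemma flipperD:
 assumes "flipper n \<nu> r"
 shows "ZZ n" "n * n = sc \<nu>" "\<nu> ~= 0" "Ho j * r = r * Ho j" "z : Alg ==> app (z * n) vac = app r (app z vac)"
  "(!!S. lk F (- w) S = 0) ==> lk (app r F) w S = 0"
 using assms rt_apply[of z n r] unfolding flipper_def by auto

text \<open>Right multiplication by n preserves degrees and exchanges the components at w and -w, so
  a symbol at -1 can be examined at 1.\<close>

lemma flipper_top:
 assumes n: "flipper n \<nu> r" and z: "z : Alg"
 shows "degle k (app z vac) ==> degle k (app (z * n) vac)"
  "(!!S. hcp k (lk (app z vac) (- w) S) = 0) ==> hcp k (lk (app (z * n) vac) w S) = 0"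
proof -
 show "degle k (app (z * n) vac)" if "degle k (app z vac)"
  using that flipperD(4)[OF n] unfolding degle_def flipperD(5)[OF n z] by (metis app_0 app_simps(4))
 assume a: "!!S. hcp k (lk (app z vac) (- w) S) = 0"
 have "lk (app r (app (Ho k) (app z vac))) w S = 0"
  by (rule flipperD(6)[OF n]) (simp add: a)
 thus "hcp k (lk (app (z * n) vac) w S) = 0"
  using flipperD(4)[OF n, of k] unfolding flipperD(5)[OF n z] by (metis app_simps(4) lk_diag(7))
qed

text \<open>The equation is stated on the vacuum, where degrees are measured; faithfulness later
  upgrades it to an identity of operators.\<close>

definition zdec :: "'n op => 'n op => bool" where
 "zdec n z \<longleftrightarrow> (\<exists>p q. (- mat 1 \<notin> W --> q = 0) & app (z - (pe p DD + pe q DD * n)) vac = 0)"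

lemma degle_less:
 assumes "degle k F" "!!w S. hcp k (lk F w S) = 0" shows "F = 0 \<or> (k > 0 & degle (k - 1) F)"
proof -
 have "app (Ho k) F = 0" by (rule poly_mapping_eqI) (metis assms(2) lk_diag(7) lookup_zero surj_pair)
 hence all: "app (Ho j) F = 0" if "j \<ge> k" for j
  using assms(1) that by (cases "j = k") (auto simp: degle_def)
 show ?thesis
 proof (cases k)
  case 0
  have "lk F w S = 0" for w S
   by (rule hcp_all_0) (metis 0 all lk_diag(7) lookup_zero zero_le)
  thus ?thesis by (metis poly_mapping_eqI lookup_zero surj_pair)
 next
  case (Suc l)
  thus ?thesis using all by (auto simp: degle_def)
 qed
qed

lemma minus_mat1_ne: "- (mat 1 :: real^'n^'n) ~= mat 1"
proof
 assume "- (mat 1 :: real^'n^'n) = mat 1"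
 from arg_cong[OF this, of "%m. m $ i $ i" for i] show False by (simp add: mat_def)
qed

text \<open>The symbol lives at 1 and at -1. A multiple of D^m removes the part at 1. Multiplication
  by n brings the part at -1 to 1, where a second multiple is removed, and multiplication by n/\<nu>
  moves the result back.\<close>

lemma decompose_step:
 assumes n: "- mat 1 : W ==> flipper n \<nu> r" and z: "ZZ z" "degle k (app z vac)"
 shows "\<exists>p q. (- mat 1 \<notin> W --> q = 0) & ZZ (z - (pe p DD + pe q DD * n)) & degle k (app (z - (pe p DD + pe q DD * n)) vac)
  & (\<forall>w S. hcp k (lk (app (z - (pe p DD + pe q DD * n)) vac) w S) = 0)"
proof -
 obtain s m where b: "degle k (app (sc s * DD ^ m) vac)" "!!w S. w ~= mat 1 ==> hcp k (lk (app (sc s * DD ^ m) vac) w S) = 0"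
  "!!S. smb k (z - sc s * DD ^ m) S = 0"
  using top_at_one[OF z] by blast
 define z1 where "z1 = z - sc s * DD ^ m"
 have z1: "ZZ z1" "degle k (app z1 vac)"
  unfolding z1_def by (intro ZZ_diff ZZ_mult ZZ_sc ZZ_power ZZ_DD z ZZ_degle_lin b)+
 show ?thesis
 proof (cases "- mat 1 : W")
  case False
  have "hcp k (lk (app z1 vac) w S) = 0" for w S
   using top_support[OF z1, of w S] False b(3)[folded z1_def] by blast
  thus ?thesis using z1 False
   by - (rule exI[of _ "monom s m"], rule exI[of _ 0], auto simp: pe_monom z1_def)
 next
  case True
  note n = n[OF True]
  have z1n: "ZZ (z1 * n)" "degle k (app (z1 * n) vac)"
   using ZZ_mult[OF z1(1) flipperD(1)[OF n]] flipper_top(1)[OF n _ z1(2)] z1(1) by (auto simp: ZZ_def)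
  obtain s' m' where b': "degle k (app (sc s' * DD ^ m') vac)" "!!w S. w ~= mat 1 ==> hcp k (lk (app (sc s' * DD ^ m') vac) w S) = 0"
   "!!S. smb k (z1 * n - sc s' * DD ^ m') S = 0"
   using top_at_one[OF z1n] by blast
  let ?b = "sc s' * DD ^ m'"
  define z2 where "z2 = z1 - sc (1 / \<nu>) * (?b * n)"
  have bA: "?b : Alg" using ZZ_mult[OF ZZ_sc ZZ_power[OF ZZ_DD]] by (simp add: ZZ_def)
  have z2: "ZZ z2" "degle k (app z2 vac)"
   unfolding z2_def by (intro ZZ_diff ZZ_mult ZZ_sc ZZ_power ZZ_DD z1 flipperD(1)[OF n] ZZ_degle_lin flipper_top(1)[OF n bA] b'(1))+
  \<comment> \<open>In top degree the correction \<open>?b * n\<close> sits at -1 only, so it does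
    not disturb the part at 1 that has already been cancelled.\<close>
  have "hcp k (lk (app (?b * n) vac) (mat 1) S) = 0" for S
   by (rule flipper_top(2)[OF n bA]) (use b'(2) minus_mat1_ne in blast)
  moreover have sc_app: "app (sc l * a) F = smul l (app a F)" for l a and F :: "'n M" by simp
  ultimately have t1: "hcp k (lk (app z2 vac) (mat 1) S) = 0" for S
   using b(3)[folded z1_def] unfolding z2_def by (simp add: lk_simps sc_app del: app_simps(4))
  \<comment> \<open>With n n = \<nu> the corrected element is a right multiple of n, and its part at
    -1 is controlled by the part at 1 of \<open>z1 * n - ?b\<close>, which is 0.\<close>
  have "z2 = sc (1 / \<nu>) * ((z1 * n - ?b) * n)"
   using flipperD(2,3)[OF n] S.sc_comm[of z1 \<nu>]
   by (simp add: z2_def diff_dists m_ass)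
  moreover have "hcp k (lk (app ((z1 * n - ?b) * n) vac) (- mat 1) S) = 0" for S
   by (rule flipper_top(2)[OF n]) (use b'(3) z1n(1) bA in \<open>auto simp: ZZ_def Alg_simps\<close>)
  ultimately have t2: "hcp k (lk (app z2 vac) (- mat 1) S) = 0" for S
   by (simp only: sc_app lk_smul hcp_simps mult_zero_right)
  have "hcp k (lk (app z2 vac) w S) = 0" for w S
   using top_support(1)[OF z2, of w S] t1 t2 by blast
  moreover have "z2 = z - (pe (monom s m) DD + pe (Polynomial.smult (1 / \<nu>) (monom s' m')) DD * n)"
   by (simp add: pe_monom pe_smult z2_def z1_def m_ass)
  ultimately show ?thesis using z2 True by metis
 qed
qed

lemma decompose_degle:
 assumes n: "- mat 1 : W ==> flipper n \<nu> r" shows "ZZ z ==> degle k (app z vac) ==> zdec n z"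
proof (induction k arbitrary: z rule: less_induct)
 case (less k)
 obtain p q where pq: "- mat 1 \<notin> W --> q = 0" "ZZ (z - (pe p DD + pe q DD * n))"
  "degle k (app (z - (pe p DD + pe q DD * n)) vac)" "!!w S. hcp k (lk (app (z - (pe p DD + pe q DD * n)) vac) w S) = 0"
  using decompose_step[of n \<nu> r, OF n less.prems] by blast
 have "zdec n (z - (pe p DD + pe q DD * n))"
  using degle_less[OF pq(3,4)]
 proof
  assume "app (z - (pe p DD + pe q DD * n)) vac = 0"
  thus ?thesis unfolding zdec_def by (intro exI[of _ 0]) simp
 qed (use less.IH[OF _ pq(2), of "k - 1"] in auto)
 then obtain p' q' where pq': "- mat 1 \<notin> W --> q' = 0" "app (z - (pe p DD + pe q DD * n) - (pe p' DD + pe q' DD * n)) vac = 0"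
  unfolding zdec_def by blast
 have "z - (pe p DD + pe q DD * n) - (pe p' DD + pe q' DD * n) = z - (pe (p + p') DD + pe (q + q') DD * n)"
  by (simp add: pe_add distrib_right)
 hence "app (z - (pe (p + p') DD + pe (q + q') DD * n)) vac = 0" using pq'(2) by (simp only:)
 thus ?case unfolding zdec_def using pq(1) pq'(1) by (metis add_0_left)
qed

lemma degle_ex: "\<exists>k. degle k F"
proof -
 have "\<exists>N. \<forall>j>N. hcp j (lookup F x) = 0" for x by (rule hcp_bounded)
 then obtain N where N: "!!x j. j > N x ==> hcp j (lookup F x) = 0" by metis
 define k where "k = Max (insert 0 (N ` keys F))"
 have "hcp j (lk F w S) = 0" if "j > k" for j w S
 proof (cases "(w, S) : keys F")
  case True
  hence "N (w, S) \<le> k" unfolding k_def by (intro Max_ge) auto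
  thus ?thesis using N that by simp
 next
  case False
  thus ?thesis by (simp add: in_keys_iff)
 qed
 hence "app (Ho j) F = 0" if "j > k" for j
  using that by (intro poly_mapping_eqI) (metis lk_diag(7) lookup_zero surj_pair)
 thus ?thesis unfolding degle_def by blast
qed

lemma decompose:
 assumes "- mat 1 : W ==> flipper n \<nu> r" "ZZ z" shows "zdec n z"
 using decompose_degle[OF assms(1,2)] degle_ex by blast

lemma pe_top:
 assumes "p ~= 0"
 shows "degle (2 * degree p) (app (pe p DD) vac)" "app (Ho (2 * degree p)) (app (pe p DD) vac) = smul (lead_coeff p) (app (D2 ^ degree p) vac)"
proof -
 have "degle (2 * degree p) (app (pe p DD) vac) & app (Ho (2 * degree p)) (app (pe p DD) vac) = smul (lead_coeff p) (app (D2 ^ degree p) vac)"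
  using assms
 proof (induction p)
  case (pCons k p)
  show ?case
  proof (cases "p = 0")
   case True
   thus ?thesis using degle_vac by (simp add: pe_pCons) (simp add: degle_def)
  next
   case False
   hence IH: "degle (2 * degree p) (app (pe p DD) vac)" "app (Ho (2 * degree p)) (app (pe p DD) vac) = smul (lead_coeff p) (app (D2 ^ degree p) vac)"
    using pCons.IH by auto
   from tops_DD[unfolded tops_def, rule_format, OF IH(1)] IH(2) False
   have 1: "degle (2 * degree (pCons k p)) (app (DD * pe p DD) vac)"
    "app (Ho (2 * degree (pCons k p))) (app (DD * pe p DD) vac) = smul (lead_coeff (pCons k p)) (app (D2 ^ degree (pCons k p)) vac)"
    by (simp_all add: numeral_2_eq_2)
   have "app (Ho j) (app (sc k) (vac :: 'n M)) = 0" if "j > 0" for j using degle_vac(1) that by (simp add: degle_def)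
   thus ?thesis using 1 False by (simp add: pe_pCons) (auto simp: degle_def)
  qed
 qed simp
 thus "degle (2 * degree p) (app (pe p DD) vac)" "app (Ho (2 * degree p)) (app (pe p DD) vac) = smul (lead_coeff p) (app (D2 ^ degree p) vac)"
  by auto
qed

lemma ZZ_pe: "ZZ (pe p DD)"
 by (induction p) (auto simp: pe_pCons intro!: ZZ_add ZZ_mult ZZ_sc ZZ_DD ZZ_sc[of 0, simplified])

text \<open>The leading symbols of \<open>p(D)\<close> and \<open>q(D) n\<close> are supported at \<open>1\<close> and \<open>-1\<close>, so they cannot cancel.\<close>

lemma decompose_unique:
 assumes n: "- mat 1 : W ==> flipper n \<nu> r" and q: "- mat 1 \<notin> W ==> q = 0"
  and 0: "app (pe p DD + pe q DD * n) vac = 0"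
 shows "p = 0" "q = 0"
proof -
 \<comment> \<open>If q has at most the degree of p, the top symbol at 1 comes from p alone. The
   opposite case is reduced to this one by multiplying with n, which exchanges the two polynomials
   up to \<nu>.\<close>
 have one: "p = 0" if v: "app (pe p DD + pe q DD * n) vac = 0" and d: "q = 0 \<or> degree q \<le> degree p" and n: "q ~= 0 ==> flipper n \<nu> r" for p q
 proof (rule ccontr)
  assume p: "p ~= 0"
  let ?k = "2 * degree p"
  have P: "smb ?k (pe p DD) S = pconst (lead_coeff p) * lk (app (D2 ^ degree p) vac) (mat 1) S" for S
   using arg_cong[OF pe_top(2)[OF p], of "%F. lk F (mat 1) S"] by simp
  have Q: "smb ?k (pe q DD * n) S = 0" for S
  proof (cases "q = 0")
   case False
   note n = n[OF False]
   have A: "pe q DD : Alg" using ZZ_pe by (simp add: ZZ_def)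
   have "hcp ?k (lk (app (pe q DD) vac) (- mat 1) S) = 0" for S
   proof (cases "degree q = degree p")
    case True
    thus ?thesis using arg_cong[OF pe_top(2)[OF False], of "%F. lk F (- mat 1) S"] D2_support[OF minus_mat1_ne] by simp
   next
    case F: False
    hence "2 * degree q < ?k" using d False by simp
    hence "app (Ho ?k) (app (pe q DD) vac) = 0" using pe_top(1)[OF False] by (auto simp: degle_def)
    thus ?thesis by (metis lk_diag(7) lookup_zero)
   qed
   thus ?thesis by (rule flipper_top(2)[OF n A])
  qed simp
  have "smb ?k (pe p DD) S = 0" for S
   using arg_cong[OF v, of "%F. hcp ?k (lk F (mat 1) S)"] Q[of S] by (simp add: lk_simps)
  hence "pev (lk (app (D2 ^ degree p) vac) (mat 1) S) p0 = 0" for S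
   unfolding P using p by (metis leading_coeff_0_iff mult_eq_0_iff pev_basic(1) pev_simps(1,4))
  thus False using D2_nonzero by blast
 qed
 have n': "q ~= 0 ==> flipper n \<nu> r" using n q by blast
 have two: "q = 0" if "p = 0 \<or> degree p \<le> degree q"
 proof (rule ccontr)
  assume q0: "q ~= 0"
  note n = n'[OF q0]
  have "(pe p DD + pe q DD * n) * n = pe (Polynomial.smult \<nu> q) DD + pe p DD * n"
   using S.sc_comm[of "pe q DD" \<nu>] by (simp add: pe_smult distrib_right m_ass flipperD(2)[OF n])
  moreover have "pe p DD + pe q DD * n : Alg"
   using ZZ_pe flipperD(1)[OF n] by (intro Alg.add Alg.mult) (auto simp: ZZ_def)
  ultimately have "app (pe (Polynomial.smult \<nu> q) DD + pe p DD * n) vac = 0"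
   using flipperD(5)[OF n] 0 by (metis app_0)
  hence "Polynomial.smult \<nu> q = 0" by (rule one) (use that n flipperD(3)[OF n] in auto)
  thus False using q0 flipperD(3)[OF n] by simp
 qed
 show "p = 0" using one[OF 0 _ n'] two 0 one[of p 0] by (metis nat_le_linear)
 thus "q = 0" using two by simp
qed

end

section \<open>Normal ordering in H (x) C and faithfulness of the representation on the
  vacuum\<close>

section \<open>Faithfulness of the polynomial representation\<close>

lemma monoid_free: "Group.monoid (free_monoid G)"
 by (rule monoidI) (auto simp: free_monoid_def)

lemma free_carrier: "carrier (free_alg G) = {f. keys f <= lists G}"
 by (simp add: monoid_alg_simps free_monoid_def)

lemma keys_closed: "keys (single k (v::complex)) <= K \<longleftrightarrow> k : K \<or> v = 0"
 "keys f <= K ==> keys g <= K ==> keys (f - g :: 'k \<Rightarrow>\<^sub>0 complex) <= K"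
 "keys f <= K ==> keys (scale c f) <= K"
 "(!!j. j : J ==> keys (h j :: 'k \<Rightarrow>\<^sub>0 complex) <= K) ==> keys (sum h J) <= K"
proof -
 show "(!!j. j : J ==> keys (h j :: 'k \<Rightarrow>\<^sub>0 complex) <= K) ==> keys (sum h J) <= K"
 proof (induction J rule: infinite_finite_induct)
  case (insert x F)
  thus ?case using keys_add[of "h x" "sum h F"] by auto
 qed simp_all
 show "keys f <= K ==> keys (scale c f) <= K" using keys_scale[of c f] by blast
qed (use keys_diff[of f g] in auto)

context scalars
begin

text \<open>The universal property of an algebra given by generators and relators: a word goes to
  the product of the images of its letters.\<close>

lemma ahom_quot_gens:
 assumes q: "calg_quot (free_alg G) S" and s: "!!s. s : S ==> mlin (%l. foldr (%a r. \<phi> a * r) l 1) s = 0"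
 shows "ahom (quot_alg (free_alg G) S) (qlift (mlin (%l. foldr (%a r. \<phi> a * r) l 1)))"
  "l : lists G ==> qlift (mlin (%l. foldr (%a r. \<phi> a * r) l 1)) (quot_class (free_alg G) S (word l)) = foldr (%a r. \<phi> a * r) l 1"
proof -
 let ?w = "%l. foldr (%a r. \<phi> a * r) l 1"
 have a: "?w (l @ l') = ?w l * ?w l'" for l l' by (induction l) (simp_all add: m_ass)
 have h: "ahom (free_alg G) (mlin ?w)"
  by (rule ahom_mlin) (simp_all add: free_monoid_def a del: foldr_append)
 show "ahom (quot_alg (free_alg G) S) (qlift (mlin ?w))" by (rule qlift_props(1)[OF q h s])
 show "l : lists G ==> qlift (mlin ?w) (quot_class (free_alg G) S (word l)) = ?w l"
  using qlift_props(2)[OF q h s, of "word l"] by (simp add: free_carrier)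
qed

end

context calg
begin

lemma lin_span_mult_left:
 assumes "S <= carrier A" "g : carrier A" "!!s. s : S ==> g \<otimes> s : lin_span A S'" "S' <= carrier A" "u : lin_span A S"
 shows "g \<otimes> u : lin_span A S'"
 using assms(5)
proof induction
 case zero
 thus ?case using assms by (simp add: lin_span.zero)
next
 case (step u s k)
 hence "u : carrier A" "s : carrier A" using assms(1) lin_span_subset[OF assms(1)] by auto
 hence "g \<otimes> (k \<odot> s \<oplus> u) = k \<odot> (g \<otimes> s) \<oplus> g \<otimes> u" using assms by (simp add: r_distr smult_mult_r)
 thus ?case using step assms lin_span_add lin_span_smult by metis
qed

lemma lin_span_mult_right:
 assumes "S <= carrier A" "s : carrier A" "!!g. g : S ==> g \<otimes> s : lin_span A S'" "S' <= carrier A" "u : lin_span A S"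
 shows "u \<otimes> s : lin_span A S'"
 using assms(5)
proof induction
 case zero
 thus ?case using assms by (simp add: lin_span.zero)
next
 case (step u g k)
 hence "u : carrier A" "g : carrier A" using assms(1) lin_span_subset[OF assms(1)] by auto
 hence "(k \<odot> g \<oplus> u) \<otimes> s = k \<odot> (g \<otimes> s) \<oplus> u \<otimes> s" using assms by (simp add: l_distr smult_mult_l)
 thus ?case using step assms lin_span_add lin_span_smult by metis
qed

lemma lin_span_mono: "S <= lin_span A S' ==> S' <= carrier A ==> u : lin_span A S ==> u : lin_span A S'"
proof -
 assume a: "S <= lin_span A S'" "S' <= carrier A" "u : lin_span A S"
 show ?thesis using a(3)
  by induction (use a lin_span_add lin_span_smult in \<open>auto intro: lin_span.zero\<close>)
qed

lemma lin_span_lext: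
 assumes "\<nu> ` K <= carrier A" "u : lin_span A (\<nu> ` K)"
 obtains F where "keys F <= K" "u = lext A \<nu> F"
proof -
 have "\<exists>F. keys F <= K & u = lext A \<nu> F" using assms(2)
 proof induction
  case zero
  show ?case by (intro exI[of _ 0]) simp
 next
  case (step u s k)
  then obtain F i where F: "keys F <= K" "u = lext A \<nu> F" and i: "i : K" "s = \<nu> i" by blast
  have c: "\<nu> ` keys F <= carrier A" "\<nu> i : carrier A" "\<nu> ` keys (single i k) <= carrier A"
   using assms(1) F(1) i(1) by auto
  have "keys (single i k + F) <= K"
   using keys_add[of "single i k" F] F(1) i(1) by (auto split: if_splits)
  moreover have "k \<odot> s \<oplus> u = lext A \<nu> (single i k + F)"
   unfolding lext_add[OF c(3,1)] lext_single[of \<nu> i, OF c(2)] by (simp add: i F)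
  ultimately show ?case by blast
 qed
 thus ?thesis using that by blast
qed

lemma foldr_closed: "(!!a. a : set l ==> f a : carrier A) ==> u : carrier A ==> foldr (%a u. f a \<otimes> u) l u : carrier A"
 by (induction l) auto

lemma foldr_move:
 assumes "!!a. a : set l ==> f a : carrier A" "b : carrier A" "!!a. a : set l ==> f a \<otimes> b = b \<otimes> f a" "u : carrier A"
 shows "foldr (%a u. f a \<otimes> u) l (b \<otimes> u) = b \<otimes> foldr (%a u. f a \<otimes> u) l u"
 using assms
proof (induction l)
 case (Cons a l)
 have c: "foldr (%a u. f a \<otimes> u) l u : carrier A" using Cons.prems by (induction l) auto
 have "f a \<otimes> (b \<otimes> foldr (%a u. f a \<otimes> u) l u) = b \<otimes> (f a \<otimes> foldr (%a u. f a \<otimes> u) l u)"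
  using Cons.prems c by (metis list.set_intros(1) m_assoc)
 thus ?case using Cons by simp
qed simp

lemma foldr_perm:
 assumes "!!a. f a : carrier A" "!!a b. f a \<otimes> f b = f b \<otimes> f a" "u : carrier A"
 shows "mset l = mset l' ==> foldr (%a u. f a \<otimes> u) l u = foldr (%a u. f a \<otimes> u) l' u"
proof (induction l arbitrary: l')
 case (Cons a l)
 hence "a : set l'" by (metis list.set_intros(1) mset_eq_setD)
 then obtain p s where l': "l' = p @ a # s" by (meson split_list)
 have "mset l = mset (p @ s)" using Cons.prems l' by simp
 hence "foldr (%a u. f a \<otimes> u) l u = foldr (%a u. f a \<otimes> u) (p @ s) u" by (rule Cons.IH)
 moreover have "foldr (%a u. f a \<otimes> u) p (f a \<otimes> foldr (%a u. f a \<otimes> u) s u) = f a \<otimes> foldr (%a u. f a \<otimes> u) p (foldr (%a u. f a \<otimes> u) s u)"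
  by (rule foldr_move) (use assms foldr_closed[of s f] in auto)
 ultimately show ?case by (simp add: l')
qed simp

end

text \<open>Words are built by adding letters on the left, so a span that contains 1 and is stable
  under left multiplication by generators is everything.\<close>

lemma word_span:
 fixes G and S
 defines "A == free_alg G"
 defines "Q == quot_alg A S" and "q == quot_class A S"
 assumes cq: "calg_quot A S" and N: "N <= carrier Q" "\<one>\<^bsub>Q\<^esub> : lin_span Q N"
  and g: "!!a s. a : G ==> s : N ==> q (word [a]) \<otimes>\<^bsub>Q\<^esub> s : lin_span Q N" and X: "X : carrier Q"
 shows "X : lin_span Q N"
proof -
 interpret A: calg_quot A S by (rule cq)
 interpret QQ: calg Q unfolding Q_def by (rule A.calg_Q)
 note q_props = A.q_props[folded Q_def q_def] and q_smult = A.q_smult[folded Q_def q_def]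
 have w: "word l : carrier A" if "l : lists G" for l using that by (simp add: A_def free_carrier)
 have 1: "q (word l) : lin_span Q N" if "l : lists G" for l
  using that
 proof induction
  case Nil
  have "\<one>\<^bsub>A\<^esub> = word []" by (simp add: A_def monoid_alg_simps free_monoid_def)
  thus ?case using N(2) q_props(4)[OF A.one_closed A.one_closed] by simp
 next
  case (Cons a l)
  have "word (a # l) = word [a] \<otimes>\<^bsub>A\<^esub> word l" by (simp add: A_def monoid_alg_simps mmul_single free_monoid_def)
  hence "q (word (a # l)) = q (word [a]) \<otimes>\<^bsub>Q\<^esub> q (word l)" using q_props(2) w Cons by simp
  moreover have "q (word [a]) : carrier Q" using q_props(1)[of "word [a]" "word [a]"] w Cons by simp
  ultimately show ?case using QQ.lin_span_mult_left[OF N(1) _ g N(1)] Cons by simp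
 qed
 obtain F where F: "F : carrier A" "X = q F" using A.q_surj X unfolding Q_def q_def by blast
 from F(1) have "keys F <= lists G" by (simp add: A_def free_carrier)
 hence "q F : lin_span Q N"
 proof (induction rule: pm_induct_on)
  case zero
  have "q 0 = \<zero>\<^bsub>Q\<^esub>" using A.q_zero unfolding Q_def q_def by (simp add: A_def monoid_alg_simps)
  thus ?case by (simp add: lin_span.zero)
 next
  case (add l v f)
  have fc: "f : carrier A" using add by (simp add: A_def free_carrier)
  have "single l v + f = (v \<odot>\<^bsub>A\<^esub> word l) \<oplus>\<^bsub>A\<^esub> f" by (simp add: A_def monoid_alg_simps)
  hence "q (single l v + f) = v \<odot>\<^bsub>Q\<^esub> q (word l) \<oplus>\<^bsub>Q\<^esub> q f"
   using q_props(3) fc w[OF add(1)] q_smult by simp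
  thus ?case using QQ.lin_span_add[OF N(1)] QQ.lin_span_smult[OF N(1)] 1[OF add(1)] add by simp
 qed
 thus ?thesis by (simp add: F)
qed

lemma free_quot_ops:
 assumes cq: "calg_quot (free_alg G) S"
 shows "keys a <= lists G ==> k \<odot>\<^bsub>quot_alg (free_alg G) S\<^esub> quot_class (free_alg G) S a = quot_class (free_alg G) S (scale k a)"
  "keys a <= lists G ==> keys b <= lists G ==>
   quot_class (free_alg G) S a \<oplus>\<^bsub>quot_alg (free_alg G) S\<^esub> quot_class (free_alg G) S b = quot_class (free_alg G) S (a + b)"
  "l : lists G ==> l' : lists G ==>
   quot_class (free_alg G) S (word l) \<otimes>\<^bsub>quot_alg (free_alg G) S\<^esub> quot_class (free_alg G) S (word l') = quot_class (free_alg G) S (word (l @ l'))"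
  "\<one>\<^bsub>quot_alg (free_alg G) S\<^esub> = quot_class (free_alg G) S (word [])"
  "a - b : S ==> keys a <= lists G ==> keys b <= lists G ==> quot_class (free_alg G) S a = quot_class (free_alg G) S b"
  "keys a <= lists G ==> quot_class (free_alg G) S a : carrier (quot_alg (free_alg G) S)"
proof -
 interpret A: calg_quot "free_alg G" S by (rule cq)
 let ?A = "free_alg G" and ?q = "quot_class (free_alg G) S" and ?Q = "quot_alg (free_alg G) S"
 have ops: "a \<otimes>\<^bsub>?A\<^esub> b = mmul (free_monoid G) a b" "a \<oplus>\<^bsub>?A\<^esub> b = a + b" "k \<odot>\<^bsub>?A\<^esub> a = scale k a" "\<one>\<^bsub>?A\<^esub> = word []" for a b k
  by (simp_all add: monoid_alg_simps free_monoid_def)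
 have c: "a : carrier ?A \<longleftrightarrow> keys a <= lists G" for a by (simp add: free_carrier)
 show "keys a <= lists G ==> k \<odot>\<^bsub>?Q\<^esub> ?q a = ?q (scale k a)"
  using A.q_smult[of a k] unfolding ops c .
 show "keys a <= lists G ==> keys b <= lists G ==> ?q a \<oplus>\<^bsub>?Q\<^esub> ?q b = ?q (a + b)"
  using A.q_props(3)[of a b] unfolding ops c .
 show "l : lists G ==> l' : lists G ==> ?q (word l) \<otimes>\<^bsub>?Q\<^esub> ?q (word l') = ?q (word (l @ l'))"
  using A.q_props(2)[of "word l" "word l'"] unfolding ops c mmul_single by (simp add: free_monoid_def)
 show "\<one>\<^bsub>?Q\<^esub> = ?q (word [])" using A.q_props(4)[OF A.one_closed A.one_closed] unfolding ops .
 show "keys a <= lists G ==> ?q a : carrier ?Q" using A.q_props(1)[of a a] unfolding c .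
 have "\<ominus>\<^bsub>?A\<^esub> b = - b" if "keys b <= lists G" for b
  by (rule A.minus_equality) (use that in \<open>auto simp: c monoid_alg_simps free_monoid_def\<close>)
 thus "a - b : S ==> keys a <= lists G ==> keys b <= lists G ==> ?q a = ?q b"
  using A.q_eq_iff[of a b, unfolded c] A.genideal_self[OF A.S_sub] by (auto simp: c a_minus_def monoid_alg_simps)
qed

subsection \<open>The Clifford algebra\<close>

abbreviation otimes_c (infixl "\<otimes>\<^sub>c" 70) where "a \<otimes>\<^sub>c b == a \<otimes>\<^bsub>cliff\<^esub> b"
abbreviation oplus_c (infixl "\<oplus>\<^sub>c" 65) where "a \<oplus>\<^sub>c b == a \<oplus>\<^bsub>cliff\<^esub> b"
abbreviation odot_c (infixl "\<odot>\<^sub>c" 70) where "a \<odot>\<^sub>c b == a \<odot>\<^bsub>cliff\<^esub> b"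
abbreviation one_c ("\<one>\<^sub>c") where "\<one>\<^sub>c == \<one>\<^bsub>cliff\<^esub>"
abbreviation zero_c ("\<zero>\<^sub>c") where "\<zero>\<^sub>c == \<zero>\<^bsub>cliff\<^esub>"

lemma cliff_quot: "calg_quot (free_alg UNIV) (cliff_rels :: ((complex^'n) list \<Rightarrow>\<^sub>0 complex) set)"
proof -
 interpret calg "free_alg (UNIV :: (complex^'n) set)" by (rule monoid.calg_monoid_alg[OF monoid_free])
 show ?thesis by unfold_locales (simp add: free_carrier)
qed

interpretation CL: calg "cliff :: (complex, 'n::finite cliff) module"
 unfolding cliff_def by (rule calg_quot.calg_Q[OF cliff_quot])

lemma word_carrier [simp]: "word l : carrier (free_alg UNIV)"
 by (simp add: free_carrier)

lemma gamma_closed [simp]: "\<gamma> v : carrier cliff"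
 unfolding \<gamma>_def cliff_def by (rule calg_quot.q_props(1)[OF cliff_quot]) (auto simp: free_carrier)

lemma gamma_rels: "\<gamma> (k *s u + v) = k \<odot>\<^sub>c \<gamma> u \<oplus>\<^sub>c \<gamma> v" "\<gamma> v \<otimes>\<^sub>c \<gamma> v = pairing v v \<odot>\<^sub>c \<one>\<^sub>c"
proof -
 note o = free_quot_ops[OF cliff_quot, folded cliff_def]
 have e: "quot_class (free_alg UNIV) cliff_rels a = quot_class (free_alg UNIV) cliff_rels b" if "a - b : cliff_rels" for a b :: "(complex^'n) list \<Rightarrow>\<^sub>0 complex"
  by (rule free_quot_ops(5)[OF cliff_quot that]) auto
 have "word [k *s u + v] - (scale k (word [u]) + word [v]) : cliff_rels"
  unfolding cliff_rels_def by (auto simp: algebra_simps simp del: scale_single)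
 from e[OF this] show "\<gamma> (k *s u + v) = k \<odot>\<^sub>c \<gamma> u \<oplus>\<^sub>c \<gamma> v" unfolding \<gamma>_def by (simp add: o del: scale_single)
 have "word [v, v] - scale (pairing v v) (word []) : cliff_rels" unfolding cliff_rels_def by blast
 from e[OF this] show "\<gamma> v \<otimes>\<^sub>c \<gamma> v = pairing v v \<odot>\<^sub>c \<one>\<^sub>c" unfolding \<gamma>_def
  by (simp add: o del: scale_single)
qed

lemma gamma_lin: "\<gamma> (u + v) = \<gamma> u \<oplus>\<^sub>c \<gamma> v" "\<gamma> (k *s u) = k \<odot>\<^sub>c \<gamma> u" "\<gamma> 0 = \<zero>\<^sub>c"
proof -
 show 1: "\<gamma> (u + v) = \<gamma> u \<oplus>\<^sub>c \<gamma> v" for u v :: "complex^'n" using gamma_rels(1)[of 1 u v] by simp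
 show 0: "\<gamma> (0 :: complex^'n) = \<zero>\<^sub>c" using 1[of 0 0] CL.add.l_cancel_one'[of "\<gamma> (0 :: complex^'n)" "\<gamma> 0"] by simp
 show "\<gamma> (k *s u) = k \<odot>\<^sub>c \<gamma> u" using gamma_rels(1)[of k u 0] by (simp add: 0)
qed

text \<open>Polarisation of the quadratic relation at u + v.\<close>

lemma gamma_anti: "pairing u v = 0 ==> \<gamma> u \<otimes>\<^sub>c \<gamma> v = (-1) \<odot>\<^sub>c (\<gamma> v \<otimes>\<^sub>c \<gamma> u)"
proof -
 assume 0: "pairing u v = 0"
 let ?a = "\<gamma> u \<otimes>\<^sub>c \<gamma> v" and ?b = "\<gamma> v \<otimes>\<^sub>c \<gamma> u"
 have "\<gamma> (u + v) \<otimes>\<^sub>c \<gamma> (u + v) = (pairing u u \<odot>\<^sub>c \<one>\<^sub>c \<oplus>\<^sub>c pairing v v \<odot>\<^sub>c \<one>\<^sub>c) \<oplus>\<^sub>c (?a \<oplus>\<^sub>c ?b)"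
  unfolding gamma_lin(1) by (simp add: CL.l_distr CL.r_distr gamma_rels(2)[symmetric] CL.a_ac)
 moreover have "\<gamma> (u + v) \<otimes>\<^sub>c \<gamma> (u + v) = pairing u u \<odot>\<^sub>c \<one>\<^sub>c \<oplus>\<^sub>c pairing v v \<odot>\<^sub>c \<one>\<^sub>c"
  unfolding gamma_rels(2) using 0 by (simp add: pairing_add pairing_commute[of v u] CL.smult_l_distr)
 ultimately have "?a \<oplus>\<^sub>c ?b = \<zero>\<^sub>c"
  using CL.add.l_cancel_one'[of "pairing u u \<odot>\<^sub>c \<one>\<^sub>c \<oplus>\<^sub>c pairing v v \<odot>\<^sub>c \<one>\<^sub>c" "?a \<oplus>\<^sub>c ?b"]
  by simp
 thus ?thesis using CL.minus_equality[of ?a ?b] CL.smult_minus_one[of ?b] by simp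
qed

context dunkl
begin

abbreviation "gw l == foldr (%p u. \<gamma> (cvec (y p)) \<otimes>\<^sub>c u) l \<one>\<^bsub>cliff :: (complex, 'n cliff) module\<^esub>"

lemma gw_closed [simp]: "gw l : carrier cliff"
 by (rule CL.foldr_closed) simp_all

text \<open>Insertion into an increasing word: e_p moves past smaller indices with a sign each, then
  either finds its place or cancels against an equal factor.\<close>

lemma gw_left:
 assumes "p : {1..CARD('n)}" "sorted_wrt (<) l" "set l <= {1..CARD('n)}"
 shows "\<exists>k l'. \<gamma> (cvec (y p)) \<otimes>\<^sub>c gw l = k \<odot>\<^sub>c gw l' & sorted_wrt (<) l' & set l' <= insert p (set l)"
 using assms(2,3)
proof (induction l)
 case Nil
 show ?case by (intro exI[of _ 1] exI[of _ "[p]"]) simp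
next
 case (Cons q l)
 consider "p < q" | "p = q" | "q < p" by linarith
 thus ?case
 proof cases
  case 1
  thus ?thesis using Cons.prems
   by (intro exI[of _ 1] exI[of _ "p # q # l"]) auto
 next
  case 2
  have "\<gamma> (cvec (y p)) \<otimes>\<^sub>c gw (q # l) = 1 \<odot>\<^sub>c gw l"
   using onb_delta[OF assms(1) assms(1)] by (simp add: 2 CL.m_assoc[symmetric] gamma_rels(2))
  thus ?thesis using Cons.prems by (intro exI[of _ 1] exI[of _ l]) auto
 next
  case 3
  then obtain k l' where l': "\<gamma> (cvec (y p)) \<otimes>\<^sub>c gw l = k \<odot>\<^sub>c gw l'" "sorted_wrt (<) l'" "set l' <= insert p (set l)"
   using Cons by auto
  have "\<gamma> (cvec (y p)) \<otimes>\<^sub>c \<gamma> (cvec (y q)) = (-1) \<odot>\<^sub>c (\<gamma> (cvec (y q)) \<otimes>\<^sub>c \<gamma> (cvec (y p)))"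
   by (rule gamma_anti) (use onb_delta[OF assms(1), of q] Cons.prems 3 in auto)
  hence "\<gamma> (cvec (y p)) \<otimes>\<^sub>c gw (q # l) = (-1) \<odot>\<^sub>c (\<gamma> (cvec (y q)) \<otimes>\<^sub>c (\<gamma> (cvec (y p)) \<otimes>\<^sub>c gw l))"
   by (simp add: CL.m_assoc[symmetric] CL.smult_mult_l)
  hence "\<gamma> (cvec (y p)) \<otimes>\<^sub>c gw (q # l) = (-k) \<odot>\<^sub>c gw (q # l')"
   unfolding l'(1) by (simp add: CL.smult_mult_r CL.smult_smult)
  moreover have "sorted_wrt (<) (q # l')" using l'(2,3) 3 Cons.prems by auto
  ultimately show ?thesis using l'(3) by (intro exI[of _ "-k"] exI[of _ "q # l'"]) auto
 qed
qed

abbreviation "CN == gw ` {l. sorted_wrt (<) l & set l <= {1..CARD('n)}}"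

lemma CN_closed: "CN <= carrier cliff"
 by auto

lemma gamma_expand: "\<gamma> v : lin_span cliff {\<gamma> (cvec (y p)) | p. p : {1..CARD('n)}}"
proof -
 let ?S = "{\<gamma> (cvec (y p)) | p. p : {1..CARD('n)}}"
 have S: "?S <= carrier cliff" by auto
 have "finite J ==> J <= {1..CARD('n)} ==> \<gamma> (SUM p:J. pairing v (cvec (y p)) *s cvec (y p)) : lin_span cliff ?S" for J
 proof (induction J rule: finite_induct)
  case empty
  thus ?case by (simp add: gamma_lin lin_span.zero)
 next
  case (insert p J)
  hence "\<gamma> (cvec (y p)) : ?S" by blast
  thus ?case using insert lin_span.step[of _ cliff ?S] by (simp add: gamma_rels(1))
 qed
 from this[of "{1..CARD('n)}"] show ?thesis unfolding onb_expand by simp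
qed

lemma cliff_span: "b : carrier cliff ==> b : lin_span cliff CN"
proof (rule word_span[where G = UNIV, OF cliff_quot, folded cliff_def])
 have "\<one>\<^sub>c : CN" by (rule image_eqI[of _ _ "[]"]) auto
 from CL.lin_span_base[OF CN_closed this] show "\<one>\<^sub>c : lin_span cliff CN" .
 fix a :: "complex^'n" and s assume s: "s : CN"
 have sc: "s : carrier cliff" using s by auto
 let ?S = "{\<gamma> (cvec (y p)) | p. p : {1..CARD('n)}}"
 have "g \<otimes>\<^sub>c s : lin_span cliff CN" if gS: "g : ?S" for g
 proof -
  obtain p where p: "p : {1..CARD('n)}" "g = \<gamma> (cvec (y p))" using gS by blast
  obtain l where l: "sorted_wrt (<) l" "set l <= {1..CARD('n)}" "s = gw l" using s by blast
  obtain k' l' where "g \<otimes>\<^sub>c s = k' \<odot>\<^sub>c gw l'" "sorted_wrt (<) l'" "set l' <= insert p (set l)"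
   using gw_left[OF p(1) l(1,2)] p l by blast
  thus ?thesis
   using CL.lin_span_smult[OF CN_closed CL.lin_span_base[OF CN_closed]] l(2) p(1) by fastforce
 qed
 hence "\<gamma> a \<otimes>\<^sub>c s : lin_span cliff CN"
  by (intro CL.lin_span_mult_right[OF _ sc _ CN_closed gamma_expand[of a]]) auto
 thus "quot_class (free_alg UNIV) cliff_rels (word [a]) \<otimes>\<^sub>c s : lin_span cliff CN"
  by (simp only: \<gamma>_def)
qed (use CN_closed in simp_all)

definition phi2 :: "'n cliff => 'n op" where
 "phi2 = S.qlift (S.mlin (%l. foldr (%v r. cl v * r) l 1))"

lemma phi2: "S.ahom cliff phi2" "phi2 (\<gamma> v) = cl v"
proof -
 have k: "S.mlin (%l. foldr (%v r. cl v * r) l 1) s = 0" if "s : cliff_rels" for s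
  using that by (auto simp: cliff_rels_def S.mlin_diff cl_lin cl_sq)
 show "S.ahom cliff phi2" unfolding phi2_def cliff_def by (rule S.ahom_quot_gens(1)[OF cliff_quot k])
 show "phi2 (\<gamma> v) = cl v" unfolding phi2_def \<gamma>_def using S.ahom_quot_gens(2)[OF cliff_quot k, of "[v]"] by simp
qed

lemmas phi2_one = S.ahomD(3)[OF phi2(1) CL.one_closed CL.one_closed]

end

subsection \<open>The rational Cherednik algebra\<close>

text \<open>The generators are indexed by all vectors; the linearity relations reduce them to the
  axis vectors.\<close>

lemma (in calg) lin_family_expand:
 fixes f :: "complex^'n => 'a"
 assumes "!!k u v. f (k *s u + v) = k \<odot> f u \<oplus> f v" "!!u. f u : carrier A"
 shows "f u : lin_span A (range (%i. f (axis i 1)))"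
proof -
 let ?S = "range (%i. f (axis i 1))"
 have "f (1 *s 0 + 0) = 1 \<odot> f 0 \<oplus> f 0" by (rule assms(1))
 hence 0: "f 0 = \<zero>" using assms(2) by simp
 have "finite J ==> f (SUM i:J. u $ i *s axis i 1) : lin_span A ?S" for J :: "'n set"
 proof (induction J rule: finite_induct)
  case empty
  thus ?case by (simp add: 0 lin_span.zero)
 next
  case (insert i J)
  thus ?case using lin_span.step[of _ A ?S "f (axis i 1)"] by (simp add: assms(1))
 qed
 from this[of UNIV] show ?thesis by (simp add: basis_expansion)
qed

context dunkl
begin

abbreviation "rels == smash_rels R \<union> cherednik_rels P c t"
abbreviation "RC == rca R P c t"
abbreviation otimes_r (infixl "\<otimes>\<^sub>r" 70) where "a \<otimes>\<^sub>r b == a \<otimes>\<^bsub>RC\<^esub> b"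
abbreviation oplus_r (infixl "\<oplus>\<^sub>r" 65) where "a \<oplus>\<^sub>r b == a \<oplus>\<^bsub>RC\<^esub> b"
abbreviation odot_r (infixl "\<odot>\<^sub>r" 70) where "a \<odot>\<^sub>r b == a \<odot>\<^bsub>RC\<^esub> b"
abbreviation one_r ("\<one>\<^sub>r") where "\<one>\<^sub>r == \<one>\<^bsub>RC\<^esub>"
abbreviation zero_r ("\<zero>\<^sub>r") where "\<zero>\<^sub>r == \<zero>\<^bsub>RC\<^esub>"
abbreviation otimes_h (infixl "\<otimes>\<^sub>h" 70) where "a \<otimes>\<^sub>h b == a \<otimes>\<^bsub>HC\<^esub> b"
abbreviation oplus_h (infixl "\<oplus>\<^sub>h" 65) where "a \<oplus>\<^sub>h b == a \<oplus>\<^bsub>HC\<^esub> b"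
abbreviation odot_h (infixl "\<odot>\<^sub>h" 70) where "a \<odot>\<^sub>h b == a \<odot>\<^bsub>HC\<^esub> b"
abbreviation one_h ("\<one>\<^sub>h") where "\<one>\<^sub>h == \<one>\<^bsub>HC\<^esub>"
abbreviation zero_h ("\<zero>\<^sub>h") where "\<zero>\<^sub>h == \<zero>\<^bsub>HC\<^esub>"

lemma P_W: "al : P ==> root_refl al : W"
 using P_props(1) W_refl by blast

lemma gens [simp]: "Vec u : rca_gens R" "Cov u : rca_gens R" "Grp g : rca_gens R \<longleftrightarrow> g : W"
 by (auto simp: rca_gens_def)

lemma word_keys: "l : lists (rca_gens R) ==> keys (word l) <= lists (rca_gens R)"
 by simp

lemma keys_plus: "keys f <= K ==> keys g <= K ==> keys (f + g :: 'k \<Rightarrow>\<^sub>0 complex) <= K"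
 using keys_add[of f g] by auto

lemma rca_quot: "calg_quot (free_alg (rca_gens R)) rels"
proof -
 interpret calg "free_alg (rca_gens R)" by (rule monoid.calg_monoid_alg[OF monoid_free])
 have "keys s <= lists (rca_gens R)" if "s : rels" for s
  using that unfolding smash_rels_def cherednik_rels_def
  by (elim UnE CollectE exE conjE singletonE; simp only:; intro keys_closed(2-4) word_keys; simp add: W_mult refl_group.one P_W)
 hence "rels <= carrier (free_alg (rca_gens R))" by (auto simp only: free_carrier)
 thus ?thesis by unfold_locales
qed

lemma calg_RC: "calg RC"
 unfolding rca_def by (rule calg_quot.calg_Q[OF rca_quot])

sublocale RC: calg RC
 by (rule calg_RC)

abbreviation "xg u == rca_gen R P c t (Cov u)"
abbreviation "yg u == rca_gen R P c t (Vec u)"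
abbreviation "wg g == rca_gen R P c t (Grp g)"

lemma rca_gen_closed: "a : rca_gens R ==> rca_gen R P c t a : carrier RC"
 unfolding rca_gen_def rca_def by (rule free_quot_ops(6)[OF rca_quot]) simp

lemma gen_closed [simp]: "xg u : carrier RC" "yg u : carrier RC" "g : W ==> wg g : carrier RC"
 by (simp_all add: rca_gen_closed)

lemma rca_ops:
 "keys a <= lists (rca_gens R) ==> k \<odot>\<^sub>r quot_class (free_alg (rca_gens R)) rels a = quot_class (free_alg (rca_gens R)) rels (scale k a)"
 "keys a <= lists (rca_gens R) ==> keys b <= lists (rca_gens R) ==>
  quot_class (free_alg (rca_gens R)) rels a \<oplus>\<^sub>r quot_class (free_alg (rca_gens R)) rels b = quot_class (free_alg (rca_gens R)) rels (a + b)"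
 "g : rca_gens R ==> h : rca_gens R ==> rca_gen R P c t g \<otimes>\<^sub>r rca_gen R P c t h = quot_class (free_alg (rca_gens R)) rels (word [g, h])"
 "\<one>\<^sub>r = quot_class (free_alg (rca_gens R)) rels (word [])"
 "a - b : rels ==> keys a <= lists (rca_gens R) ==> keys b <= lists (rca_gens R) ==>
  quot_class (free_alg (rca_gens R)) rels a = quot_class (free_alg (rca_gens R)) rels b"
 using free_quot_ops(1,2,5)[OF rca_quot, of a] free_quot_ops(4)[OF rca_quot] free_quot_ops(3)[OF rca_quot, of "[g]" "[h]"] unfolding rca_def rca_gen_def by auto

lemma rca_rels:
 "xg (k *s u + v) = k \<odot>\<^sub>r xg u \<oplus>\<^sub>r xg v" "yg (k *s u + v) = k \<odot>\<^sub>r yg u \<oplus>\<^sub>r yg v"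
 "wg (mat 1) = \<one>\<^sub>r" "g : W ==> h : W ==> wg g \<otimes>\<^sub>r wg h = wg (g ** h)"
 "g : W ==> wg g \<otimes>\<^sub>r xg u = xg (cmat g *v u) \<otimes>\<^sub>r wg g" "g : W ==> wg g \<otimes>\<^sub>r yg u = yg (cmat g *v u) \<otimes>\<^sub>r wg g"
 "xg u \<otimes>\<^sub>r xg v = xg v \<otimes>\<^sub>r xg u" "yg u \<otimes>\<^sub>r yg v = yg v \<otimes>\<^sub>r yg u"
proof -
 note sm = smash_rels_def and ch = cherednik_rels_def
 have c1: "word [Cov (k *s u + v)] - (scale k (word [Cov u]) + word [Cov v]) : rels"
  unfolding diff_diff_eq[symmetric] sm by blast
 show "xg (k *s u + v) = k \<odot>\<^sub>r xg u \<oplus>\<^sub>r xg v"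
  using rca_ops(5)[OF c1] unfolding rca_gen_def by (simp add: rca_ops(1,2) keys_closed(3) keys_plus del: scale_single)
 have c2: "word [Vec (k *s u + v)] - (scale k (word [Vec u]) + word [Vec v]) : rels"
  unfolding diff_diff_eq[symmetric] sm by blast
 show "yg (k *s u + v) = k \<odot>\<^sub>r yg u \<oplus>\<^sub>r yg v"
  using rca_ops(5)[OF c2] unfolding rca_gen_def by (simp add: rca_ops(1,2) keys_closed(3) keys_plus del: scale_single)
 have "word [Grp (mat 1)] - word [] : rels" unfolding sm by blast
 from rca_ops(5)[OF this] show "wg (mat 1) = \<one>\<^sub>r" unfolding rca_gen_def rca_ops(4) by (simp add: refl_group.one)
 have g: "rca_gen R P c t a \<otimes>\<^sub>r rca_gen R P c t b = rca_gen R P c t a' \<otimes>\<^sub>r rca_gen R P c t b'"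
  if "word [a, b] - word [a', b'] : rels" "{a, b, a', b'} <= rca_gens R" for a b a' b'
  using rca_ops(5)[OF that(1)] that(2) by (simp add: rca_ops(3))
 show "wg g \<otimes>\<^sub>r wg h = wg (g ** h)" if "g : W" "h : W"
 proof -
  have "word [Grp g, Grp h] - word [Grp (g ** h)] : rels" unfolding sm using that by blast
  from rca_ops(5)[OF this] show ?thesis using that by (simp add: rca_ops(3) W_mult) (simp add: rca_gen_def)
 qed
 have "word [Grp g, Cov u] - word [Cov (cmat g *v u), Grp g] : rels" "word [Grp g, Vec u] - word [Vec (cmat g *v u), Grp g] : rels" if "g : W"
  unfolding sm using that by blast+
 from g[OF this(1)] g[OF this(2)] show "g : W ==> wg g \<otimes>\<^sub>r xg u = xg (cmat g *v u) \<otimes>\<^sub>r wg g" "g : W ==> wg g \<otimes>\<^sub>r yg u = yg (cmat g *v u) \<otimes>\<^sub>r wg g"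
  by simp_all
 have "word [Cov u, Cov v] - word [Cov v, Cov u] : rels" "word [Vec u, Vec v] - word [Vec v, Vec u] : rels"
  unfolding ch by blast+
 from g[OF this(1)] g[OF this(2)] show "xg u \<otimes>\<^sub>r xg v = xg v \<otimes>\<^sub>r xg u" "yg u \<otimes>\<^sub>r yg v = yg v \<otimes>\<^sub>r yg u"
  by simp_all
qed

lemma wg_closed: "wg ` W <= carrier RC"
 by auto

text \<open>Only the shape of the commutator is retained, a combination of group elements, which is
  all that normal ordering requires.\<close>

lemma rca_rel_yx: "\<exists>B \<in> lin_span RC (wg ` W). yg u \<otimes>\<^sub>r xg v = xg v \<otimes>\<^sub>r yg u \<oplus>\<^sub>r B"
proof -
 let ?q = "quot_class (free_alg (rca_gens R)) rels"
 define a where "a al = - (pairing u (cvec al) * pairing (cvec (coroot al)) v * c al)" for al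
 define b where "b J = scale (t * pairing u v) (word []) + (SUM al:J. scale (a al) (word [Grp (root_refl al)]))" for J
 have bk: "keys (b J) <= lists (rca_gens R)" if "J <= P" for J
 proof -
  have "keys (SUM al:J. scale (a al) (word [Grp (root_refl al)])) <= lists (rca_gens R)"
   by (intro keys_closed(3,4)) (use that P_W in auto)
  moreover have "keys (scale (t * pairing u v) (word [])) <= lists (rca_gens R)" by (intro keys_closed(3)) simp
  ultimately show ?thesis unfolding b_def by (intro keys_plus)
 qed
 have q: "?q (b J) : lin_span RC (wg ` W)" if "finite J" "J <= P" for J
  using that
 proof (induction J rule: finite_induct)
  case empty
  have "?q (b {}) = (t * pairing u v) \<odot>\<^sub>r \<one>\<^sub>r" unfolding b_def rca_ops(4) by (subst rca_ops(1)) auto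
  moreover have "\<one>\<^sub>r : lin_span RC (wg ` W)"
   using RC.lin_span_base[OF wg_closed imageI[OF refl_group.one]] unfolding rca_rels(3) .
  ultimately show ?case using RC.lin_span_smult[OF wg_closed] by simp
 next
  case (insert al J)
  hence w: "root_refl al : W" using P_W by auto
  have "b (insert al J) = scale (a al) (word [Grp (root_refl al)]) + b J" using insert by (simp add: b_def add_ac)
  hence "?q (b (insert al J)) = a al \<odot>\<^sub>r wg (root_refl al) \<oplus>\<^sub>r ?q (b J)"
   unfolding rca_gen_def using insert bk[of J] w by (simp add: rca_ops keys_closed(3))
  thus ?case using insert lin_span.step[of _ RC "wg ` W"] w by simp
 qed
 have "word [Vec u, Cov v] - (word [Cov v, Vec u] + b P) = word [Vec u, Cov v] - word [Cov v, Vec u]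
   - (scale (t * pairing u v) (word []) - (SUM al:P. scale (pairing u (cvec al) * pairing (cvec (coroot al)) v * c al) (word [Grp (root_refl al)])))"
  by (simp add: b_def a_def single_uminus sum_negf)
 also have "... : rels" unfolding cherednik_rels_def by blast
 finally have "?q (word [Vec u, Cov v]) = ?q (word [Cov v, Vec u] + b P)"
  by (rule rca_ops(5)) (simp, intro keys_plus bk, simp_all)
 hence "yg u \<otimes>\<^sub>r xg v = xg v \<otimes>\<^sub>r yg u \<oplus>\<^sub>r ?q (b P)"
  by (simp add: rca_ops(3) rca_ops(2) bk)
 thus ?thesis using q[OF P_props(2)] by blast
qed

text \<open>Normally ordered words: x letters, y letters, one group element. The order of the
  letters inside a block is still free at this stage.\<close>

abbreviation "xw == %l. foldr (%i u. xg (axis i 1) \<otimes>\<^sub>r u) l"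
abbreviation "yw == %l. foldr (%i u. yg (axis i 1) \<otimes>\<^sub>r u) l"
abbreviation "YN == {yw js (wg g) | js g. g : W}"
abbreviation "RN == {xw ks (yw js (wg g)) | ks js g. g : W}"

lemma RN_closed: "YN <= carrier RC" "RN <= carrier RC"
proof -
 have 1: "u : carrier RC ==> yw l u : carrier RC" "u : carrier RC ==> xw l u : carrier RC" for l u
  by (induction l) auto
 thus "YN <= carrier RC" "RN <= carrier RC" by auto
qed

lemma YN_left:
 assumes u: "u : lin_span RC YN"
 shows "yg v \<otimes>\<^sub>r u : lin_span RC YN" "h : W ==> wg h \<otimes>\<^sub>r u : lin_span RC YN"
proof -
 have y: "yg v \<otimes>\<^sub>r u : lin_span RC YN" if "u : lin_span RC YN" for v u
 proof (rule RC.lin_span_mult_left[OF RN_closed(1) _ _ RN_closed(1) that])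
  fix s assume s: "s : YN"
  show "yg v \<otimes>\<^sub>r s : lin_span RC YN"
  proof (rule RC.lin_span_mult_right[OF _ _ _ RN_closed(1) RC.lin_family_expand[of yg, OF rca_rels(2)]])
   fix g assume "g : range (%i. yg (axis i 1))"
   then obtain i where "g = yg (axis i 1)" by blast
   moreover obtain js h where "s = yw js (wg h)" "h : W" using s by blast
   ultimately have "g \<otimes>\<^sub>r s = yw (i # js) (wg h)" by simp
   hence "g \<otimes>\<^sub>r s : YN" using \<open>h : W\<close> by blast
   thus "g \<otimes>\<^sub>r s : lin_span RC YN" by (rule RC.lin_span_base[OF RN_closed(1)])
  qed (use s RN_closed(1) in auto)
 qed simp
 thus "yg v \<otimes>\<^sub>r u : lin_span RC YN" using u .
 have w: "wg h \<otimes>\<^sub>r yw js (wg g) : lin_span RC YN" if "h : W" "g : W" for h g js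
 proof (induction js)
  case Nil
  have "yw [] (wg (h ** g)) : YN" using W_mult[OF that] by blast
  from RC.lin_span_base[OF RN_closed(1) this] show ?case using that by (simp add: rca_rels(4))
 next
  case (Cons i js)
  have c: "yw js (wg g) : carrier RC" using that by (induction js) auto
  have "wg h \<otimes>\<^sub>r yw (i # js) (wg g) = yg (cmat h *v axis i 1) \<otimes>\<^sub>r (wg h \<otimes>\<^sub>r yw js (wg g))"
   using that c by (simp add: RC.m_assoc[symmetric] rca_rels(6))
  thus ?case using y[OF Cons] by simp
 qed
 show "wg h \<otimes>\<^sub>r u : lin_span RC YN" if "h : W"
  by (rule RC.lin_span_mult_left[OF RN_closed(1) _ _ RN_closed(1) u]) (use w that in auto)
qed

text \<open>A letter is moved to the right past the x's. The case of group elements precedes that of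
  y, because moving y past x creates group elements.\<close>

lemma RN_left:
 assumes u: "u : lin_span RC RN"
 shows "xg v \<otimes>\<^sub>r u : lin_span RC RN" "h : W ==> wg h \<otimes>\<^sub>r u : lin_span RC RN" "yg v \<otimes>\<^sub>r u : lin_span RC RN"
proof -
 have x: "xg v \<otimes>\<^sub>r u : lin_span RC RN" if "u : lin_span RC RN" for v u
 proof (rule RC.lin_span_mult_left[OF RN_closed(2) _ _ RN_closed(2) that])
  fix s assume s: "s : RN"
  show "xg v \<otimes>\<^sub>r s : lin_span RC RN"
  proof (rule RC.lin_span_mult_right[OF _ _ _ RN_closed(2) RC.lin_family_expand[of xg, OF rca_rels(1)]])
   fix g assume "g : range (%i. xg (axis i 1))"
   then obtain i where "g = xg (axis i 1)" by blast
   moreover obtain ks js h where "s = xw ks (yw js (wg h))" "h : W" using s by blast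
   ultimately have "g \<otimes>\<^sub>r s = xw (i # ks) (yw js (wg h))" by simp
   hence "g \<otimes>\<^sub>r s : RN" using \<open>h : W\<close> by blast
   thus "g \<otimes>\<^sub>r s : lin_span RC RN" by (rule RC.lin_span_base[OF RN_closed(2)])
  qed (use s RN_closed(2) in auto)
 qed simp
 thus "xg v \<otimes>\<^sub>r u : lin_span RC RN" using u .
 have YR: "yw js (wg g) : RN" if "g : W" for js g
 proof -
  have "xw [] (yw js (wg g)) : RN" using that by blast
  thus ?thesis by simp
 qed
 have YR: "YN <= RN"
 proof
  fix u assume "u : YN"
  then obtain js g where "u = yw js (wg g)" "g : W" by auto
  thus "u : RN" using YR by simp
 qed
 have "YN <= lin_span RC RN"
  by (rule subsetI, rule RC.lin_span_base[OF RN_closed(2)], rule subsetD[OF YR])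
 from RC.lin_span_mono[OF this RN_closed(2)] have sub: "v : lin_span RC YN ==> v : lin_span RC RN" for v .
 have YN: "yw js (wg g) : lin_span RC YN" if "g : W" for js g
  by (rule RC.lin_span_base[OF RN_closed(1)]) (use that in blast)
 have c: "xw ks (yw js (wg g)) : carrier RC" if "g : W" for ks js g using RN_closed(2) that by blast
 have w: "wg h \<otimes>\<^sub>r xw ks (yw js (wg g)) : lin_span RC RN" if "h : W" "g : W" for h g js ks
 proof (induction ks)
  case Nil
  thus ?case using sub[OF YN_left(2)[OF YN[OF that(2)] that(1)]] by simp
 next
  case (Cons i ks)
  have "wg h \<otimes>\<^sub>r xw (i # ks) (yw js (wg g)) = xg (cmat h *v axis i 1) \<otimes>\<^sub>r (wg h \<otimes>\<^sub>r xw ks (yw js (wg g)))"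
   using that c[of g ks js] by (simp add: RC.m_assoc[symmetric] rca_rels(5))
  thus ?case using x[OF Cons] by simp
 qed
 have W: "wg h \<otimes>\<^sub>r u : lin_span RC RN" if "h : W" "u : lin_span RC RN" for h u
  by (rule RC.lin_span_mult_left[OF RN_closed(2) _ _ RN_closed(2) that(2)]) (use w that in auto)
 thus "h : W ==> wg h \<otimes>\<^sub>r u : lin_span RC RN" using u by blast
 have y: "yg v \<otimes>\<^sub>r xw ks (yw js (wg g)) : lin_span RC RN" if "g : W" for v g js ks
 proof (induction ks)
  case Nil
  thus ?case using sub[OF YN_left(1)[OF YN[OF that(1)]]] by simp
 next
  case (Cons i ks)
  let ?r = "xw ks (yw js (wg g))"
  obtain B where B: "B : lin_span RC (wg ` W)" "yg v \<otimes>\<^sub>r xg (axis i 1) = xg (axis i 1) \<otimes>\<^sub>r yg v \<oplus>\<^sub>r B"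
   using rca_rel_yx by blast
  have Bc: "B : carrier RC" using B(1) RC.lin_span_subset[OF wg_closed] by blast
  have rr: "?r : lin_span RC RN" by (rule RC.lin_span_base[OF RN_closed(2)]) (use that in blast)
  have "yg v \<otimes>\<^sub>r xw (i # ks) (yw js (wg g)) = xg (axis i 1) \<otimes>\<^sub>r (yg v \<otimes>\<^sub>r ?r) \<oplus>\<^sub>r B \<otimes>\<^sub>r ?r"
   using c[OF that, of ks js] Bc by (simp add: RC.m_assoc[symmetric] B(2) RC.l_distr)
  moreover have "B \<otimes>\<^sub>r ?r : lin_span RC RN"
   by (rule RC.lin_span_mult_right[OF wg_closed c[OF that] _ RN_closed(2) B(1)]) (use W rr in auto)
  ultimately show ?case using x[OF Cons] RC.lin_span_add[OF RN_closed(2)] by simp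
 qed
 show "yg v \<otimes>\<^sub>r u : lin_span RC RN"
  by (rule RC.lin_span_mult_left[OF RN_closed(2) _ _ RN_closed(2) u]) (use y in auto)
qed

lemma rca_span: "X : carrier RC ==> X : lin_span RC RN"
proof (rule word_span[OF rca_quot, folded rca_def])
 have "xw [] (yw [] (wg (mat 1))) : RN" using refl_group.one by blast
 from RC.lin_span_base[OF RN_closed(2) this] show "\<one>\<^sub>r : lin_span RC RN" by (simp add: rca_rels(3))
 fix a s assume a: "a : rca_gens R" and s: "s : RN"
 have "s : lin_span RC RN" using s by (rule RC.lin_span_base[OF RN_closed(2)])
 hence "rca_gen R P c t a \<otimes>\<^sub>r s : lin_span RC RN" using RN_left[of s] a by (cases a) auto
 thus "quot_class (free_alg (rca_gens R)) rels (word [a]) \<otimes>\<^sub>r s : lin_span RC RN" by (simp only: rca_gen_def)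
qed (use RN_closed(2) in simp_all)

definition phig :: "'n rca_gen => 'n op" where
 "phig a = (case a of Vec v => T v | Cov v => Xo v | Grp g => gr g)"

definition phi1 :: "('n rca_gen list \<Rightarrow>\<^sub>0 complex) set => 'n op" where
 "phi1 = S.qlift (S.mlin (%l. foldr (%v r. phig v * r) l 1))"

text \<open>\<alpha> and -\<alpha> contribute equally, so weight c/2 on all roots becomes the weight
  c on positive roots that occurs in the relators.\<close>

lemma Bo_P: "Bo u a = sc (t * pairing u a) - (SUM al:P. sc (pairing u (cvec al) * pairing (cvec (coroot al)) a * c al) * gr (root_refl al))"
proof -
 have "sc (c (- al) / 2 * pairing u (cvec (- al)) * pairing (cvec (coroot (- al))) a) * gr (root_refl (- al))
   = sc (c al / 2 * pairing u (cvec al) * pairing (cvec (coroot al)) a) * gr (root_refl al)" if "al : P" for al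
  using that P_props(1) by (simp add: c_minus subsetD cvec_simps pairing_minus)
 moreover have "sc (k / 2 * p * q) * b + sc (k / 2 * p * q) * b = sc (p * q * k) * b" for k p q and b :: "'n op"
  unfolding distrib_right[symmetric] S.sc_add[symmetric] by (simp add: mult_ac)
 ultimately show ?thesis unfolding Bo_def P_props(3) by simp
qed

lemma phi1: "S.ahom RC phi1" "a : rca_gens R ==> phi1 (rca_gen R P c t a) = phig a"
proof -
 have k: "S.mlin (%l. foldr (%v r. phig v * r) l 1) s = 0" if "s : rels" for s
  using that unfolding smash_rels_def cherednik_rels_def
  by (auto simp: S.mlin_diff S.mlin_sum phig_def T_lin Xo_lin gr_one gr_gr gr_T gr_Xo W_orth Xo_Xo T_Xo Bo_P
    T_T[of _ _] intro: T_T)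
 show "S.ahom RC phi1" unfolding phi1_def rca_def by (rule S.ahom_quot_gens(1)[OF rca_quot k])
 show "a : rca_gens R ==> phi1 (rca_gen R P c t a) = phig a"
  unfolding phi1_def rca_gen_def using S.ahom_quot_gens(2)[OF rca_quot k, of "[a]"] by simp
qed

end

subsection \<open>The tensor product\<close>

lemma (in calg) minus_zero_eq: "a : carrier A ==> b : carrier A ==> a \<ominus> b = \<zero> ==> a = b"
 using add.inv_equality[of a "\<ominus> b"] by (simp add: a_minus_def minus_equality) (metis a_minus_def add.inv_closed minus_equality minus_minus)

definition lst :: "'a multiset => 'a list" where "lst m = (SOME l. mset l = m)"

lemma mset_lst [simp]: "mset (lst m) = m"
 unfolding lst_def by (rule someI_ex) (rule ex_mset)

context dunkl
begin

abbreviation "tn a b == tensor RC cliff a b"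
abbreviation "tmon == RC \<times>\<times> (cliff :: (complex, 'n cliff) module)"

lemma monoid_tmon: "Group.monoid tmon"
 by (rule DirProd_monoid) unfold_locales

lemma hc_quot: "calg_quot (monoid_alg tmon) (tensor_rels RC cliff)"
proof -
 interpret calg "monoid_alg tmon" by (rule monoid.calg_monoid_alg[OF monoid_tmon])
 have "keys s <= carrier tmon" if "s : tensor_rels RC cliff" for s
  using that unfolding tensor_rels_def
  by (elim UnE CollectE exE conjE; simp only:; intro keys_closed(2); simp)
 thus ?thesis by unfold_locales (auto simp only: monoid_alg_simps)
qed

sublocale HC: calg HC
 unfolding HC_def tensor_alg_def by (rule calg_quot.calg_Q[OF hc_quot])

lemma tn:
 assumes a: "a : carrier RC" "a' : carrier RC" and b: "b : carrier cliff" "b' : carrier cliff"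
 shows "tn a b : carrier HC" "tn a b \<otimes>\<^sub>h tn a' b' = tn (a \<otimes>\<^sub>r a') (b \<otimes>\<^sub>c b')"
  "tn (a \<oplus>\<^sub>r a') b = tn a b \<oplus>\<^sub>h tn a' b" "tn a (b \<oplus>\<^sub>c b') = tn a b \<oplus>\<^sub>h tn a b'"
  "tn (k \<odot>\<^sub>r a) b = k \<odot>\<^sub>h tn a b" "tn a (k \<odot>\<^sub>c b) = k \<odot>\<^sub>h tn a b"
  "\<one>\<^sub>h = tn \<one>\<^sub>r \<one>\<^sub>c"
proof -
 let ?A = "monoid_alg tmon" and ?q = "quot_class (monoid_alg tmon) (tensor_rels RC cliff)"
 interpret A: calg_quot ?A "tensor_rels RC cliff" by (rule hc_quot)
 have HC: "HC = quot_alg ?A (tensor_rels RC cliff)" by (simp add: HC_def tensor_alg_def)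
 have w: "single (u, v) k : carrier ?A" if "u : carrier RC" "v : carrier cliff" for u v k
  using that by (simp add: monoid_alg_simps)
 show "tn a b : carrier HC" unfolding HC tensor_def using A.q_props(1)[OF w w] a b by blast
 have "?q (single (a, b) 1) \<otimes>\<^sub>h ?q (single (a', b') 1) = ?q (single (a, b) 1 \<otimes>\<^bsub>?A\<^esub> single (a', b') 1)"
  unfolding HC by (rule A.q_props(2)[OF w w]) (use a b in auto)
 thus "tn a b \<otimes>\<^sub>h tn a' b' = tn (a \<otimes>\<^sub>r a') (b \<otimes>\<^sub>c b')"
  by (simp add: tensor_def monoid_alg_simps mmul_single)
 show "\<one>\<^sub>h = tn \<one>\<^sub>r \<one>\<^sub>c"
  using A.q_props(4)[OF A.one_closed A.one_closed] unfolding HC by (simp add: tensor_def monoid_alg_simps)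
 have minus: "u \<ominus>\<^bsub>?A\<^esub> v = u - v" if "v : carrier ?A" for u v
 proof -
  have "\<ominus>\<^bsub>?A\<^esub> v = - v" by (rule A.minus_equality) (use that in \<open>auto simp: monoid_alg_simps\<close>)
  thus ?thesis by (simp add: a_minus_def monoid_alg_simps)
 qed
 have e: "?q u = ?q v" if "u - v : tensor_rels RC cliff" "u : carrier ?A" "v : carrier ?A" for u v
  using A.q_eq_iff[OF that(2,3)] that minus A.genideal_self[OF A.S_sub] by auto
 have s: "?q (single (u, v) k) = k \<odot>\<^sub>h tn u v" if "u : carrier RC" "v : carrier cliff" for u v k
  unfolding HC tensor_def using A.q_smult[OF w[OF that, of 1], of k] by (simp add: monoid_alg_simps)
 have p: "?q (u + v) = ?q u \<oplus>\<^sub>h ?q v" if "u : carrier ?A" "v : carrier ?A" for u v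
  unfolding HC using A.q_props(3)[OF that] by (simp add: monoid_alg_simps)
 have pc: "u + v : carrier ?A" if "u : carrier ?A" "v : carrier ?A" for u v
  using A.a_closed[OF that] by (simp add: monoid_alg_simps)
 have 1: "single (a \<oplus>\<^sub>r a', b) 1 - (single (a, b) 1 + single (a', b) 1) : tensor_rels RC cliff"
  unfolding diff_diff_eq[symmetric] tensor_rels_def using a b by blast
 show "tn (a \<oplus>\<^sub>r a') b = tn a b \<oplus>\<^sub>h tn a' b"
  using e[OF 1 w pc[OF w w]] p[OF w w] a b unfolding tensor_def by simp
 have 2: "single (a, b \<oplus>\<^sub>c b') 1 - (single (a, b) 1 + single (a, b') 1) : tensor_rels RC cliff"
  unfolding diff_diff_eq[symmetric] tensor_rels_def using a b by blast
 show "tn a (b \<oplus>\<^sub>c b') = tn a b \<oplus>\<^sub>h tn a b'"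
  using e[OF 2 w pc[OF w w]] p[OF w w] a b unfolding tensor_def by simp
 have 3: "single (k \<odot>\<^sub>r a, b) 1 - single (a, b) k : tensor_rels RC cliff"
  "single (a, k \<odot>\<^sub>c b) 1 - single (a, b) k : tensor_rels RC cliff"
  unfolding tensor_rels_def using a b by blast+
 show "tn (k \<odot>\<^sub>r a) b = k \<odot>\<^sub>h tn a b" "tn a (k \<odot>\<^sub>c b) = k \<odot>\<^sub>h tn a b"
  using e[OF 3(1) w w] e[OF 3(2) w w] s[OF a(1) b(1), of k] a b unfolding tensor_def by (simp_all only: RC.smult_closed CL.smult_closed)
qed

lemma tn_closed: "a : carrier RC ==> b : carrier cliff ==> tn a b : carrier HC"
 by (rule tn(1))

lemma tn_zero: "b : carrier cliff ==> tn \<zero>\<^sub>r b = \<zero>\<^sub>h" "a : carrier RC ==> tn a \<zero>\<^sub>c = \<zero>\<^sub>h"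
proof -
 note z = RC.zero_closed and z' = CL.zero_closed
 show "tn \<zero>\<^sub>r b = \<zero>\<^sub>h" if b: "b : carrier cliff"
  using tn(5)[OF z z b b, of 0] RC.smult_zero_l[OF z] HC.smult_zero_l[OF tn(1)[OF z z b b]] by metis
 show "tn a \<zero>\<^sub>c = \<zero>\<^sub>h" if a: "a : carrier RC"
  using tn(6)[OF a a z' z', of 0] CL.smult_zero_l[OF z'] HC.smult_zero_l[OF tn(1)[OF a a z' z']] by metis
qed

lemma hc_span_tn: "X : carrier HC ==> X : lin_span HC {tn a b | a b. a : carrier RC & b : carrier cliff}"
proof -
 let ?A = "monoid_alg tmon" and ?q = "quot_class (monoid_alg tmon) (tensor_rels RC cliff)"
 let ?N = "{tn a b | a b. a : carrier RC & b : carrier cliff}"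
 interpret A: calg_quot ?A "tensor_rels RC cliff" by (rule hc_quot)
 have HC: "HC = quot_alg ?A (tensor_rels RC cliff)" by (simp add: HC_def tensor_alg_def)
 assume "X : carrier HC"
 then obtain F where F: "F : carrier ?A" "X = ?q F" unfolding HC using A.q_surj by blast
 from F(1) have "keys F <= carrier tmon" by (simp add: monoid_alg_simps)
 hence "?q F : lin_span HC ?N"
 proof (induction rule: pm_induct_on)
  case zero
  have "?q 0 = \<zero>\<^sub>h" using A.q_zero unfolding HC by (simp add: monoid_alg_simps)
  thus ?case by (simp add: lin_span.zero)
 next
  case (add k v f)
  have k: "single k 1 : carrier ?A" "f : carrier ?A" using add by (auto simp: monoid_alg_simps)
  have "single k v + f = v \<odot>\<^bsub>?A\<^esub> single k 1 \<oplus>\<^bsub>?A\<^esub> f" by (simp add: monoid_alg_simps)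
  hence "?q (single k v + f) = v \<odot>\<^sub>h ?q (single k 1) \<oplus>\<^sub>h ?q f"
   unfolding HC using A.q_props(3)[OF A.smult_closed[OF k(1)] k(2)] A.q_smult[OF k(1)] by simp
  moreover have "?q (single k 1) : ?N"
   using add(1) by (auto simp: tensor_def)
  ultimately show ?case using lin_span.step[OF add(3)] by simp
 qed
 thus ?thesis unfolding F .
qed

definition HN :: "'n rcc set" where "HN = {tn n m | n m. n : RN & m : CN}"

lemma HN_E: "X : HN ==> \<exists>n m. X = tn n m & n : RN & m : CN"
 unfolding HN_def by (rule CollectD)

lemma HN_closed: "HN <= carrier HC"
proof
 fix X assume "X : HN"
 from HN_E[OF this] obtain n m where X: "X = tn n m" "n : RN" "m : CN" by (elim exE conjE) (rule that)
 from X(2) have n: "n : carrier RC" by (rule subsetD[OF RN_closed(2)])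
 from X(3) have m: "m : carrier cliff" by (rule subsetD[OF CN_closed])
 show "X : carrier HC" unfolding X(1) by (rule tn(1)[OF n n m m])
qed

lemma hc_span: "X : carrier HC ==> X : lin_span HC HN"
proof -
 assume X: "X : carrier HC"
 have 1: "tn a m : lin_span HC HN" if "a : lin_span RC RN" "m : CN" for a m
  using that(1)
 proof induction
  case zero
  thus ?case using tn_zero(1)[of m] that(2) CN_closed by (auto simp: lin_span.zero)
 next
  case (step u s k)
  have c: "u : carrier RC" "s : carrier RC" "m : carrier cliff"
   using RC.lin_span_subset[OF RN_closed(2)] RN_closed(2) CN_closed step that(2) by blast+
  have "tn s m : HN" using step(2) that(2) unfolding HN_def by blast
  from lin_span.step[OF step(3) this, of k] show ?case
   using tn(3)[of "k \<odot>\<^sub>r s" u m m] tn(5)[of s s m m k] c by simp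
 qed
 have 2: "tn a b : lin_span HC HN" if "a : carrier RC" "b : lin_span cliff CN" for a b
  using that(2)
 proof induction
  case zero
  thus ?case using tn_zero(2)[OF that(1)] by (simp add: lin_span.zero)
 next
  case (step u s k)
  have c: "u : carrier cliff" "s : carrier cliff"
   using CL.lin_span_subset[OF CN_closed] CN_closed step by blast+
  have "k \<odot>\<^sub>h tn a s \<oplus>\<^sub>h tn a u : lin_span HC HN"
   by (intro HC.lin_span_add[OF HN_closed] HC.lin_span_smult[OF HN_closed] step(3) 1 rca_span that(1) step(2))
  thus ?case using tn(4)[of a a "k \<odot>\<^sub>c s" u] tn(6)[of a a s s k] c that(1) by simp
 qed
 show ?thesis
  by (rule HC.lin_span_mono[OF _ HN_closed hc_span_tn[OF X]]) (use 2 cliff_span in blast)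
qed

lemma phi1_words: "g : W ==> phi1 (xw ks (yw js (wg g))) = foldr (%i r. Xo (axis i 1) * r) ks (foldr (%i r. T (axis i 1) * r) js (gr g))"
proof -
 assume g: "g : W"
 have y: "phi1 (yw js (wg g)) = foldr (%i r. T (axis i 1) * r) js (gr g)"
  by (induction js) (simp_all add: phi1(2) phig_def g S.ahomD(1)[OF phi1(1)] RC.foldr_closed)
 have c: "yw js (wg g) : carrier RC" by (rule RC.foldr_closed) (simp_all add: g)
 show ?thesis
  by (induction ks) (simp_all add: y c phi1(2) phig_def S.ahomD(1)[OF phi1(1)] RC.foldr_closed)
qed

lemma phi2_words: "set l <= {1..CARD('n)} ==> phi2 (gw l) = foldr (%p r. el p * r) l 1"
 using phi2_one
 by (induction l) (simp_all add: phi2(2) cl_y S.ahomD(1)[OF phi2(1)])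

lemma span_prop:
 assumes A: "calg A" and f: "S.ahom A f" and S: "N <= carrier A" "X : lin_span A N"
  and P: "!!s. s : N ==> Q (f s)" "Q 0" "!!a b k. Q a ==> Q b ==> Q (sc k * a + b)"
 shows "Q (f X)"
 using S(2)
proof induction
 case zero
 thus ?case by (simp add: S.ahom_group(1)[OF f A] P)
next
 case (step u s k)
 interpret A: calg A by (rule A)
 have "u : carrier A" "s : carrier A" using A.lin_span_subset[OF S(1)] step S(1) by auto
 hence "f (k \<odot>\<^bsub>A\<^esub> s \<oplus>\<^bsub>A\<^esub> u) = sc k * f s + f u" by (simp add: S.ahomD[OF f])
 thus ?case using P step by simp
qed

lemma phi1_props: assumes "h : carrier RC" shows "phi1 h : Alg" "hat (phi1 h) = phi1 h" "el p * phi1 h = phi1 h * el p"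
proof -
 let ?Q = "%a. a : Alg & hat a = a & el p * a = a * el p"
 have m: "?Q a ==> ?Q b ==> ?Q (a * b)" for a b by (auto simp: Alg.mult hat_mult) (metis m_ass)
 have b: "?Q (Xo u)" "?Q (T u)" "g : W ==> ?Q (gr g)" for u g
  using Alg.intros el_comm el_T by auto
 have y: "?Q (foldr (%i r. T (axis i 1) * r) js (gr g))" if "g : W" for js g
  by (induction js) (use that b m in simp_all)
 have x: "?Q (foldr (%i r. Xo (axis i 1) * r) ks (foldr (%i r. T (axis i 1) * r) js (gr g)))" if "g : W" for ks js g
  by (induction ks) (use y[OF that] b m in simp_all)
 have "?Q (phi1 h)"
 proof (rule span_prop[OF calg_RC phi1(1) RN_closed(2) rca_span[OF assms]])
  show "?Q (phi1 s)" if "s : RN" for s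
  proof -
   obtain ks js g where "s = xw ks (yw js (wg g))" "g : W" using \<open>s : RN\<close> by auto
   thus ?thesis using x by (simp add: phi1_words)
  qed
 qed (use S.slc[of "el p :: 'n op"] in \<open>auto simp: Alg_simps Alg.intros add_dists m_ass\<close>)
 thus "phi1 h : Alg" "hat (phi1 h) = phi1 h" "el p * phi1 h = phi1 h * el p" by auto
qed

lemma phi2_props:
 assumes "b : carrier cliff"
 shows "phi2 b : Alg" "(!!p. el p * a = a * el p) ==> phi2 b * a = a * phi2 b"
proof -
 have f: "foldr (%p r. el p * r) l 1 : Alg" if "set l <= {1..CARD('n)}" for l
  using that by (induction l) (auto intro!: Alg.mult Alg_el Alg_simps)
 note sp = span_prop[OF CL.calg_axioms phi2(1) CN_closed cliff_span[OF assms]]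
 show "phi2 b : Alg"
  by (rule sp) (auto simp: phi2_words f Alg_simps Alg.intros)
 show "phi2 b * a = a * phi2 b" if "!!p. el p * a = a * el p"
  by (rule sp) (use S.slc[of a] in \<open>auto simp: phi2_words comm_foldr[OF that] add_dists m_ass\<close>)
qed

lemma phi_comm: "h : carrier RC ==> b : carrier cliff ==> phi2 b * phi1 h = phi1 h * phi2 b"
 using phi2_props(2)[OF _ phi1_props(3)] by blast

definition Phi :: "'n rcc => 'n op" where
 "Phi = S.qlift (S.mlin (%(h, b). phi1 h * phi2 b))"

lemma Phi: "S.ahom HC Phi" "h : carrier RC ==> b : carrier cliff ==> Phi (tn h b) = phi1 h * phi2 b"
proof -
 have h: "S.ahom (monoid_alg tmon) (S.mlin (%(h, b). phi1 h * phi2 b))"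
 proof (rule S.ahom_mlin)
  fix x y assume "x : carrier tmon" "y : carrier tmon"
  then obtain a b a' b' where [simp]: "x = (a, b)" "y = (a', b')" and c: "a : carrier RC" "b : carrier cliff" "a' : carrier RC" "b' : carrier cliff"
   by (cases x; cases y) auto
  have "phi1 a * phi1 a' * (phi2 b * phi2 b') = phi1 a * (phi2 b * phi1 a') * phi2 b'" using c by (simp add: phi_comm m_ass)
  thus "(case x \<otimes>\<^bsub>tmon\<^esub> y of (h, b) => phi1 h * phi2 b) = (case x of (h, b) => phi1 h * phi2 b) * (case y of (h, b) => phi1 h * phi2 b)"
   using c by (simp add: S.ahomD(1)[OF phi1(1)] S.ahomD(1)[OF phi2(1)] m_ass)
 qed (simp add: S.ahomD(3)[OF phi1(1) RC.one_closed RC.one_closed] phi2_one)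
 have k: "S.mlin (%(h, b). phi1 h * phi2 b) s = 0" if "s : tensor_rels RC cliff" for s
  using that S.ahomD[OF phi1(1)] S.ahomD[OF phi2(1)] S.slc unfolding tensor_rels_def
  by (auto simp: S.mlin_diff add_dists m_ass)
 show "S.ahom HC Phi" unfolding Phi_def HC_def tensor_alg_def by (rule S.qlift_props(1)[OF hc_quot h k])
 show "h : carrier RC ==> b : carrier cliff ==> Phi (tn h b) = phi1 h * phi2 b"
  unfolding Phi_def tensor_def using S.qlift_props(2)[OF hc_quot h k, of "single (h, b) 1"] by (simp add: monoid_alg_simps)
qed

lemmas PhiD = S.ahomD[OF Phi(1)] and Phi_group = S.ahom_group[OF Phi(1) HC.calg_axioms]

lemma Phi_one: "Phi \<one>\<^sub>h = 1"
 by (rule PhiD(3)[OF HC.one_closed HC.one_closed])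

subsection \<open>Values on the vacuum\<close>

lemma el_vac: "sorted_wrt (<) l ==> app (foldr (%p r. el p * r) l 1) (vac :: 'n M) = single (mat 1, set l) 1"
proof (induction l)
 case (Cons p l)
 have "set l \<inter> {..<p} = {}" "p \<notin> set l" using Cons.prems by force+
 thus ?case using Cons by (simp add: sg_def sd_def pconst_simps(2))
qed (simp add: vac_def)

text \<open>On x-free vectors T is multiplication by y. Normally ordered words therefore produce
  single monomials, without lower order terms.\<close>

lemma normal_vac:
 "app (foldr (%i r. Xo (axis i 1) * r) ks (foldr (%i r. T (axis i 1) * r) js (gr g))) (single (mat 1, S) 1)
  = single (g, S) (mon (mset ks) (mset js))"
proof -
 have yo: "yonly (mon {#} m)" for m :: "'n multiset"
  by (induction m) (simp_all add: mon_simps yonly_rules(3) yonly_def[of 1])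
 have y: "app (foldr (%i r. T (axis i 1) * r) js (gr g)) (single (mat 1, S) 1) = single (g, S) (mon {#} (mset js))"
  by (induction js) (simp_all add: T_single[OF yo] mon_simps)
 show ?thesis by (induction ks) (simp_all add: y mon_simps)
qed

text \<open>The PBW family, indexed by exponents. \<open>lst\<close> fixes an order of the letters,
  which is immaterial because the x's commute with each other, and so do the y's.\<close>

definition nu :: "('n multiset \<times> 'n multiset) \<times> 'n idx => 'n rcc" where
 "nu k = tn (xw (lst (fst (fst k))) (yw (lst (snd (fst k))) (wg (fst (snd k))))) (gw (sorted_list_of_set (snd (snd k))))"

abbreviation "nuK == UNIV \<times> (W \<times> {S. S <= {1..CARD('n)}})"

lemma HN_nu: "HN <= nu ` nuK"
proof
 fix X assume "X : HN"
 from HN_E[OF this] obtain n m where nm: "X = tn n m" "n : RN" "m : CN" by (elim exE conjE) (rule that)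
 from nm(2) obtain ks js g where n: "n = xw ks (yw js (wg g))" and g: "g : W" by (elim CollectE exE conjE) (rule that)
 from nm(3) obtain l where m: "m = gw l" and l: "sorted_wrt (<) l" "set l <= {1..CARD('n)}" by blast
 note X = nm(1)[unfolded n m]
 have y: "yw js (wg g) = yw (lst (mset js)) (wg g)"
  by (rule RC.foldr_perm) (use g rca_rels(8) in auto)
 have x: "xw ks u = xw (lst (mset ks)) u" if "u : carrier RC" for u
  by (rule RC.foldr_perm) (use that rca_rels(7) in auto)
 have c: "yw js (wg g) : carrier RC" by (rule RC.foldr_closed) (simp_all add: g)
 have "l = sorted_list_of_set (set l)" using l(1) by (simp add: strict_sorted_iff sorted_list_of_set.idem_if_sorted_distinct)
 hence "X = nu ((mset ks, mset js), (g, set l))"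
  unfolding nu_def X x[OF c] by (simp add: y[symmetric])
 thus "X : nu ` nuK" using g l by blast
qed

lemma nu_props:
 assumes "k : nuK"
 shows "nu k : carrier HC" "app (Phi (nu k)) vac = single (snd k) (mon (fst (fst k)) (snd (fst k)))"
proof -
 obtain a b g S where k: "k = ((a, b), (g, S))" "g : W" "S <= {1..CARD('n)}" using assms by force
 have S: "finite S" using k(3) finite_subset by blast
 have c: "xw ks (yw js (wg g)) : carrier RC" for ks js
  by (intro RC.foldr_closed) (simp_all add: k)
 thus "nu k : carrier HC" unfolding nu_def k(1) using tn(1)[OF c c gw_closed gw_closed] by simp
 have "phi2 (gw (sorted_list_of_set S)) = foldr (%p r. el p * r) (sorted_list_of_set S) 1"
  by (rule phi2_words) (use S k in simp)
 thus "app (Phi (nu k)) vac = single (snd k) (mon (fst (fst k)) (snd (fst k)))"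
  unfolding nu_def k(1) using S el_vac[of "sorted_list_of_set S"]
  by (simp add: Phi(2)[OF c gw_closed] phi1_words k(2) normal_vac)
qed

text \<open>On the vacuum the PBW elements become distinct monomials at basis indices, and these are
  independent. Thus an element is determined by its image of the vacuum alone.\<close>

lemma Phi_inj0:
 assumes X: "X : carrier HC" and 0: "app (Phi X) vac = 0" shows "X = \<zero>\<^sub>h"
proof -
 have nuc: "nu ` nuK <= carrier HC" using nu_props(1) by blast
 have "X : lin_span HC (nu ` nuK)"
  by (rule HC.lin_span_mono[OF _ nuc hc_span[OF X]]) (use HN_nu HC.lin_span_base[OF nuc] in blast)
 then obtain F where F: "keys F <= nuK" "X = lext HC nu F"
  by (rule HC.lin_span_lext[OF nuc])
 let ?m = "%k. mon (fst (fst k)) (snd (fst k))"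
 have "Phi X = (SUM k:keys F. Phi (lookup F k \<odot>\<^sub>h nu k))"
  unfolding F(2) lext_def by (rule S.ahom_finsum[OF Phi(1) HC.calg_axioms]) (use F(1) nu_props(1) in blast)
 also have "... = (SUM k:keys F. sc (lookup F k) * Phi (nu k))"
  by (intro sum.cong refl PhiD(4)[OF _ HC.one_closed]) (use F(1) nu_props(1) in blast)
 finally have "app (Phi X) vac = (SUM k:keys F. smul (lookup F k) (app (Phi (nu k)) vac))"
  by (simp add: app_sum)
 also have "... = (SUM k:keys F. smul (lookup F k) (single (snd k) (?m k)))"
  by (intro sum.cong refl, subst nu_props(2)) (use F(1) in auto)
 finally have e: "(SUM k:keys F. smul (lookup F k) (single (snd k) (?m k))) = 0" using 0 by simp
 have "lookup F (a, s) = 0" for a s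
 proof (cases "(a, s) : keys F")
  case True
  let ?A = "{a. (a, s) : keys F}"
  have fin: "finite ?A" by (rule finite_subset[of _ "fst ` keys F"]) force+
  have "0 = (SUM k:keys F. if snd k = s then pconst (lookup F k) * ?m k else 0)"
   using arg_cong[OF e, of "%G. lookup G s"] by (cases s) (simp add: lk_simps lookup_single when_def)
  also have "... = (SUM k:(%a. (a, s)) ` ?A. pconst (lookup F k) * ?m k)"
   by (rule sum.mono_neutral_cong_right) auto
  also have "... = (SUM a:?A. pconst (lookup F (a, s)) * mon (fst a) (snd a))"
   by (subst sum.reindex) (auto simp: inj_on_def)
  finally show ?thesis using mon_independent[OF fin, of "%a. lookup F (a, s)" a] True by simp
 qed (simp add: in_keys_iff)
 hence "F = 0" by (intro poly_mapping_eqI) auto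
 thus ?thesis by (simp add: F)
qed

lemma Phi_inj: "X : carrier HC ==> Y : carrier HC ==> app (Phi X) vac = app (Phi Y) vac ==> X = Y"
 using Phi_inj0[of "X \<ominus>\<^bsub>HC\<^esub> Y"] HC.minus_zero_eq[of X Y] by (simp add: Phi_group(3))

lemma phi2_inj:
 assumes b: "b : carrier cliff" "b' : carrier cliff" and e: "phi2 b = phi2 b'" shows "b = b'"
proof -
 have "b \<ominus>\<^bsub>cliff\<^esub> b' : lin_span cliff CN" using b by (intro cliff_span) auto
 then obtain F where F: "keys F <= {l. sorted_wrt (<) l & set l <= {1..CARD('n)}}" "b \<ominus>\<^bsub>cliff\<^esub> b' = lext cliff gw F"
  by (rule CL.lin_span_lext[OF CN_closed])
 have "0 = phi2 (b \<ominus>\<^bsub>cliff\<^esub> b')" using b e by (simp add: S.ahom_group(3)[OF phi2(1) CL.calg_axioms])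
 also have "... = (SUM l:keys F. phi2 (lookup F l \<odot>\<^sub>c gw l))"
  unfolding F(2) lext_def by (rule S.ahom_finsum[OF phi2(1) CL.calg_axioms]) simp
 also have "... = (SUM l:keys F. sc (lookup F l) * phi2 (gw l))"
  by (intro sum.cong refl S.ahomD(4)[OF phi2(1) _ CL.one_closed]) simp
 finally have "app 0 vac = app (SUM l:keys F. sc (lookup F l) * phi2 (gw l)) vac" by simp
 also have "... = (SUM l:keys F. smul (lookup F l) (app (phi2 (gw l)) vac))" by (simp add: app_sum)
 also have "... = (SUM l:keys F. smul (lookup F l) (single (mat 1, set l) 1))"
  by (intro sum.cong refl, subst phi2_words) (use F(1) el_vac in auto)
 finally have e: "(SUM l:keys F. smul (lookup F l) (single (mat 1 :: real^'n^'n, set l) 1)) = 0" by simp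
 have "lookup F l = 0" for l
 proof (cases "l : keys F")
  case True
  have s: "set l' = set l \<longleftrightarrow> l' = l" if "l' : keys F" for l'
   using that True F(1) by (auto simp: subset_iff strict_sorted_iff intro: sorted_distinct_set_unique)
  have "(0 :: 'n pfun) = (SUM l':keys F. if l' = l then pconst (lookup F l') else 0)"
   using arg_cong[OF e, of "%G. lk G (mat 1) (set l)"] s by (simp add: lk_simps lookup_single when_def cong: sum.cong if_cong)
  hence "pconst (lookup F l) = (0 :: 'n pfun)" using True by (simp add: sum.delta)
  thus ?thesis by (metis pev_basic(1) pev_simps(1))
 qed (simp add: in_keys_iff)
 hence "F = 0" by (intro poly_mapping_eqI) auto
 hence "b \<ominus>\<^bsub>cliff\<^esub> b' = \<zero>\<^sub>c" by (simp add: F)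
 thus ?thesis using b CL.minus_zero_eq by blast
qed

lemma Phi_gens: "a : rca_gens R ==> of_H a : carrier HC" "a : rca_gens R ==> Phi (of_H a) = phig a"
 "b : carrier cliff ==> of_C b : carrier HC" "b : carrier cliff ==> Phi (of_C b) = phi2 b"
 unfolding of_H_def of_C_def using rca_gen_closed
 by (simp_all add: tn_closed Phi(2) phi1(2) S.ahomD(3)[OF phi1(1) RC.one_closed RC.one_closed] phi2_one)

lemma Phi_Alg: "X : carrier HC ==> Phi X : Alg"
proof (rule span_prop[OF HC.calg_axioms Phi(1) HN_closed hc_span])
 show "Phi s : Alg" if "s : HN" for s
 proof -
  obtain n m where "s = tn n m" "n : carrier RC" "m : carrier cliff"
   using \<open>s : HN\<close> RN_closed(2) CN_closed unfolding HN_def by blast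
  thus ?thesis using phi1_props(1) phi2_props(1) by (simp add: Phi(2) Alg.mult)
 qed
qed (auto simp: Alg_simps Alg.intros)

lemma Alg_Phi: "a : Alg ==> \<exists>X \<in> carrier HC. Phi X = a"
proof (induction rule: Alg.induct)
 case (sc k)
 show ?case by (intro bexI[of _ "k \<odot>\<^sub>h \<one>\<^sub>h"]) (simp_all add: PhiD(4)[OF _ HC.one_closed] Phi_one)
next
 case (Xo u)
 show ?case using Phi_gens(1,2)[of "Cov u"] by (force simp: phig_def)
next
 case (T u)
 show ?case using Phi_gens(1,2)[of "Vec u"] by (force simp: phig_def)
next
 case (gr g)
 thus ?case using Phi_gens(1,2)[of "Grp g"] by (force simp: phig_def)
next
 case (cl v)
 show ?case using Phi_gens(3,4)[of "\<gamma> v"] by (force simp: phi2)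
next
 case (add a b)
 thus ?case using PhiD(2) HC.a_closed by metis
next
 case (mult a b)
 thus ?case using PhiD(1) HC.m_closed by metis
qed

end

section \<open>Gradings, superbrackets and the algebra O translated into operator identities\<close>

subsection \<open>The grading and the total angular momentum algebra\<close>

context dunkl
begin

abbreviation "tgen i == {tn h b | h b. h : carrier RC & b : cliff_part i}"

lemma cliff_part_props:
 assumes "b : cliff_part i" shows "b : carrier cliff" "hat (phi2 b) = sc ((-1) ^ i) * phi2 b"
proof -
 let ?q = "quot_class (free_alg UNIV) (cliff_rels :: ((complex^'n) list \<Rightarrow>\<^sub>0 complex) set)"
 obtain f where f: "b = ?q f" "!!l. l : keys f ==> length l mod 2 = i"
  using assms unfolding cliff_part_def by blast
 have q: "?q g : carrier cliff" for g unfolding cliff_def by (rule free_quot_ops(6)[OF cliff_quot]) auto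
 thus "b : carrier cliff" by (simp add: f)
 have w: "hat (phi2 (?q (word l))) = sc ((-1) ^ length l) * phi2 (?q (word l))" for l
 proof (induction l)
  case Nil
  have "?q (word []) = \<one>\<^sub>c" unfolding cliff_def by (rule free_quot_ops(4)[OF cliff_quot, symmetric])
  thus ?case by (simp add: phi2_one)
 next
  case (Cons v l)
  have "?q (word (v # l)) = \<gamma> v \<otimes>\<^sub>c ?q (word l)"
   unfolding \<gamma>_def using free_quot_ops(3)[OF cliff_quot, of "[v]" l] by (simp add: cliff_def)
  hence "phi2 (?q (word (v # l))) = cl v * phi2 (?q (word l))"
   by (simp add: S.ahomD(1)[OF phi2(1) gamma_closed q] phi2(2))
  thus ?case using Cons S.slc[of "cl v"] by (simp add: hat_mult S.sc_minus)
 qed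
 have "hat (phi2 (?q f)) = sc ((-1) ^ i) * phi2 (?q f)" if "keys f <= {l. length l mod 2 = i}" for f
  using that
 proof (induction rule: pm_induct_on)
  case zero
  have "?q 0 = \<zero>\<^sub>c" unfolding cliff_def using calg_quot.q_zero[OF cliff_quot, symmetric] by (simp add: monoid_alg_simps)
  thus ?case by (simp add: S.ahom_group(1)[OF phi2(1) CL.calg_axioms])
 next
  case (add l v f)
  have "single l v + f = scale v (word l) + f" by simp
  hence "?q (single l v + f) = v \<odot>\<^sub>c ?q (word l) \<oplus>\<^sub>c ?q f"
   unfolding cliff_def using free_quot_ops(1)[OF cliff_quot, of "word l" v] free_quot_ops(2)[OF cliff_quot, of "scale v (word l)" f] by simp
  hence e: "phi2 (?q (single l v + f)) = sc v * phi2 (?q (word l)) + phi2 (?q f)"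
   by (simp add: S.ahomD(2)[OF phi2(1)] S.ahomD(4)[OF phi2(1) _ CL.one_closed] q)
  have "(-1) ^ length l = ((-1) ^ i :: complex)" using add(1) by (auto simp: minus_one_power_iff even_iff_mod_2_eq_zero)
  thus ?case unfolding e using add(3) w[of l] by (simp add: distrib_left mult.commute)
 qed
 thus "hat (phi2 b) = sc ((-1) ^ i) * phi2 b" using f by blast
qed

lemma tgen_closed: "tgen i <= carrier HC"
 using tn_closed cliff_part_props(1) by blast

lemma HC_part_props:
 assumes "X : HC_part i" shows "X : carrier HC" "hat (Phi X) = sc ((-1) ^ i) * Phi X"
proof -
 have X: "X : lin_span HC (tgen i)" using assms by (simp add: HC_part_def)
 show "X : carrier HC" using HC.lin_span_subset[OF tgen_closed] X by blast
 show "hat (Phi X) = sc ((-1) ^ i) * Phi X"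
 proof (rule span_prop[OF HC.calg_axioms Phi(1) tgen_closed X])
  show "hat (Phi s) = sc ((-1) ^ i) * Phi s" if s: "s : tgen i" for s
  proof -
   obtain h b where "s = tn h b" "h : carrier RC" "b : cliff_part i" using s by blast
   thus ?thesis using cliff_part_props[of b i] S.slc[of "phi1 h"] by (simp add: Phi(2) hat_mult phi1_props(2))
  qed
 qed (simp_all add: distrib_left mult.commute)
qed

lemma HC_split: "X : carrier HC ==> EX u:HC_part 0. EX v:HC_part 1. X = u \<oplus>\<^sub>h v"
proof -
 assume "X : carrier HC"
 from hc_span[OF this] show ?thesis
 proof induction
  case zero
  show ?case unfolding HC_part_def by (intro bexI[of _ "\<zero>\<^sub>h"] lin_span.zero) simp
 next
  case (step u s k)
  obtain n m where s: "s = tn n m" "n : RN" "m : CN" using HN_E[OF step(2)] by (elim exE conjE) (rule that)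
  have n: "n : carrier RC" by (rule subsetD[OF RN_closed(2) s(2)])
  have "gw l : cliff_part (length l mod 2)" for l
  proof -
   have "gw l = quot_class (free_alg UNIV) cliff_rels (word (map (%p. cvec (y p)) l))"
   proof (induction l)
    case Nil
    show ?case unfolding cliff_def using free_quot_ops(4)[OF cliff_quot] by simp
   next
    case (Cons p l)
    thus ?case using free_quot_ops(3)[OF cliff_quot, of "[cvec (y p)]" "map (%p. cvec (y p)) l", folded cliff_def] by (simp add: \<gamma>_def)
   qed
   thus ?thesis unfolding cliff_part_def by (intro image_eqI[of _ _ "word (map (%p. cvec (y p)) l)"]) auto
  qed
  then obtain i where i: "i = 0 \<or> i = 1" "m : cliff_part i" using s(3) by (metis (no_types, lifting) imageE mod2_eq_if)
  have st: "s : tgen i" using s n i by blast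
  obtain a b where ab: "a : HC_part 0" "b : HC_part 1" "u = a \<oplus>\<^sub>h b" using step by blast
  have c: "a : carrier HC" "b : carrier HC" "s : carrier HC" using HC_part_props(1)[OF ab(1)] HC_part_props(1)[OF ab(2)] subsetD[OF tgen_closed st] by auto
  from i(1) show ?case
  proof
   assume [simp]: "i = 0"
   have "k \<odot>\<^sub>h s \<oplus>\<^sub>h a : HC_part 0" using ab(1) st unfolding HC_part_def by (intro lin_span.step) simp_all
   moreover have "k \<odot>\<^sub>h s \<oplus>\<^sub>h u = (k \<odot>\<^sub>h s \<oplus>\<^sub>h a) \<oplus>\<^sub>h b" using c by (simp add: ab(3) HC.a_assoc)
   ultimately show ?thesis using ab(2) by blast
  next
   assume [simp]: "i = 1"
   have "k \<odot>\<^sub>h s \<oplus>\<^sub>h b : HC_part 1" using ab(2) st unfolding HC_part_def by (intro lin_span.step) simp_all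
   moreover have "k \<odot>\<^sub>h s \<oplus>\<^sub>h u = a \<oplus>\<^sub>h (k \<odot>\<^sub>h s \<oplus>\<^sub>h b)" using c by (simp add: ab(3) HC.a_lcomm)
   ultimately show ?thesis using ab(1) by blast
  qed
 qed
qed

text \<open>The grading corresponds to \<open>hat\<close>, so homogeneous parts are half sums and
  half differences of \<open>Phi X\<close> and its \<open>hat\<close>. Faithfulness gives the
  uniqueness that the definite description demands.\<close>

lemma hcomp:
 assumes X: "X : carrier HC" and i: "i = 0 \<or> i = (1::nat)"
 shows "hcomp HC HC_part i X : carrier HC" "Phi (hcomp HC HC_part i X) = sc (1/2) * (Phi X + sc ((-1) ^ i) * hat (Phi X))"
proof -
 have val: "Phi u = sc (1/2) * (Phi X + sc ((-1) ^ i) * hat (Phi X))" if "u : HC_part i" "v : HC_part (1 - i)" "X = u \<oplus>\<^sub>h v" for u v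
 proof -
  have e: "Phi X = Phi u + Phi v" using that HC_part_props(1) by (simp add: PhiD(2))
  have "hat (Phi X) = sc ((-1) ^ i) * Phi u - sc ((-1) ^ i) * Phi v"
   using i HC_part_props(2)[OF that(1)] HC_part_props(2)[OF that(2)] by (auto simp: e S.sc_minus)
  hence "Phi X + sc ((-1) ^ i) * hat (Phi X) = Phi u + Phi u"
   using i by (auto simp: e right_diff_distrib S.sc_minus)
  thus ?thesis by (simp only: half_double)
 qed
 have "\<exists>u. u : HC_part i & (EX v:HC_part (1 - i). X = u \<oplus>\<^sub>h v)"
 proof -
  obtain u v where uv: "u : HC_part 0" "v : HC_part 1" "X = u \<oplus>\<^sub>h v" using HC_split[OF X] by blast
  have vu: "X = v \<oplus>\<^sub>h u" using uv HC_part_props(1) by (metis HC.a_comm)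
  show ?thesis using i
  proof
   assume "i = 0" thus ?thesis using uv by auto
  next
   assume "i = 1" thus ?thesis using uv(1,2) vu by auto
  qed
 qed
 moreover have "u = u'" if "u : HC_part i & (EX v:HC_part (1 - i). X = u \<oplus>\<^sub>h v)" "u' : HC_part i & (EX v:HC_part (1 - i). X = u' \<oplus>\<^sub>h v)" for u u'
 proof (rule Phi_inj)
  show "u : carrier HC" "u' : carrier HC" using that HC_part_props(1) by blast+
  have "Phi u = Phi u'" using that val by metis
  thus "app (Phi u) vac = app (Phi u') vac" by simp
 qed
 ultimately have "\<exists>!u. u : HC_part i & (EX v:HC_part (1 - i). X = u \<oplus>\<^sub>h v)" by blast
 from theI'[OF this] have h: "hcomp HC HC_part i X : HC_part i & (EX v:HC_part (1 - i). X = hcomp HC HC_part i X \<oplus>\<^sub>h v)"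
  unfolding hcomp_def .
 thus "hcomp HC HC_part i X : carrier HC" using HC_part_props(1) by blast
 show "Phi (hcomp HC HC_part i X) = sc (1/2) * (Phi X + sc ((-1) ^ i) * hat (Phi X))" using h val by blast
qed

text \<open>The even part of Y contributes a commutator with X, the odd part one in which X is
  twisted by \<open>hat\<close>. The displayed expression is twice the image of the bracket, so
  these parts appear without the factor 1/2.\<close>

lemma superbracket:
 assumes X: "X : carrier HC" and Y: "Y : carrier HC"
 shows "superbracket HC HC_part X Y = \<zero>\<^sub>h \<longleftrightarrow>
  Phi X * (Phi Y + hat (Phi Y)) - (Phi Y + hat (Phi Y)) * Phi X
  + (Phi X * (Phi Y - hat (Phi Y)) - (Phi Y - hat (Phi Y)) * hat (Phi X)) = 0"
proof -
 let ?h = "hcomp HC HC_part"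
 let ?t = "%i j. ?h i X \<otimes>\<^sub>h ?h j Y \<ominus>\<^bsub>HC\<^esub> ((-1) ^ (i * j)) \<odot>\<^sub>h (?h j Y \<otimes>\<^sub>h ?h i X)"
 have c: "?h i X : carrier HC" "?h i Y : carrier HC" if "i = 0 \<or> i = 1" for i
  using hcomp(1) X Y that by auto
 have tc: "?t i j : carrier HC" if "i : {0, 1}" "j : {0, 1}" for i j
  using c[of i] c[of j] that by (intro HC.minus_closed HC.smult_closed HC.m_closed) auto
 have Pt: "Phi (?t i j) = Phi (?h i X) * Phi (?h j Y) - sc ((-1) ^ (i * j)) * (Phi (?h j Y) * Phi (?h i X))" if "i : {0, 1}" "j : {0, 1}" for i j
  using c[of i] c[of j] that by (auto simp: Phi_group(3) PhiD)
 have ic: "(\<Oplus>\<^bsub>HC\<^esub>j\<in>{0, 1}. ?t i j) : carrier HC" if "i : {0, 1}" for i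
  by (intro HC.finsum_closed Pi_I tc that)
 have sc: "superbracket HC HC_part X Y : carrier HC"
  unfolding superbracket_def by (intro HC.finsum_closed Pi_I ic)
 have "Phi (superbracket HC HC_part X Y) = (SUM i:{0, 1}. Phi (\<Oplus>\<^bsub>HC\<^esub>j\<in>{0, 1}. ?t i j))"
  unfolding superbracket_def by (rule S.ahom_finsum[OF Phi(1) HC.calg_axioms]) (intro Pi_I ic)
 also have "... = (SUM i:{0, 1}. SUM j:{0, 1}. Phi (?t i j))"
  by (intro sum.cong refl S.ahom_finsum[OF Phi(1) HC.calg_axioms] Pi_I tc)
 also have "... = (SUM i:{0, 1}. SUM j:{0, 1}. Phi (?h i X) * Phi (?h j Y) - sc ((-1) ^ (i * j)) * (Phi (?h j Y) * Phi (?h i X)))"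
  by (intro sum.cong refl Pt)
 finally have P: "Phi (superbracket HC HC_part X Y) = (SUM i:{0, 1}. SUM j:{0, 1}. Phi (?h i X) * Phi (?h j Y) - sc ((-1) ^ (i * j)) * (Phi (?h j Y) * Phi (?h i X)))" .
 let ?A = "Phi X" and ?B = "Phi Y"
 have h: "Phi (?h 0 X) = sc (1/2) * (?A + hat ?A)" "Phi (?h 1 X) = sc (1/2) * (?A - hat ?A)"
  "Phi (?h 0 Y) = sc (1/2) * (?B + hat ?B)" "Phi (?h 1 Y) = sc (1/2) * (?B - hat ?B)"
  using hcomp(2)[OF X] hcomp(2)[OF Y] by (simp_all add: S.sc_minus)
 have "Phi (superbracket HC HC_part X Y) = sc (1/4) * (((?A + hat ?A) * (?B + hat ?B) - (?B + hat ?B) * (?A + hat ?A))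
   + ((?A + hat ?A) * (?B - hat ?B) - (?B - hat ?B) * (?A + hat ?A))
   + ((?A - hat ?A) * (?B + hat ?B) - (?B + hat ?B) * (?A - hat ?A))
   + ((?A - hat ?A) * (?B - hat ?B) + (?B - hat ?B) * (?A - hat ?A)))"
 proof -
  have 1: "(SUM i:{0, 1}. SUM j:{0, 1}. f i j) = f 0 0 + f 0 1 + (f 1 0 + f 1 1)" for f :: "nat => nat => 'n op" by simp
  have 2: "sc (1/2 * (1/2)) * p1 - sc ((-1) ^ (0 * 0)) * (sc (1/2 * (1/2)) * q1) + (sc (1/2 * (1/2)) * p2 - sc ((-1) ^ (0 * 1)) * (sc (1/2 * (1/2)) * q2))
   + (sc (1/2 * (1/2)) * p3 - sc ((-1) ^ (1 * 0)) * (sc (1/2 * (1/2)) * q3) + (sc (1/2 * (1/2)) * p4 - sc ((-1) ^ (1 * 1)) * (sc (1/2 * (1/2)) * q4)))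
   = sc (1/4) * ((p1 - q1) + (p2 - q2) + (p3 - q3) + (p4 + q4))" for p1 p2 p3 p4 q1 q2 q3 q4 :: "'n op"
   by (simp add: S.sc_minus distrib_left right_diff_distrib)
  show ?thesis unfolding P 1 h S.sc_mult_mult by (rule 2)
 qed
 also have "... = sc (1/4) * ((?A * (?B + hat ?B) - (?B + hat ?B) * ?A + (?A * (?B - hat ?B) - (?B - hat ?B) * hat ?A))
   + (?A * (?B + hat ?B) - (?B + hat ?B) * ?A + (?A * (?B - hat ?B) - (?B - hat ?B) * hat ?A)))"
  by (rule arg_cong[of _ _ "%z. sc (1/4) * z"]) (simp add: algebra_simps)
 also have "... = sc (1/2) * (?A * (?B + hat ?B) - (?B + hat ?B) * ?A + (?A * (?B - hat ?B) - (?B - hat ?B) * hat ?A))" (is "_ = sc (1/2) * ?Z")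
  using arg_cong[OF half_double[of "sc (1/2) * ?Z"], of "%z. z"] by (simp add: distrib_left[symmetric])
 finally have e: "Phi (superbracket HC HC_part X Y) = sc (1/2) * ?Z" .
 have "superbracket HC HC_part X Y = \<zero>\<^sub>h \<longleftrightarrow> Phi (superbracket HC HC_part X Y) = 0"
  using Phi_inj0[OF sc] Phi_group(1) by auto
 also have "... \<longleftrightarrow> ?Z = 0"
 proof
  assume "Phi (superbracket HC HC_part X Y) = 0"
  hence "sc 2 * (sc (1/2) * ?Z) = 0" by (simp only: e mult_zero_right)
  thus "?Z = 0" by simp
 qed (simp add: e)
 finally show ?thesis .
qed

lemma superbracket_even:
 "X : carrier HC ==> Y : carrier HC ==> hat (Phi Y) = Phi Y ==> superbracket HC HC_part X Y = \<zero>\<^sub>h \<longleftrightarrow> Phi X * Phi Y = Phi Y * Phi X"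
proof -
 assume a: "X : carrier HC" "Y : carrier HC" "hat (Phi Y) = Phi Y"
 have "a * (b + b) - (b + b) * a + (a * 0 - 0 * c) = 0 \<longleftrightarrow> a * b = b * a" for a b c :: "'n op"
 proof
  assume "a * (b + b) - (b + b) * a + (a * 0 - 0 * c) = 0"
  hence "(a * b - b * a) + (a * b - b * a) = 0" by (simp add: algebra_simps)
  thus "a * b = b * a" by (metis half_double mult_zero_right right_minus_eq)
 qed (simp add: algebra_simps)
 thus ?thesis unfolding superbracket[OF a(1,2)] a(3) diff_self .
qed

lemma superbracket_odd:
 "X : carrier HC ==> Y : carrier HC ==> hat (Phi Y) = - Phi Y ==> superbracket HC HC_part X Y = \<zero>\<^sub>h \<longleftrightarrow> Phi X * Phi Y = Phi Y * hat (Phi X)"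
proof -
 assume a: "X : carrier HC" "Y : carrier HC" "hat (Phi Y) = - Phi Y"
 have "a * (b + - b) - (b + - b) * a + (a * (b - - b) - (b - - b) * c) = 0 \<longleftrightarrow> a * b = b * c" for a b c :: "'n op"
 proof
  assume "a * (b + - b) - (b + - b) * a + (a * (b - - b) - (b - - b) * c) = 0"
  hence "(a * b - b * c) + (a * b - b * c) = 0" by (simp add: algebra_simps)
  thus "a * b = b * c" by (metis half_double mult_zero_right right_minus_eq)
 qed (simp add: algebra_simps)
 thus ?thesis unfolding superbracket[OF a(1,2)] a(3) .
qed

lemma gens_closed: "ex p : carrier HC" "ey p : carrier HC" "ee p : carrier HC" "al : P ==> of_H (Grp (root_refl al)) : carrier HC"
 using Phi_gens(1) Phi_gens(3) P_W by (auto simp: ex_def ey_def ee_def)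

lemma Phi_ex: "Phi (ex p) = Xo (cvec (y p))" "Phi (ey p) = T (cvec (y p))" "Phi (ee p) = cl (cvec (y p))"
 using Phi_gens(2)[of "Cov (cvec (y p))"] Phi_gens(2)[of "Vec (cvec (y p))"] Phi_gens(4)[of "\<gamma> (cvec (y p))"]
 by (simp_all add: ex_def ey_def ee_def phig_def phi2)

lemma Phi_sum2:
 assumes "!!p. a p : carrier HC" "!!p. b p : carrier HC"
 shows "Phi (\<Oplus>\<^bsub>HC\<^esub>p\<in>{1..CARD('n)}. a p \<otimes>\<^sub>h b p) = (SUM p:{1..CARD('n)}. Phi (a p) * Phi (b p))"
  "(\<Oplus>\<^bsub>HC\<^esub>p\<in>{1..CARD('n)}. a p \<otimes>\<^sub>h b p) : carrier HC"
proof -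
 have "Phi (\<Oplus>\<^bsub>HC\<^esub>p\<in>{1..CARD('n)}. a p \<otimes>\<^sub>h b p) = (SUM p:{1..CARD('n)}. Phi (a p \<otimes>\<^sub>h b p))"
  by (rule S.ahom_finsum[OF Phi(1) HC.calg_axioms]) (use assms in auto)
 thus "Phi (\<Oplus>\<^bsub>HC\<^esub>p\<in>{1..CARD('n)}. a p \<otimes>\<^sub>h b p) = (SUM p:{1..CARD('n)}. Phi (a p) * Phi (b p))"
  using assms by (simp add: PhiD(1))
qed (use assms in \<open>auto intro!: HC.finsum_closed\<close>)

abbreviation "rt2t == 1 / csqrt (2 * t)"

lemma rt2t: "rt2t * rt2t = 1 / (2 * t)" "rt2t ~= 0"
proof -
 have "csqrt (2 * t) * csqrt (2 * t) = 2 * t" using power2_csqrt[of "2 * t"] by (simp add: power2_eq_square)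
 thus "rt2t * rt2t = 1 / (2 * t)" by simp
qed (use t0 in simp)

lemma Phi_osp:
 "Fp : carrier HC" "Fm : carrier HC" "Ep : carrier HC" "Em : carrier HC" "Hh : carrier HC"
 "Phi Fp = sc rt2t * XX" "Phi Fm = sc rt2t * YY" "Phi Ep = sc (1 / (2 * t)) * (XX * XX)" "Phi Em = sc (- 1 / (2 * t)) * (YY * YY)"
 "Phi Hh = sc (1 / (2 * t)) * (XX * YY + YY * XX)"
proof -
 note g = gens_closed
 show "Fp : carrier HC" "Fm : carrier HC" "Ep : carrier HC" "Em : carrier HC"
  unfolding Fp_def Fm_def Ep_def Em_def by (intro HC.smult_closed Phi_sum2(2) g)+
 note s = PhiD(4)[OF _ HC.one_closed]
 show "Phi Fp = sc rt2t * XX" "Phi Fm = sc rt2t * YY" "Phi Ep = sc (1 / (2 * t)) * (XX * XX)" "Phi Em = sc (- 1 / (2 * t)) * (YY * YY)"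
  unfolding Fp_def Fm_def Ep_def Em_def XX_sq by (simp_all only: s[OF Phi_sum2(2)[OF g(1,3)]] s[OF Phi_sum2(2)[OF g(2,3)]] s[OF Phi_sum2(2)[OF g(1,1)]] s[OF Phi_sum2(2)[OF g(2,2)]]
   Phi_sum2(1)[OF g(1,3)] Phi_sum2(1)[OF g(2,3)] Phi_sum2(1)[OF g(1,1)] Phi_sum2(1)[OF g(2,2)] Phi_ex XX_def YY_def)
 have Oc: "Omega : carrier HC" unfolding Omega_def by (intro HC.finsum_closed) (use g(4) in auto)
 have "Phi Omega = (SUM al:P. Phi (c al \<odot>\<^sub>h of_H (Grp (root_refl al))))"
  unfolding Omega_def by (rule S.ahom_finsum[OF Phi(1) HC.calg_axioms]) (use g(4) in auto)
 also have "... = (SUM al:P. sc (c al) * gr (root_refl al))"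
  by (intro sum.cong refl) (use g(4) P_W Phi_gens(2) in \<open>simp add: s phig_def\<close>)
 finally have O: "Phi Omega = (SUM al:P. sc (c al) * gr (root_refl al))" .
 have O2: "(SUM al:R. sc (c al) * gr (root_refl al)) = Phi Omega + Phi Omega"
  unfolding P_props(3) O sum.distrib[symmetric] using P_props(1) by (intro sum.cong refl) (simp add: c_minus subsetD)
 note xy = Phi_sum2[OF g(1,2)]
 show "Hh : carrier HC" unfolding Hh_def by (intro HC.smult_closed HC.minus_closed HC.a_closed xy(2) Oc HC.one_closed)
 let ?X = "SUM p:{1..CARD('n)}. Xo (cvec (y p)) * T (cvec (y p))"
 have h: "Phi Hh = sc (1 / t) * (?X + sc (t * of_nat CARD('n) / 2) - Phi Omega)"
  unfolding Hh_def using xy Oc by (simp add: s Phi_group(3) PhiD(2) Phi_one Phi_ex)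
 have "XX * YY + YY * XX = (?X + sc (t * of_nat CARD('n) / 2) - Phi Omega) + (?X + sc (t * of_nat CARD('n) / 2) - Phi Omega)"
 proof -
  have "sc (t * of_nat CARD('n)) = sc (t * of_nat CARD('n) / 2) + sc (t * of_nat CARD('n) / 2)"
   unfolding S.sc_add[symmetric] by simp
  thus ?thesis unfolding XX_YY O2 by (simp add: sum.distrib algebra_simps)
 qed
 hence "sc (1 / (2 * t)) * (XX * YY + YY * XX) = sc (1 / t) * (sc (1/2) * ((?X + sc (t * of_nat CARD('n) / 2) - Phi Omega) + (?X + sc (t * of_nat CARD('n) / 2) - Phi Omega)))"
  by (simp add: mult.commute)
 thus "Phi Hh = sc (1 / (2 * t)) * (XX * YY + YY * XX)" unfolding half_double h by simp
qed

lemma Phi_Dirac: "Gamma : carrier HC" "Phi Gamma = GG" "Scasimir : carrier HC" "Phi Scasimir = SS" "Dirac : carrier HC" "Phi Dirac = DD"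
proof -
 note s = PhiD(4)[OF _ HC.one_closed]
 have f: "foldr (%p u. ee p \<otimes>\<^sub>h u) l \<one>\<^sub>h : carrier HC" for l by (rule HC.foldr_closed) (use gens_closed in auto)
 have Pf: "set l <= {1..CARD('n)} ==> Phi (foldr (%p u. ee p \<otimes>\<^sub>h u) l \<one>\<^sub>h) = foldr (%p u. el p * u) l 1" for l
  by (induction l) (simp_all add: Phi_one PhiD(1) f gens_closed Phi_ex cl_y)
 show 1: "Gamma : carrier HC" unfolding Gamma_def by (intro HC.smult_closed f)
 show 2: "Phi Gamma = GG" unfolding Gamma_def GG_def s[OF f] by (subst Pf) auto
 show 3: "Scasimir : carrier HC" unfolding Scasimir_def by (intro HC.minus_closed HC.m_closed HC.smult_closed HC.one_closed Phi_osp)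
 have "Phi Scasimir = sc rt2t * YY * (sc rt2t * XX) - sc rt2t * XX * (sc rt2t * YY) - sc (1/2)"
  unfolding Scasimir_def using Phi_osp(1,2) by (simp add: Phi_group(3) PhiD(1) s Phi_one Phi_osp(6,7) HC.minus_closed)
 thus 4: "Phi Scasimir = SS" unfolding S.sc_mult_mult rt2t SS_def by (simp only: right_diff_distrib)
 show "Dirac : carrier HC" "Phi Dirac = DD" unfolding Dirac_def DD_def using 1 2 3 4 by (simp_all add: PhiD(1))
qed

text \<open>F+ and F- alone give one direction. Conversely E+, E- and H are, up to scalars,
  \<open>XX * XX\<close>, \<open>YY * YY\<close> and \<open>XX * YY + YY * XX\<close>, past which
  the twists cancel.\<close>

lemma tama_iff: "X : tama \<longleftrightarrow> X : carrier HC & osp_ok (Phi X)"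
proof
 note o = Phi_osp
 have S: "{Fp, Fm, Ep, Em, Hh} <= carrier HC" using o by auto
 have canc: "a = b" if "sc rt2t * a = sc rt2t * b" for a b :: "'n op"
 proof -
  have "sc (1 / rt2t) * (sc rt2t * a) = sc (1 / rt2t) * (sc rt2t * b)" using that by simp
  thus ?thesis using rt2t(2) by simp
 qed
 { assume X: "X : tama"
  hence Xc: "X : carrier HC" by (simp add: tama_def)
  have "Fp : osp" "Fm : osp" unfolding osp_def using HC.lin_span_base[OF S] by auto
  hence "superbracket HC HC_part X Fp = \<zero>\<^sub>h" "superbracket HC HC_part X Fm = \<zero>\<^sub>h" using X by (auto simp: tama_def)
  hence "Phi X * (sc rt2t * XX) = sc rt2t * XX * hat (Phi X)" "Phi X * (sc rt2t * YY) = sc rt2t * YY * hat (Phi X)"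
   using superbracket_odd[OF Xc o(1)] superbracket_odd[OF Xc o(2)] o by simp_all
  hence "osp_ok (Phi X)" unfolding osp_ok_def S.slc m_ass using canc by blast
  with Xc show "X : carrier HC & osp_ok (Phi X)" by blast }
 assume X: "X : carrier HC & osp_ok (Phi X)"
 let ?A = "Phi X"
 let ?B = "%b. ?A * (b + hat b) - (b + hat b) * ?A + (?A * (b - hat b) - (b - hat b) * hat ?A)"
 have x: "?A * XX = XX * hat ?A" "?A * YY = YY * hat ?A" "hat ?A * XX = XX * ?A" "hat ?A * YY = YY * ?A"
  using X osp_ok_hat by (auto simp: osp_ok_def)
 have ev: "?A * (u * v) = u * v * ?A" if "?A * u = u * hat ?A" "hat ?A * v = v * ?A" for u v
 proof -
  have "?A * (u * v) = u * (hat ?A * v)" by (simp only: m_ass[symmetric] that(1))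
  thus ?thesis by (simp only: that(2) m_ass)
 qed
 note ev = ev[OF x(1,3)] ev[OF x(1,4)] ev[OF x(2,3)] ev[OF x(2,4)]
 have "?B (Phi b) = 0" if "b : {Fp, Fm, Ep, Em, Hh}" for b
 proof -
  have evb: "?B (sc k * e) = 0" if "?A * e = e * ?A" "hat e = e" for k e
   using that S.slc[of ?A k] by (simp add: add_dists m_ass)
  have oddb: "?B (sc k * e) = 0" if "?A * e = e * hat ?A" "hat e = - e" for k e
   using that S.slc[of ?A k] by (simp add: add_dists m_ass)
  have h: "?A * (XX * YY + YY * XX) = (XX * YY + YY * XX) * ?A" unfolding add_dists ev ..
  have "?B (Phi Fp) = 0" "?B (Phi Fm) = 0" unfolding o(6,7) by (rule oddb; simp add: x)+
  moreover have "?B (Phi Ep) = 0" "?B (Phi Em) = 0" "?B (Phi Hh) = 0"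
   unfolding o(8-10) by (rule evb; simp only: ev h hat_mult hat_simps hat_XX minus_mult_minus)+
  ultimately show ?thesis using \<open>b : _\<close> by blast
 qed
 moreover have "?B (sc k * a + b) = sc k * ?B a + ?B b" for k a b
  using S.slc[of ?A k] by (simp add: add_dists diff_dists m_ass)
 ultimately have "?B (Phi b) = 0" if "b : osp" for b
  using span_prop[OF HC.calg_axioms Phi(1) S, of b "%z. ?B z = 0"] that unfolding osp_def by simp
 moreover have "b : carrier HC" if "b : osp" for b using that HC.lin_span_subset[OF S] unfolding osp_def by blast
 ultimately show "X : tama" unfolding tama_def using X superbracket by auto
qed

text \<open>Central elements are tested against \<open>AA u v\<close> only; these are even, so the
  superbracket is an ordinary commutator.\<close>

lemma tama_center_ZZ:
 assumes "z : tama_center" shows "z : carrier HC" "ZZ (Phi z)"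
proof -
 have z: "z : tama" "!!x. x : tama ==> superbracket HC HC_part z x = \<zero>\<^sub>h"
  using assms by (auto simp: tama_center_def graded_center_def)
 thus zc: "z : carrier HC" by (simp add: tama_iff)
 have "Phi z * AA u v = AA u v * Phi z" for u v
 proof -
  obtain X where X: "X : carrier HC" "Phi X = AA u v" using Alg_Phi[OF AA_Alg] by blast
  hence "X : tama" by (simp add: tama_iff osp_ok_AA)
  from z(2)[OF this] show ?thesis using superbracket_even[OF zc X(1)] X(2) osp_ok_AA(2) by simp
 qed
 thus "ZZ (Phi z)" using z(1) Phi_Alg by (simp add: ZZ_def tama_iff)
qed

end

section \<open>The double cover inside the Clifford units: presentations, covering map,
  kernel\<close>

section \<open>The double cover\<close>

context dunkl
begin

definition nn :: "real^'n => complex^'n" where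
 "nn al = complex_of_real (1 / norm (coroot al)) *s cvec (coroot al)"

lemma pairing_nn: "al : R ==> pairing (nn al) (nn al) = 1"
 using R_nz[of al] by (simp add: nn_def pairing_scale pairing_cvec dot_square_norm power2_eq_square)

lemma nn_scale: "\<exists>k. nn al = k *s cvec al"
proof -
 have "cvec (k *\<^sub>R v) = complex_of_real k *s cvec v" for k and v :: "real^'n"
  by (simp add: cvec_def vec_eq_iff)
 thus ?thesis unfolding nn_def coroot_def by (metis vector_smult_assoc)
qed

abbreviation "gq l == foldr (%al u. \<gamma> (nn al) \<otimes>\<^sub>c u) l \<one>\<^bsub>cliff :: (complex, 'n cliff) module\<^esub>"
abbreviation "gl l == foldr (%al g. root_refl al ** g) l (mat 1)"
abbreviation "PG == pin_group R"

lemma gq_closed [simp]: "gq l : carrier cliff"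
 by (rule CL.foldr_closed) simp_all

lemma gq_append: "gq (l @ l') = gq l \<otimes>\<^sub>c gq l'"
proof (induction l)
 case (Cons a l)
 thus ?case using gq_closed[of l] gq_closed[of l'] by (simp add: CL.m_assoc del: foldr_append)
qed simp

lemma gl_append: "gl (l @ l') = gl l ** gl l'"
proof (induction l)
 case (Cons a l)
 thus ?case by (simp add: matrix_mul_assoc del: foldr_append)
qed simp

lemma gq_rev: "set l <= R ==> gq l \<otimes>\<^sub>c gq (rev l) = \<one>\<^sub>c"
proof (induction l)
 case (Cons a l)
 have aa: "\<gamma> (nn a) \<otimes>\<^sub>c \<gamma> (nn a) = \<one>\<^sub>c" using Cons.prems pairing_nn by (simp add: gamma_rels(2))
 have "gq (a # l) \<otimes>\<^sub>c gq (rev (a # l)) = \<gamma> (nn a) \<otimes>\<^sub>c ((gq l \<otimes>\<^sub>c gq (rev l)) \<otimes>\<^sub>c \<gamma> (nn a))"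
  using gq_append[of "rev l" "[a]"] gq_closed[of l] gq_closed[of "rev l"] by (simp add: CL.m_assoc del: foldr_append)
 thus ?case using Cons aa by simp
qed simp

lemma gl_W: "set l <= R ==> gl l : W"
 by (induction l) (auto intro: refl_group.intros)

lemma W_gl: "g : W ==> \<exists>l. set l <= R & g = gl l"
proof (induction rule: refl_group.induct)
 case one
 show ?case by (intro exI[of _ "[]"]) simp
next
 case (step al g)
 then obtain l where "set l <= R" "g = gl l" by blast
 thus ?case using step(1) by (intro exI[of _ "al # l"]) simp
qed

abbreviation "bl l == foldr (%al r. cl (nn al) * r) l 1"

lemma phi2_gq: "phi2 (gq l) = bl l"
 by (induction l) (simp_all add: S.ahomD(1)[OF phi2(1)] phi2(2) phi2_one)

lemma gq_part: "gq l : cliff_part (length l mod 2)"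
proof -
 have "gq l = quot_class (free_alg UNIV) cliff_rels (word (map nn l))"
 proof (induction l)
  case Nil
  show ?case unfolding cliff_def using free_quot_ops(4)[OF cliff_quot] by simp
 next
  case (Cons p l)
  thus ?case using free_quot_ops(3)[OF cliff_quot, of "[nn p]" "map nn l", folded cliff_def] by (simp add: \<gamma>_def)
 qed
 thus ?thesis unfolding cliff_part_def by (intro image_eqI[of _ _ "word (map nn l)"]) auto
qed

text \<open>A presentation of w as a signed product of unit root vectors. It gives the parity by
  length, the inverse by reversal and the projection by \<open>gl\<close>; every element of the
  double cover has one.\<close>

definition pl :: "'n cliff => complex => (real^'n) list => bool" where
 "pl w k l \<longleftrightarrow> (k = 1 \<or> k = -1) & set l <= R & w = k \<odot>\<^sub>c gq l"

lemma pl_closed: "pl w k l ==> w : carrier cliff"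
 by (simp add: pl_def)

lemma pl_mult: "pl w k l ==> pl w' k' l' ==> pl (w \<otimes>\<^sub>c w') (k * k') (l @ l')"
 using gq_append[of l l'] gq_closed[of l] gq_closed[of l']
 by (auto simp: pl_def CL.smult_mult_l CL.smult_mult_r CL.smult_smult simp del: foldr_append)

lemma pl_rev: "pl w k l ==> pl (k \<odot>\<^sub>c gq (rev l)) k (rev l)"
 by (auto simp: pl_def)

lemma pl_inv: assumes "pl w k l" shows "w \<otimes>\<^sub>c (k \<odot>\<^sub>c gq (rev l)) = \<one>\<^sub>c" "(k \<odot>\<^sub>c gq (rev l)) \<otimes>\<^sub>c w = \<one>\<^sub>c"
 "inv\<^bsub>cliff\<^esub> w = k \<odot>\<^sub>c gq (rev l)" "w : Units cliff"
proof -
 show 1: "w \<otimes>\<^sub>c (k \<odot>\<^sub>c gq (rev l)) = \<one>\<^sub>c" "(k \<odot>\<^sub>c gq (rev l)) \<otimes>\<^sub>c w = \<one>\<^sub>c"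
  using assms gq_rev[of l] gq_rev[of "rev l"] gq_closed[of l] gq_closed[of "rev l"] by (auto simp: pl_def CL.smult_mult_l CL.smult_mult_r CL.smult_smult)
 show "inv\<^bsub>cliff\<^esub> w = k \<odot>\<^sub>c gq (rev l)" using CL.inv_char[OF pl_closed[OF assms] _ 1] by simp
 show "w : Units cliff" unfolding Units_def using 1 pl_closed[OF assms] by auto
qed

lemma group_U: "Group.group (units_of (cliff :: (complex, 'n cliff) module))"
 by (rule CL.units_group)

lemma theta_pl: "pl (\<ominus>\<^bsub>cliff\<^esub> \<one>\<^sub>c) (-1) []"
 by (simp add: pl_def CL.smult_minus_one)

lemma gen_pl: "al : R ==> pl (complex_of_real (1 / norm (coroot al)) \<odot>\<^sub>c \<gamma> (cvec (coroot al))) 1 [al]"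
 by (simp add: pl_def nn_def gamma_lin)

abbreviation "pgens == {\<ominus>\<^bsub>cliff\<^esub> \<one>\<^sub>c} \<union> {complex_of_real (1 / norm (coroot al)) \<odot>\<^sub>c \<gamma> (cvec (coroot al)) | al. al : R}"

lemma PG_simps: "mult PG = mult cliff" "one PG = \<one>\<^sub>c" "carrier PG = generate (units_of cliff) pgens"
 by (simp_all add: pin_group_def units_of_def)

lemma pgens_pl: "w : pgens ==> \<exists>k l. pl w k l"
 using theta_pl gen_pl by blast

lemma pgens_sub: "pgens <= carrier (units_of cliff)"
 using pgens_pl pl_inv(4) by (auto simp: units_of_carrier simp del: of_real_divide)

lemma PG_pl: "w : carrier PG ==> \<exists>k l. pl w k l"
 unfolding PG_simps
proof (induction rule: generate.induct)
 case one
 show ?case by (intro exI[of _ 1] exI[of _ "[]"]) (simp add: pl_def units_of_one)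
next
 case (incl h)
 thus ?case by (rule pgens_pl)
next
 case (inv h)
 then obtain k l where "pl h k l" using pgens_pl by blast
 thus ?case using pl_inv(3,4)[of h k l] pl_rev[of h k l] CL.units_of_inv[of h] by metis
next
 case (eng h1 h2)
 thus ?case using pl_mult by (metis units_of_mult)
qed

lemma PG_group: "Group.group PG"
proof -
 interpret U: Group.group "units_of (cliff :: (complex, 'n cliff) module)" by (rule group_U)
 show ?thesis unfolding pin_group_def
  by (rule U.subgroup_imp_group[OF U.generate_is_subgroup[OF pgens_sub]])
qed

sublocale PG: Group.group PG
 by (rule PG_group)

lemma theta_PG: "\<ominus>\<^bsub>cliff\<^esub> \<one>\<^sub>c : carrier PG"
 unfolding PG_simps by (rule generate.incl) blast

lemma gq_PG: "set l <= R ==> gq l : carrier PG"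
proof (induction l)
 case Nil
 show ?case using PG.one_closed by (simp add: PG_simps(2))
next
 case (Cons a l)
 have "\<gamma> (nn a) : carrier PG" unfolding PG_simps nn_def gamma_lin by (rule generate.incl) (use Cons.prems in auto)
 from PG.m_closed[OF this, of "gq l"] show ?case using Cons by (simp add: PG_simps(1))
qed

lemma sc_eq_0: "sc k = (0 :: 'n op) ==> k = 0"
proof -
 assume "sc k = (0 :: 'n op)"
 from arg_cong[OF this, of "%a. lk (app a vac) (mat 1) {}"] have "pconst k = (0 :: 'n pfun)" by (simp add: vac_def)
 thus "k = 0" by (metis pev_basic(1) pev_simps(1))
qed

lemma cl_inj: "cl u = cl v ==> u = v"
proof -
 assume "cl u = cl v"
 hence "cl (u - v) = 0" by (simp add: cl_lin)
 hence "sc (2 * pairing (u - v) (axis i 1)) = (0 :: 'n op)" for i using cl_cl[of "u - v" "axis i 1"] by simp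
 hence "(u - v) $ i = 0" for i using sc_eq_0 by fastforce
 thus "u = v" by (simp add: vec_eq_iff)
qed

lemma bl_rel:
 assumes "set l <= R" shows "bl l * cl v = sc ((-1) ^ length l) * (cl (cmat (gl l) *v v) * bl l)"
 using assms
proof (induction l arbitrary: v)
 case Nil
 show ?case by (simp add: cmat_simps)
next
 case (Cons a l)
 obtain k where k: "nn a = k *s cvec a" using nn_scale by blast
 have a: "cl (nn a) * cl u = - (cl (cmat (root_refl a) *v u) * cl (nn a))" for u
 proof -
  have "cl (cvec a) * cl u = sc (-1) * (cl (cmat (root_refl a) *v u) * cl (cvec a))"
   using pok_refl[of a] Cons.prems by (simp add: pok_def)
  thus ?thesis unfolding k cl_lin(2) using S.slc[of "cl _" k] by (simp add: m_ass S.sc_minus)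
 qed
 have "bl (a # l) * cl v = cl (nn a) * (sc ((-1) ^ length l) * (cl (cmat (gl l) *v v) * bl l))"
  using Cons by (simp add: m_ass)
 also have "... = sc ((-1) ^ length l) * (cl (nn a) * cl (cmat (gl l) *v v) * bl l)"
  using S.slc[of "cl (nn a)"] by (simp add: m_ass)
 also have "... = sc ((-1) ^ length (a # l)) * (cl (cmat (gl (a # l)) *v v) * bl (a # l))"
  unfolding a by (simp add: cmat_simps matrix_vector_mul_assoc m_ass S.sc_minus)
 finally show ?case .
qed

lemma phi2_pl: "pl w k l ==> phi2 w = sc k * bl l"
 by (auto simp: pl_def S.ahomD(4)[OF phi2(1) _ CL.one_closed] phi2_gq)

lemma pl_part: "pl w k l ==> hat (phi2 w) = sc ((-1) ^ length l) * phi2 w"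
 using cliff_part_props(2)[OF gq_part[of l]] by (auto simp: phi2_pl phi2_gq minus_one_power_iff even_iff_mod_2_eq_zero S.sc_minus split: if_splits)

lemma phi2_nz: "pl w k l ==> phi2 w ~= 0"
proof
 assume "pl w k l" "phi2 w = 0"
 hence "phi2 \<one>\<^sub>c = 0" using pl_inv(1)[of w k l] S.ahomD(1)[OF phi2(1), of w] by (metis pl_closed pl_rev mult_zero_left)
 thus False using phi2_one by simp
qed

text \<open>A unit cannot be both even and odd, for then \<open>hat\<close> would fix and negate its
  nonzero image.\<close>

lemma pl_parity: assumes "pl w k l" shows "cliff_parity w = length l mod 2"
proof (cases "even (length l)")
 case True
 have "w \<notin> cliff_part 1"
 proof
  assume "w : cliff_part 1"
  hence "phi2 w = - phi2 w" using cliff_part_props(2)[of w 1] pl_part[OF assms] True by (simp add: S.sc_minus)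
  hence "phi2 w + phi2 w = 0" by (metis add.right_inverse)
  thus False using half_double[of "phi2 w"] phi2_nz[OF assms] by simp
 qed
 thus ?thesis using True by (simp add: cliff_parity_def even_iff_mod_2_eq_zero)
next
 case False
 hence 1: "length l mod 2 = 1" by (simp add: odd_iff_mod_2_eq_one)
 obtain f where f: "gq l = quot_class (free_alg UNIV) cliff_rels f" "ALL l:keys f. length l mod 2 = 1"
  using gq_part[of l] unfolding 1 cliff_part_def by blast
 have "w = quot_class (free_alg UNIV) cliff_rels (scale k f)"
  using assms free_quot_ops(1)[OF cliff_quot, of f k, folded cliff_def] by (simp add: pl_def f)
 hence "w : cliff_part 1" unfolding cliff_part_def using f(2) keys_scale[of k f] by blast
 thus ?thesis by (simp add: cliff_parity_def 1)
qed

text \<open>Twisted conjugation is computed on operators and pulled back by injectivity of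
  \<open>phi2\<close>. The matrix is unique because \<open>cl\<close> is injective on
  vectors.\<close>

lemma pl_proj: assumes "pl w k l" shows "pin_proj w = gl l"
 unfolding pin_proj_def
proof (rule the_equality)
 have l: "set l <= R" using assms by (simp add: pl_def)
 note wc = pl_closed[OF assms] and wi = pl_closed[OF pl_rev[OF assms]]
 have e: "((-1) ^ cliff_parity w) \<odot>\<^sub>c (w \<otimes>\<^sub>c \<gamma> v \<otimes>\<^sub>c inv\<^bsub>cliff\<^esub> w) = \<gamma> (cmat (gl l) *v v)" for v
 proof (rule phi2_inj)
  have s: "(-1) ^ cliff_parity w = ((-1) ^ length l :: complex)" by (simp add: pl_parity[OF assms] minus_one_power_iff)
  have kk: "k * k = 1" using assms by (auto simp: pl_def)
  have "phi2 w * phi2 (inv\<^bsub>cliff\<^esub> w) = 1"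
   using pl_inv(1)[OF assms] wc wi S.ahomD(1)[OF phi2(1) wc wi] phi2_one unfolding pl_inv(3)[OF assms] by simp
  moreover have "phi2 w * cl v = sc ((-1) ^ length l) * (cl (cmat (gl l) *v v) * phi2 w)"
   unfolding phi2_pl[OF assms] using bl_rel[OF l, of v] S.slc[of "cl _" k] by (simp add: m_ass) (simp add: mult.commute)
  ultimately have "phi2 w * cl v * phi2 (inv\<^bsub>cliff\<^esub> w) = sc ((-1) ^ length l) * cl (cmat (gl l) *v v)" by (simp add: m_ass)
  thus "phi2 (((-1) ^ cliff_parity w) \<odot>\<^sub>c (w \<otimes>\<^sub>c \<gamma> v \<otimes>\<^sub>c inv\<^bsub>cliff\<^esub> w)) = phi2 (\<gamma> (cmat (gl l) *v v))"
   unfolding s pl_inv(3)[OF assms] using wc wi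
   by (simp add: S.ahomD(4)[OF phi2(1) _ CL.one_closed] S.ahomD(1)[OF phi2(1)] phi2(2) flip: power_add)
 qed (use wc wi pl_inv(3)[OF assms] in simp_all)
 thus "\<forall>v. \<gamma> (cmat (gl l) *v v) = ((-1) ^ cliff_parity w) \<odot>\<^sub>c (w \<otimes>\<^sub>c \<gamma> v \<otimes>\<^sub>c inv\<^bsub>cliff\<^esub> w)" by simp
 fix g :: "real^'n^'n" assume g: "\<forall>v. \<gamma> (cmat g *v v) = ((-1) ^ cliff_parity w) \<odot>\<^sub>c (w \<otimes>\<^sub>c \<gamma> v \<otimes>\<^sub>c inv\<^bsub>cliff\<^esub> w)"
 have v: "cmat g *v v = cmat (gl l) *v v" for v using g e[of v] phi2(2) by (metis cl_inj)
 have "cmat g = cmat (gl l)" using v by (simp add: matrix_eq)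
 thus "g = gl l" by (simp add: cmat_def vec_eq_iff)
qed

text \<open>Reversal of Clifford products turns left into right multiplication.\<close>

primrec jj :: "nat => complex" where "jj 0 = 1" | "jj (Suc m) = (-1) ^ m * jj m"

text \<open>\<open>jj m\<close> is (-1)^(m (m-1)/2), the sign for reversing a product of m
  anticommuting factors.\<close>

definition Jo :: "'n op" where "Jo = mop (%k. k) (%k. (*) (pconst (jj (card (snd k)))))"

lemma lk_Jo: "lk (app Jo F) w S = pconst (jj (card S)) * lk F w S"
 unfolding Jo_def using lookup_mop[of "%k. (*) (pconst (jj (card (snd k))))" "%k. k" "%k. k" F "(w, S)"] by simp

lemma jj_sign:
 assumes S: "S <= {1..CARD('n)}" and p: "p : {1..CARD('n)}"
 shows "jj (card S) * sg {..<p} S = sg {p<..CARD('n)} S * jj (card (sd S p))"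
proof -
 have fin: "finite S" using S finite_subset by blast
 have 1: "jj (Suc (card U)) * sg {..<p} U = sg {p<..CARD('n)} U * jj (card U)" if U: "U <= {1..CARD('n)}" "p \<notin> U" for U
 proof -
  have "sg {1..CARD('n)} U = (-1) ^ card U" using U by (simp add: sg_def Int_absorb2)
  hence "(-1) ^ card U * sg {..<p} U = (sg {..<p} U * sg {p<..CARD('n)} U) * sg {..<p} U" using sg_split[OF U(1), of p] U(2) by simp
  thus ?thesis by (simp add: mult_ac)
 qed
 show ?thesis
 proof (cases "p : S")
  case True
  define U where "U = S - {p}"
  have U: "S = insert p U" "p \<notin> U" "sd S p = U" using True by (auto simp: U_def sd_def)
  have "card S = Suc (card U)" using U fin by simp
  moreover have "sg {..<p} S = sg {..<p} U" "sg {p<..CARD('n)} S = sg {p<..CARD('n)} U" unfolding U(3)[symmetric] by (simp_all add: sg_sd)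
  ultimately show ?thesis using 1[of U] U S by auto
 next
  case False
  hence "sd S p = insert p S" by (auto simp: sd_def)
  hence c: "card (sd S p) = Suc (card S)" using fin False by simp
  have "jj (card S) * sg {..<p} S = sg {p<..CARD('n)} S * ((sg {p<..CARD('n)} S * jj (card S)) * sg {..<p} S)" by (simp add: m_ass)
  also have "... = sg {p<..CARD('n)} S * (jj (Suc (card S)) * (sg {..<p} S * sg {..<p} S))" by (simp only: 1[OF S False, symmetric] m_ass)
  finally show ?thesis unfolding c by simp
 qed
qed

lemma Jo_el: assumes F: "suppW F" and p: "p : {1..CARD('n)}" shows "app Jo (app (el p) F) = app (re p) (app Jo F)"
proof -
 have "lk (app Jo (app (el p) F)) w S = lk (app (re p) (app Jo F)) w S" for w S
 proof (cases "lk F w (sd S p) = 0")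
  case False
  hence "sd S p <= {1..CARD('n)}" using F by (auto simp: suppW_def)
  hence "S <= {1..CARD('n)}" using p by (auto simp: sd_def split: if_splits)
  from jj_sign[OF this p] show ?thesis by (simp add: lk_Jo)
 qed (simp add: lk_Jo)
 thus ?thesis by (intro poly_mapping_eqI) auto
qed

lemma Jo_cl: assumes F: "suppW F" shows "app Jo (app (cl v) F) = app (rcl v) (app Jo F)"
proof -
 have s: "app Jo (smul k G) = smul k (app Jo G)" for k and G :: "'n M"
  using arg_cong[OF S.sc_comm[of Jo k], of "%a. app a G"] by simp
 have "app Jo (app (cl v) F) = (SUM p:{1..CARD('n)}. smul (pairing v (cvec (y p))) (app Jo (app (el p) F)))"
  unfolding cl_def by (simp add: app_sum s)
 also have "... = (SUM p:{1..CARD('n)}. smul (pairing v (cvec (y p))) (app (re p) (app Jo F)))"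
  by (intro sum.cong refl) (simp add: Jo_el[OF F])
 also have "... = app (rcl v) (app Jo F)" unfolding rcl_def by (simp add: app_sum)
 finally show ?thesis .
qed

abbreviation "rbl l == foldr (%al r. rcl (nn al) * r) l 1"

lemma bl_append: "bl (l @ l') = bl l * bl l'"
proof (induction l)
 case (Cons a l)
 thus ?case by (simp add: m_ass del: foldr_append)
qed simp

lemma rt_bl: "rt (bl (rev l)) (rbl l)"
proof (induction l)
 case Nil
 show ?case by (auto simp: rt_def Alg_simps rok_def)
next
 case (Cons a l)
 have "bl (rev (a # l)) = bl (rev l) * cl (nn a)" using bl_append[of "rev l" "[a]"] by (simp del: foldr_append)
 thus ?case using rt_mult[OF Cons rt_basic(5)] by simp
qed

lemma bl_Alg: "bl l : Alg"
 by (induction l) (auto intro: Alg.intros Alg_simps)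

lemma bl_reverse: "app Jo (app (bl l) vac) = app (bl (rev l)) vac"
proof -
 have "app Jo (app (bl l) vac) = app (rbl l) vac"
 proof (induction l)
  case Nil
  have "app Jo vac = vac" unfolding vac_def Jo_def by (simp add: pconst_simps)
  thus ?case by simp
 next
  case (Cons a l)
  thus ?case using Jo_cl[OF Alg_suppW[OF bl_Alg suppW_vac]] by simp
 qed
 thus ?thesis using rt_bl[of l] by (simp add: rt_def)
qed

lemma phi2_vac: assumes "b : carrier cliff"
 shows "w ~= mat 1 ==> lk (app (phi2 b) vac) w S = 0" "\<exists>k. lk (app (phi2 b) vac) (mat 1) S = pconst k"
  "h ~= g ==> lk (app (gr g * phi2 b) vac) h S = 0"
proof -
 let ?Q = "%a :: 'n op. (\<forall>w S. w ~= mat 1 --> lk (app a vac) w S = 0) & (\<forall>S. \<exists>k. lk (app a vac) (mat 1) S = pconst k)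
  & (\<forall>g h S. h ~= g --> lk (app (gr g * a) vac) h S = 0)"
 have pc: "\<exists>k. pconst k = (0 :: 'n pfun)" "\<exists>k. 0 = (pconst k :: 'n pfun)" "\<exists>k. 1 = (pconst k :: 'n pfun)"
  using pconst_simps(1,2) by metis+
 have "?Q (phi2 b)"
 proof (rule span_prop[OF CL.calg_axioms phi2(1) CN_closed cliff_span[OF assms]])
  fix s assume "s : CN"
  then obtain l where l: "s = gw l" "sorted_wrt (<) l" "set l <= {1..CARD('n)}" by blast
  have v: "app (phi2 s) vac = single (mat 1, set l) 1" using el_vac[OF l(2)] phi2_words[OF l(3)] l(1) by simp
  show "?Q (phi2 s)"
   using pc by (auto simp: v lookup_single when_def)
 next
  show "?Q 0" using pc(2) by auto
 next
  fix a b k assume ab: "?Q a" "?Q b"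
  have "gr g * (sc k * a + b) = sc k * (gr g * a) + gr g * b" for g
   using S.slc[of "gr g :: 'n op"] by (simp add: distrib_left)
  moreover have "\<exists>j. lk (app (sc k * a + b) vac) (mat 1) S = pconst j" for S
  proof -
   obtain k1 k2 where "lk (app a vac) (mat 1) S = pconst k1" "lk (app b vac) (mat 1) S = pconst k2" using ab by blast
   thus ?thesis by (intro exI[of _ "k * k1 + k2"]) (simp add: lk_simps pconst_simps(3,4))
  qed
  ultimately show "?Q (sc k * a + b)" using ab by (simp add: lk_simps)
 qed
 thus "w ~= mat 1 ==> lk (app (phi2 b) vac) w S = 0" "\<exists>k. lk (app (phi2 b) vac) (mat 1) S = pconst k"
  "h ~= g ==> lk (app (gr g * phi2 b) vac) h S = 0" by blast+
qed

text \<open>An element of the Clifford group acting as \<open>\<delta> = \<plusminus>1\<close> on vectors is, up to a scalar,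
 \<open>1\<close> or the product of all \<open>e\<^sub>p\<close>.\<close>

lemma supp_scalar:
 assumes B: "B : Alg" "hat B = sc s * B" "!!p. p : {1..CARD('n)} ==> B * el p = sc (\<delta> * s) * (el p * B)"
  and s: "s * s = 1" "\<delta> = 1 \<or> \<delta> = -1" and nz: "lk (app B vac) w S ~= 0"
 shows "sg {1..CARD('n)} S = s" "p : {1..CARD('n)} ==> p : S \<longleftrightarrow> \<delta> = -1"
proof -
 have S: "S <= {1..CARD('n)}" using Alg_suppW[OF B(1) suppW_vac] nz by (auto simp: suppW_def)
 have pc: "k = l" if "pconst k * q = pconst l * q" "q ~= 0" for k l and q :: "'n pfun"
  using that by (metis mult_right_cancel pev_basic(1))
 have "par * B = sc s * B * par"
 proof -
  have "par * B = par * B * (par * par)" by (simp add: par_par)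
  also have "... = hat B * par" by (simp add: hat_def m_ass)
  finally show ?thesis by (simp add: B(2))
 qed
 hence "app par (app B vac) = smul s (app B vac)" using vac_swap(5) by (metis app_simps)
 from arg_cong[OF this, of "%F. lk F w S"] show 1: "sg {1..CARD('n)} S = s" using pc[OF _ nz] by simp
 assume p: "p : {1..CARD('n)}"
 have "app (re p) (app B vac) = app (B * el p) vac"
  using rt_apply[OF B(1) rt_basic(4)[OF p]] by simp
 also have "... = smul (\<delta> * s) (app (el p) (app B vac))" by (simp add: B(3)[OF p])
 finally have e: "app (re p) (app B vac) = smul (\<delta> * s) (app (el p) (app B vac))" .
 have "sg {p<..CARD('n)} (sd S p) = \<delta> * s * sg {..<p} (sd S p)"
  using arg_cong[OF e, of "%F. lk F w (sd S p)"] pc[OF _ nz] by simp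
 hence "sg {..<p} S * sg {p<..CARD('n)} S = \<delta> * s" using p by (simp add: sg_sd mult.left_commute)
 hence "s = (if p : S then -1 else 1) * (\<delta> * s)" using sg_split[OF S, of p] 1 by simp
 moreover have "s ~= 0" using s by auto
 ultimately show "p : S \<longleftrightarrow> \<delta> = -1" using s(2) by (auto split: if_splits simp: eq_neg_iff_add_eq_0)
qed

end

context dunkl
begin

lemma Alg_eq: "a : Alg ==> b : Alg ==> app a vac = app b vac ==> a = b"
 using Alg_Phi[of a] Alg_Phi[of b] Phi_inj by metis

lemma vac_nz: "vac ~= (0 :: 'n M)"
proof
 assume "vac = (0 :: 'n M)"
 from arg_cong[OF this, of "%F. lk F (mat 1) {}"] show False by (simp add: vac_def)
qed

lemma bl_inv: "set l <= R ==> bl l * bl (rev l) = 1" "set l <= R ==> bl (rev l) * bl l = 1"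
proof -
 have 1: "bl l * bl (rev l) = 1" if "set l <= R" for l
  using S.ahomD(1)[OF phi2(1) gq_closed[of l] gq_closed[of "rev l"]] gq_rev[OF that] phi2_one
  by (simp add: phi2_gq)
 thus "set l <= R ==> bl l * bl (rev l) = 1" "set l <= R ==> bl (rev l) * bl l = 1" using 1[of l] 1[of "rev l"] by simp_all
qed

lemma hat_bl: "set l <= R ==> hat (bl l) = sc ((-1) ^ length l) * bl l"
 using pl_part[of "gq l" 1 l] by (simp add: pl_def phi2_gq)

text \<open>A product of unit root vectors acting trivially on vectors is a scalar \<kappa>.
  Reversal fixes scalars and sends the product to its inverse, so \<kappa>^2 = 1. This is where the
  unit length of the generators enters.\<close>

lemma pin_kernel:
 assumes w: "w : carrier PG" and g: "pin_proj w = mat 1" shows "w = \<one>\<^sub>c \<or> w = \<ominus>\<^bsub>cliff\<^esub> \<one>\<^sub>c"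
proof -
 obtain k l where pl: "pl w k l" using PG_pl[OF w] by blast
 hence l: "set l <= R" and k: "k = 1 \<or> k = -1" and wl: "w = k \<odot>\<^sub>c gq l" and gl: "gl l = mat 1" using pl_proj[OF pl] g by (auto simp: pl_def)
 let ?s = "(-1) ^ length l :: complex"
 have rel: "bl l * el p = sc (1 * ?s) * (el p * bl l)" if "p : {1..CARD('n)}" for p
  using bl_rel[OF l, of "cvec (y p)"] that unfolding gl by (simp add: cl_y cmat_simps)
 have ss: "?s * ?s = 1" by (simp flip: power_mult_distrib)
 have supp: "S = {}" if "lk (app (bl l) vac) u S ~= 0" for u S
 proof -
  have "S <= {1..CARD('n)}" using Alg_suppW[OF bl_Alg suppW_vac] that by (auto simp: suppW_def)
  moreover have "p \<notin> S" if "p : {1..CARD('n)}" for p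
   using supp_scalar(2)[OF bl_Alg hat_bl[OF l] rel ss _ \<open>lk (app (bl l) vac) u S ~= 0\<close> that] by simp
  ultimately show ?thesis by blast
 qed
 have u1: "lk (app (bl l) vac) u S = 0" if "u ~= mat 1" for u S using phi2_vac(1)[OF gq_closed[of l] that] by (simp add: phi2_gq)
 obtain \<kappa> where \<kappa>: "lk (app (bl l) vac) (mat 1) {} = pconst \<kappa>" using phi2_vac(2)[OF gq_closed[of l]] by (auto simp: phi2_gq)
 have v: "app (bl l) vac = smul \<kappa> vac"
 proof (rule poly_mapping_eqI)
  fix i :: "'n idx"
  obtain u S where i: "i = (u, S)" by (cases i)
  show "lookup (app (bl l) vac) i = lookup (smul \<kappa> vac) i"
  proof (cases "u = mat 1 & S = {}")
   case True
   thus ?thesis using \<kappa> by (simp add: i vac_def)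
  next
   case False
   hence "lk (app (bl l) vac) u S = 0" using supp u1 by blast
   thus ?thesis using False by (auto simp: i vac_def lookup_single when_def)
  qed
 qed
 have "app (bl (rev l)) vac = app Jo (smul \<kappa> vac)" using bl_reverse[of l] by (simp add: v)
 also have "... = smul \<kappa> (app Jo vac)" using arg_cong[OF S.sc_comm[of Jo \<kappa>], of "%a. app a vac"] by simp
 also have "app Jo vac = vac" unfolding vac_def Jo_def by (simp add: pconst_simps)
 finally have r: "app (bl (rev l)) vac = smul \<kappa> vac" .
 have "app (bl l * bl (rev l)) vac = app (bl l) (smul \<kappa> vac)" by (simp add: r)
 also have "... = smul \<kappa> (app (bl l) vac)" using arg_cong[OF S.sc_comm[of "bl l" \<kappa>], of "%a. app a vac"] by simp
 finally have "(vac :: 'n M) = smul \<kappa> (smul \<kappa> vac)" using bl_inv(1)[OF l] by (simp add: v)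
 from arg_cong[OF this, of "%F. lk F (mat 1) {}"] have "(1 :: 'n pfun) = pconst (\<kappa> * \<kappa>)" by (simp add: vac_def pconst_simps(4) del: pc_pc)
 hence kk: "\<kappa> * \<kappa> = 1" by (metis pev_basic(1) pev_simps(2))
 hence k1: "\<kappa> = 1 \<or> \<kappa> = -1" by (simp add: square_eq_1_iff)
 have "bl l = sc \<kappa>" by (rule Alg_eq) (simp_all add: bl_Alg Alg.sc v)
 moreover have "phi2 (\<kappa> \<odot>\<^sub>c \<one>\<^sub>c) = sc \<kappa>"
  using S.ahomD(4)[OF phi2(1) CL.one_closed CL.one_closed] phi2_one by simp
 ultimately have "gq l = \<kappa> \<odot>\<^sub>c \<one>\<^sub>c" by (intro phi2_inj) (simp_all add: phi2_gq)
 hence "w = (k * \<kappa>) \<odot>\<^sub>c \<one>\<^sub>c" by (simp add: wl CL.smult_smult)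
 thus ?thesis using k k1 by (auto simp: CL.smult_minus_one)
qed

abbreviation "th == \<ominus>\<^bsub>cliff\<^esub> \<one>\<^bsub>cliff :: (complex, 'n cliff) module\<^esub>"

lemma pin_proj_mult: "w : carrier PG ==> w' : carrier PG ==> pin_proj (w \<otimes>\<^sub>c w') = pin_proj w ** pin_proj w'"
proof -
 assume "w : carrier PG" "w' : carrier PG"
 then obtain k l k' l' where pl: "pl w k l" "pl w' k' l'" using PG_pl by blast
 show ?thesis using pl_proj[OF pl_mult[OF pl]] pl_proj[OF pl(1)] pl_proj[OF pl(2)] gl_append[of l l'] by simp
qed

lemma pin_proj_one: "pin_proj \<one>\<^sub>c = (mat 1 :: real^'n^'n)" "pin_proj th = mat 1"
 using pl_proj[of "\<one>\<^sub>c" 1 "[]"] pl_proj[OF theta_pl] by (simp_all add: pl_def)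

lemma PG_closed: "w : carrier PG ==> w : carrier cliff"
 using PG_pl pl_closed by blast

lemma PG_ops: "w : carrier PG ==> w' : carrier PG ==> w \<otimes>\<^sub>c w' : carrier PG" "\<one>\<^sub>c : carrier PG"
 "w : carrier PG ==> inv\<^bsub>PG\<^esub> w : carrier PG" "w : carrier PG ==> inv\<^bsub>PG\<^esub> w \<otimes>\<^sub>c w = \<one>\<^sub>c"
 "w : carrier PG ==> w \<otimes>\<^sub>c inv\<^bsub>PG\<^esub> w = \<one>\<^sub>c"
 using PG.m_closed[of w w'] PG.one_closed PG.inv_closed[of w] PG.l_inv[of w] PG.r_inv[of w] by (simp_all add: PG_simps(1,2))

lemma pin_fiber:
 assumes w: "w : carrier PG" "w' : carrier PG" and g: "pin_proj w = pin_proj w'"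
 shows "w' = w \<or> w' = th \<otimes>\<^sub>c w"
proof -
 let ?v = "inv\<^bsub>PG\<^esub> w"
 have "pin_proj (w' \<otimes>\<^sub>c ?v) = pin_proj (w \<otimes>\<^sub>c ?v)" using w PG_ops(3) g by (simp add: pin_proj_mult)
 hence "pin_proj (w' \<otimes>\<^sub>c ?v) = mat 1" using w PG_ops(5) by (simp add: pin_proj_one)
 hence "w' \<otimes>\<^sub>c ?v = \<one>\<^sub>c \<or> w' \<otimes>\<^sub>c ?v = th" using pin_kernel PG_ops w by blast
 moreover have "w' = (w' \<otimes>\<^sub>c ?v) \<otimes>\<^sub>c w"
  using w PG_ops(3,4)[OF w(1)] by (simp add: CL.m_assoc PG_closed)
 ultimately show ?thesis using w(1) PG_closed by (metis CL.l_one)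
qed

text \<open>\<rho> seen on operators (\<open>Phi_rho\<close>). It sends \<theta> to -1, so only the
  ideal generated by (1 - \<theta>)/2 is visible.\<close>

definition psi1 :: "'n cliff => 'n op" where "psi1 w = gr (pin_proj w) * phi2 w"
definition psi :: "('n cliff \<Rightarrow>\<^sub>0 complex) => 'n op" where "psi = S.mlin psi1"

lemma phi2_gr: "w : carrier cliff ==> phi2 w * gr g = gr g * phi2 w"
 by (rule phi2_props(2)) (auto simp: el_comm)

lemma psi1_mult: "w : carrier PG ==> w' : carrier PG ==> psi1 (w \<otimes>\<^sub>c w') = psi1 w * psi1 w'"
proof -
 assume w: "w : carrier PG" "w' : carrier PG"
 have "psi1 w * psi1 w' = gr (pin_proj w) * (phi2 w * gr (pin_proj w')) * phi2 w'" by (simp add: psi1_def m_ass)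
 also have "... = gr (pin_proj w) * gr (pin_proj w') * (phi2 w * phi2 w')" using w by (simp add: phi2_gr PG_closed m_ass)
 finally show ?thesis using w by (simp add: psi1_def pin_proj_mult gr_gr S.ahomD(1)[OF phi2(1)] PG_closed)
qed

lemma psi1_one: "psi1 \<one>\<^sub>c = 1" "psi1 th = -1"
proof -
 have 1: "phi2 \<one>\<^sub>c = 1" by (rule phi2_one)
 thus "psi1 \<one>\<^sub>c = 1" "psi1 th = -1"
  by (simp_all add: psi1_def pin_proj_one gr_one S.ahom_group(2)[OF phi2(1) CL.calg_axioms])
qed

lemma psi_hom: "S.ahom (pin_alg R) psi"
 unfolding psi_def pin_alg_def by (rule S.ahom_mlin) (simp_all add: PG_simps(1,2) psi1_mult psi1_one)

lemma psi1_inv: "w : carrier PG ==> psi1 (inv\<^bsub>PG\<^esub> w) * psi1 w = 1"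
 using psi1_mult[of "inv\<^bsub>PG\<^esub> w" w] PG_ops psi1_one by simp

lemma eps_pl: "pl w k l ==> eps CARD('n) (cliff_parity w) = ((-1) ^ (CARD('n) - 1)) ^ length l"
 by (auto simp: eps_def pl_parity minus_one_power_iff)

lemma scaled_comm_bl:
 assumes "!!v. N * cl v = sc \<sigma> * (cl v * N)" shows "N * bl l = sc (\<sigma> ^ length l) * (bl l * N)"
proof (induction l)
 case (Cons a l)
 have "N * bl (a # l) = sc \<sigma> * (cl (nn a) * (N * bl l))" by (simp only: foldr.simps o_apply m_ass[symmetric] assms)
 thus ?case using S.slc[of "cl (nn a)"] by (simp add: Cons m_ass)
qed simp

text \<open>The sign with D is the one with \<Gamma>, because the Scasimir commutes with everything
  that supercommutes with F+ and F-.\<close>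

lemma psi1_props:
 assumes w: "w : carrier PG"
 shows "psi1 w : Alg" "osp_ok (psi1 w)" "hat (psi1 w) = sc ((-1) ^ cliff_parity w) * psi1 w"
  "DD * psi1 w = sc (eps CARD('n) (cliff_parity w)) * (psi1 w * DD)"
proof -
 obtain k l where pl: "pl w k l" using PG_pl[OF w] by blast
 hence l: "set l <= R" by (simp add: pl_def)
 have gW: "pin_proj w : W" using pl_proj[OF pl] gl_W[OF l] by simp
 note wc = PG_closed[OF w]
 show "psi1 w : Alg" unfolding psi1_def by (intro Alg.mult Alg.gr gW phi2_props(1) wc)
 have "pok (pin_proj w) (length l) (phi2 w)"
  unfolding pok_def
 proof (intro conjI allI)
  show "phi2 w * cl v = sc ((-1) ^ length l) * (cl (cmat (pin_proj w) *v v) * phi2 w)" for v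
   unfolding phi2_pl[OF pl] pl_proj[OF pl] using bl_rel[OF l, of v] S.slc[of "cl _" k] by (simp add: m_ass) (simp add: mult.commute)
  show "hat (phi2 w) = sc ((-1) ^ length l) * phi2 w" by (rule pl_part[OF pl])
 qed (auto intro!: phi2_props(2)[OF wc] simp: el_comm el_T)
 from pok_osp_ok[OF gW this] show o: "osp_ok (psi1 w)" and "hat (psi1 w) = sc ((-1) ^ cliff_parity w) * psi1 w"
  by (simp_all add: psi1_def pl_parity[OF pl] minus_one_power_iff)
 have "GG * phi2 w = sc (eps CARD('n) (cliff_parity w)) * (phi2 w * GG)"
  unfolding phi2_pl[OF pl] eps_pl[OF pl] using scaled_comm_bl[of GG, OF GG_cl, of l] S.slc[of GG k]
  by (simp add: m_ass) (simp add: mult.commute)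
 hence "GG * psi1 w = sc (eps CARD('n) (cliff_parity w)) * (psi1 w * GG)"
  unfolding psi1_def using S.slc[of "gr (pin_proj w)"] by (simp add: m_ass GG_comms flip: m_ass[of GG "gr _"]) 
 hence "GG * psi1 w * SS = sc (eps CARD('n) (cliff_parity w)) * (psi1 w * (GG * SS))" by (simp add: m_ass)
 thus "DD * psi1 w = sc (eps CARD('n) (cliff_parity w)) * (psi1 w * DD)"
  unfolding DD_def by (simp add: m_ass osp_ok_SS[OF o])
qed

lemma Phi_rho: assumes "keys a <= carrier PG" shows "\<rho> a : carrier HC" "Phi (\<rho> a) = psi a"
proof -
 have t: "tn (wg (pin_proj w)) w : carrier HC & Phi (tn (wg (pin_proj w)) w) = psi1 w" if "w : keys a" for w
 proof -
  have w: "w : carrier PG" using assms that by blast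
  obtain k l where "pl w k l" using PG_pl[OF w] by blast
  hence "pin_proj w : W" using pl_proj gl_W by (metis pl_def)
  thus ?thesis using PG_closed[OF w] by (simp add: tn_closed Phi(2) phi1(2) phig_def psi1_def)
 qed
 show "\<rho> a : carrier HC" unfolding \<rho>_def by (intro HC.finsum_closed Pi_I HC.smult_closed) (use t in blast)
 have "Phi (\<rho> a) = (SUM w:keys a. Phi (lookup a w \<odot>\<^sub>h tn (wg (pin_proj w)) w))"
  unfolding \<rho>_def by (rule S.ahom_finsum[OF Phi(1) HC.calg_axioms]) (use t in auto)
 also have "... = psi a" unfolding psi_def S.mlin_def
  by (intro sum.cong refl) (use t PhiD(4)[OF _ HC.one_closed] in auto)
 finally show "Phi (\<rho> a) = psi a" .
qed

section \<open>The ideal of the group algebra on which \<theta> is -1, injectivity of rho on it, and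
  a lift of -1\<close>

sublocale PA: calg "pin_alg R"
 unfolding pin_alg_def by (rule PG.calg_monoid_alg)

abbreviation "mi == minus_idem :: 'n cliff \<Rightarrow>\<^sub>0 complex"
abbreviation "MC == carrier (pin_alg_minus R)"

lemma PA_simps: "carrier (pin_alg R) = {a. keys a <= carrier PG}" "mult (pin_alg R) = mmul PG" "add (pin_alg R) = (+)"
 "smult (pin_alg R) = scale" "zero (pin_alg R) = 0"
 by (simp_all add: pin_alg_def monoid_alg_simps)

lemma PM_simps: "mult (pin_alg_minus R) = mmul PG" "add (pin_alg_minus R) = (+)" "smult (pin_alg_minus R) = scale" "one (pin_alg_minus R) = mi"
 "carrier (pin_alg_minus R) = mmul PG mi ` carrier (pin_alg R)"
 by (simp_all add: pin_alg_minus_def PA_simps)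

lemma th_th: "th \<otimes>\<^sub>c th = \<one>\<^sub>c"
 by (simp add: CL.l_minus CL.r_minus)

lemma mi_alt: "mi = single \<one>\<^sub>c (1/2) + single th (-1/2)"
 by (simp add: minus_idem_def single_uminus)

lemma mi_props: "mi : carrier (pin_alg R)" "mmul PG mi mi = mi" "mmul PG (single th 1) mi = - mi" "psi mi = 1"
proof -
 show "mi : carrier (pin_alg R)" unfolding PA_simps mi_alt using keys_plus[of "single \<one>\<^sub>c (1/2)" "carrier PG" "single th (-1/2)"] theta_PG PG_ops(2) by simp
 have 4: "single a (1/4) + single b (-1/4) + (single b (-1/4) + single a (1/4 :: complex)) = single a (1/2) + single b (-1/2)" for a b :: "'n cliff"
  using single_add[of a "1/4" "1/4 :: complex"] single_add[of b "-1/4" "-1/4 :: complex"] by (simp add: ac_simps)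
 show "mmul PG mi mi = mi" unfolding mi_alt using th_th 4[of "\<one>\<^sub>c" th] by (simp add: mmul_add_l mmul_add_r mmul_single PG_simps(1))
 show "mmul PG (single th 1) mi = - mi"
  unfolding mi_alt mmul_add_r mmul_single PG_simps(1) th_th CL.r_one[OF PG_closed[OF theta_PG]] mult_1 by (simp add: single_uminus)
 have "psi mi = sc (1/2) * 1 + sc (-1/2) * (-1)" unfolding psi_def mi_alt S.mlin_add S.mlin_single psi1_one ..
 moreover have "sc (-1/2) * (-1) = (sc (1/2) :: 'n op)" by (simp add: S.sc_minus)
 moreover have "sc (1/2) + sc (1/2) = (1 :: 'n op)" using half_double[of "1 :: 'n op"] unfolding distrib_left by simp
 ultimately show "psi mi = 1" by (simp only: mult_1_right)
qed

lemma MC_iff: "a : MC \<longleftrightarrow> keys a <= carrier PG & mmul PG mi a = a"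
proof
 assume "a : MC"
 then obtain b where b: "b : carrier (pin_alg R)" "a = mmul PG mi b" unfolding PM_simps by blast
 have "mmul PG mi (mmul PG mi b) = mmul PG (mmul PG mi mi) b" using PA.m_assoc[OF mi_props(1) mi_props(1) b(1)] by (simp add: PA_simps)
 moreover have "a : carrier (pin_alg R)" using PA.m_closed[OF mi_props(1) b(1)] b(2) by (simp add: PA_simps)
 ultimately show "keys a <= carrier PG & mmul PG mi a = a" using b(2) mi_props(2) by (simp add: PA_simps)
next
 assume "keys a <= carrier PG & mmul PG mi a = a"
 thus "a : MC" unfolding PM_simps PA_simps by (intro image_eqI[of _ _ a]) auto
qed

lemma MC_sub: "a : MC ==> a : carrier (pin_alg R)"
 by (simp add: MC_iff PA_simps)

lemma MC_ops: "a : MC ==> b : MC ==> mmul PG a b : MC" "a : MC ==> b : MC ==> a + b : MC" "a : MC ==> scale k a : MC" "mi : MC"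
proof -
 show "mmul PG a b : MC" if "a : MC" "b : MC"
  using PA.m_assoc[OF mi_props(1) MC_sub[OF that(1)] MC_sub[OF that(2)]] PA.m_closed[OF MC_sub[OF that(1)] MC_sub[OF that(2)]] that by (simp add: PA_simps MC_iff)
 show "a + b : MC" if "a : MC" "b : MC" using that keys_plus[of a "carrier PG" b] by (simp add: MC_iff mmul_add_r)
 show "scale k a : MC" if "a : MC" using that keys_closed(3)[of a "carrier PG" k] by (simp add: MC_iff mmul_scale)
 show "mi : MC" using mi_props(1,2) by (simp add: MC_iff PA_simps)
qed

lemma psiD: "a : carrier (pin_alg R) ==> b : carrier (pin_alg R) ==> psi (mmul PG a b) = psi a * psi b"
 "psi (a + b) = psi a + psi b" "psi (scale k a) = sc k * psi a"
 using S.ahomD(1)[OF psi_hom, of a b] by (simp_all add: PA_simps psi_def S.mlin_add S.mlin_scale)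

lemma psi_MC: "a : carrier (pin_alg R) ==> mmul PG mi a : MC & psi (mmul PG mi a) = psi a"
 using mi_props by (auto simp: PM_simps psiD)

lemma lookup_th: "w : carrier PG ==> keys a <= carrier PG ==>
 lookup (mmul PG (single th 1) a) (th \<otimes>\<^sub>c w) = lookup a w"
proof -
 assume w: "w : carrier PG" and a: "keys a <= carrier PG"
 have c: "th \<otimes>\<^sub>c k = th \<otimes>\<^sub>c w \<longleftrightarrow> k = w" if "k : carrier PG" for k
  using PG.Units_l_cancel[of th k w] theta_PG that w by (simp add: PG_simps(1))
 show ?thesis using a
  by (induction rule: pm_induct_on) (auto simp: mmul_add_r mmul_single PG_simps(1) lookup_add lookup_single when_def c)
qed

lemma MC_anti: assumes a: "a : MC" and w: "w : carrier PG" shows "lookup a (th \<otimes>\<^sub>c w) = - lookup a w"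
proof -
 have s: "single th 1 : carrier (pin_alg R)" using theta_PG by (simp add: PA_simps)
 have "mmul PG (single th 1) a = mmul PG (single th 1) (mmul PG mi a)" using a by (simp add: MC_iff)
 also have "... = mmul PG (- mi) a" using PA.m_assoc[OF s mi_props(1) MC_sub[OF a]] by (simp add: PA_simps mi_props(3))
 also have "- mi = scale (-1) mi" by (rule poly_mapping_eqI) simp
 also have "mmul PG (scale (-1) mi) a = scale (-1) a" using a by (simp add: mmul_scale MC_iff)
 finally have "lookup a w = lookup (scale (-1) a) (th \<otimes>\<^sub>c w)"
  using lookup_th[OF w, of a] a by (simp add: MC_iff)
 thus ?thesis by simp
qed

text \<open>Elements over different g land in different components. The fibre over g is {w, \<theta>
  w}, and its two contributions coincide, as coefficient and image both change sign; a nonzero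
  coefficient would make the invertible \<open>psi1 w\<close> kill the vacuum.\<close>

lemma psi_inj0: assumes a: "a : MC" and 0: "psi a = 0" shows "a = 0"
proof (rule poly_mapping_eqI, rule ccontr)
 fix w assume nz: "lookup a w ~= lookup 0 w"
 have k: "keys a <= carrier PG" using a by (simp add: MC_iff)
 have wk: "w : keys a" using nz by (simp add: in_keys_iff)
 hence w: "w : carrier PG" using k by blast
 let ?w' = "th \<otimes>\<^sub>c w" and ?l = "lookup a w"
 have l': "lookup a ?w' = - ?l" by (rule MC_anti[OF a w])
 hence w'k: "?w' : keys a" and ne: "?w' ~= w" using nz by (auto simp: in_keys_iff)
 have p': "psi1 ?w' = - psi1 w" using psi1_mult[OF theta_PG w] psi1_one by simp
 have z: "lk (app (psi1 v) vac) h S = 0" if "v : carrier PG" "h ~= pin_proj v" for v h S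
  unfolding psi1_def by (rule phi2_vac(3)[OF PG_closed[OF that(1)] that(2)])
 have "lk (app (psi1 w) vac) (pin_proj w) S = 0" for S
 proof -
  let ?f = "%v. pconst (lookup a v) * lk (app (psi1 v) vac) (pin_proj w) S"
  have "0 = lk (app (psi a) vac) (pin_proj w) S" by (simp add: 0)
  also have "... = (SUM v:keys a. ?f v)" unfolding psi_def S.mlin_def by (simp add: lk_simps)
  also have "... = (SUM v:{w, ?w'}. ?f v)"
  proof (rule sum.mono_neutral_right)
   show "ALL v:keys a - {w, ?w'}. ?f v = 0"
   proof
    fix v assume v: "v : keys a - {w, ?w'}"
    hence "v : carrier PG" "pin_proj w ~= pin_proj v" using k pin_fiber[OF w] by blast+
    thus "?f v = 0" using z by simp
   qed
  qed (use wk w'k in auto)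
  also have "... = ?f w + ?f ?w'" using ne by simp
  also have "?f ?w' = ?f w" by (simp add: l' p' lk_simps)
  finally have "pconst (1 + 1) * ?f w = 0" by (simp only: pconst_simps(2,3) distrib_right mult_1)
  hence "?f w = 0" by (rule pconst_cancel) simp
  thus ?thesis by (rule pconst_cancel) (use nz in simp)
 qed
 hence "lk (app (psi1 w) vac) h S = 0" for h S using z[OF w] by (cases "h = pin_proj w") auto
 hence "app (psi1 w) vac = 0" by (intro poly_mapping_eqI) auto
 hence "app (psi1 (inv\<^bsub>PG\<^esub> w) * psi1 w) vac = 0" by simp
 thus False using psi1_inv[OF w] vac_nz by simp
qed

lemma psi_inj: "a : MC ==> b : MC ==> psi a = psi b ==> a = b"
proof -
 assume a: "a : MC" "b : MC" "psi a = psi b"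
 have "a + scale (-1) b = 0" by (rule psi_inj0) (use a in \<open>simp_all add: MC_ops psiD S.sc_minus\<close>)
 hence "a = - scale (-1) b" by (simp add: eq_neg_iff_add_eq_0)
 also have "... = b" by (rule poly_mapping_eqI) simp
 finally show "a = b" .
qed

text \<open>Every term of \<open>AA\<close> contains either one x and one y or an even number of
  Clifford vectors, so the signs \<tau> and \<sigma> cancel in pairs.\<close>

lemma comm_AA:
 assumes X: "!!u. N * Xo u = sc \<tau> * (Xo u * N)" "!!u. N * T u = sc \<tau> * (T u * N)" and C: "!!v. N * cl v = sc \<sigma> * (cl v * N)"
  and g: "!!al. al : R ==> N * gr (root_refl al) = gr (root_refl al) * N" and s: "\<tau> * \<tau> = 1" "\<sigma> * \<sigma> = 1"
 shows "N * AA u v = AA u v * N"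
proof -
 have k: "N * (sc k * a) = sc \<sigma> * (sc k * a * N)" if "N * a = sc \<sigma> * (a * N)" for k a
  using S.slc[of N k] that by (simp add: m_ass) (simp add: mult.commute)
 have E: "N * EE w = sc \<sigma> * (EE w * N)" for w
 proof -
  have "N * (gr (root_refl al) * cl v) = sc \<sigma> * (gr (root_refl al) * cl v * N)" if "al : R" for al v
  proof -
   have "N * (gr (root_refl al) * cl v) = gr (root_refl al) * (N * cl v)" by (simp only: m_ass[symmetric] g[OF that])
   thus ?thesis unfolding C using S.slc[of "gr (root_refl al)"] by (simp add: m_ass)
  qed
  hence "N * (sc j * (gr (root_refl al) * cl v)) = sc \<sigma> * (sc j * (gr (root_refl al) * cl v) * N)" if "al : R" for j al v
   using that k by blast
  thus ?thesis unfolding EE_def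
   by (simp only: diff_dists sum_dists k[OF C] cong: sum.cong)
 qed
 have 2: "N * (a * b) = a * b * N" if "N * a = sc k * (a * N)" "N * b = sc k * (b * N)" "k * k = 1" for a b k
 proof -
  have "N * (a * b) = sc k * (a * (N * b))" by (simp only: m_ass[symmetric] that(1))
  also have "... = sc (k * k) * (a * b * N)" unfolding that(2) using S.slc[of a k] by (simp add: m_ass)
  finally show ?thesis by (simp add: that(3))
 qed
 have "N * (sc k * a) = sc k * a * N" if "N * a = a * N" for k a
  using S.slc[of N k] that by (simp add: m_ass)
 note k1 = this
 have "N * (cl u * EE v + EE u * cl v - sc t * (cl u * cl v)) = (cl u * EE v + EE u * cl v - sc t * (cl u * cl v)) * N"
  by (simp only: add_dists diff_dists 2[OF C E s(2)] 2[OF E C s(2)] k1[OF 2[OF C C s(2)]])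
 from k1[OF this] show ?thesis unfolding AA_def
  by (simp only: distrib_left[of N] distrib_right[of _ _ N] left_diff_distrib[of _ _ N] right_diff_distrib[of N] 2[OF X(1) X(2) s(1)] 2[OF X(2) X(1) s(1)])
qed

lemma matrix_minus_one: "(w :: real^'n^'n) ** - mat 1 = - w" "- mat 1 ** w = - w"
proof -
 have "w ** - mat 1 = - (w ** mat 1)" "- mat 1 ** w = - (mat 1 ** w)" by (simp_all add: matrix_matrix_mult_def vec_eq_iff sum_negf)
 thus "w ** - mat 1 = - w" "- mat 1 ** w = - w" by simp_all
qed

lemma cmat_minus_one: "cmat (- mat 1 :: real^'n^'n) *v v = - v"
proof -
 have "cmat (- mat 1 :: real^'n^'n) = - mat 1" by (simp add: cmat_def mat_def vec_eq_iff)
 hence "cmat (- mat 1 :: real^'n^'n) *v v = - (mat 1 *v v)" by (simp add: matrix_vector_mult_def vec_eq_iff sum_negf)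
 thus ?thesis by simp
qed

text \<open>The Clifford part of a lift of -1 sends the vacuum to components at e_1 ... e_d only, so
  the word in the roots has length congruent to d modulo 2. Its signs with Clifford vectors are
  therefore those of \<Gamma>, which gives the sign \<epsilon> against the double cover, and the
  lift is even for even d.\<close>

lemma lift_minus_one:
 assumes m: "- mat 1 : W"
 obtains w r \<nu> where "w : carrier PG" "flipper (psi1 w) \<nu> r" "eps CARD('n) (cliff_parity w) = 1"
  "!!v. v : carrier PG ==> psi1 w * psi1 v = sc (eps CARD('n) (cliff_parity v)) * (psi1 v * psi1 w)"
  "even CARD('n) ==> hat (psi1 w) = psi1 w"
proof -
 obtain l where l: "set l <= R" "gl l = - mat 1" using W_gl[OF m] by metis
 let ?w = "gq l" and ?s = "(-1) ^ length l :: complex" and ?\<sigma> = "(-1) ^ (CARD('n) - 1) :: complex"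
 have pl: "pl ?w 1 l" using l by (simp add: pl_def)
 have w: "?w : carrier PG" by (rule gq_PG[OF l(1)])
 have psi: "psi1 ?w = gr (- mat 1) * bl l" by (simp add: psi1_def pl_proj[OF pl] l(2) phi2_gq)
 have rel: "bl l * cl v = sc (- ?s) * (cl v * bl l)" for v
  using bl_rel[OF l(1), of v] by (simp add: l(2) cmat_minus_one cl_lin S.sc_minus)
 have ss: "?s * ?s = 1" by (simp flip: power_mult_distrib)
 have "app (bl l) vac ~= 0"
 proof
  assume "app (bl l) vac = 0"
  hence "app (bl (rev l) * bl l) vac = 0" by simp
  thus False using bl_inv(2)[OF l(1)] vac_nz by simp
 qed
 then obtain u S where nz: "lk (app (bl l) vac) u S ~= 0" by (metis lookup_zero poly_mapping_eqI surj_pair)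
 have e: "bl l * el p = sc (-1 * ?s) * (el p * bl l)" if "p : {1..CARD('n)}" for p using rel[of "cvec (y p)"] that by (simp add: cl_y)
 have "S <= {1..CARD('n)}" using Alg_suppW[OF bl_Alg suppW_vac] nz by (auto simp: suppW_def)
 moreover have "p : S" if "p : {1..CARD('n)}" for p
  using supp_scalar(2)[OF bl_Alg hat_bl[OF l(1)] e ss _ nz that] by simp
 ultimately have S: "S = {1..CARD('n)}" by blast
 have sd: "?s = (-1) ^ CARD('n)"
  using supp_scalar(1)[OF bl_Alg hat_bl[OF l(1)] e ss _ nz] by (simp add: S sg_def)
 obtain d where d: "CARD('n) = Suc d" using card3 by (cases "CARD('n)") auto
 have \<sigma>: "- ?s = ?\<sigma>" unfolding sd d by simp
 note rel = rel[unfolded \<sigma>]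
 have ep: "eps CARD('n) (cliff_parity ?w) = 1"
  using sd unfolding eps_pl[OF pl] by (cases "even CARD('n)") (auto simp: minus_one_power_iff split: if_splits)
 have B: "bl l * gr g = gr g * bl l" "bl l * Xo v = Xo v * bl l" "bl l * T v = T v * bl l" for g v
  using phi2_props(2)[OF gq_closed[of l]] by (auto simp: phi2_gq el_comm el_T)
 have om: "orthogonal_matrix (- mat 1 :: real^'n^'n)" by (rule W_orth[OF m])
 have nX: "psi1 ?w * Xo v = sc (-1) * (Xo v * psi1 ?w)" "psi1 ?w * T v = sc (-1) * (T v * psi1 ?w)" for v
 proof -
  have "psi1 ?w * Xo v = gr (- mat 1) * Xo v * bl l" "psi1 ?w * T v = gr (- mat 1) * T v * bl l" by (simp_all add: psi B m_ass)
  thus "psi1 ?w * Xo v = sc (-1) * (Xo v * psi1 ?w)" "psi1 ?w * T v = sc (-1) * (T v * psi1 ?w)"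
   using T_lin(2)[of "-1" v] by (simp_all add: gr_Xo[OF om] gr_T[OF m] cmat_minus_one Xo_lin psi m_ass S.sc_minus)
 qed
 have nC: "psi1 ?w * cl v = sc ?\<sigma> * (cl v * psi1 ?w)" for v
 proof -
  have "psi1 ?w * cl v = gr (- mat 1) * (sc ?\<sigma> * (cl v * bl l))" by (simp add: psi rel m_ass)
  also have "... = sc ?\<sigma> * (gr (- mat 1) * cl v * bl l)" using S.slc[of "gr (- mat 1)"] by (simp add: m_ass)
  finally show ?thesis by (simp add: psi cl_comm(3)[symmetric] m_ass)
 qed
 have ng: "psi1 ?w * gr g = gr g * psi1 ?w" for g
 proof -
  have "psi1 ?w * gr g = gr (- mat 1) * gr g * bl l" by (simp add: psi B m_ass)
  also have "gr (- mat 1) * gr g = gr g * gr (- mat 1)" by (simp add: gr_gr matrix_minus_one)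
  finally show ?thesis by (simp add: psi m_ass)
 qed
 have "?\<sigma> * ?\<sigma> = 1" by (simp flip: power_mult_distrib)
 hence ZZ: "ZZ (psi1 ?w)" using comm_AA[of "psi1 ?w" "-1" ?\<sigma>, OF nX nC ng] psi1_props[OF w] by (simp add: ZZ_def)
 have "?w \<otimes>\<^sub>c ?w = \<one>\<^sub>c \<or> ?w \<otimes>\<^sub>c ?w = th"
  by (rule pin_kernel) (simp_all add: PG_ops w pin_proj_mult[OF w w] pl_proj[OF pl] l(2) matrix_minus_one)
 hence "psi1 ?w * psi1 ?w = 1 \<or> psi1 ?w * psi1 ?w = - 1" using psi1_mult[OF w w] psi1_one by metis
 hence "psi1 ?w * psi1 ?w = sc 1 \<or> psi1 ?w * psi1 ?w = sc (-1)" by (simp add: S.sc_minus)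
 hence "\<exists>\<nu>. psi1 ?w * psi1 ?w = sc \<nu> & \<nu> ~= 0" by (metis neg_equal_0_iff_equal zero_neq_one)
 then obtain \<nu> where \<nu>: "psi1 ?w * psi1 ?w = sc \<nu>" "\<nu> ~= 0" by blast
 define r where "r = rbl (rev l) * rg (- mat 1)"
 have rt: "rt (psi1 ?w) r" unfolding psi r_def using rt_mult[OF rt_basic(3)[OF m] rt_bl[of "rev l"]] by simp
 have Hr: "Ho j * rbl k = rbl k * Ho j" for j k
 proof (induction k)
  case (Cons a k)
  have "Ho j * rbl (a # k) = rcl (nn a) * (Ho j * rbl k)" by (simp add: m_ass[symmetric] Ho_EE(2))
  thus ?case by (simp add: Cons m_ass)
 qed simp
 have Ho: "Ho j * r = r * Ho j" for j
 proof -
  have "Ho j * r = rbl (rev l) * (Ho j * rg (- mat 1))" by (simp only: r_def m_ass[symmetric] Hr)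
  also have "Ho j * rg (- mat 1) = rg (- mat 1) * Ho j" by (simp add: Ho_shift)
  finally show ?thesis by (simp add: r_def m_ass)
 qed
 have flip: "lk (app r F) u S = 0" if "!!S. lk F (- u) S = 0" for F u S
 proof -
  have z: "lk (app (rbl k) G) u S = 0" if "!!S. lk G u S = 0" for k G S
   by (induction k arbitrary: S) (simp_all add: that lk_cl(2))
  have "lk (app (rg (- mat 1)) F) u S = lk F (- u) S" for S
   unfolding rg_def using lookup_mop[of "%_ p. p" "%k. (fst k ** - mat 1, snd k)" "%k. (fst k ** - mat 1, snd k)" F "(u, S)"]
   by (simp add: matrix_minus_one)
  thus ?thesis unfolding r_def using z[of "app (rg (- mat 1)) F"] that by simp
 qed
 have fl: "flipper (psi1 ?w) \<nu> r" unfolding flipper_def using ZZ \<nu> rt Ho flip by blast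
 have comm: "psi1 ?w * psi1 v = sc (eps CARD('n) (cliff_parity v)) * (psi1 v * psi1 ?w)" if v: "v : carrier PG" for v
 proof -
  obtain k' l' where pl': "pl v k' l'" using PG_pl[OF v] by blast
  have "psi1 ?w * bl l' = sc (?\<sigma> ^ length l') * (bl l' * psi1 ?w)" by (rule scaled_comm_bl[OF nC])
  hence b: "psi1 ?w * phi2 v = sc (?\<sigma> ^ length l') * (phi2 v * psi1 ?w)"
   unfolding phi2_pl[OF pl'] using S.slc[of "psi1 ?w" k'] by (simp add: m_ass) (simp add: mult.commute)
  have "psi1 ?w * psi1 v = gr (pin_proj v) * (psi1 ?w * phi2 v)" by (simp only: psi1_def[of v] m_ass[symmetric] ng)
  thus ?thesis unfolding b eps_pl[OF pl'] psi1_def[of v] using S.slc[of "gr (pin_proj v)"] by (simp add: m_ass)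
 qed
 have "hat (psi1 ?w) = psi1 ?w" if "even CARD('n)"
  using ep that psi1_props(3)[OF w] by (auto simp: eps_def)
 from that[OF w fl ep comm this] show ?thesis .
qed

section \<open>Commutation of admissible elements with D\<close>

subsection \<open>Admissible elements\<close>

lemma cliff_parity_th: "w : carrier PG ==> cliff_parity (th \<otimes>\<^sub>c w) = cliff_parity w"
proof -
 assume "w : carrier PG"
 then obtain k l where pl: "pl w k l" using PG_pl by blast
 show ?thesis using pl_parity[OF pl] pl_parity[OF pl_mult[OF theta_pl pl]] by simp
qed

text \<open>The condition concerns homogeneous elements of the ideal. It is applied to (w - \<theta>
  w)/2, which is homogeneous since w and \<theta> w have the same parity, and whose image is that of
  w.\<close>

lemma eps_central_psi1:
 assumes a: "eps_central R a" and w: "w : carrier PG"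
 shows "psi a * psi1 w = sc (eps CARD('n) (cliff_parity w)) * (psi1 w * psi a)"
proof -
 let ?b = "mmul PG mi (single w 1)"
 have sw: "single w 1 : carrier (pin_alg R)" using w by (simp add: PA_simps)
 note b = psi_MC[OF sw]
 have be: "?b = single w (1/2) + single (th \<otimes>\<^sub>c w) (-1/2)"
  using w by (simp add: mi_alt mmul_add_l mmul_single PG_simps(1) PG_closed)
 have "cliff_parity v = cliff_parity w" if "v : keys ?b" for v
  using that keys_add[of "single w (1/2 :: complex)" "single (th \<otimes>\<^sub>c w) (-1/2)"] cliff_parity_th[OF w] unfolding be by auto
 hence "?b : pin_minus_part R (cliff_parity w)" using b by (simp add: pin_minus_part_def)
 moreover have "cliff_parity w : {0, 1}" by (simp add: cliff_parity_def)
 ultimately have "mmul PG a ?b = scale (eps CARD('n) (cliff_parity w)) (mmul PG ?b a)" and ac: "a : MC"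
  using a unfolding eps_central_def PM_simps(1-3) by blast+
 from arg_cong[OF this(1), of psi] have "psi a * psi ?b = sc (eps CARD('n) (cliff_parity w)) * (psi ?b * psi a)"
  using MC_sub[OF ac] MC_sub b by (simp add: psiD)
 moreover have "psi ?b = psi1 w" using b by (simp add: psi_def)
 ultimately show ?thesis by simp
qed

lemma mmul_at_one:
 assumes "keys f <= carrier PG" "keys g <= carrier PG"
 shows "lookup (mmul PG f g) \<one>\<^sub>c = (SUM a:keys f. lookup f a * lookup g (inv\<^bsub>PG\<^esub> a))"
proof -
 have "lookup (mmul PG f g) \<one>\<^sub>c
   = (SUM a:keys f. SUM b:keys g. if b = inv\<^bsub>PG\<^esub> a then lookup f a * lookup g b else 0)"
 proof -
  have "a \<otimes>\<^bsub>PG\<^esub> b = \<one>\<^sub>c \<longleftrightarrow> b = inv\<^bsub>PG\<^esub> a" if "a : keys f" "b : keys g" for a b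
  proof -
   have ab: "a : carrier PG" "b : carrier PG" using that assms by auto
   show ?thesis using PG.inv_equality[of b a] PG.inv_equality[of a b] PG.r_inv[OF ab(1)] PG.inv_comm[of a b] ab by (metis PG_simps(2))
  qed
  thus ?thesis unfolding mmul_def by (simp add: lookup_sum lookup_single when_def cong: sum.cong if_cong)
 qed
 also have "... = (SUM a:keys f. lookup f a * lookup g (inv\<^bsub>PG\<^esub> a))"
  by (intro sum.cong refl) (auto simp: sum.delta in_keys_iff)
 finally show ?thesis .
qed

text \<open>Applied to \<omega> itself, \<epsilon>-centrality says that its square is the negative
  of itself. For odd \<omega> fixed by the anti-involution, the coefficient of this square at 1 is
  minus the sum of the squared moduli of the coefficients, so all of them vanish.\<close>

lemma odd_admissible_0:
 assumes ad: "eps_central R \<omega>" "bullet \<omega> = \<omega>" and o: "\<omega> : pin_minus_part R 1" and d: "even CARD('n)" shows "\<omega> = 0"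
proof -
 have mc: "\<omega> : MC" and p1: "!!w. w : keys \<omega> ==> cliff_parity w = 1" using o by (auto simp: pin_minus_part_def)
 have k: "keys \<omega> <= carrier PG" using mc by (simp add: MC_iff)
 have "mmul PG \<omega> \<omega> = scale (eps CARD('n) 1) (mmul PG \<omega> \<omega>)" using ad(1) o unfolding eps_central_def PM_simps(1-3) by blast
 from arg_cong[OF this, of "%f. lookup f \<one>\<^sub>c"] have 0: "lookup (mmul PG \<omega> \<omega>) \<one>\<^sub>c = 0"
  using d by (simp add: eps_def eq_neg_iff_add_eq_0)
 have inv: "inv\<^bsub>cliff\<^esub> w = inv\<^bsub>PG\<^esub> w" if w: "w : carrier PG" for w
  using CL.inv_char[of w "inv\<^bsub>PG\<^esub> w"] PG_ops w PG_closed by metis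
 have bl: "lookup \<omega> (inv\<^bsub>PG\<^esub> w) = - cnj (lookup \<omega> w)" if w: "w : keys \<omega>" for w
 proof -
  have e: "inv\<^bsub>cliff\<^esub> v = inv\<^bsub>PG\<^esub> w \<longleftrightarrow> v = w" if "v : keys \<omega>" for v
  proof -
   have c: "v : carrier PG" "w : carrier PG" using k w that by auto
   show ?thesis unfolding inv[OF c(1)] using PG.inv_inv[OF c(1)] PG.inv_inv[OF c(2)] by metis
  qed
  have "lookup (bullet \<omega>) (inv\<^bsub>PG\<^esub> w) = (SUM v:keys \<omega>. if v = w then - cnj (lookup \<omega> v) else 0)"
   unfolding bullet_def using e p1 by (simp add: lookup_sum lookup_single when_def cong: sum.cong if_cong)
  thus ?thesis using w by (simp add: ad(2) sum.delta)
 qed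
 have "(SUM w:keys \<omega>. complex_of_real ((cmod (lookup \<omega> w))\<^sup>2)) = - (SUM w:keys \<omega>. lookup \<omega> w * lookup \<omega> (inv\<^bsub>PG\<^esub> w))"
  unfolding sum_negf[symmetric] by (intro sum.cong refl) (simp only: bl complex_norm_square mult_minus_right minus_minus)
 also have "... = 0" using mmul_at_one[OF k k] 0 by simp
 finally have "(SUM w:keys \<omega>. (cmod (lookup \<omega> w))\<^sup>2) = 0" by (simp only: of_real_sum[symmetric] of_real_eq_0_iff)
 hence "ALL w:keys \<omega>. (cmod (lookup \<omega> w))\<^sup>2 = 0" by (subst (asm) sum_nonneg_eq_0_iff) auto
 thus ?thesis by (intro poly_mapping_eqI) (auto simp: in_keys_iff)
qed

text \<open>\<epsilon> is 1 on every group element occurring in \<omega>, except for even d and odd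
  \<omega>, where \<omega> = 0.\<close>

lemma DD_admissible: assumes "admissible R \<omega>" shows "DD * psi \<omega> = psi \<omega> * DD"
proof -
 obtain i where i: "i = 0 \<or> i = 1" "\<omega> : pin_minus_part R i" and ad: "eps_central R \<omega>" "bullet \<omega> = \<omega>"
  using assms by (auto simp: admissible_def)
 show ?thesis
 proof (cases "even CARD('n) & i = 1")
  case True
  hence "\<omega> = 0" using odd_admissible_0 ad i by blast
  thus ?thesis by (simp add: psi_def)
 next
  case False
  have "DD * psi1 w = psi1 w * DD" if w: "w : keys \<omega>" for w
  proof -
   have "w : carrier PG" "cliff_parity w = i" using w i(2) by (auto simp: pin_minus_part_def MC_iff)
   thus ?thesis using psi1_props(4)[of w] False i(1) by (auto simp: eps_def)
  qed
  thus ?thesis unfolding psi_def S.mlin_def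
   using S.slc[of DD] by (simp add: sum_dists m_ass cong: sum.cong)
 qed
qed

end

section \<open>Construction of zeta and the decomposition of central elements\<close>

section \<open>The homomorphism\<close>

context dunkl
begin

definition ev :: "'n op => 'n op => complex poly \<times> complex poly => 'n op" where
 "ev n a pq = pe (fst pq) a + pe (snd pq) a * n"

text \<open>The product of pairs does not involve \<open>a\<close>. The same formula thus holds at D
  and at -\<omega>, which makes the substitution multiplicative.\<close>

lemma ev_mult:
 assumes "a * n = n * a" "n * n = sc \<nu>"
 shows "ev n a (p, q) * ev n a (p', q') = ev n a (p * p' + Polynomial.smult \<nu> (q * q'), p * q' + q * p')"
proof -
 have c: "n * pe p a = pe p a * n" for p using pe_comm[OF assms(1)] by simp
 have "pe q a * n * (pe q' a * n) = pe q a * pe q' a * (n * n)" by (simp add: m_ass c flip: m_ass[of n "pe _ _"])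
 also have "... = sc \<nu> * (pe q a * pe q' a)" by (simp add: assms(2) S.sc_comm)
 finally have 1: "pe q a * n * (pe q' a * n) = sc \<nu> * (pe q a * pe q' a)" .
 have 2: "pe q a * n * pe p' a = pe q a * pe p' a * n" by (simp add: m_ass c)
 have 3: "pe p a * (pe q' a * n) = pe p a * pe q' a * n" by (simp add: m_ass)
 show ?thesis
  unfolding ev_def by (simp only: fst_conv snd_conv pe_add pe_mult pe_smult add_dists 1 2 3) (simp add: add_ac)
qed

lemma ev_lin: "ev n a (p, q) + ev n a (p', q') = ev n a (p + p', q + q')"
 "sc k * ev n a (p, q) = ev n a (Polynomial.smult k p, Polynomial.smult k q)" "ev n a (1, 0) = 1"
 using pe_pCons[of 1 0 a] by (simp_all add: ev_def pe_add pe_smult add_dists m_ass one_pCons)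

text \<open>Without a lift of \<open>-1\<close> the element \<open>n\<close> is taken to be \<open>0\<close>.\<close>

lemma lift_data:
 "\<exists>n \<nu>. n * n = sc \<nu> & (- mat 1 : W --> (\<exists>\<nu> r. flipper n \<nu> r))
  & (ALL v:carrier PG. n * psi1 v = sc (eps CARD('n) (cliff_parity v)) * (psi1 v * n))
  & (n = 0 \<or> (EX w:carrier PG. n = psi1 w & eps CARD('n) (cliff_parity w) = 1)) & (even CARD('n) --> hat n = n)"
proof (cases "- mat 1 : W")
 case True
 show ?thesis
 proof (rule lift_minus_one[OF True])
  fix w r \<nu>
  assume w: "w : carrier PG" "flipper (psi1 w) \<nu> r" "eps CARD('n) (cliff_parity w) = 1"
   "!!v. v : carrier PG ==> psi1 w * psi1 v = sc (eps CARD('n) (cliff_parity v)) * (psi1 v * psi1 w)"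
   "even CARD('n) ==> hat (psi1 w) = psi1 w"
  show ?thesis
   by (rule exI[of _ "psi1 w"], rule exI[of _ \<nu>], intro conjI impI ballI exI[of _ \<nu>] exI[of _ r] disjI2 bexI[of _ w] flipperD(2)[OF w(2)] w refl)
 qed
next
 case False
 thus ?thesis by - (rule exI[of _ 0], rule exI[of _ 0], simp)
qed

lemma psi1_in: "w : carrier PG ==> EX a:MC. psi a = psi1 w"
 using psi_MC[of "single w 1"] by (intro bexI[of _ "mmul PG mi (single w 1)"]) (simp_all add: PA_simps psi_def)

lemma psi_range:
 "EX a:MC. psi a = sc k" "EX a:MC. psi a = x ==> EX a:MC. psi a = x' ==> EX a:MC. psi a = x * x'"
 "EX a:MC. psi a = x ==> EX a:MC. psi a = x' ==> EX a:MC. psi a = x + x'"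
proof -
 show "EX a:MC. psi a = sc k" by (rule bexI[of _ "scale k mi"]) (simp_all add: MC_ops psiD mi_props(4))
 assume "EX a:MC. psi a = x" "EX a:MC. psi a = x'"
 then obtain a b where ab: "a : MC" "psi a = x" "b : MC" "psi b = x'" by blast
 show "EX a:MC. psi a = x * x'" by (rule bexI[of _ "mmul PG a b"]) (simp_all add: ab MC_ops psiD MC_sub)
 show "EX a:MC. psi a = x + x'" by (rule bexI[of _ "a + b"]) (simp_all add: ab MC_ops psiD)
qed

lemma pe_range: "EX a:MC. psi a = x ==> EX a:MC. psi a = pe p x"
 by (induction p) (use psi_range(1)[of 0] in \<open>simp_all add: pe_pCons psi_range\<close>)

lemma psi_tama: "a : carrier (pin_alg R) ==> psi a : Alg" "a : carrier (pin_alg R) ==> osp_ok (psi a)"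
proof -
 assume "a : carrier (pin_alg R)"
 hence "keys a <= carrier PG" by (simp add: PA_simps)
 hence "psi a : Alg & osp_ok (psi a)" unfolding psi_def
  by (induction rule: pm_induct_on)
   (use psi1_props in \<open>auto simp: S.mlin_add intro!: Alg.intros Alg_simps osp_ok_add osp_ok_mult osp_ok_sc osp_ok_0_1\<close>)
 thus "psi a : Alg" "osp_ok (psi a)" by auto
qed

lemma rho_psi1: "w : carrier PG ==> EX X:tama. Phi X = psi1 w"
 using Alg_Phi[OF psi1_props(1)] psi1_props(2) tama_iff by metis

text \<open>Conjugation by \<open>\<psi>\<close> replaces \<open>a\<close> by \<open>s a\<close>.\<close>

lemma pe_twist: "a * x = sc s * (x * a) ==> pe p a * x = x * pe p (sc s * a)"
proof (induction p)
 case (pCons k p)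
 have "a * pe p a * x = a * (x * pe p (sc s * a))" using pCons by (simp add: m_ass)
 also have "... = sc s * (x * a) * pe p (sc s * a)" by (simp add: m_ass[symmetric] pCons.prems)
 also have "... = x * (sc s * a * pe p (sc s * a))" using S.slc[of x s] by (simp add: m_ass)
 finally show ?case by (simp add: pe_pCons add_dists S.sc_comm[of x])
qed simp

theorem graded_center_hom:
 assumes ad: "admissible R \<omega>"
 shows "\<exists>\<zeta> \<in> alg_hom (HC\<lparr>carrier := tama_center\<rparr>) ((pin_alg_minus R)\<lparr>carrier := ungraded_center (pin_alg_minus R)\<rparr>).
  \<forall>z \<in> tama_center. \<exists>a \<in> tama. z = \<rho> (\<zeta> z) \<oplus>\<^sub>h (Dirac_deformed \<omega> \<otimes>\<^sub>h a \<oplus>\<^sub>h a \<otimes>\<^sub>h Dirac_deformed \<omega>)"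
proof -
 define om where "om = psi \<omega>"
 have ec: "eps_central R \<omega>" using ad by (simp add: admissible_def)
 hence om_mc: "\<omega> : MC" by (simp add: eps_central_def)
 have om1: "om * psi1 w = sc (eps CARD('n) (cliff_parity w)) * (psi1 w * om)" if "w : carrier PG" for w
  unfolding om_def by (rule eps_central_psi1[OF ec that])
 have Dom: "DD * om = om * DD" unfolding om_def by (rule DD_admissible[OF ad])
 have omA: "om : Alg" "osp_ok om" unfolding om_def using psi_tama[OF MC_sub[OF om_mc]] by auto
 obtain n \<nu> where nd: "n * n = sc \<nu> & (- mat 1 : W --> (\<exists>\<nu> r. flipper n \<nu> r))
  & (ALL v:carrier PG. n * psi1 v = sc (eps CARD('n) (cliff_parity v)) * (psi1 v * n))
  & (n = 0 \<or> (EX w:carrier PG. n = psi1 w & eps CARD('n) (cliff_parity w) = 1)) & (even CARD('n) --> hat n = n)"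
  using lift_data by (elim exE) (rule that)
 hence n: "n * n = sc \<nu>" "- mat 1 : W ==> \<exists>\<nu> r. flipper n \<nu> r"
  "!!v. v : carrier PG ==> n * psi1 v = sc (eps CARD('n) (cliff_parity v)) * (psi1 v * n)"
  "n = 0 \<or> (EX w:carrier PG. n = psi1 w & eps CARD('n) (cliff_parity w) = 1)" "even CARD('n) ==> hat n = n"
  by simp_all
 from n(2) have "\<exists>\<nu> r. - mat 1 : W --> flipper n \<nu> r" by blast
 then obtain \<nu>' r where "- mat 1 : W --> flipper n \<nu>' r" by blast
 hence fl: "- mat 1 : W ==> flipper n \<nu>' r" by blast
 have nD: "DD * n = n * DD" and no: "om * n = n * om" and nA: "n : Alg" "osp_ok n"
 proof -
  have "DD * n = n * DD & om * n = n * om & n : Alg & osp_ok n" using n(4)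
  proof
   assume "n = 0"
   thus ?thesis by (simp add: Alg_simps osp_ok_0_1)
  next
   assume "EX w:carrier PG. n = psi1 w & eps CARD('n) (cliff_parity w) = 1"
   then obtain w where w: "w : carrier PG" "n = psi1 w" "eps CARD('n) (cliff_parity w) = 1" by blast
   show ?thesis using psi1_props[OF w(1)] om1[OF w(1)] by (simp add: w(2,3))
  qed
  thus "DD * n = n * DD" "om * n = n * om" "n : Alg" "osp_ok n" by simp_all
 qed
 have n_in: "EX a:MC. psi a = n" using n(4) psi1_in psi_range(1)[of 0] by auto
 have DA: "DD : Alg" "osp_ok DD" using DD_Alg osp_ok_DD by auto
 let ?m = "- om" and ?E = "ev n"
 have mn: "?m * n = n * ?m" using no by simp
 have pcA: "pe p DD : Alg" for p using ZZ_pe by (simp add: ZZ_def)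
 have evA: "?E DD (p, q) : Alg" for p q unfolding ev_def by (simp add: Alg.add Alg.mult pcA nA)
 \<comment> \<open>Requiring q = 0 when -1 is not in W makes the pair unique, so that it may be
   evaluated at -\<omega> instead of D.\<close>
 define good where "good x pq \<longleftrightarrow> (- mat 1 \<notin> W --> snd pq = 0) & x = ?E DD pq" for x pq
 have uniq: "pq = pq'" if "good x pq" "good x pq'" for x pq pq'
 proof -
  obtain p q p' q' where e: "pq = (p, q)" "pq' = (p', q')" by (cases pq, cases pq')
  have "?E DD (p, q) + sc (-1) * ?E DD (p', q') = 0" using that by (simp add: good_def e S.sc_minus)
  hence 0: "app (pe (p + Polynomial.smult (-1) p') DD + pe (q + Polynomial.smult (-1) q') DD * n) vac = 0"
   unfolding ev_lin by (simp add: ev_def)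
  have "p + Polynomial.smult (-1) p' = 0" "q + Polynomial.smult (-1) q' = 0"
   using decompose_unique[OF fl _ 0] that by (auto simp: good_def e)
  thus ?thesis by (simp add: e)
 qed
 have ex: "\<exists>pq. good (Phi z) pq" if z: "z : tama_center" for z
 proof -
  have "zdec n (Phi z)" using decompose[OF fl tama_center_ZZ(2)[OF z]] .
  then obtain p q where pq: "- mat 1 \<notin> W --> q = 0" "app (Phi z - (pe p DD + pe q DD * n)) vac = 0" unfolding zdec_def by blast
  have "Phi z = ?E DD (p, q)"
   by (rule Alg_eq) (use pq(2) evA Phi_Alg[OF tama_center_ZZ(1)[OF z]] in \<open>simp_all add: ev_def\<close>)
  thus ?thesis using pq(1) by (intro exI[of _ "(p, q)"]) (simp add: good_def)
 qed
 define pq where "pq z = (THE pq. good (Phi z) pq)" for z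
 have pqI: "pq z = x" if "good (Phi z) x" for z x
  unfolding pq_def using that uniq by blast
 have pq: "good (Phi z) (pq z)" if "z : tama_center" for z using ex[OF that] pqI by metis
 have ev_in: "EX a:MC. psi a = ?E ?m x" for x
 proof -
  have "EX a:MC. psi a = ?m" using psi_range(2)[OF psi_range(1)[of "-1"], of om] om_mc by (force simp: om_def S.sc_minus)
  thus ?thesis unfolding ev_def by (intro psi_range(2,3) pe_range n_in)
 qed
 define \<zeta> where "\<zeta> z = (SOME a. a : MC & psi a = ?E ?m (pq z))" for z
 have \<zeta>: "\<zeta> z : MC" "psi (\<zeta> z) = ?E ?m (pq z)" for z
  using someI_ex[of "%a. a : MC & psi a = ?E ?m (pq z)"] ev_in[of "pq z"] unfolding \<zeta>_def by blast+
 have \<zeta>I: "\<zeta> z = a" if "a : MC" "psi a = ?E ?m (pq z)" for z a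
  by (rule psi_inj) (use that \<zeta> in auto)
 \<comment> \<open>For sign 1 this is immediate. The sign -1 occurs only for even d and odd w; then
   both \<omega> and n anticommute with the group element, and commutation must come from a symmetry
   of (p, q).\<close>
 have comm: "?E ?m (pq z) * psi1 w = psi1 w * ?E ?m (pq z)" if z: "z : tama_center" and w: "w : carrier PG" for z w
 proof -
  obtain p q where e: "pq z = (p, q)" by (cases "pq z")
  let ?s = "eps CARD('n) (cliff_parity w)"
  have s: "?s = 1 \<or> ?s = -1 & even CARD('n) & cliff_parity w = 1" by (auto simp: eps_def cliff_parity_def)
  have tw: "?E a (p, q) * psi1 w = psi1 w * (pe p (sc ?s * a) + sc ?s * (pe q (sc ?s * a) * n))" if a: "a * psi1 w = sc ?s * (psi1 w * a)" for a
  proof -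
   have "pe q a * n * psi1 w = sc ?s * (pe q a * psi1 w * n)"
    using S.slc[of "pe q a" ?s] by (simp add: m_ass n(3)[OF w])
   hence "pe q a * n * psi1 w = psi1 w * (sc ?s * (pe q (sc ?s * a) * n))"
    using S.slc[of "psi1 w" ?s] by (simp add: pe_twist[OF a] m_ass)
   thus ?thesis unfolding ev_def by (simp add: add_dists pe_twist[OF a])
  qed
  have twm: "?m * psi1 w = sc ?s * (psi1 w * ?m)" using om1[OF w] by simp
  show ?thesis unfolding e using s
  proof
   assume "?s = 1"
   thus "?E ?m (p, q) * psi1 w = psi1 w * ?E ?m (p, q)" using tw[OF twm] by (simp add: ev_def)
  next
   assume s1: "?s = -1 & even CARD('n) & cliff_parity w = 1"
   have nh: "hat DD = DD" "hat n = n" using hat_DD n(5) s1 by auto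
   have hp: "hat (pe p DD) = pe p DD" for p by (induction p) (simp_all add: pe_pCons hat_mult nh)
   have P: "Phi z = ?E DD (p, q)" using pq[OF z] by (simp add: good_def e)
   obtain X where X: "X : tama" "Phi X = psi1 w" using rho_psi1[OF w] by blast
   have "superbracket HC HC_part z X = \<zero>\<^sub>h" using z X(1) by (auto simp: tama_center_def graded_center_def)
   moreover have "X : carrier HC" using X(1) by (simp add: tama_iff)
   moreover have "hat (psi1 w) = - psi1 w" using psi1_props(3)[OF w] s1 by (simp add: S.sc_minus)
   ultimately have "Phi z * psi1 w = psi1 w * hat (Phi z)" using superbracket_odd[OF tama_center_ZZ(1)[OF z], of X] X(2) by simp
   also have "hat (Phi z) = Phi z" by (simp add: P ev_def hat_mult hp nh)
   \<comment> \<open>For even d, D and n are even, so supercommutation of z with w is commutation.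
     Moving w across replaces D by -D and n by -n; cancelling the invertible w and using uniqueness,
     p is even and q is odd.\<close>
   finally have "psi1 w * (pe p (- DD) - pe q (- DD) * n) = psi1 w * Phi z"
    using tw[OF psi1_props(4)[OF w]] unfolding P conjunct1[OF s1] by (simp add: S.sc_minus)
   from arg_cong[OF this, of "%x. psi1 (inv\<^bsub>PG\<^esub> w) * x"] have "pe p (- DD) - pe q (- DD) * n = Phi z"
    by (simp add: m_ass[symmetric] psi1_inv[OF w])
   hence "Phi z = ?E DD (pcompose p [:0, -1:], - pcompose q [:0, -1:])"
    by (simp add: ev_def pe_minus pe_pcompose_minus)
   moreover have "- mat 1 \<notin> W --> q = 0" using pq[OF z] by (simp add: good_def e)
   ultimately have "good (Phi z) (pcompose p [:0, -1:], - pcompose q [:0, -1:])" by (auto simp: good_def)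
   from pqI[OF this] have pq': "pcompose p [:0, -1:] = p" "- pcompose q [:0, -1:] = q" by (auto simp: e)
   have "pe p om = pe p ?m" "- pe q om = pe q ?m"
    using arg_cong[OF pq'(1), of "%p. pe p ?m"] arg_cong[OF pq'(2), of "%p. pe p ?m"] by (simp_all add: pe_minus pe_pcompose_minus)
   thus "?E ?m (p, q) * psi1 w = psi1 w * ?E ?m (p, q)" using tw[OF twm] unfolding conjunct1[OF s1] by (simp add: ev_def S.sc_minus flip: \<open>- pe q om = pe q ?m\<close>)
  qed
 qed
 have \<zeta>c: "\<zeta> z : ungraded_center (pin_alg_minus R)" if z: "z : tama_center" for z
 proof -
  have "mmul PG (\<zeta> z) x = mmul PG x (\<zeta> z)" if x: "x : MC" for x
  proof (rule psi_inj)
   have "psi (\<zeta> z) * psi x = psi x * psi (\<zeta> z)"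
   proof -
    have "keys x <= carrier PG" using x by (simp add: MC_iff)
    thus ?thesis unfolding \<zeta>(2) unfolding psi_def S.mlin_def
     using comm[OF z] S.slc[of "?E ?m (pq z)"] by (simp add: sum_dists m_ass subset_iff cong: sum.cong)
   qed
   thus "psi (mmul PG (\<zeta> z) x) = psi (mmul PG x (\<zeta> z))" using MC_sub x \<zeta>(1) by (simp add: psiD)
  qed (use x \<zeta>(1) MC_ops in auto)
  thus ?thesis using \<zeta>(1) by (simp add: ungraded_center_def PM_simps(1))
 qed
 have hom: "\<zeta> \<in> alg_hom (HC\<lparr>carrier := tama_center\<rparr>) ((pin_alg_minus R)\<lparr>carrier := ungraded_center (pin_alg_minus R)\<rparr>)"
 proof -
  have 1: "\<zeta> (z \<otimes>\<^sub>h z') = mmul PG (\<zeta> z) (\<zeta> z')" "\<zeta> (z \<oplus>\<^sub>h z') = \<zeta> z + \<zeta> z'" "\<zeta> (k \<odot>\<^sub>h z) = scale k (\<zeta> z)"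
   if z: "z : tama_center" "z' : tama_center" for z z' k
  proof -
   obtain p q p' q' where e: "pq z = (p, q)" "pq z' = (p', q')" by (cases "pq z", cases "pq z'")
   note g = pq[OF z(1), unfolded e good_def] pq[OF z(2), unfolded e good_def]
   note c = tama_center_ZZ(1)[OF z(1)] tama_center_ZZ(1)[OF z(2)]
   have "pq (z \<otimes>\<^sub>h z') = (p * p' + Polynomial.smult \<nu> (q * q'), p * q' + q * p')"
    by (rule pqI) (use g c ev_mult[OF nD n(1), of p q p' q'] in \<open>auto simp: good_def PhiD(1)\<close>)
   thus "\<zeta> (z \<otimes>\<^sub>h z') = mmul PG (\<zeta> z) (\<zeta> z')"
    using \<zeta> MC_sub ev_mult[OF mn n(1)] by (intro \<zeta>I MC_ops) (simp_all add: psiD e)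
   have "pq (z \<oplus>\<^sub>h z') = (p + p', q + q')"
    by (rule pqI) (use g c in \<open>auto simp: good_def PhiD(2) ev_lin\<close>)
   thus "\<zeta> (z \<oplus>\<^sub>h z') = \<zeta> z + \<zeta> z'" using \<zeta> by (intro \<zeta>I MC_ops) (simp_all add: psiD e ev_lin)
   have "pq (k \<odot>\<^sub>h z) = (Polynomial.smult k p, Polynomial.smult k q)"
    by (rule pqI) (use g c in \<open>auto simp: good_def PhiD(4)[OF _ HC.one_closed] ev_lin\<close>)
   thus "\<zeta> (k \<odot>\<^sub>h z) = scale k (\<zeta> z)" using \<zeta> by (intro \<zeta>I MC_ops) (simp_all add: psiD e ev_lin)
  qed
  have "pq \<one>\<^sub>h = (1, 0)" by (rule pqI) (simp add: good_def Phi_one ev_lin)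
  hence "\<zeta> \<one>\<^sub>h = mi" by (intro \<zeta>I MC_ops) (simp add: ev_lin mi_props(4))
  thus ?thesis using 1 \<zeta>c by (simp add: alg_hom_def ring_hom_def PM_simps(1-4))
 qed
 have dec: "\<exists>a \<in> tama. z = \<rho> (\<zeta> z) \<oplus>\<^sub>h (Dirac_deformed \<omega> \<otimes>\<^sub>h a \<oplus>\<^sub>h a \<otimes>\<^sub>h Dirac_deformed \<omega>)" if z: "z : tama_center" for z
 proof -
  obtain p q where e: "pq z = (p, q)" by (cases "pq z")
  \<comment> \<open>The subalgebra in which the quotients must lie for \<open>a\<close> to belong to
    O.\<close>
  let ?A = "{a : Alg. osp_ok a}"
  have A: "\<forall>k. sc k : ?A" "ALL x:?A. ALL y:?A. x + y : ?A & x * y : ?A" "DD : ?A" "?m : ?A"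
   using DA omA Alg_simps(3) osp_ok_diff[OF osp_ok_0_1(1), of om] by (auto intro: Alg.intros osp_ok_sc osp_ok_add osp_ok_mult)
  have Dm: "DD * ?m = ?m * DD" using Dom by simp
  obtain f where f: "pe p DD - pe p ?m = (DD - ?m) * f" "!!e. DD * e = e * DD ==> ?m * e = e * ?m ==> f * e = e * f" "f : ?A"
   using pe_diff_factor[OF Dm, of p] A by blast
  obtain h where h: "pe q DD - pe q ?m = (DD - ?m) * h" "!!e. DD * e = e * DD ==> ?m * e = e * ?m ==> h * e = e * h" "h : ?A"
   using pe_diff_factor[OF Dm, of q] A by blast
  \<comment> \<open>The quotient of z - zeta(z) by D + \<omega>. It commutes with D + \<omega>, so
    multiplying by half of it on both sides gives the required sum.\<close>
  define b where "b = f + h * n"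
  have bA: "b : ?A" unfolding b_def using f(3) h(3) nA by (auto intro: Alg.intros osp_ok_add osp_ok_mult)
  have cD: "DD * (DD - ?m) = (DD - ?m) * DD" "?m * (DD - ?m) = (DD - ?m) * ?m" "n * (DD - ?m) = (DD - ?m) * n"
   using Dm mn nD by (simp_all add: diff_dists add_dists)
  have "h * n * (DD - ?m) = (DD - ?m) * (h * n)" using h(2)[OF cD(1,2)] cD(3) by (metis m_ass)
  hence bc: "b * (DD - ?m) = (DD - ?m) * b" unfolding b_def using f(2)[OF cD(1,2)] by (simp only: add_dists)
  have "Phi z = ?E DD (p, q)" using pq[OF z] by (simp add: good_def e)
  also have "... = ?E ?m (p, q) + ((pe p DD - pe p ?m) + (pe q DD - pe q ?m) * n)" by (simp add: ev_def left_diff_distrib)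
  also have "... = ?E ?m (p, q) + (DD - ?m) * b" unfolding f(1) h(1) b_def by (simp only: distrib_left m_ass)
  finally have Pz: "Phi z = psi (\<zeta> z) + (DD - ?m) * b" by (simp add: \<zeta>(2) e)
  obtain a where a: "a : carrier HC" "Phi a = sc (1/2) * b" using Alg_Phi[of "sc (1/2) * b"] bA Alg.intros by blast
  hence at: "a : tama" using bA by (simp add: tama_iff osp_ok_mult osp_ok_sc)
  have k: "keys (\<zeta> z) <= carrier PG" "keys \<omega> <= carrier PG" using \<zeta>(1) om_mc by (simp_all add: MC_iff)
  note rz = Phi_rho[OF k(1)] and rw = Phi_rho[OF k(2)]
  have Dd: "Dirac_deformed \<omega> : carrier HC" "Phi (Dirac_deformed \<omega>) = DD - ?m"
   unfolding Dirac_deformed_def using Phi_Dirac(5,6) rw by (simp_all add: PhiD(2) om_def)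
  have "(DD - ?m) * (sc (1/2) * b) + sc (1/2) * b * (DD - ?m) = (DD - ?m) * b"
   using S.slc[of "DD - ?m" "1/2"] half_double[of "(DD - ?m) * b"] by (simp only: m_ass bc distrib_left)
  hence "Phi z = Phi (\<rho> (\<zeta> z) \<oplus>\<^sub>h (Dirac_deformed \<omega> \<otimes>\<^sub>h a \<oplus>\<^sub>h a \<otimes>\<^sub>h Dirac_deformed \<omega>))"
   using rz Dd a by (simp add: PhiD(1,2) Pz del: diff_minus_eq_add)
  hence "z = \<rho> (\<zeta> z) \<oplus>\<^sub>h (Dirac_deformed \<omega> \<otimes>\<^sub>h a \<oplus>\<^sub>h a \<otimes>\<^sub>h Dirac_deformed \<omega>)"
   using rz Dd a tama_center_ZZ(1)[OF z] by (intro Phi_inj) simp_all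
  thus ?thesis using at by blast
 qed
 show ?thesis using hom dec by blast
qed

end

theorem theorem5p10:
  fixes R P :: "(real^'n) set"
    and c :: "real^'n \<Rightarrow> complex"
    and t :: complex
    and y :: "nat \<Rightarrow> real^'n"
    and \<omega> :: "'n cliff \<Rightarrow>\<^sub>0 complex"
  assumes "CARD('n) \<ge> 3"
    and "root_system R"
    and "positive_roots R P"
    and "W_invariant R c"
    and "t \<noteq> 0"
    and "orthonormal_basis y"
    and "admissible R \<omega>"
  shows "\<exists>\<zeta> \<in> alg_hom
            ((dunkl_data.HC R P c t)\<lparr>carrier := dunkl_data.tama_center R P c t y\<rparr>)
            ((pin_alg_minus R)\<lparr>carrier := ungraded_center (pin_alg_minus R)\<rparr>).
          \<forall>z \<in> dunkl_data.tama_center R P c t y.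
          \<exists>a \<in> dunkl_data.tama R P c t y.
            z = dunkl_data.\<rho> R P c t (\<zeta> z)
                \<oplus>\<^bsub>dunkl_data.HC R P c t\<^esub>
                  (dunkl_data.Dirac_deformed R P c t y \<omega> \<otimes>\<^bsub>dunkl_data.HC R P c t\<^esub> a
                   \<oplus>\<^bsub>dunkl_data.HC R P c t\<^esub>
                     a \<otimes>\<^bsub>dunkl_data.HC R P c t\<^esub> dunkl_data.Dirac_deformed R P c t y \<omega>)"
proof -
 have "dunkl R P c t y" by unfold_locales fact+
 thus ?thesis using assms(7) by (rule dunkl.graded_center_hom)
qed

end
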